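(* Let $G$ be the quantum general linear group of degree $n$ over a field $k$ with parameter $0\ne q\in k$. For any finite subset $\Pi$ of $X^+(n)$ and any $m\in\mathbb{Z}$ there is an isomorphism of coalgebras $A(\Pi)\cong A(m\omega+\Pi^* )$, and hence an isomorphism of algebras $S(\Pi)\cong S(m\omega+\Pi^* )$.
   Context: Let $k$ be an arbitrary field, $0\ne q\in k$. Let $A(n)$ be the $k$-bialgebra generated by $c_{ij}$ ($1\le i,j\le n$) with relations $c_{ir}c_{is}=c_{is}c_{ir}$ for all $i,r,s$; $c_{jr}c_{is}=q\,c_{is}c_{jr}$ for $i<j$, $r\le s$; $c_{js}c_{ir}=c_{ir}c_{js}+(q-1)c_{is}c_{jr}$ for $i<j$, $r<s$; comultiplication $c_{ij}\mapsto\sum_l c_{il}\otimes c_{lj}$ and counit $c_{ij}\mapsto\delta_{ij}$. The coordinate Hopf algebra $k[G]$ of the quantum general linear group $G$ is the localization of $A(n)$ at the quantum determinant $d=\sum_{\pi\in\Sigma_n}(-1)^{l(\pi)}c_{1,\pi(1)}\cdots c_{n,\pi(n)}$. Left $G$-modules are right $k[G]$-comodules. $X^+(n)$ is the set of $\lambda=(\lambda_1,\dots,\lambda_n)\in\mathbb{Z}^n$ with $\lambda_1\ge\dots\ge\lambda_n$; for $\lambda\in X^+(n)$, $L(\lambda)$ is the simple $G$-module of highest weight $\lambda$ (weights being taken with respect to the diagonal torus $k[G]\to k[t_1^{\pm1},\dots,t_n^{\pm1}]$, $c_{ij}\mapsto\delta_{ij}t_i$), and these are all the simple modules. A $G$-module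 belongs to $\Pi\subseteq X^+(n)$ if all its composition factors lie in $\{L(\lambda):\lambda\in\Pi\}$. For a $G$-module $W$, $O_\Pi(W)$ is the unique largest submodule belonging to $\Pi$. Regarding $k[G]$ as a right $k[G]$-comodule via comultiplication, $A(\Pi)=O_\Pi(k[G])$, which is a subcoalgebra of $k[G]$, finite dimensional for finite $\Pi$ (saturation of $\Pi$ is not assumed); $S(\Pi)$ is the dual algebra of $A(\Pi)$. For $\lambda\in X^+(n)$, $\lambda^*=(-\lambda_n,\dots,-\lambda_1)$; $\Pi^*=\{\lambda^*:\lambda\in\Pi\}$; $\omega=(1,1,\dots,1)$; $m\omega+\Pi^*=\{m\omega+\mu:\mu\in\Pi^*\}$. *)

theory Defs
  imports
    "HOL-Algebra.Algebra"
    "HOL-Algebra.Algebraic_Closure_Type"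
    "HOL-Combinatorics.Permutations"
    "HOL-Library.Function_Algebras"
    "HOL-Library.Poly_Mapping"
begin

text \<open>
  The field is a type \<open>'k\<close> of class \<^class>\<open>field\<close>. Vector spaces and algebras over it are records of
  type \<^typ>\<open>('k, 'v) module\<close> with explicit carriers; for a bare vector space the fields
  \<open>mult\<close> and \<open>one\<close> are irrelevant.
\<close>

section \<open>Vector spaces, quotients and tensor products\<close>

definition scalars :: "('k::field, 'k) module" where
  "scalars = ring.extend ring_of_type_algebra (module.fields (*))"

definition pscale :: "'k \<Rightarrow> ('a \<Rightarrow>\<^sub>0 'k) \<Rightarrow> ('a \<Rightarrow>\<^sub>0 'k::field)" where
  "pscale a f = Poly_Mapping.map ((*) a) f"

definition linear_maps ::
    "('k, 'v, 'm) module_scheme \<Rightarrow> ('k, 'w, 'l) module_scheme \<Rightarrow> ('v \<Rightarrow> 'w) set" where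
  "linear_maps V W = {f \<in> carrier V \<rightarrow> carrier W.
     (\<forall>x\<in>carrier V. \<forall>y\<in>carrier V. f (x \<oplus>\<^bsub>V\<^esub> y) = f x \<oplus>\<^bsub>W\<^esub> f y) \<and>
     (\<forall>a. \<forall>x\<in>carrier V. f (a \<odot>\<^bsub>V\<^esub> x) = a \<odot>\<^bsub>W\<^esub> f x)}"

text \<open>Quotient by a subspace, or, for an algebra, by a two-sided ideal.\<close>

definition quot_mod :: "('k, 'v, 'm) module_scheme \<Rightarrow> 'v set \<Rightarrow> ('k, 'v set) module" where
  "quot_mod V U = ring.extend (V Quot U)
     (module.fields (\<lambda>a Z. \<Union>x\<in>Z. U +>\<^bsub>V\<^esub> (a \<odot>\<^bsub>V\<^esub> x)))"

text \<open>Linear extension of a map defined on a basis.\<close>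

definition linext :: "('k::field, 'u, 'm) module_scheme \<Rightarrow> ('a \<Rightarrow> 'u) \<Rightarrow> ('a \<Rightarrow>\<^sub>0 'k) \<Rightarrow> 'u" where
  "linext U b f = (\<Oplus>\<^bsub>U\<^esub>p\<in>Poly_Mapping.keys f. Poly_Mapping.lookup f p \<odot>\<^bsub>U\<^esub> b p)"

text \<open>
  \<open>V \<otimes> W\<close> is the vector space with basis \<open>carrier V \<times> carrier W\<close> modulo the bilinearity relations.
  The multiplication of \<open>formal_tensors\<close> induces the usual one on the tensor product of two algebras.
\<close>

definition formal_tensors ::
    "('k::field, 'v, 'm) module_scheme \<Rightarrow> ('k, 'w, 'l) module_scheme \<Rightarrow> ('k, ('v \<times> 'w) \<Rightarrow>\<^sub>0 'k) module"
  where
  "formal_tensors V W =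
    \<lparr>carrier = {f. Poly_Mapping.keys f \<subseteq> carrier V \<times> carrier W},
     monoid.mult = (\<lambda>f g. \<Sum>(v, w)\<in>Poly_Mapping.keys f. \<Sum>(v', w')\<in>Poly_Mapping.keys g.
       Poly_Mapping.single (v \<otimes>\<^bsub>V\<^esub> v', w \<otimes>\<^bsub>W\<^esub> w')
         (Poly_Mapping.lookup f (v, w) * Poly_Mapping.lookup g (v', w'))),
     one = Poly_Mapping.single (\<one>\<^bsub>V\<^esub>, \<one>\<^bsub>W\<^esub>) 1,
     ring.zero = 0,
     add = (+),
     module.smult = pscale\<rparr>"

inductive_set bilinear_relations ::
    "('k::field, 'v, 'm) module_scheme \<Rightarrow> ('k, 'w, 'l) module_scheme \<Rightarrow> (('v \<times> 'w) \<Rightarrow>\<^sub>0 'k) set"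
  for V :: "('k, 'v, 'm) module_scheme" and W :: "('k, 'w, 'l) module_scheme" where
  add_left: "\<lbrakk>v \<in> carrier V; v' \<in> carrier V; w \<in> carrier W\<rbrakk> \<Longrightarrow>
    Poly_Mapping.single (v \<oplus>\<^bsub>V\<^esub> v', w) 1 - Poly_Mapping.single (v, w) 1
      - Poly_Mapping.single (v', w) 1 \<in> bilinear_relations V W"
| add_right: "\<lbrakk>v \<in> carrier V; w \<in> carrier W; w' \<in> carrier W\<rbrakk> \<Longrightarrow>
    Poly_Mapping.single (v, w \<oplus>\<^bsub>W\<^esub> w') 1 - Poly_Mapping.single (v, w) 1
      - Poly_Mapping.single (v, w') 1 \<in> bilinear_relations V W"
| smult_left: "\<lbrakk>v \<in> carrier V; w \<in> carrier W\<rbrakk> \<Longrightarrow>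
    Poly_Mapping.single (a \<odot>\<^bsub>V\<^esub> v, w) 1 - Poly_Mapping.single (v, w) a \<in> bilinear_relations V W"
| smult_right: "\<lbrakk>v \<in> carrier V; w \<in> carrier W\<rbrakk> \<Longrightarrow>
    Poly_Mapping.single (v, a \<odot>\<^bsub>W\<^esub> w) 1 - Poly_Mapping.single (v, w) a \<in> bilinear_relations V W"

definition tensor_kernel ::
    "('k::field, 'v, 'm) module_scheme \<Rightarrow> ('k, 'w, 'l) module_scheme \<Rightarrow> (('v \<times> 'w) \<Rightarrow>\<^sub>0 'k) set" where
  "tensor_kernel V W = module.span pscale (bilinear_relations V W)"

definition tensor ::
    "('k::field, 'v, 'm) module_scheme \<Rightarrow> ('k, 'w, 'l) module_scheme \<Rightarrow>
     ('k, (('v \<times> 'w) \<Rightarrow>\<^sub>0 'k) set) module" where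
  "tensor V W = quot_mod (formal_tensors V W) (tensor_kernel V W)"

definition tens ::
    "('k::field, 'v, 'm) module_scheme \<Rightarrow> ('k, 'w, 'l) module_scheme \<Rightarrow> 'v \<Rightarrow> 'w \<Rightarrow>
     (('v \<times> 'w) \<Rightarrow>\<^sub>0 'k) set" where
  "tens V W v w = tensor_kernel V W +>\<^bsub>formal_tensors V W\<^esub> Poly_Mapping.single (v, w) 1"

text \<open>The linear map \<open>V \<otimes> W \<rightarrow> U\<close> induced by a bilinear map \<open>b\<close>, and the map \<open>f \<otimes> g\<close>
  with values in \<open>V' \<otimes> W'\<close>.\<close>

definition tensor_lift ::
    "('k::field, 'u, 'm) module_scheme \<Rightarrow> ('v \<times> 'w \<Rightarrow> 'u) \<Rightarrow> (('v \<times> 'w) \<Rightarrow>\<^sub>0 'k) set \<Rightarrow> 'u" where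
  "tensor_lift U b Z = the_elem (linext U b ` Z)"

definition tensor_map ::
    "('k::field, 'v1, 'm) module_scheme \<Rightarrow> ('k, 'w1, 'l) module_scheme \<Rightarrow>
     ('v \<Rightarrow> 'v1) \<Rightarrow> ('w \<Rightarrow> 'w1) \<Rightarrow> (('v \<times> 'w) \<Rightarrow>\<^sub>0 'k) set \<Rightarrow> (('v1 \<times> 'w1) \<Rightarrow>\<^sub>0 'k) set" where
  "tensor_map V' W' f g = tensor_lift (tensor V' W') (\<lambda>(v, w). tens V' W' (f v) (g w))"

text \<open>The canonical map \<open>(V \<otimes> W) \<otimes> U \<rightarrow> V \<otimes> (W \<otimes> U)\<close>.\<close>

definition tensor_assoc ::
    "('k::field, 'v, 'm) module_scheme \<Rightarrow> ('k, 'w, 'l) module_scheme \<Rightarrow> ('k, 'u, 'h) module_scheme \<Rightarrow>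
     (((('v \<times> 'w) \<Rightarrow>\<^sub>0 'k) set \<times> 'u) \<Rightarrow>\<^sub>0 'k) set \<Rightarrow>
     (('v \<times> (('w \<times> 'u) \<Rightarrow>\<^sub>0 'k) set) \<Rightarrow>\<^sub>0 'k) set" where
  "tensor_assoc V W U =
     tensor_lift (tensor V (tensor W U)) (\<lambda>(x, u).
       tensor_lift (tensor V (tensor W U)) (\<lambda>(v, w). tens V (tensor W U) v (tens W U w u)) x)"


section \<open>Coalgebras and right comodules\<close>

record (overloaded) ('k, 'c) coalg = "('k, 'c) module" +
  comult :: "'c \<Rightarrow> (('c \<times> 'c) \<Rightarrow>\<^sub>0 'k) set"
  counit :: "'c \<Rightarrow> 'k"

record (overloaded) ('k, 'c, 'v) comod = "('k, 'v) module" +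
  coact :: "'v \<Rightarrow> (('v \<times> 'c) \<Rightarrow>\<^sub>0 'k) set"

definition coalgebra_isomorphic :: "('k::field, 'c) coalg \<Rightarrow> ('k, 'd) coalg \<Rightarrow> bool" where
  "coalgebra_isomorphic C D \<longleftrightarrow>
     (\<exists>f. f \<in> linear_maps C D \<and> bij_betw f (carrier C) (carrier D) \<and>
       (\<forall>x\<in>carrier C. tensor_map D D f f (comult C x) = comult D (f x)) \<and>
       (\<forall>x\<in>carrier C. counit D (f x) = counit C x))"

text \<open>A subcoalgebra \<open>B\<close> carries the comultiplication obtained by lifting along the injection
  \<open>B \<otimes> B \<rightarrow> C \<otimes> C\<close>; similarly for subcomodules below.\<close>

definition sub_coalg :: "('k::field, 'c) coalg \<Rightarrow> 'c set \<Rightarrow> ('k, 'c) coalg" where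
  "sub_coalg C B = C\<lparr>carrier := B,
     comult := (\<lambda>x. inv_into (carrier (tensor (C\<lparr>carrier := B\<rparr>) (C\<lparr>carrier := B\<rparr>)))
       (tensor_map C C (\<lambda>b. b) (\<lambda>b. b)) (comult C x))\<rparr>"

text \<open>The dual algebra, with the convolution product \<open>(f g)(x) = \<Sum> f(x\<^sub>1) g(x\<^sub>2)\<close>. Functionals are
  taken to be \<^const>\<open>undefined\<close> outside the carrier, so that equal functionals are equal functions.\<close>

definition dual_algebra :: "('k::field, 'c) coalg \<Rightarrow> ('k, 'c \<Rightarrow> 'k) module" where
  "dual_algebra C =
    \<lparr>carrier = linear_maps C scalars \<inter> extensional (carrier C),
     monoid.mult = (\<lambda>f g. \<lambda>x\<in>carrier C. tensor_lift scalars (\<lambda>(y, z). f y * g z) (comult C x)),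
     one = restrict (counit C) (carrier C),
     ring.zero = (\<lambda>x\<in>carrier C. 0),
     add = (\<lambda>f g. \<lambda>x\<in>carrier C. f x + g x),
     module.smult = (\<lambda>a f. \<lambda>x\<in>carrier C. a * f x)\<rparr>"

definition algebra_isomorphic ::
    "('k, 'a, 'm) module_scheme \<Rightarrow> ('k, 'b, 'l) module_scheme \<Rightarrow> bool" where
  "algebra_isomorphic A B \<longleftrightarrow> ring_iso A B \<inter> linear_maps A B \<noteq> {}"

definition comodule :: "('k::field, 'c) coalg \<Rightarrow> ('k, 'c, 'v) comod \<Rightarrow> bool" where
  "comodule C V \<longleftrightarrow>
     Module.module (ring_of_type_algebra :: 'k ring) V \<and>
     coact V \<in> linear_maps V (tensor V C) \<and>
     (\<forall>v\<in>carrier V. tensor_lift V (\<lambda>(u, c). counit C c \<odot>\<^bsub>V\<^esub> u) (coact V v) = v) \<and>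
     (\<forall>v\<in>carrier V. tensor_assoc V C C (tensor_map (tensor V C) C (coact V) (\<lambda>c. c) (coact V v))
        = tensor_map V (tensor C C) (\<lambda>u. u) (comult C) (coact V v))"

definition regular_comod :: "('k, 'c) coalg \<Rightarrow> ('k, 'c, 'c) comod" where
  "regular_comod C = module.extend (module.truncate C) (comod.fields (comult C))"

definition subcomodule :: "('k::field, 'c) coalg \<Rightarrow> ('k, 'c, 'v) comod \<Rightarrow> 'v set \<Rightarrow> bool" where
  "subcomodule C V N \<longleftrightarrow>
     submodule N (ring_of_type_algebra :: 'k ring) V \<and>
     (\<forall>x\<in>N. coact V x \<in>
        tensor_map V C (\<lambda>v. v) (\<lambda>c. c) ` carrier (tensor (V\<lparr>carrier := N\<rparr>) C))"

definition sub_comod :: "('k::field, 'c) coalg \<Rightarrow> ('k, 'c, 'v) comod \<Rightarrow> 'v set \<Rightarrow> ('k, 'c, 'v) comod"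
  where
  "sub_comod C V N = V\<lparr>carrier := N,
     coact := (\<lambda>x. inv_into (carrier (tensor (V\<lparr>carrier := N\<rparr>) C))
       (tensor_map V C (\<lambda>v. v) (\<lambda>c. c)) (coact V x))\<rparr>"

definition quot_comod ::
    "('k::field, 'c) coalg \<Rightarrow> ('k, 'c, 'v) comod \<Rightarrow> 'v set \<Rightarrow> ('k, 'c, 'v set) comod" where
  "quot_comod C V Y = module.extend (quot_mod V Y) (comod.fields
     (\<lambda>Z. the_elem ((\<lambda>x. tensor_map (quot_mod V Y) C (\<lambda>v. Y +>\<^bsub>V\<^esub> v) (\<lambda>c. c) (coact V x)) ` Z)))"

definition simple_comodule :: "('k::field, 'c) coalg \<Rightarrow> ('k, 'c, 'v) comod \<Rightarrow> bool" where
  "simple_comodule C V \<longleftrightarrow>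
     comodule C V \<and> carrier V \<noteq> {\<zero>\<^bsub>V\<^esub>} \<and>
     (\<forall>N. subcomodule C V N \<longrightarrow> N = {\<zero>\<^bsub>V\<^esub>} \<or> N = carrier V)"


section \<open>The quantum general linear group\<close>

text \<open>Generators of the coordinate algebra: \<open>Gen i j\<close> for \<open>c\<^sub>i\<^sub>j\<close>, and \<open>Dinv\<close> for the inverse
  of the quantum determinant. The free algebra is the algebra of the free monoid.\<close>

datatype gen = Gen nat nat | Dinv

datatype gen_word = Word (letters: "gen list")

instantiation gen_word :: monoid_add
begin

definition zero_gen_word :: gen_word where
  "0 = Word []"

definition plus_gen_word :: "gen_word \<Rightarrow> gen_word \<Rightarrow> gen_word" where
  "u + v = Word (letters u @ letters v)"

instance
  by standard (simp_all add: zero_gen_word_def plus_gen_word_def)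

end

definition generators :: "nat \<Rightarrow> gen set" where
  "generators n = {Gen i j | i j. i \<in> {1..n} \<and> j \<in> {1..n}} \<union> {Dinv}"

definition free_algebra :: "nat \<Rightarrow> ('k::field, gen_word \<Rightarrow>\<^sub>0 'k) module" where
  "free_algebra n = ring.extend
     (ring_of_type_algebra
       \<lparr>carrier := {p. \<forall>w\<in>Poly_Mapping.keys p. set (letters w) \<subseteq> generators n}\<rparr>)
     (module.fields pscale)"

definition gen_elt :: "gen \<Rightarrow> (gen_word \<Rightarrow>\<^sub>0 'k::field)" where
  "gen_elt x = Poly_Mapping.single (Word [x]) 1"

abbreviation gc :: "nat \<Rightarrow> nat \<Rightarrow> (gen_word \<Rightarrow>\<^sub>0 'k::field)" where
  "gc i j \<equiv> gen_elt (Gen i j)"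

text \<open>\<^const>\<open>sign\<close> \<open>p\<close> is \<open>(-1)\<close> to the length of \<open>p\<close>.\<close>

definition qdet :: "nat \<Rightarrow> (gen_word \<Rightarrow>\<^sub>0 'k::field)" where
  "qdet n = (\<Sum>p | p permutes {1..n}.
     Poly_Mapping.single (Word (map (\<lambda>i. Gen i (p i)) [1..<Suc n])) (of_int (sign p)))"

text \<open>The first three families present \<open>A(n)\<close>; adjoining a two-sided inverse of the determinant
  gives its localization.\<close>

definition relations :: "nat \<Rightarrow> 'k::field \<Rightarrow> (gen_word \<Rightarrow>\<^sub>0 'k) set" where
  "relations n q =
     {gc i r * gc i s - gc i s * gc i r | i r s. {i, r, s} \<subseteq> {1..n}} \<union>
     {gc j r * gc i s - pscale q (gc i s * gc j r) | i j r s.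
        {i, j, r, s} \<subseteq> {1..n} \<and> i < j \<and> r \<le> s} \<union>
     {gc j s * gc i r - (gc i r * gc j s + pscale (q - 1) (gc i s * gc j r)) | i j r s.
        {i, j, r, s} \<subseteq> {1..n} \<and> i < j \<and> r < s} \<union>
     {qdet n * gen_elt Dinv - 1, gen_elt Dinv * qdet n - 1}"

definition qgl_ideal :: "nat \<Rightarrow> 'k::field \<Rightarrow> (gen_word \<Rightarrow>\<^sub>0 'k) set" where
  "qgl_ideal n q = genideal (free_algebra n) (relations n q)"

definition qgl_algebra :: "nat \<Rightarrow> 'k::field \<Rightarrow> ('k, (gen_word \<Rightarrow>\<^sub>0 'k) set) module" where
  "qgl_algebra n q = quot_mod (free_algebra n) (qgl_ideal n q)"

definition qgl_gen :: "nat \<Rightarrow> 'k::field \<Rightarrow> gen \<Rightarrow> (gen_word \<Rightarrow>\<^sub>0 'k) set" where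
  "qgl_gen n q x = qgl_ideal n q +>\<^bsub>free_algebra n\<^esub> gen_elt x"

text \<open>The algebra homomorphism from the coordinate algebra to \<open>B\<close> with prescribed values on the
  generators.\<close>

definition qgl_hom ::
    "('k::field, 'b, 'm) module_scheme \<Rightarrow> (gen \<Rightarrow> 'b) \<Rightarrow> (gen_word \<Rightarrow>\<^sub>0 'k) set \<Rightarrow> 'b" where
  "qgl_hom B b Z =
     the_elem (linext B (\<lambda>w. foldr (\<lambda>x y. b x \<otimes>\<^bsub>B\<^esub> y) (letters w) \<one>\<^bsub>B\<^esub>) ` Z)"

text \<open>The determinant is group-like, whence the values at \<open>Dinv\<close>.\<close>

fun qgl_comult_gen ::
    "nat \<Rightarrow> 'k::field \<Rightarrow> gen \<Rightarrow> (((gen_word \<Rightarrow>\<^sub>0 'k) set \<times> (gen_word \<Rightarrow>\<^sub>0 'k) set) \<Rightarrow>\<^sub>0 'k) set" where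
  "qgl_comult_gen n q (Gen i j) = (\<Oplus>\<^bsub>tensor (qgl_algebra n q) (qgl_algebra n q)\<^esub>l\<in>{1..n}.
     tens (qgl_algebra n q) (qgl_algebra n q) (qgl_gen n q (Gen i l)) (qgl_gen n q (Gen l j)))"
| "qgl_comult_gen n q Dinv =
     tens (qgl_algebra n q) (qgl_algebra n q) (qgl_gen n q Dinv) (qgl_gen n q Dinv)"

fun qgl_counit_gen :: "gen \<Rightarrow> 'k::field" where
  "qgl_counit_gen (Gen i j) = (if i = j then 1 else 0)"
| "qgl_counit_gen Dinv = 1"

definition kG :: "nat \<Rightarrow> 'k::field \<Rightarrow> ('k, (gen_word \<Rightarrow>\<^sub>0 'k) set) coalg" where
  "kG n q = module.extend (qgl_algebra n q) (coalg.fields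
     (qgl_hom (tensor (qgl_algebra n q) (qgl_algebra n q)) (qgl_comult_gen n q))
     (qgl_hom scalars qgl_counit_gen))"


section \<open>Weights and the truncations \<open>A(\<Pi>)\<close> and \<open>S(\<Pi>)\<close>\<close>

text \<open>Elements of \<open>\<int>\<^sup>n\<close> are functions indexed by \<open>1, \<dots>, n\<close> and vanishing elsewhere.\<close>

definition weight_lattice :: "nat \<Rightarrow> (nat \<Rightarrow> int) set" where
  "weight_lattice n = {l. \<forall>i. i \<notin> {1..n} \<longrightarrow> l i = 0}"

definition X_plus :: "nat \<Rightarrow> (nat \<Rightarrow> int) set" where
  "X_plus n = {l \<in> weight_lattice n. \<forall>i j. 1 \<le> i \<and> i \<le> j \<and> j \<le> n \<longrightarrow> l j \<le> l i}"

definition weight_dual :: "nat \<Rightarrow> (nat \<Rightarrow> int) \<Rightarrow> (nat \<Rightarrow> int)" where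
  "weight_dual n l = (\<lambda>i. if i \<in> {1..n} then - l (n + 1 - i) else 0)"

definition omega :: "nat \<Rightarrow> (nat \<Rightarrow> int)" where
  "omega n = (\<lambda>i. if i \<in> {1..n} then 1 else 0)"

definition dominated :: "nat \<Rightarrow> (nat \<Rightarrow> int) \<Rightarrow> (nat \<Rightarrow> int) \<Rightarrow> bool" where
  "dominated n \<mu> l \<longleftrightarrow>
     (\<forall>i\<le>n. (\<Sum>j=1..i. \<mu> j) \<le> (\<Sum>j=1..i. l j)) \<and> (\<Sum>j=1..n. \<mu> j) = (\<Sum>j=1..n. l j)"

text \<open>The Laurent polynomial algebra \<open>k[t\<^sub>1, t\<^sub>1\<^sup>-\<^sup>1, \<dots>, t\<^sub>n, t\<^sub>n\<^sup>-\<^sup>1]\<close> is the group algebra of \<open>\<int>\<^sup>n\<close>.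
  The determinant restricts to \<open>t\<^sub>1 \<cdots> t\<^sub>n\<close>, which has exponent \<^const>\<open>omega\<close>.\<close>

definition laurent :: "nat \<Rightarrow> ('k::field, (nat \<Rightarrow> int) \<Rightarrow>\<^sub>0 'k) module" where
  "laurent n = ring.extend
     (ring_of_type_algebra\<lparr>carrier := {p. Poly_Mapping.keys p \<subseteq> weight_lattice n}\<rparr>)
     (module.fields pscale)"

fun torus_gen :: "nat \<Rightarrow> gen \<Rightarrow> ((nat \<Rightarrow> int) \<Rightarrow>\<^sub>0 'k::field)" where
  "torus_gen n (Gen i j) =
     (if i = j then Poly_Mapping.single (\<lambda>l. if l = i then 1 else 0) 1 else 0)"
| "torus_gen n Dinv = Poly_Mapping.single (- omega n) 1"

definition torus_restrict :: "nat \<Rightarrow> (gen_word \<Rightarrow>\<^sub>0 'k::field) set \<Rightarrow> ((nat \<Rightarrow> int) \<Rightarrow>\<^sub>0 'k)" where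
  "torus_restrict n = qgl_hom (laurent n) (torus_gen n)"

text \<open>A \<open>G\<close>-module is a right comodule over \<^term>\<open>kG n q\<close>.\<close>

definition weight_space ::
    "nat \<Rightarrow> ('k::field, (gen_word \<Rightarrow>\<^sub>0 'k) set, 'v) comod \<Rightarrow> (nat \<Rightarrow> int) \<Rightarrow> 'v set" where
  "weight_space n V \<mu> = {v \<in> carrier V.
     tensor_map V (laurent n) (\<lambda>u. u) (torus_restrict n) (coact V v)
       = tens V (laurent n) v (Poly_Mapping.single \<mu> 1)}"

definition weights ::
    "nat \<Rightarrow> ('k::field, (gen_word \<Rightarrow>\<^sub>0 'k) set, 'v) comod \<Rightarrow> (nat \<Rightarrow> int) set" where
  "weights n V = {\<mu> \<in> weight_lattice n. weight_space n V \<mu> \<noteq> {\<zero>\<^bsub>V\<^esub>}}"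

text \<open>\<open>V\<close> is (isomorphic to) \<open>L(l)\<close>.\<close>

definition is_L ::
    "nat \<Rightarrow> 'k::field \<Rightarrow> (nat \<Rightarrow> int) \<Rightarrow> ('k, (gen_word \<Rightarrow>\<^sub>0 'k) set, 'v) comod \<Rightarrow> bool" where
  "is_L n q l V \<longleftrightarrow>
     simple_comodule (kG n q) V \<and> l \<in> weights n V \<and> (\<forall>\<mu>\<in>weights n V. dominated n \<mu> l)"

text \<open>Composition factors of a possibly infinite-dimensional module are its simple subquotients.\<close>

definition belongs_to ::
    "nat \<Rightarrow> 'k::field \<Rightarrow> (nat \<Rightarrow> int) set \<Rightarrow> ('k, (gen_word \<Rightarrow>\<^sub>0 'k) set, 'v) comod \<Rightarrow> bool" where
  "belongs_to n q P V \<longleftrightarrow>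
     (\<forall>Z Y. subcomodule (kG n q) V Z \<and> subcomodule (kG n q) V Y \<and> Y \<subseteq> Z \<and>
        simple_comodule (kG n q) (quot_comod (kG n q) (sub_comod (kG n q) V Z) Y) \<longrightarrow>
        (\<exists>l\<in>P. is_L n q l (quot_comod (kG n q) (sub_comod (kG n q) V Z) Y)))"

definition O_trunc ::
    "nat \<Rightarrow> 'k::field \<Rightarrow> (nat \<Rightarrow> int) set \<Rightarrow> ('k, (gen_word \<Rightarrow>\<^sub>0 'k) set, 'v) comod \<Rightarrow> 'v set" where
  "O_trunc n q P V =
     (GREATEST N. subcomodule (kG n q) V N \<and> belongs_to n q P (sub_comod (kG n q) V N))"

definition A_trunc :: "nat \<Rightarrow> 'k::field \<Rightarrow> (nat \<Rightarrow> int) set \<Rightarrow> ('k, (gen_word \<Rightarrow>\<^sub>0 'k) set) coalg" where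
  "A_trunc n q P = sub_coalg (kG n q) (O_trunc n q P (regular_comod (kG n q)))"

definition S_trunc ::
    "nat \<Rightarrow> 'k::field \<Rightarrow> (nat \<Rightarrow> int) set \<Rightarrow> ('k, (gen_word \<Rightarrow>\<^sub>0 'k) set \<Rightarrow> 'k) module" where
  "S_trunc n q P = dual_algebra (A_trunc n q P)"

definition shifted_dual :: "nat \<Rightarrow> int \<Rightarrow> (nat \<Rightarrow> int) set \<Rightarrow> (nat \<Rightarrow> int) set" where
  "shifted_dual n m P = (\<lambda>\<mu>. (\<lambda>i. m * omega n i + \<mu> i)) ` (weight_dual n ` P)"

end

theory Submission
 imports Defs
begin

text \<open>
  The isomorphism is induced by a coalgebra automorphism of the coordinate algebra \<open>k[G]\<close> which acts on
  weights by \<open>\<mu> \<mapsto> m\<omega> + \<mu>\<^sup>*\<close>. It sends \<open>c\<^sub>i\<^sub>j\<close> to the entry of the inverse matrix of \<open>(c\<^sub>r\<^sub>s)\<close> at the reflected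
  position \<open>(j', i')\<close>, \<open>i' = n + 1 - i\<close>, is multiplicative up to a power of \<open>q\<close> that is a bilinear form in the
  row and column degrees (antipode and transposition are each only compatible with the defining relations after such
  a twist), and is followed by multiplication by the group-like element \<open>d\<^sup>m\<close>. An automorphism compatible with
  weights up to a dominance preserving bijection permutes the simple modules accordingly, hence maps \<open>O\<^sub>\<Pi>(k[G])\<close>
  onto the truncation for the shifted dual of \<open>\<Pi>\<close>. Elements of \<open>k[G]\<close> and of its tensor square are compared by
  evaluating linear functionals on words, so that convolution replaces the comultiplication.
\<close>

text \<open>Reversal and transposition, both built into the inverse matrix, interchange rows and
  columns in the relations: its reflected entries commute within a column and q-commute within a
  row, the opposite of the generators. A power of \<open>q\<close> with exponent B(columns) -
  B(rows), where the bilinear form B has 1 above and 0 below the diagonal, moves the factor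
  \<open>q\<close> back. As a difference of one form on two degrees, the exponent telescopes along a
  comultiplication and vanishes on the torus, so coproduct and weights are respected. The diagonal
  value \<open>l\<close> of B stays free because the maps for \<open>l\<close> and
  \<open>1 - l\<close> are inverse to each other: the form for \<open>l\<close> and the reflected
  form for \<open>1 - l\<close> add up to the constant 1, which contributes nothing as rows and
  columns have equal total degree. The main computation is the agreement of row and column
  expansions of quantum minors. It yields a two-sided inverse matrix although the determinant need
  not be central, the diagonal powers of \<open>q\<close> that measure the square of the antipode,
  and the interchange of the determinant with its inverse.\<close>

abbreviation vadd ("_ +[_]/ _" [65, 0, 66] 65) where "x +[V] y == x \<oplus>\<^bsub>V\<^esub> y"

abbreviation vsmult ("_ *[_]/ _" [70, 0, 71] 70) where "a *[V] x == a \<odot>\<^bsub>V\<^esub> x"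

abbreviation "keys == Poly_Mapping.keys"
abbreviation "single == Poly_Mapping.single"
abbreviation "lookup == Poly_Mapping.lookup"
abbreviation "FA n == carrier (free_algebra n)"

section \<open>Vector spaces as records\<close>

text \<open>The library locale over the field viewed as a ring record, for arbitrary record
  extensions, so that coalgebras and comodules are covered as well.\<close>

abbreviation vspace :: "('k::field, 'v, 'm) module_scheme => bool" where
 "vspace V \<equiv> Module.module (ring_of_type_algebra :: 'k ring) V"

lemma type_algebra_simps [simp]:
 "carrier ring_of_type_algebra = UNIV"
 "x +[ring_of_type_algebra] y = x + y"
 "x \<otimes>\<^bsub>ring_of_type_algebra\<^esub> y = x * y"
 "\<zero>\<^bsub>ring_of_type_algebra\<^esub> = 0"
 "\<one>\<^bsub>ring_of_type_algebra\<^esub> = 1"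
 by (simp_all add: ring_of_type_algebra_def)

lemma scalars_simps [simp]:
 "carrier scalars = UNIV"
 "x +[scalars] y = x + y"
 "x \<otimes>\<^bsub>scalars\<^esub> y = x * y"
 "\<zero>\<^bsub>scalars\<^esub> = 0"
 "\<one>\<^bsub>scalars\<^esub> = 1"
 "x *[scalars] y = x * y"
 by (simp_all add: scalars_def ring.extend_def module.fields_def ring_of_type_algebra_def)

text \<open>Additive inverses are not among the premises: (-1) x is one, by distributivity and the
  premise on 0 x.\<close>

lemma vspaceI:
 fixes V :: "('k::field, 'v, 'm) module_scheme"
 assumes "!!x y. x : carrier V ==> y : carrier V ==> x +[V] y : carrier V"
  and "\<zero>\<^bsub>V\<^esub> : carrier V"
  and "!!a x. x : carrier V ==> a *[V] x : carrier V"
  and "!!x y z. x : carrier V ==> y : carrier V ==> z : carrier V ==>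
   (x +[V] y) +[V] z = x +[V] (y +[V] z)"
  and "!!x y. x : carrier V ==> y : carrier V ==> x +[V] y = y +[V] x"
  and "!!x. x : carrier V ==> \<zero>\<^bsub>V\<^esub> +[V] x = x"
  and "!!a b x. x : carrier V ==> (a + b) *[V] x = a *[V] x +[V] b *[V] x"
  and "!!a x y. x : carrier V ==> y : carrier V ==>
   a *[V] (x +[V] y) = a *[V] x +[V] a *[V] y"
  and "!!a b x. x : carrier V ==> (a * b) *[V] x = a *[V] (b *[V] x)"
  and "!!x. x : carrier V ==> 1 *[V] x = x"
  and zero_smult: "!!x. x : carrier V ==> 0 *[V] x = \<zero>\<^bsub>V\<^esub>"
 shows "vspace V"
proof (rule moduleI)
 show "cring (ring_of_type_algebra :: 'k ring)"
  by (rule cring_from_type_algebra)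
 show "abelian_group V"
 proof (rule abelian_groupI)
  fix x assume x: "x : carrier V"
  have "(- 1) *[V] x +[V] x = (- 1 + 1) *[V] x"
   using assms(7)[OF x, of "-1" 1] assms(10)[OF x] by simp
  then show "\<exists>y\<in>carrier V. y +[V] x = \<zero>\<^bsub>V\<^esub>"
   using assms(3)[OF x] zero_smult[OF x] by auto
 qed (use assms in auto)
qed (use assms in auto)

context
 fixes V :: "('k::field, 'v, 'm) module_scheme"
 assumes V: "vspace V"
begin

interpretation V: Module.module "ring_of_type_algebra :: 'k ring" V by (rule V)

text \<open>From here on the facts of the module locale are restated with \<open>vspace V\<close> as
  a premise, because many later statements involve several spaces at once.\<close>

lemma vs_abelian_group: "abelian_group V" by (rule V.abelian_group_axioms)
lemma vs_add_closed: "x : carrier V ==> y : carrier V ==> x +[V] y : carrier V" by simp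
lemma vs_zero_closed: "\<zero>\<^bsub>V\<^esub> : carrier V" by simp
lemma vs_smult_closed: "x : carrier V ==> a *[V] x : carrier V" by simp
lemma vs_assoc: "x : carrier V ==> y : carrier V ==> z : carrier V ==>
  (x +[V] y) +[V] z = x +[V] (y +[V] z)" by (rule V.a_assoc)
lemma vs_commute: "x : carrier V ==> y : carrier V ==> x +[V] y = y +[V] x"
 by (rule V.M.a_comm)
lemma vs_lcommute: "x : carrier V ==> y : carrier V ==> z : carrier V ==>
  x +[V] (y +[V] z) = y +[V] (x +[V] z)" by (rule V.M.a_lcomm)
lemma vs_add_zero: "x : carrier V ==> \<zero>\<^bsub>V\<^esub> +[V] x = x" "x : carrier V ==> x +[V] \<zero>\<^bsub>V\<^esub> = x"
 by simp_all
lemma vs_distrib_right: "x : carrier V ==> (a + b) *[V] x = a *[V] x +[V] b *[V] x"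
 using V.smult_l_distr[of a b x] by simp
lemma vs_distrib_left: "x : carrier V ==> y : carrier V ==>
  a *[V] (x +[V] y) = a *[V] x +[V] a *[V] y"
 using V.smult_r_distr[of a x y] by simp
lemma vs_smult_smult: "x : carrier V ==> a *[V] (b *[V] x) = (a * b) *[V] x"
 using V.smult_assoc1[of a b x] by simp
lemma vs_one: "x : carrier V ==> 1 *[V] x = x"
 using V.smult_one[of x] by simp
lemma vs_zero_smult: "x : carrier V ==> 0 *[V] x = \<zero>\<^bsub>V\<^esub>"
 using V.smult_l_null[of x] by simp
lemma vs_smult_zero: "a *[V] \<zero>\<^bsub>V\<^esub> = \<zero>\<^bsub>V\<^esub>"
 by simp
lemma vs_minus: "x : carrier V ==> \<ominus>\<^bsub>V\<^esub> x = (- 1) *[V] x"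
proof -
 assume x: "x : carrier V"
 have "(- 1) *[V] x +[V] x = (- 1 + 1) *[V] x"
  using vs_distrib_right[OF x, of "-1" 1] vs_one[OF x] by simp
 then show ?thesis
  using x vs_zero_smult[OF x] by (simp add: V.minus_equality)
qed
lemma vs_add_minus: "x : carrier V ==> x +[V] (- 1) *[V] x = \<zero>\<^bsub>V\<^esub>"
 using vs_minus[of x] V.r_neg[of x] by simp

lemma vs_eq_iff_diff:
 "x : carrier V ==> y : carrier V ==> x = y \<longleftrightarrow> x +[V] (- 1) *[V] y = \<zero>\<^bsub>V\<^esub>"
 by (metis vs_add_minus vs_add_zero(2) vs_assoc vs_commute vs_smult_closed)

lemma vs_finsum_closed: "(!!i. i : I ==> f i : carrier V) ==> (\<Oplus>\<^bsub>V\<^esub>i\<in>I. f i) : carrier V"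
 by (rule V.finsum_closed) auto

lemma vs_finsum_insert: "finite I ==> i \<notin> I ==> (!!j. j : insert i I ==> f j : carrier V) ==>
  (\<Oplus>\<^bsub>V\<^esub>j\<in>insert i I. f j) = f i +[V] (\<Oplus>\<^bsub>V\<^esub>j\<in>I. f j)"
 by (rule V.finsum_insert) auto

lemma vs_finsum_empty: "(\<Oplus>\<^bsub>V\<^esub>j\<in>{}. f j) = \<zero>\<^bsub>V\<^esub>"
 by simp

lemma vs_finsum_add: "(!!i. i : I ==> f i : carrier V) ==> (!!i. i : I ==> g i : carrier V) ==>
  (\<Oplus>\<^bsub>V\<^esub>i\<in>I. f i +[V] g i) = (\<Oplus>\<^bsub>V\<^esub>i\<in>I. f i) +[V] (\<Oplus>\<^bsub>V\<^esub>i\<in>I. g i)"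
 by (rule V.finsum_addf) auto

lemma vs_finsum_cong: "(!!i. i : I ==> g i : carrier V) ==> (!!i. i : I ==> f i = g i) ==>
  (\<Oplus>\<^bsub>V\<^esub>i\<in>I. f i) = (\<Oplus>\<^bsub>V\<^esub>i\<in>I. g i)"
 by (rule V.finsum_cong') auto

lemma vs_finsum_smult: "finite I ==> (!!i. i : I ==> f i : carrier V) ==>
  (\<Oplus>\<^bsub>V\<^esub>i\<in>I. a *[V] f i) = a *[V] (\<Oplus>\<^bsub>V\<^esub>i\<in>I. f i)"
proof (induction I rule: finite_induct)
 case (insert i I)
 have "(\<Oplus>\<^bsub>V\<^esub>j\<in>insert i I. a *[V] f j) = a *[V] f i +[V] (\<Oplus>\<^bsub>V\<^esub>j\<in>I. a *[V] f j)"
  by (rule vs_finsum_insert) (use insert in \<open>auto intro: vs_smult_closed\<close>)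
 then show ?case
  using insert by (simp add: vs_finsum_insert vs_distrib_left vs_finsum_closed)
qed simp

lemma vs_finsum_mono_neutral: "finite B ==> A \<subseteq> B ==> (!!i. i : B - A ==> f i = \<zero>\<^bsub>V\<^esub>) ==>
  (!!i. i : B ==> f i : carrier V) ==> (\<Oplus>\<^bsub>V\<^esub>i\<in>B. f i) = (\<Oplus>\<^bsub>V\<^esub>i\<in>A. f i)"
 by (rule V.add.finprod_mono_neutral_cong_left[symmetric]) auto

end

lemmas vs_closed = vs_add_closed vs_zero_closed vs_smult_closed

lemma vspace_scalars: "vspace (scalars :: ('k::field, 'k) module)"
 by (rule vspaceI) (auto simp: algebra_simps)

lemma finsum_scalars: "finite I ==> (\<Oplus>\<^bsub>scalars\<^esub>i\<in>I. f i) = (\<Sum>i\<in>I. f i :: 'k::field)"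
 by (induction I rule: finite_induct)
  (auto simp: vs_finsum_insert[OF vspace_scalars] vs_finsum_empty[OF vspace_scalars])

text \<open>Free of additive inverses, which come from the scalar -1;
  \<open>submodule_iff_subspace_of\<close> gives the link to the library notion.\<close>

definition subspace_of :: "('k::field, 'v, 'm) module_scheme => 'v set => bool" where
 "subspace_of V U \<longleftrightarrow> U \<subseteq> carrier V & \<zero>\<^bsub>V\<^esub> : U & (\<forall>x\<in>U. \<forall>y\<in>U. x +[V] y : U) &
   (\<forall>a. \<forall>x\<in>U. a *[V] x : U)"

lemma subspD:
 assumes "subspace_of V U"
 shows "x : U ==> x : carrier V" "\<zero>\<^bsub>V\<^esub> : U" "x : U ==> y : U ==> x +[V] y : U"
  "x : U ==> a *[V] x : U"
 using assms by (auto simp: subspace_of_def)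

lemma vspace_sub:
 assumes V: "vspace V" and U: "subspace_of V U"
 shows "vspace (V\<lparr>carrier := U\<rparr>)"
 by (rule vspaceI)
  (use subspD[OF U] in \<open>auto simp: vs_assoc[OF V] vs_add_zero[OF V] vs_commute[OF V, of x y for x y]
   vs_lcommute[OF V]
   vs_distrib_left[OF V] vs_distrib_right[OF V] vs_smult_smult[OF V] vs_one[OF V] vs_zero_smult[OF V]\<close>)

lemma submodule_iff_subspace_of:
 fixes V :: "('k::field, 'v, 'm) module_scheme"
 assumes V: "vspace V"
 shows "submodule U (ring_of_type_algebra :: 'k ring) V \<longleftrightarrow> subspace_of V U"
proof
 assume "submodule U (ring_of_type_algebra :: 'k ring) V"
 then interpret submodule U "ring_of_type_algebra :: 'k ring" V .
 show "subspace_of V U"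
  using subset one_closed m_closed smult_closed unfolding subspace_of_def by auto
next
 assume U: "subspace_of V U"
 have "(\<ominus>\<^bsub>V\<^esub> x) : U" if "x : U" for x
  using subspD[OF U] that vs_minus[OF V] by metis
 then show "submodule U (ring_of_type_algebra :: 'k ring) V"
  by (intro module.submoduleI[OF V]) (use subspD[OF U] in auto)
qed

lemma abelian_subgroup_subspace:
 fixes V :: "('k::field, 'v, 'm) module_scheme"
 assumes V: "vspace V" and U: "subspace_of V U"
 shows "abelian_subgroup U V"
proof -
 interpret submodule U "ring_of_type_algebra :: 'k ring" V
  using submodule_iff_subspace_of[OF V] U by simp
 show ?thesis
  by (rule abelian_subgroupI3[OF _ vs_abelian_group[OF V]]) (rule additive_subgroup.intro, unfold_locales)
qed

lemma linD:
 assumes "f : linear_maps V W"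
 shows "x : carrier V ==> f x : carrier W"
  "x : carrier V ==> y : carrier V ==> f (x +[V] y) = f x +[W] f y"
  "x : carrier V ==> f (a *[V] x) = a *[W] f x"
 using assms by (auto simp: linear_maps_def)

lemma linear_mapsI:
 assumes "!!x. x : carrier V ==> f x : carrier W"
  "!!x y. x : carrier V ==> y : carrier V ==> f (x +[V] y) = f x +[W] f y"
  "!!a x. x : carrier V ==> f (a *[V] x) = a *[W] f x"
 shows "f : linear_maps V W"
 using assms by (auto simp: linear_maps_def)

lemma linear_maps_zero:
 assumes "vspace V" "vspace W" "f : linear_maps V W"
 shows "f \<zero>\<^bsub>V\<^esub> = \<zero>\<^bsub>W\<^esub>"
 using linD(3)[OF assms(3), of "\<zero>\<^bsub>V\<^esub>" 0] vs_zero_smult[OF assms(1)] vs_zero_smult[OF assms(2)]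
  vs_zero_closed[OF assms(1)] linD(1)[OF assms(3)] by metis

lemma lin_comp: "f : linear_maps V W ==> g : linear_maps W U ==> (%x. g (f x)) : linear_maps V U"
 by (rule linear_mapsI) (simp_all add: linD)

lemma linear_maps_id: "(%x. x) : linear_maps V V"
 by (auto simp: linear_maps_def)

lemma linear_maps_sub: "f : linear_maps V W ==> U \<subseteq> carrier V ==> f : linear_maps (V\<lparr>carrier := U\<rparr>) W"
 by (rule linear_mapsI) (auto simp: linD subset_iff)

lemma linear_maps_finsum:
 assumes V: "vspace V" and W: "vspace W" and f: "f : linear_maps V W" and "finite I"
  and "!!i. i : I ==> g i : carrier V"
 shows "f (\<Oplus>\<^bsub>V\<^esub>i\<in>I. g i) = (\<Oplus>\<^bsub>W\<^esub>i\<in>I. f (g i))"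
 using assms(4,5)
proof (induction I rule: finite_induct)
 case (insert i I)
 have "f (\<Oplus>\<^bsub>V\<^esub>j\<in>insert i I. g j) = f (g i +[V] (\<Oplus>\<^bsub>V\<^esub>j\<in>I. g j))"
  by (subst vs_finsum_insert[OF V]) (use insert in auto)
 also have "... = f (g i) +[W] (\<Oplus>\<^bsub>W\<^esub>j\<in>I. f (g j))"
  using insert by (simp add: linD[OF f] vs_finsum_closed[OF V])
 also have "... = (\<Oplus>\<^bsub>W\<^esub>j\<in>insert i I. f (g j))"
  by (subst vs_finsum_insert[OF W]) (use insert linD[OF f] in auto)
 finally show ?case .
qed (simp add: vs_finsum_empty[OF V] vs_finsum_empty[OF W] linear_maps_zero[OF V W f])

lemma subspace_of_ker:
 assumes V: "vspace V" and W: "vspace W" and f: "f : linear_maps V W" and N: "subspace_of W N"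
 shows "subspace_of V {x : carrier V. f x : N}"
 using subspD[OF N] linD[OF f] vs_closed[OF V] linear_maps_zero[OF V W f]
 by (auto simp: subspace_of_def)

lemma subspace_of_image:
 assumes V: "vspace V" and W: "vspace W" and f: "f : linear_maps V W" and N: "subspace_of V N"
 shows "subspace_of W (f ` N)"
 unfolding subspace_of_def
proof (intro conjI ballI allI)
 show "f ` N \<subseteq> carrier W"
  using subspD[OF N] linD[OF f] by auto
 show "\<zero>\<^bsub>W\<^esub> : f ` N"
  using subspD(2)[OF N] linear_maps_zero[OF V W f] by force
 fix x y a assume "x : f ` N"
 then obtain x' where x': "x = f x'" "x' : N" by auto
 show "a *[W] x : f ` N"
  using x' linD(3)[OF f, of x' a] subspD(4)[OF N, of x' a] subspD(1)[OF N, of x']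
  by (auto intro: rev_image_eqI)
 assume "y : f ` N"
 then obtain y' where y': "y = f y'" "y' : N" by auto
 show "x +[W] y : f ` N"
  using x' y' linD(2)[OF f, of x' y'] subspD(3)[OF N, of x' y'] subspD(1)[OF N]
  by (auto intro: rev_image_eqI)
qed

lemma subspace_of_inter: "subspace_of V U ==> subspace_of V W ==> subspace_of V (U \<inter> W)"
 by (auto simp: subspace_of_def)

lemma subspace_of_carrier: "vspace V ==> subspace_of V (carrier V)"
 using vs_closed by (auto simp: subspace_of_def)

lemma subspace_of_zero: "vspace V ==> subspace_of V {\<zero>\<^bsub>V\<^esub>}"
 using vs_zero_closed[of V] vs_smult_zero[of V] vs_add_zero(1)[of V "\<zero>\<^bsub>V\<^esub>"] by (auto simp: subspace_of_def)

definition subspace_sum :: "('k::field, 'v, 'm) module_scheme => 'v set => 'v set => 'v set" where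
 "subspace_sum V U W = {x +[V] y | x y. x : U & y : W}"

lemma subspace_of_sum:
 assumes V: "vspace V" and U: "subspace_of V U" and W: "subspace_of V W"
 shows "subspace_of V (subspace_sum V U W)" "U \<subseteq> subspace_sum V U W" "W \<subseteq> subspace_sum V U W"
proof -
 note [simp] = subspD(1,2)[OF U] subspD(1,2)[OF W]
 show UU: "U \<subseteq> subspace_sum V U W"
  unfolding subspace_sum_def
  using vs_add_zero(2)[OF V] subspD(2)[OF W] subspD(1)[OF U] by (auto, metis)
 show "W \<subseteq> subspace_sum V U W"
  unfolding subspace_sum_def
  using vs_add_zero(1)[OF V] subspD(2)[OF U] subspD(1)[OF W] by (auto, metis)
 have "(x +[V] y) +[V] (x' +[V] y') = (x +[V] x') +[V] (y +[V] y')"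
  if "x : U" "x' : U" "y : W" "y' : W" for x x' y y'
  using that by (simp add: vs_assoc[OF V] vs_lcommute[OF V] vs_add_closed[OF V])
 then show "subspace_of V (subspace_sum V U W)"
  unfolding subspace_of_def
 proof (intro conjI ballI allI)
  show "subspace_sum V U W \<subseteq> carrier V"
   by (auto simp: subspace_sum_def vs_add_closed[OF V])
  show "\<zero>\<^bsub>V\<^esub> : subspace_sum V U W"
   using UU by auto
 next
  fix x y assume "x : subspace_sum V U W" "y : subspace_sum V U W"
  then obtain x1 x2 y1 y2 where *: "x = x1 +[V] x2" "y = y1 +[V] y2" "x1 : U" "y1 : U" "x2 : W" "y2 : W"
   by (auto simp: subspace_sum_def)
  have "x +[V] y = (x1 +[V] y1) +[V] (x2 +[V] y2)"
   using * by (simp add: vs_assoc[OF V] vs_lcommute[OF V] vs_add_closed[OF V])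
  then show "x +[V] y : subspace_sum V U W"
   unfolding subspace_sum_def using * subspD(3)[OF U] subspD(3)[OF W] by blast
 next
  fix a x assume "x : subspace_sum V U W"
  then obtain x1 x2 where *: "x = x1 +[V] x2" "x1 : U" "x2 : W"
   by (auto simp: subspace_sum_def)
  then show "a *[V] x : subspace_sum V U W"
   unfolding subspace_sum_def
   using subspD(4)[OF U] subspD(4)[OF W] vs_distrib_left[OF V, of x1 x2 a]
   subspD(1)[OF U] subspD(1)[OF W] by blast
 qed
qed

section \<open>Separation by linear functionals\<close>

abbreviation dual :: "('k::field, 'v, 'm) module_scheme => ('v => 'k) set" where
 "dual V \<equiv> linear_maps V scalars"

text \<open>A complement \<open>M\<close> of \<open>N\<close> is found by Zorn's lemma as a maximal
  subspace meeting \<open>N\<close> trivially, and the projection is taken along \<open>M\<close>.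
  Spaces such as k[G] offer no finite dimension to rely on.\<close>

lemma subspace_projection:
 fixes V :: "('k::field, 'v, 'm) module_scheme"
 assumes V: "vspace V" and N: "subspace_of V N"
 shows "\<exists>p. p : linear_maps V V & (\<forall>x\<in>carrier V. p x : N) & (\<forall>x\<in>N. p x = x)"
proof -
 let ?A = "{M. subspace_of V M & M \<inter> N \<subseteq> {\<zero>\<^bsub>V\<^esub>}}"
 note Nc = subspD[OF N]
 have "\<exists>M\<in>?A. \<forall>T\<in>?A. M \<subseteq> T --> T = M"
 proof (rule subset_Zorn_nonempty)
  show "?A ~= {}" using subspace_of_zero[OF V] by blast
  fix \<C> assume C: "\<C> ~= {}" "subset.chain ?A \<C>"
  then have sub: "subspace_of V M" "M \<inter> N \<subseteq> {\<zero>\<^bsub>V\<^esub>}" if "M : \<C>" for M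
   using that by (auto simp: subset.chain_def)
  have tot: "M \<subseteq> M' \<or> M' \<subseteq> M" if "M : \<C>" "M' : \<C>" for M M'
   using C(2) that unfolding subset.chain_def by blast
  have "subspace_of V (\<Union>\<C>)"
   unfolding subspace_of_def
  proof (intro conjI ballI allI)
   fix x y assume "x : \<Union>\<C>" "y : \<Union>\<C>"
   then obtain M M' where "x : M" "M : \<C>" "y : M'" "M' : \<C>" by auto
   with tot obtain M'' where "M'' : \<C>" "x : M''" "y : M''" by blast
   then show "x +[V] y : \<Union>\<C>" using subspD(3)[OF sub(1)] by blast
  next
   show "\<Union>\<C> \<subseteq> carrier V" using subspD(1)[OF sub(1)] by auto
   show "\<zero>\<^bsub>V\<^esub> : \<Union>\<C>" using subspD(2)[OF sub(1)] C(1) by auto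
  next
   fix a x assume "x : \<Union>\<C>"
   then show "a *[V] x : \<Union>\<C>" using subspD(4)[OF sub(1)] by auto
  qed
  then show "\<Union>\<C> : ?A" using sub(2) by blast
 qed
 then obtain M where M_in: "M : ?A" and M_max: "\<forall>T\<in>?A. M \<subseteq> T --> T = M"
  by (rule bexE)
 from M_in have M: "subspace_of V M" "M \<inter> N \<subseteq> {\<zero>\<^bsub>V\<^esub>}" by auto
 note Mc = subspD[OF M(1)]
 let ?d = "%x y. x +[V] (-1) *[V] y"
 note [simp] = vs_closed[OF V]
 \<comment> \<open>Two such decompositions differ by a vector that lies in both \<open>M\<close> and
   \<open>N\<close>.\<close>
 have uniq: "y = z" if x: "x : carrier V" and y: "y : N" "?d x y : M" and z: "z : N" "?d x z : M" for x y z
 proof -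
  have c: "y : carrier V" "z : carrier V" using y z Nc(1) by auto
  have "?d (?d x z) (?d x y) = ?d x x +[V] ?d y z"
   using x c by (simp add: vs_distrib_left[OF V] vs_smult_smult[OF V] vs_one[OF V] vs_assoc[OF V] vs_lcommute[OF V] vs_commute[OF V])
  also have "... = ?d y z" using x c by (simp add: vs_add_minus[OF V] vs_add_zero[OF V])
  finally have "?d y z : M" using Mc(3)[OF z(2) Mc(4)[OF y(2), of "-1"]] by simp
  moreover have "?d y z : N" by (intro Nc(3,4) y z)
  ultimately show ?thesis using M(2) vs_eq_iff_diff[OF V c] by blast
 qed
 \<comment> \<open>Otherwise \<open>M\<close> could be enlarged by the line through \<open>x\<close>
   and would still meet \<open>N\<close> trivially, against maximality.\<close>
 have ex: "\<exists>y\<in>N. ?d x y : M" if x: "x : carrier V" for x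
 proof (rule ccontr)
  assume neg: "\<not> ?thesis"
  define L where "L = (%a. a *[V] x) ` UNIV"
  have L: "subspace_of V L"
   unfolding L_def subspace_of_def
   using x rangeI[of "%a. a *[V] x" 0] vs_zero_smult[OF V x]
   by (auto simp: vs_distrib_right[OF V, symmetric] vs_smult_smult[OF V] intro: rev_image_eqI)
  let ?S = "subspace_sum V M L"
  note S = subspace_of_sum[OF V M(1) L]
  have "?S \<inter> N \<subseteq> {\<zero>\<^bsub>V\<^esub>}"
  proof
   fix z assume z: "z : ?S \<inter> N"
   then obtain m a where m: "z = m +[V] a *[V] x" "m : M" by (auto simp: subspace_sum_def L_def)
   have mc: "m : carrier V" using Mc m by auto
   show "z : {\<zero>\<^bsub>V\<^esub>}"
   proof (cases "a = 0")
    case True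
    then have "z = m" using m mc by (simp add: vs_zero_smult[OF V x] vs_add_zero[OF V])
    then show ?thesis using M(2) m(2) z by blast
   next
    \<comment> \<open>Here \<open>z\<close> divided by \<open>a\<close> lies in \<open>N\<close> and
      differs from \<open>x\<close> by an element of \<open>M\<close>, which \<open>neg\<close>
      excludes.\<close>
    case False
    have "?d x (inverse a *[V] z) = (- inverse a) *[V] m +[V] ?d x x"
     unfolding m(1) using False x mc by (simp add: vs_distrib_left[OF V] vs_smult_smult[OF V] vs_lcommute[OF V])
    also have "... = (- inverse a) *[V] m" using x mc by (simp add: vs_add_minus[OF V] vs_add_zero[OF V])
    finally show ?thesis using neg Mc(4)[OF m(2)] Nc(4)[of z "inverse a"] z by auto
   qed
  qed
  then have "?S = M" using bspec[OF M_max, of ?S] S(1,2) by simp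
  moreover have "x : L" unfolding L_def using vs_one[OF V x] by (auto intro: rev_image_eqI[of 1])
  ultimately have "x : M" using S(3) by blast
  \<comment> \<open>The zero vector is then an admissible \<open>N\<close>-component of
    \<open>x\<close>.\<close>
  then have "?d x \<zero>\<^bsub>V\<^esub> : M" using x by (simp add: vs_smult_zero[OF V] vs_add_zero[OF V])
  then show False using neg Nc(2) by blast
 qed
 define p where "p x = (THE y. y : N & ?d x y : M)" for x
 have pI: "p x = y" if "x : carrier V" "y : N" "?d x y : M" for x y
  unfolding p_def using that uniq by blast
 have p: "p x : N" "?d x (p x) : M" "p x : carrier V" if x: "x : carrier V" for x
  using ex[OF x] pI[OF x] Nc(1) by metis+
 have "p : linear_maps V V"
 proof (rule linear_mapsI)
  fix x assume x: "x : carrier V"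
  show "p x : carrier V" by (rule p(3)[OF x])
  have "?d (a *[V] x) (a *[V] p x) = a *[V] ?d x (p x)" for a
   using x p(3)[OF x] by (simp add: vs_distrib_left[OF V] vs_smult_smult[OF V])
  then show "p (a *[V] x) = a *[V] p x" for a
   using x p[OF x] Mc(4) Nc(4) by (intro pI) simp_all
  fix y assume y: "y : carrier V"
  have "?d (x +[V] y) (p x +[V] p y) = ?d x (p x) +[V] ?d y (p y)"
   using x y p(3)[OF x] p(3)[OF y] by (simp add: vs_distrib_left[OF V] vs_assoc[OF V] vs_lcommute[OF V])
  then show "p (x +[V] y) = p x +[V] p y"
   using x y p[OF x] p[OF y] Mc(3) Nc(3) by (intro pI) simp_all
 qed
 moreover have "p x = x" if "x : N" for x
  by (rule pI) (use that Nc(1) Mc(2) vs_add_minus[OF V] in auto)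
 ultimately show ?thesis using p(1) by blast
qed

text \<open>For a projection p onto \<open>N\<close>, the vector u = v - p v is nonzero and spans a
  line. Projecting x - p x to that line and reading off the coefficient gives the functional; it
  vanishes on \<open>N\<close> because p fixes \<open>N\<close>.\<close>

lemma dual_separates_subspace:
 fixes V :: "('k::field, 'v, 'm) module_scheme"
 assumes V: "vspace V" and N: "subspace_of V N" and v: "v : carrier V" "v \<notin> N"
 shows "\<exists>ph\<in>dual V. ph v = 1 & (\<forall>x\<in>N. ph x = 0)"
proof -
 obtain p where p: "p : linear_maps V V" "!!x. x : carrier V ==> p x : N" "!!x. x : N ==> p x = x"
  using subspace_projection[OF V N] by blast
 let ?d = "%x. x +[V] (-1) *[V] p x"
 note [simp] = vs_closed[OF V] linD(1)[OF p(1)]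
 define u where "u = ?d v"
 have u: "u : carrier V" using v by (simp add: u_def)
 have u0: "u ~= \<zero>\<^bsub>V\<^esub>"
  unfolding u_def using vs_eq_iff_diff[OF V v(1) linD(1)[OF p(1) v(1)]] p(2)[OF v(1)] v(2) by auto
 define L where "L = (%a. a *[V] u) ` UNIV"
 have L: "subspace_of V L"
  unfolding L_def subspace_of_def
  using u rangeI[of "%a. a *[V] u" 0] vs_zero_smult[OF V u]
  by (auto simp: vs_distrib_right[OF V, symmetric] vs_smult_smult[OF V] intro: rev_image_eqI)
 obtain r where r: "r : linear_maps V V" "!!x. x : carrier V ==> r x : L" "!!x. x : L ==> r x = x"
  using subspace_projection[OF V L] by blast
 define h where "h x = (THE a. r (?d x) = a *[V] u)" for x
 have inj: "a = b" if "a *[V] u = b *[V] u" for a b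
 proof (rule ccontr)
  assume "a ~= b"
  have "(a - b) *[V] u = a *[V] u +[V] (-1) *[V] (b *[V] u)"
   using u vs_distrib_right[OF V u, of a "- b"] by (simp add: vs_smult_smult[OF V])
  also have "... = \<zero>\<^bsub>V\<^esub>" unfolding that using u by (simp add: vs_add_minus[OF V])
  finally have "inverse (a - b) *[V] ((a - b) *[V] u) = \<zero>\<^bsub>V\<^esub>" by (simp add: vs_smult_zero[OF V])
  then show False using \<open>a ~= b\<close> u u0 by (simp add: vs_smult_smult[OF V] vs_one[OF V])
 qed
 have hI: "h x = a" if "r (?d x) = a *[V] u" for x a
  unfolding h_def that using inj by blast
 have h: "r (?d x) = h x *[V] u" if x: "x : carrier V" for x
 proof -
  have "r (?d x) : L" using x by (intro r(2)) simp
  then obtain a where "r (?d x) = a *[V] u" unfolding L_def by blast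
  with hI[OF this] show ?thesis by simp
 qed
 have "h : dual V"
 proof (rule linear_mapsI)
  fix x assume x: "x : carrier V"
  have "?d (a *[V] x) = a *[V] ?d x" for a
   using x by (simp add: linD(3)[OF p(1)] vs_distrib_left[OF V] vs_smult_smult[OF V])
  then show "h (a *[V] x) = a *[scalars] h x" for a
   using x u by (intro hI) (simp add: linD(3)[OF r(1)] h vs_smult_smult[OF V])
  fix y assume y: "y : carrier V"
  have "?d (x +[V] y) = ?d x +[V] ?d y"
   using x y by (simp add: linD(2)[OF p(1)] vs_distrib_left[OF V] vs_assoc[OF V] vs_lcommute[OF V])
  then show "h (x +[V] y) = h x +[scalars] h y"
   using x y u by (intro hI) (simp add: linD(2)[OF r(1), of "?d x" "?d y"] h[OF x] h[OF y] vs_distrib_right[OF V])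
 qed simp
 moreover have "h v = 1"
 proof (rule hI)
  have "u : L" unfolding L_def using vs_one[OF V u] by (auto intro: rev_image_eqI[of 1])
  then show "r (?d v) = 1 *[V] u" unfolding u_def[symmetric] using vs_one[OF V u] r(3) by simp
 qed
 moreover have "h x = 0" if "x : N" for x
 proof (rule hI)
  have x: "x : carrier V" using that subspD(1)[OF N] by blast
  show "r (?d x) = 0 *[V] u"
   using p(3)[OF that] linear_maps_zero[OF V V r(1)] x by (simp add: vs_add_minus[OF V] vs_zero_smult[OF V u])
 qed
 ultimately show ?thesis by blast
qed

text \<open>The case of the zero subspace, applied to the difference. Many equations between vectors
  below are reduced to scalars in this way.\<close>

lemma dual_separates:
 fixes V :: "('k::field, 'v, 'm) module_scheme"
 assumes V: "vspace V" and v: "x : carrier V" "y : carrier V" and eq: "!!ph. ph : dual V ==> ph x = ph y"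
 shows "x = y"
proof (rule ccontr)
 let ?d = "x +[V] (-1) *[V] y"
 assume "x ~= y"
 then have "?d \<notin> {\<zero>\<^bsub>V\<^esub>}" "?d : carrier V"
  using vs_eq_iff_diff[OF V v] v vs_closed[OF V] by auto
 then obtain ph where ph: "ph : dual V" "ph ?d = 1"
  using dual_separates_subspace[OF V subspace_of_zero[OF V]] by blast
 have "ph ?d = ph x - ph y"
  using linD[OF ph(1)] v vs_closed[OF V] by simp
 then show False using ph eq[OF ph(1)] by simp
qed

section \<open>Linear extension and tensor products\<close>

lemma keys_pscale: "keys (pscale a f) \<subseteq> keys f"
 unfolding pscale_def by transfer auto

lemma lookup_pscale [simp]: "lookup (pscale a f) x = a * lookup f x"
 unfolding pscale_def by transfer (auto simp: when_def)

lemma pscale_single [simp]: "pscale a (single x b) = single x (a * b)"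
 by (rule poly_mapping_eqI) (simp add: lookup_single when_def)

lemma pscale_simps:
 "pscale a (f + g) = pscale a f + pscale a g"
 "pscale a (f - g) = pscale a f - pscale a g"
 "pscale (a + b) f = pscale a f + pscale b f"
 "pscale a (pscale b f) = pscale (a * b) f"
 "pscale 1 f = f" "pscale 0 f = 0" "pscale a 0 = 0" "pscale (-1) f = - f"
 by (rule poly_mapping_eqI, simp add: lookup_add lookup_minus algebra_simps)+

lemma pscale_sum: "pscale a (\<Sum>i\<in>I. f i) = (\<Sum>i\<in>I. pscale a (f i))"
 by (rule poly_mapping_eqI) (simp add: lookup_sum sum_distrib_left)

lemma poly_mapping_induct_on [consumes 1, case_names zero add]:
 assumes "keys f \<subseteq> S" and "P 0"
  and step: "!!p a f. p : S ==> keys f \<subseteq> S ==> P f ==> P (single p a + f)"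
 shows "P f"
proof -
 have "keys f \<subseteq> S --> P f"
 proof (induction f rule: update_induct)
  case const then show ?case using assms(2) by simp
 next
  case (update f a b)
  have eq: "Poly_Mapping.update a b f = single a b + f"
   using update(1) by (intro poly_mapping_eqI)
    (auto simp: lookup_update lookup_add lookup_single when_def in_keys_iff)
  have keys: "keys (Poly_Mapping.update a b f) = insert a (keys f)"
   using update(2) by (simp add: keys_update)
  show ?case
   unfolding keys using step[of a f b] update(3) unfolding eq[symmetric] by auto
 qed
 then show ?thesis using assms(1) by simp
qed

text \<open>Adding two linear extensions requires a common finite index set, since supports change
  under addition.\<close>

lemma linext_superset:
 assumes U: "vspace U" and "finite A" "keys f \<subseteq> A" "!!p. p : A ==> b p : carrier U"
 shows "linext U b f = (\<Oplus>\<^bsub>U\<^esub>p\<in>A. lookup f p *[U] b p)"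
 unfolding linext_def
 by (rule vs_finsum_mono_neutral[OF U, symmetric])
  (use assms in \<open>auto simp: vs_smult_closed[OF U] vs_zero_smult[OF U] in_keys_iff\<close>)

lemma linext_closed:
 assumes "vspace U" "!!p. p : keys f ==> b p : carrier U"
 shows "linext U b f : carrier U"
 unfolding linext_def by (rule vs_finsum_closed[OF assms(1)]) (use assms(2) vs_smult_closed[OF assms(1)] in auto)

lemma linext_add:
 assumes U: "vspace U" and b: "!!p. p : S ==> b p : carrier U"
  and "keys f \<subseteq> S" "keys g \<subseteq> S"
 shows "linext U b (f + g) = linext U b f +[U] linext U b g"
proof -
 let ?A = "keys f \<union> keys g"
 have c: "b p : carrier U" if "p : ?A" for p using that assms by auto
 have "linext U b (f + g) = (\<Oplus>\<^bsub>U\<^esub>p\<in>?A. lookup (f + g) p *[U] b p)"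
  by (rule linext_superset[OF U]) (use c Poly_Mapping.keys_add[of f g] in auto)
 also have "... = (\<Oplus>\<^bsub>U\<^esub>p\<in>?A. lookup f p *[U] b p +[U] lookup g p *[U] b p)"
  by (rule vs_finsum_cong[OF U]) (use c in \<open>auto simp: lookup_add vs_distrib_right[OF U] vs_closed[OF U]\<close>)
 also have "... = (\<Oplus>\<^bsub>U\<^esub>p\<in>?A. lookup f p *[U] b p) +[U] (\<Oplus>\<^bsub>U\<^esub>p\<in>?A. lookup g p *[U] b p)"
  by (rule vs_finsum_add[OF U]) (use c in \<open>auto simp: vs_closed[OF U]\<close>)
 also have "... = linext U b f +[U] linext U b g"
  using linext_superset[OF U, of ?A f b] linext_superset[OF U, of ?A g b] c by simp
 finally show ?thesis .
qed

lemma linext_pscale: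
 assumes U: "vspace U" and b: "!!p. p : keys f ==> b p : carrier U"
 shows "linext U b (pscale a f) = a *[U] linext U b f"
proof -
 have "linext U b (pscale a f) = (\<Oplus>\<^bsub>U\<^esub>p\<in>keys f. (a * lookup f p) *[U] b p)"
  using linext_superset[OF U, of "keys f" "pscale a f" b] b keys_pscale[of a f] by simp
 also have "... = (\<Oplus>\<^bsub>U\<^esub>p\<in>keys f. a *[U] (lookup f p *[U] b p))"
  by (rule vs_finsum_cong[OF U]) (use b in \<open>auto simp: vs_smult_smult[OF U] vs_closed[OF U]\<close>)
 also have "... = a *[U] linext U b f"
  unfolding linext_def by (rule vs_finsum_smult[OF U]) (use b vs_closed[OF U] in auto)
 finally show ?thesis .
qed

lemma linext_single [simp]:
 assumes U: "vspace U" and b: "b p : carrier U"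
 shows "linext U b (single p a) = a *[U] b p"
proof -
 have "linext U b (single p a) = (\<Oplus>\<^bsub>U\<^esub>p'\<in>{p}. lookup (single p a) p' *[U] b p')"
  by (rule linext_superset[OF U]) (use b in auto)
 also have "... = a *[U] b p"
  using b by (subst vs_finsum_insert[OF U]) (auto simp: vs_finsum_empty[OF U] vs_add_zero[OF U] vs_closed[OF U])
 finally show ?thesis .
qed

lemma linext_zero [simp]: "vspace U ==> linext U b 0 = \<zero>\<^bsub>U\<^esub>"
 by (simp add: linext_def vs_finsum_empty)

lemma linext_diff:
 assumes U: "vspace U" and b: "!!p. p : S ==> b p : carrier U"
  and "keys f \<subseteq> S" "keys g \<subseteq> S"
 shows "linext U b (f - g) = linext U b f +[U] (-1) *[U] linext U b g"
proof -
 have "f - g = f + pscale (-1) g" by (rule poly_mapping_eqI) (simp add: lookup_minus lookup_add)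
 moreover have "linext U b (f + pscale (-1) g) = linext U b f +[U] linext U b (pscale (-1) g)"
  by (rule linext_add[OF U b, where S = S]) (use assms keys_pscale[of "-1" g] in auto)
 moreover have "linext U b (pscale (-1) g) = (-1) *[U] linext U b g"
  by (rule linext_pscale[OF U]) (use assms in auto)
 ultimately show ?thesis by (simp only:)
qed

lemma linext_cong:
 assumes "vspace U" "!!p. p : keys f ==> b p = b' p" "!!p. p : keys f ==> b' p : carrier U"
 shows "linext U b f = linext U b' f"
 unfolding linext_def by (rule vs_finsum_cong[OF assms(1)]) (use assms vs_closed[OF assms(1)] in auto)

lemma linear_maps_linext:
 assumes U: "vspace U" and W: "vspace W" and g: "g : linear_maps U W"
  and b: "!!p. p : keys f ==> b p : carrier U"
 shows "g (linext U b f) = linext W (%p. g (b p)) f"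
proof -
 have "g (linext U b f) = (\<Oplus>\<^bsub>W\<^esub>p\<in>keys f. g (lookup f p *[U] b p))"
  unfolding linext_def by (rule linear_maps_finsum[OF U W g]) (use b vs_closed[OF U] in auto)
 also have "... = linext W (%p. g (b p)) f"
  unfolding linext_def
  by (rule vs_finsum_cong[OF W]) (use b linD[OF g] vs_closed[OF W] in auto)
 finally show ?thesis .
qed

section \<open>Quotient spaces by cosets\<close>

lemma carrier_quot_mod: "carrier (quot_mod V U) = {U +>\<^bsub>V\<^esub> x | x. x : carrier V}"
 by (auto simp: quot_mod_def ring.extend_def module.fields_def FactRing_def A_RCOSETS_def' a_r_coset_def')

lemma zero_quot_mod: "\<zero>\<^bsub>quot_mod V U\<^esub> = U"
 by (simp add: quot_mod_def ring.extend_def module.fields_def FactRing_def)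

lemma mult_quot_mod: "x \<otimes>\<^bsub>quot_mod V U\<^esub> y = rcoset_mult V U x y"
 by (simp add: quot_mod_def ring.extend_def module.fields_def FactRing_def)

lemma one_quot_mod: "\<one>\<^bsub>quot_mod V U\<^esub> = U +>\<^bsub>V\<^esub> \<one>\<^bsub>V\<^esub>"
 by (simp add: quot_mod_def ring.extend_def module.fields_def FactRing_def)

context
 fixes V :: "('k::field, 'v, 'm) module_scheme" and U
 assumes V: "vspace V" and U: "subspace_of V U"
begin

interpretation AS: abelian_subgroup U V by (rule abelian_subgroup_subspace[OF V U])

lemma coset_self: "x : carrier V ==> x : U +>\<^bsub>V\<^esub> x"
 by (rule AS.a_rcos_self)

lemma coset_subset: "x : carrier V ==> U +>\<^bsub>V\<^esub> x \<subseteq> carrier V"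
 by (meson AS.a_subset AS.a_r_coset_subset_G)

lemma coset_mem_iff: "x : carrier V ==> y : carrier V ==> y : U +>\<^bsub>V\<^esub> x \<longleftrightarrow> y +[V] (-1) *[V] x : U"
 using AS.a_rcos_module[of x y] vs_minus[OF V, of x] by (simp add: a_minus_def)

lemma coset_of_mem: "y : U +>\<^bsub>V\<^esub> x ==> x : carrier V ==> U +>\<^bsub>V\<^esub> y = U +>\<^bsub>V\<^esub> x"
 by (rule AS.a_repr_independence[symmetric, OF _ _ AS.a_subgroup])

lemma coset_eq_iff:
 assumes "x : carrier V" "y : carrier V"
 shows "U +>\<^bsub>V\<^esub> x = U +>\<^bsub>V\<^esub> y \<longleftrightarrow> x +[V] (-1) *[V] y : U"
proof
 assume "U +>\<^bsub>V\<^esub> x = U +>\<^bsub>V\<^esub> y"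
 then show "x +[V] (-1) *[V] y : U"
  using coset_self[OF assms(1)] coset_mem_iff[OF assms(2,1)] by simp
next
 assume "x +[V] (-1) *[V] y : U"
 then show "U +>\<^bsub>V\<^esub> x = U +>\<^bsub>V\<^esub> y"
  using coset_of_mem[of x y] assms(2) coset_mem_iff[OF assms(2,1)] by simp
qed

lemma add_quot_mod: "x : carrier V ==> y : carrier V ==>
  (U +>\<^bsub>V\<^esub> x) +[quot_mod V U] (U +>\<^bsub>V\<^esub> y) = U +>\<^bsub>V\<^esub> (x +[V] y)"
 by (simp add: quot_mod_def ring.extend_def module.fields_def FactRing_def AS.a_rcos_sum)

lemma smult_quot_mod:
 assumes x: "x : carrier V"
 shows "a *[quot_mod V U] (U +>\<^bsub>V\<^esub> x) = U +>\<^bsub>V\<^esub> (a *[V] x)"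
proof -
 have *: "U +>\<^bsub>V\<^esub> (a *[V] y) = U +>\<^bsub>V\<^esub> (a *[V] x)" if y: "y : U +>\<^bsub>V\<^esub> x" for y
 proof -
  have yc: "y : carrier V" using coset_subset[OF x] y by auto
  have "a *[V] (y +[V] (-1) *[V] x) : U"
   using y unfolding coset_mem_iff[OF x yc] by (rule subspD(4)[OF U])
  moreover have "a *[V] (y +[V] (-1) *[V] x) = a *[V] y +[V] (-1) *[V] (a *[V] x)"
   using x yc by (simp add: vs_closed[OF V] vs_distrib_left[OF V] vs_smult_smult[OF V])
  ultimately show ?thesis
   using coset_eq_iff[OF vs_smult_closed[OF V yc] vs_smult_closed[OF V x]] by simp
 qed
 \<comment> \<open>Scalar multiplication of cosets is defined as a union over representatives; by
   the previous step all its members are the same coset.\<close>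
 have "(\<Union>y\<in>U +>\<^bsub>V\<^esub> x. U +>\<^bsub>V\<^esub> (a *[V] y)) = (\<Union>y\<in>U +>\<^bsub>V\<^esub> x. U +>\<^bsub>V\<^esub> (a *[V] x))"
  by (rule SUP_cong[OF refl *])
 also have "... = U +>\<^bsub>V\<^esub> (a *[V] x)"
  using coset_self[OF x] by blast
 finally show ?thesis
  by (simp add: quot_mod_def ring.extend_def module.fields_def FactRing_def)
qed

lemma coset_zero_iff:
 assumes "x : carrier V"
 shows "U +>\<^bsub>V\<^esub> x = \<zero>\<^bsub>quot_mod V U\<^esub> \<longleftrightarrow> x : U"
 unfolding zero_quot_mod using assms AS.a_coset_join1[OF _ assms AS.a_subgroup]
  AS.a_coset_join2[OF assms AS.a_subgroup] by auto

lemma vspace_quot_mod: "vspace (quot_mod V U)"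
proof -
 have z: "\<zero>\<^bsub>quot_mod V U\<^esub> = U +>\<^bsub>V\<^esub> \<zero>\<^bsub>V\<^esub>"
  using coset_zero_iff[OF vs_zero_closed[OF V]] subspD(2)[OF U] by simp
 note q = carrier_quot_mod add_quot_mod smult_quot_mod vs_closed[OF V]
 show ?thesis
 proof (rule vspaceI)
  fix x y assume "x : carrier (quot_mod V U)" "y : carrier (quot_mod V U)"
  then obtain x' y' where "x' : carrier V" "y' : carrier V" "x = U +>\<^bsub>V\<^esub> x'" "y = U +>\<^bsub>V\<^esub> y'"
   by (auto simp: carrier_quot_mod)
  then show "x +[quot_mod V U] y = y +[quot_mod V U] x"
   by (simp add: add_quot_mod vs_commute[OF V, of x' y'])
 qed (auto simp: q z vs_assoc[OF V] vs_distrib_left[OF V] vs_distrib_right[OF V]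
   vs_smult_smult[OF V] vs_one[OF V] vs_zero_smult[OF V] vs_add_zero[OF V])
qed

lemma coset_linear: "(%x. U +>\<^bsub>V\<^esub> x) : linear_maps V (quot_mod V U)"
 by (rule linear_mapsI) (auto simp: carrier_quot_mod add_quot_mod smult_quot_mod)

end


section \<open>The tensor product and its universal property\<close>

lemma ft_simps:
 "carrier (formal_tensors V W) = {f. keys f \<subseteq> carrier V \<times> carrier W}"
 "x +[formal_tensors V W] y = x + y"
 "\<zero>\<^bsub>formal_tensors V W\<^esub> = 0"
 "a *[formal_tensors V W] x = pscale a x"
 by (simp_all add: formal_tensors_def)

lemma vspace_formal_tensors:
 fixes V :: "('k::field, 'v, 'm) module_scheme" and W :: "('k, 'w, 'l) module_scheme"
 shows "vspace (formal_tensors V W)"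
proof (rule vspaceI)
 fix x y :: "('v \<times> 'w) \<Rightarrow>\<^sub>0 'k" and a
 assume x: "x : carrier (formal_tensors V W)"
 show "a *[formal_tensors V W] x : carrier (formal_tensors V W)"
  using x keys_pscale[of a x] by (auto simp: ft_simps)
 assume "y : carrier (formal_tensors V W)"
 with x show "x +[formal_tensors V W] y : carrier (formal_tensors V W)"
  using Poly_Mapping.keys_add[of x y] by (auto simp: ft_simps)
qed (simp_all add: ft_simps pscale_simps add_ac)

text \<open>Provides the span calculus for \<open>tensor_kernel\<close>, whose span is formed in the
  type of all finitely supported functions.\<close>

interpretation pscale: Modules.module pscale
 by standard (simp_all add: pscale_simps)

lemma pscale_span_induct [consumes 1, case_names base zero add scale]:
 assumes "x : module.span pscale S" "!!x. x : S ==> P x" "P 0"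
  "!!x y. P x ==> P y ==> P (x + y)" "!!a x. P x ==> P (pscale a x)"
 shows "P x"
 by (rule pscale.span_induct_alt[OF assms(1)]) (use assms(2-) in auto)

lemma bilinear_relations_subset:
 assumes V: "vspace V" and W: "vspace W"
 shows "bilinear_relations V W \<subseteq> carrier (formal_tensors V W)"
proof
 fix x assume "x : bilinear_relations V W"
 note [simp] = vs_closed[OF V] vs_closed[OF W]
 have *: "keys (f - g) \<subseteq> carrier V \<times> carrier W"
  if "keys f \<subseteq> carrier V \<times> carrier W" "keys g \<subseteq> carrier V \<times> carrier W"
  for f g :: "_ \<Rightarrow>\<^sub>0 'a"
  using that Poly_Mapping.keys_diff[of f g] by blast
 show "x : carrier (formal_tensors V W)"
  using \<open>x : bilinear_relations V W\<close>
  by cases (simp_all add: ft_simps *)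
qed

text \<open>The span knows nothing of the carriers, so the support condition has to be derived from
  the generators.\<close>

lemma subspace_tensor_kernel:
 assumes V: "vspace V" and W: "vspace W"
 shows "subspace_of (formal_tensors V W) (tensor_kernel V W)"
proof -
 have "x : carrier (formal_tensors V W)" if "x : tensor_kernel V W" for x
  using that unfolding tensor_kernel_def
 proof (induction rule: pscale_span_induct)
  case (base x) then show ?case using bilinear_relations_subset[OF V W] by auto
 next
  case zero then show ?case by (simp add: ft_simps)
 next
  case (add x y) then show ?case
   using vs_add_closed[OF vspace_formal_tensors, of x V W y] by (simp add: ft_simps)
 next
  case (scale a x) then show ?case
   using vs_smult_closed[OF vspace_formal_tensors, of x V W a] by (simp add: ft_simps)
 qed
 then show ?thesis
  unfolding subspace_of_def ft_simps(2-)
  by (simp add: tensor_kernel_def pscale.span_zero pscale.span_add pscale.span_scale subset_iff)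
qed

lemma vspace_tensor: "vspace V ==> vspace W ==> vspace (tensor V W)"
 unfolding tensor_def by (rule vspace_quot_mod[OF vspace_formal_tensors subspace_tensor_kernel])

definition tclass where
 "tclass V W f = tensor_kernel V W +>\<^bsub>formal_tensors V W\<^esub> f"

lemma tens_eq_tclass: "tens V W v w = tclass V W (single (v, w) 1)"
 by (simp add: tens_def tclass_def)

lemma single_mem_formal_tensors:
 "v : carrier V ==> w : carrier W ==> single (v, w) a : carrier (formal_tensors V W)"
 by (auto simp: ft_simps)

definition bilinear_on ::
 "('k::field, 'v, 'm) module_scheme => ('k, 'w, 'l) module_scheme => ('k, 'u, 'h) module_scheme => ('v \<times> 'w => 'u) => bool" where
 "bilinear_on V W U b \<longleftrightarrow> (\<forall>v\<in>carrier V. (%w. b (v, w)) : linear_maps W U) &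
   (\<forall>w\<in>carrier W. (%v. b (v, w)) : linear_maps V U)"

context
 fixes V :: "('k::field, 'v, 'm) module_scheme" and W :: "('k, 'w, 'l) module_scheme"
 assumes V: "vspace V" and W: "vspace W"
begin

lemma carrier_tensor: "carrier (tensor V W) = tclass V W ` carrier (formal_tensors V W)"
 unfolding tensor_def carrier_quot_mod tclass_def by auto

lemma tclass_linear: "tclass V W : linear_maps (formal_tensors V W) (tensor V W)"
 unfolding tensor_def tclass_def
 using coset_linear[OF vspace_formal_tensors subspace_tensor_kernel[OF V W]] .

lemma tclass_eq_iff:
 assumes "f : carrier (formal_tensors V W)" "g : carrier (formal_tensors V W)"
 shows "tclass V W f = tclass V W g \<longleftrightarrow> f - g : tensor_kernel V W"
 using coset_eq_iff[OF vspace_formal_tensors subspace_tensor_kernel[OF V W] assms]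
 by (simp add: ft_simps pscale_simps(8) tclass_def)

lemma tens_closed: "v : carrier V ==> w : carrier W ==> tens V W v w : carrier (tensor V W)"
 unfolding carrier_tensor tens_eq_tclass by (rule imageI) (rule single_mem_formal_tensors)

text \<open>Every tensor is a finite sum of pure tensors without coefficients, since a scalar is
  absorbed into the left factor by a \<open>smult_left\<close> relation.\<close>

lemma tensor_induct [consumes 1, case_names zero add]:
 assumes t: "t : carrier (tensor V W)"
  and z: "P \<zero>\<^bsub>tensor V W\<^esub>"
  and step: "!!v w t. v : carrier V ==> w : carrier W ==> t : carrier (tensor V W) ==> P t ==>
   P (tens V W v w +[tensor V W] t)"
 shows "P t"
proof -
 obtain f where f: "t = tclass V W f" "keys f \<subseteq> carrier V \<times> carrier W"
  using t by (auto simp: carrier_tensor ft_simps)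
 have "P (tclass V W f)"
  using f(2)
 proof (induction f rule: poly_mapping_induct_on)
  case zero
  have "tclass V W 0 = \<zero>\<^bsub>tensor V W\<^esub>"
   using linear_maps_zero[OF vspace_formal_tensors vspace_tensor[OF V W] tclass_linear]
   by (simp add: ft_simps)
  then show ?case using z by simp
 next
  case (add p a f)
  obtain v w where p: "p = (v, w)" "v : carrier V" "w : carrier W"
   using add by (cases p) auto
  have f: "f : carrier (formal_tensors V W)"
   using add by (simp add: ft_simps)
  have "tclass V W (single p a) = tens V W (a *[V] v) w"
   unfolding tens_eq_tclass p
   by (subst eq_commute, subst tclass_eq_iff)
    (use p vs_closed[OF V] bilinear_relations.smult_left[OF p(2,3), of a] in
     \<open>auto simp: ft_simps tensor_kernel_def intro: pscale.span_base\<close>)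
  then have "tclass V W (single p a + f) = tens V W (a *[V] v) w +[tensor V W] tclass V W f"
   using linD(2)[OF tclass_linear, of "single p a" f] f p
   by (simp add: ft_simps)
  then show ?case
   using step[of "a *[V] v" w "tclass V W f"] p vs_closed[OF V] f add carrier_tensor by auto
 qed
 then show ?thesis using f by simp
qed

lemma tens_linear_right: "v : carrier V ==> tens V W v : linear_maps W (tensor V W)"
 and tens_linear_left: "w : carrier W ==> (%v. tens V W v w) : linear_maps V (tensor V W)"
proof -
 have add: "tclass V W f +[tensor V W] tclass V W g = tclass V W (f + g)"
  if "f : carrier (formal_tensors V W)" "g : carrier (formal_tensors V W)" for f g
  using linD(2)[OF tclass_linear that] by (simp add: ft_simps)
 have scale: "a *[tensor V W] tclass V W f = tclass V W (pscale a f)"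
  if "f : carrier (formal_tensors V W)" for a f
  using linD(3)[OF tclass_linear that] by (simp add: ft_simps)
 have plus: "f + g : carrier (formal_tensors V W)"
  if "f : carrier (formal_tensors V W)" "g : carrier (formal_tensors V W)" for f g
  using vs_add_closed[OF vspace_formal_tensors that] by (simp add: ft_simps)
 note c = single_mem_formal_tensors vs_closed[OF V] vs_closed[OF W]
 have eq: "tclass V W f = tclass V W g" if "f - g : bilinear_relations V W"
  "f : carrier (formal_tensors V W)" "g : carrier (formal_tensors V W)" for f g
  using that by (simp add: tclass_eq_iff tensor_kernel_def pscale.span_base)
 show "tens V W v : linear_maps W (tensor V W)" if v: "v : carrier V"
 proof (rule linear_mapsI)
  fix w w' a assume w: "w : carrier W"
  show "tens V W v w : carrier (tensor V W)" using v w by (rule tens_closed)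
  show "tens V W v (a *[W] w) = a *[tensor V W] tens V W v w"
   unfolding tens_eq_tclass using v w
   by (simp add: scale c) (rule eq, auto simp: c intro: bilinear_relations.smult_right)
  assume w': "w' : carrier W"
  show "tens V W v (w +[W] w') = tens V W v w +[tensor V W] tens V W v w'"
   unfolding tens_eq_tclass using v w w' bilinear_relations.add_right[OF v w w']
   by (simp add: add c) (rule eq, auto simp: c plus algebra_simps)
 qed
 show "(%v. tens V W v w) : linear_maps V (tensor V W)" if w: "w : carrier W"
 proof (rule linear_mapsI)
  fix v v' a assume v: "v : carrier V"
  show "tens V W v w : carrier (tensor V W)" using v w by (rule tens_closed)
  show "tens V W (a *[V] v) w = a *[tensor V W] tens V W v w"
   unfolding tens_eq_tclass using v w
   by (simp add: scale c) (rule eq, auto simp: c intro: bilinear_relations.smult_left)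
  assume v': "v' : carrier V"
  show "tens V W (v +[V] v') w = tens V W v w +[tensor V W] tens V W v' w"
   unfolding tens_eq_tclass using v w v' bilinear_relations.add_left[OF v v' w]
   by (simp add: add c) (rule eq, auto simp: c plus algebra_simps)
 qed
qed

context
 fixes U :: "('k, 'u, 'h) module_scheme" and b
 assumes U: "vspace U" and b: "bilinear_on V W U b"
begin

lemma bilinear_onD:
 "v : carrier V ==> w : carrier W ==> b (v, w) : carrier U"
 "v : carrier V ==> v' : carrier V ==> w : carrier W ==> b (v +[V] v', w) = b (v, w) +[U] b (v', w)"
 "v : carrier V ==> w : carrier W ==> w' : carrier W ==> b (v, w +[W] w') = b (v, w) +[U] b (v, w')"
 "v : carrier V ==> w : carrier W ==> b (a *[V] v, w) = a *[U] b (v, w)"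
 "v : carrier V ==> w : carrier W ==> b (v, a *[W] w) = a *[U] b (v, w)"
 using b unfolding bilinear_on_def by (auto dest: linD)

lemma linext_add_tensors: "keys f \<subseteq> carrier V \<times> carrier W ==> keys g \<subseteq> carrier V \<times> carrier W ==>
  linext U b (f + g) = linext U b f +[U] linext U b g"
 by (rule linext_add[OF U, where S = "carrier V \<times> carrier W"]) (auto intro: bilinear_onD)

lemma linext_tensors_closed: "keys f \<subseteq> carrier V \<times> carrier W ==> linext U b f : carrier U"
 by (rule linext_closed[OF U]) (auto intro: bilinear_onD)

lemma linext_pscale_tensors: "keys f \<subseteq> carrier V \<times> carrier W ==>
  linext U b (pscale a f) = a *[U] linext U b f"
 by (rule linext_pscale[OF U]) (auto intro: bilinear_onD)

lemma linext_diff_tensors: "keys f \<subseteq> carrier V \<times> carrier W ==> keys g \<subseteq> carrier V \<times> carrier W ==>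
  linext U b (f - g) = linext U b f +[U] (-1) *[U] linext U b g"
 by (rule linext_diff[OF U, where S = "carrier V \<times> carrier W"]) (auto intro: bilinear_onD)

text \<open>The four kinds of generators of the kernel are the four bilinearity laws, so the linear
  extension of a bilinear map kills them.\<close>

lemma linext_tensor_kernel:
 assumes "x : tensor_kernel V W"
 shows "linext U b x = \<zero>\<^bsub>U\<^esub>"
proof -
 let ?S = "carrier V \<times> carrier W"
 have "keys x \<subseteq> ?S & linext U b x = \<zero>\<^bsub>U\<^esub>"
  using assms unfolding tensor_kernel_def
 proof (induction rule: pscale_span_induct)
  case (base x)
  have d2: "linext U b (f - g) = \<zero>\<^bsub>U\<^esub>" if "linext U b f = linext U b g"
   "keys f \<subseteq> ?S" "keys g \<subseteq> ?S" for f g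
   using linext_diff_tensors[OF that(2,3)] that(1) linext_tensors_closed[OF that(3)]
   by (simp add: vs_add_minus[OF U])
  have a2: "linext U b (f + g) = linext U b f +[U] linext U b g"
   "keys (f + g) \<subseteq> ?S"
   if "keys f \<subseteq> ?S" "keys g \<subseteq> ?S" for f g
   using linext_add_tensors[OF that] Poly_Mapping.keys_add[of f g] that by auto
  note c = vs_closed[OF V] vs_closed[OF W] vs_one[OF U] bilinear_onD(1)
  have l: "linext U b (single (v, w) a) = a *[U] b (v, w)"
   "keys (single (v, w) a) \<subseteq> ?S"
   if "v : carrier V" "w : carrier W" for v w a
   using that linext_single[OF U, of b "(v, w)"] by (auto simp: c)
  have "linext U b x = \<zero>\<^bsub>U\<^esub>"
   using base
  proof cases
   case (add_left v v' w)
   show ?thesis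
    unfolding add_left diff_diff_eq
    by (rule d2) (use add_left(2-) in \<open>simp_all add: a2 l c bilinear_onD(2) vs_closed[OF U]\<close>)
  next
   case (add_right v w w')
   show ?thesis
    unfolding add_right diff_diff_eq
    by (rule d2) (use add_right(2-) in \<open>simp_all add: a2 l c bilinear_onD(3) vs_closed[OF U]\<close>)
  next
   case (smult_left v w a)
   show ?thesis
    unfolding smult_left
    by (rule d2) (use smult_left(2-) in \<open>simp_all add: l c bilinear_onD(4) vs_closed[OF U]\<close>)
  next
   case (smult_right v w a)
   show ?thesis
    unfolding smult_right
    by (rule d2) (use smult_right(2-) in \<open>simp_all add: l c bilinear_onD(5) vs_closed[OF U]\<close>)
  qed
  then show ?case
   using base bilinear_relations_subset[OF V W] by (auto simp: ft_simps)
 next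
  case zero then show ?case using U by simp
 next
  case (add x y)
  then show ?case
   using linext_add_tensors[of x y] Poly_Mapping.keys_add[of x y] vs_add_zero(1)[OF U vs_zero_closed[OF U]]
   by auto
 next
  case (scale a x)
  then show ?case
   using linext_pscale_tensors[of x a] keys_pscale[of a x] by (auto simp: vs_smult_zero[OF U])
 qed
 then show ?thesis by simp
qed

text \<open>A linear extension that kills the kernel is constant on cosets, so the
  \<open>the_elem\<close> in \<open>tensor_lift\<close> is well defined.\<close>

lemma tensor_lift_tclass:
 assumes f: "f : carrier (formal_tensors V W)"
 shows "tensor_lift U b (tclass V W f) = linext U b f"
proof -
 let ?S = "carrier V \<times> carrier W"
 note fv = vspace_formal_tensors[of V W] and tk = subspace_tensor_kernel[OF V W]
 have "linext U b g = linext U b f" if g: "g : tclass V W f" for g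
 proof -
  have gc: "g : carrier (formal_tensors V W)"
   using g coset_subset[OF fv tk f] by (auto simp: tclass_def)
  have k: "g - f : tensor_kernel V W"
   using g coset_mem_iff[OF fv tk f gc] by (simp add: tclass_def ft_simps(2,4) pscale_simps(8))
  have kf: "keys (g - f) \<subseteq> ?S" "keys f \<subseteq> ?S"
   using subspD(1)[OF tk k] f by (simp_all add: ft_simps(1))
  have "linext U b ((g - f) + f) = linext U b (g - f) +[U] linext U b f"
   by (rule linext_add_tensors[OF kf])
  moreover have "linext U b f : carrier U"
   by (rule linext_tensors_closed[OF kf(2)])
  ultimately show ?thesis
   using linext_tensor_kernel[OF k] by (simp add: vs_add_zero[OF U])
 qed
 moreover have "f : tclass V W f"
  using coset_self[OF fv tk f] by (simp add: tclass_def)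
 ultimately have "linext U b ` tclass V W f = {linext U b f}" by blast
 then show ?thesis by (simp add: tensor_lift_def)
qed

lemma tensor_lift_tens: "v : carrier V ==> w : carrier W ==> tensor_lift U b (tens V W v w) = b (v, w)"
 unfolding tens_eq_tclass
 by (subst tensor_lift_tclass) (auto simp: single_mem_formal_tensors U bilinear_onD vs_one[OF U])

lemma tensor_lift_linear: "tensor_lift U b : linear_maps (tensor V W) U"
proof -
 let ?S = "carrier V \<times> carrier W"
 note l = linD[OF tclass_linear] and fc = vs_closed[OF vspace_formal_tensors]
 show ?thesis
 proof (rule linear_mapsI)
  fix x y a assume "x : carrier (tensor V W)"
  then obtain f where f: "x = tclass V W f" "f : carrier (formal_tensors V W)"
   by (auto simp: carrier_tensor)
  then have fS: "keys f \<subseteq> ?S" by (simp add: ft_simps)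
  show "tensor_lift U b x : carrier U"
   using f linext_tensors_closed[OF fS] by (simp add: tensor_lift_tclass)
  show "tensor_lift U b (a *[tensor V W] x) = a *[U] tensor_lift U b x"
   unfolding f(1) l(3)[OF f(2), symmetric] tensor_lift_tclass[OF f(2)] tensor_lift_tclass[OF fc(3)[OF f(2)]]
   using linext_pscale_tensors[OF fS] by (simp add: ft_simps(4))
  assume "y : carrier (tensor V W)"
  then obtain g where g: "y = tclass V W g" "g : carrier (formal_tensors V W)"
   by (auto simp: carrier_tensor)
  then have gS: "keys g \<subseteq> ?S" by (simp add: ft_simps)
  show "tensor_lift U b (x +[tensor V W] y) = tensor_lift U b x +[U] tensor_lift U b y"
   unfolding f(1) g(1) l(2)[OF f(2) g(2), symmetric] tensor_lift_tclass[OF f(2)]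
    tensor_lift_tclass[OF g(2)] tensor_lift_tclass[OF fc(1)[OF f(2) g(2)]]
   using linext_add_tensors[OF fS gS] by (simp add: ft_simps(2))
 qed
qed

end

lemma tensor_linear_eqI:
 assumes U: "vspace U" and F: "F : linear_maps (tensor V W) U" and G: "G : linear_maps (tensor V W) U"
  and eq: "!!v w. v : carrier V ==> w : carrier W ==> F (tens V W v w) = G (tens V W v w)"
  and t: "t : carrier (tensor V W)"
 shows "F t = G t"
 using t
proof (induction t rule: tensor_induct)
 case zero
 show ?case using linear_maps_zero[OF vspace_tensor[OF V W] U] F G by metis
next
 case (add v w t)
 then show ?case
  using linD(2)[OF F, OF tens_closed, of v w t] linD(2)[OF G, OF tens_closed, of v w t] eq by simp
qed

end

section \<open>Slices of tensors\<close>

text \<open>The functional alp \<otimes> ph, with k \<otimes> k identified with k. The next two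
  definitions are id \<otimes> ph and alp \<otimes> id in the same sense.\<close>

definition pairing :: "('v => 'k) => ('w => 'k) => (('v \<times> 'w) \<Rightarrow>\<^sub>0 'k::field) set => 'k" where
 "pairing alp ph = tensor_lift scalars (%(v, w). alp v * ph w)"

definition rslice :: "('k::field, 'v, 'm) module_scheme => ('w => 'k) => (('v \<times> 'w) \<Rightarrow>\<^sub>0 'k) set => 'v" where
 "rslice V ph = tensor_lift V (%(v, w). ph w *[V] v)"

definition lslice :: "('k::field, 'w, 'm) module_scheme => ('v => 'k) => (('v \<times> 'w) \<Rightarrow>\<^sub>0 'k) set => 'w" where
 "lslice W alp = tensor_lift W (%(v, w). alp v *[W] w)"

definition tensor_swap :: "('k::field, 'v, 'm) module_scheme => ('k, 'w, 'l) module_scheme =>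
  (('v \<times> 'w) \<Rightarrow>\<^sub>0 'k) set => (('w \<times> 'v) \<Rightarrow>\<^sub>0 'k) set" where
 "tensor_swap V W = tensor_lift (tensor W V) (%(v, w). tens W V w v)"

lemma bilinear_onI:
 assumes "!!v. v : carrier V ==> (%w. b (v, w)) : linear_maps W U"
  "!!w. w : carrier W ==> (%v. b (v, w)) : linear_maps V U"
 shows "bilinear_on V W U b"
 using assms by (simp add: bilinear_on_def)

lemma dual_add: "ph : dual V ==> x : carrier V ==> y : carrier V ==> ph (x +[V] y) = ph x + ph y"
 and dual_smult: "ph : dual V ==> x : carrier V ==> ph (a *[V] x) = a * ph x"
 using linD(2,3)[of ph V scalars] by simp_all

lemma dualI:
 assumes "!!x y. x : carrier V ==> y : carrier V ==> f (x +[V] y) = f x + f y"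
  "!!a x. x : carrier V ==> f (a *[V] x) = a * f x"
 shows "f : dual V"
 using assms by (intro linear_mapsI) auto

context
 fixes V :: "('k::field, 'v, 'm) module_scheme" and W :: "('k, 'w, 'l) module_scheme"
 assumes V: "vspace V" and W: "vspace W"
begin

lemma bilinear_pairing: "alp : dual V ==> ph : dual W ==> bilinear_on V W scalars (%(v, w). alp v * ph w)"
 by (intro bilinear_onI dualI) (simp_all add: dual_add dual_smult algebra_simps)

lemma bilinear_rslice: "ph : dual W ==> bilinear_on V W V (%(v, w). ph w *[V] v)"
 by (intro bilinear_onI linear_mapsI)
  (simp_all add: dual_add dual_smult vs_closed[OF V] vs_distrib_left[OF V] vs_distrib_right[OF V]
   vs_smult_smult[OF V] mult.commute)

lemma bilinear_lslice: "alp : dual V ==> bilinear_on V W W (%(v, w). alp v *[W] w)"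
 by (intro bilinear_onI linear_mapsI)
  (simp_all add: dual_add dual_smult vs_closed[OF W] vs_distrib_left[OF W] vs_distrib_right[OF W]
   vs_smult_smult[OF W] mult.commute)

lemma pairing_tens:
 "alp : dual V ==> ph : dual W ==> v : carrier V ==> w : carrier W ==> pairing alp ph (tens V W v w) = alp v * ph w"
 unfolding pairing_def using tensor_lift_tens[OF V W vspace_scalars bilinear_pairing] by simp

lemma pairing_linear: "alp : dual V ==> ph : dual W ==> pairing alp ph : dual (tensor V W)"
 unfolding pairing_def by (rule tensor_lift_linear[OF V W vspace_scalars bilinear_pairing])

lemma rslice_tens:
 "ph : dual W ==> v : carrier V ==> w : carrier W ==> rslice V ph (tens V W v w) = ph w *[V] v"
 unfolding rslice_def using tensor_lift_tens[OF V W V bilinear_rslice] by simp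

lemma rslice_linear: "ph : dual W ==> rslice V ph : linear_maps (tensor V W) V"
 unfolding rslice_def by (rule tensor_lift_linear[OF V W V bilinear_rslice])

lemma lslice_tens:
 "alp : dual V ==> v : carrier V ==> w : carrier W ==> lslice W alp (tens V W v w) = alp v *[W] w"
 unfolding lslice_def using tensor_lift_tens[OF V W W bilinear_lslice] by simp

lemma lslice_linear: "alp : dual V ==> lslice W alp : linear_maps (tensor V W) W"
 unfolding lslice_def by (rule tensor_lift_linear[OF V W W bilinear_lslice])

text \<open>alp \<otimes> ph factors through id \<otimes> ph; together with
  \<open>dual_separates\<close>, pairings therefore determine slices.\<close>

lemma dual_rslice:
 assumes "alp : dual V" "ph : dual W" "t : carrier (tensor V W)"
 shows "alp (rslice V ph t) = pairing alp ph t"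
 by (rule tensor_linear_eqI[OF V W vspace_scalars _ pairing_linear _ assms(3)])
  (use assms in \<open>auto simp: rslice_tens pairing_tens dual_smult intro: lin_comp[OF rslice_linear]\<close>)

lemma dual_lslice:
 assumes "alp : dual V" "ph : dual W" "t : carrier (tensor V W)"
 shows "ph (lslice W alp t) = pairing alp ph t"
 by (rule tensor_linear_eqI[OF V W vspace_scalars _ pairing_linear _ assms(3)])
  (use assms in \<open>auto simp: lslice_tens pairing_tens dual_smult intro: lin_comp[OF lslice_linear]\<close>)

lemma bilinear_tensor_map:
 assumes V': "vspace V'" and W': "vspace W'" and f: "f : linear_maps V V'" and g: "g : linear_maps W W'"
 shows "bilinear_on V W (tensor V' W') (%(v, w). tens V' W' (f v) (g w))"
 using lin_comp[OF g tens_linear_right[OF V' W']] lin_comp[OF f tens_linear_left[OF V' W']]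
  linD(1)[OF f] linD(1)[OF g]
 by (intro bilinear_onI) simp_all

lemma tensor_map_tens:
 assumes V': "vspace V'" and W': "vspace W'" and f: "f : linear_maps V V'" and g: "g : linear_maps W W'"
  and "v : carrier V" "w : carrier W"
 shows "tensor_map V' W' f g (tens V W v w) = tens V' W' (f v) (g w)"
 unfolding tensor_map_def
 using tensor_lift_tens[OF V W vspace_tensor[OF V' W'] bilinear_tensor_map[OF assms(1-4)] assms(5,6)] by simp

lemma tensor_map_linear:
 assumes V': "vspace V'" and W': "vspace W'" and f: "f : linear_maps V V'" and g: "g : linear_maps W W'"
 shows "tensor_map V' W' f g : linear_maps (tensor V W) (tensor V' W')"
 unfolding tensor_map_def
 by (rule tensor_lift_linear[OF V W vspace_tensor[OF V' W'] bilinear_tensor_map[OF assms]])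

end

lemma pairing_tensor_map:
 assumes V: "vspace V" and W: "vspace W" and V': "vspace V'" and W': "vspace W'" and f: "f : linear_maps V V'" and g: "g : linear_maps W W'"
  and alp: "alp : dual V'" and ph: "ph : dual W'" and t: "t : carrier (tensor V W)"
 shows "pairing alp ph (tensor_map V' W' f g t) = pairing (%v. alp (f v)) (%w. ph (g w)) t"
proof (rule tensor_linear_eqI[OF V W vspace_scalars _ _ _ t])
 note af = lin_comp[OF f alp] lin_comp[OF g ph]
 show "(%t. pairing alp ph (tensor_map V' W' f g t)) : dual (tensor V W)"
  by (rule lin_comp[OF tensor_map_linear[OF V W V' W' f g] pairing_linear[OF V' W' alp ph]])
 show "pairing (%v. alp (f v)) (%w. ph (g w)) : dual (tensor V W)"
  by (rule pairing_linear[OF V W af])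
 fix v w assume vw: "v : carrier V" "w : carrier W"
 show "pairing alp ph (tensor_map V' W' f g (tens V W v w)) = pairing (%v. alp (f v)) (%w. ph (g w)) (tens V W v w)"
  using vw by (simp add: tensor_map_tens[OF V W V' W' f g] pairing_tens[OF V W af]
   pairing_tens[OF V' W' alp ph] linD(1)[OF f] linD(1)[OF g])
qed

lemma rslice_tensor_map:
 assumes V: "vspace V" and W: "vspace W" and V': "vspace V'" and W': "vspace W'"
  and f: "f : linear_maps V V'" and g: "g : linear_maps W W'"
  and ph: "ph : dual W'" and t: "t : carrier (tensor V W)"
 shows "rslice V' ph (tensor_map V' W' f g t) = f (rslice V (%w. ph (g w)) t)"
proof (rule tensor_linear_eqI[OF V W V' _ _ _ t])
 note gf = lin_comp[OF g ph] and m = tensor_map_linear[OF V W V' W' f g]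
 show "(%t. rslice V' ph (tensor_map V' W' f g t)) : linear_maps (tensor V W) V'"
  by (rule lin_comp[OF m rslice_linear[OF V' W' ph]])
 show "(%t. f (rslice V (%w. ph (g w)) t)) : linear_maps (tensor V W) V'"
  by (rule lin_comp[OF rslice_linear[OF V W gf] f])
 fix v w assume "v : carrier V" "w : carrier W"
 then show "rslice V' ph (tensor_map V' W' f g (tens V W v w)) = f (rslice V (%w. ph (g w)) (tens V W v w))"
  by (simp add: tensor_map_tens[OF V W V' W' f g] rslice_tens[OF V W gf]
   rslice_tens[OF V' W' ph] linD[OF f] linD(1)[OF g])
qed

lemma carrier_update_id [simp]: "V\<lparr>carrier := carrier V\<rparr> = V"
 by simp

lemma incl_linear:
 assumes "subspace_of V N"
 shows "(%v. v) : linear_maps (V\<lparr>carrier := N\<rparr>) V"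
 by (rule linear_maps_sub[OF linear_maps_id]) (use subspD(1)[OF assms] in auto)

lemma dual_sub: "subspace_of V N ==> ph : dual V ==> ph : dual (V\<lparr>carrier := N\<rparr>)"
 by (rule linear_maps_sub) (auto dest: subspD(1))

text \<open>Induction on the number of pure tensors. If alp v = 1 for the first left factor
  \<open>v\<close>, the vanishing pairings force its partner \<open>w\<close> to be minus the sum of
  alp(x) y over the remaining terms x \<otimes> y. Substituting this leaves the shorter sum of (x -
  alp(x) v) \<otimes> y, whose pairings still vanish. Only functionals of the ambient spaces occur,
  so N \<otimes> P embeds into V \<otimes> W.\<close>

lemma tensor_zeroI:
 fixes V :: "('k::field, 'v, 'm) module_scheme" and W :: "('k, 'w, 'l) module_scheme"
 assumes V: "vspace V" and W: "vspace W" and N: "subspace_of V N" and P: "subspace_of W P"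
  and t: "t : carrier (tensor (V\<lparr>carrier := N\<rparr>) (W\<lparr>carrier := P\<rparr>))"
  and eq: "!!alp ph. alp : dual V ==> ph : dual W ==> pairing alp ph t = 0"
 shows "t = \<zero>\<^bsub>tensor (V\<lparr>carrier := N\<rparr>) (W\<lparr>carrier := P\<rparr>)\<^esub>"
proof -
 let ?V = "V\<lparr>carrier := N\<rparr>" and ?W = "W\<lparr>carrier := P\<rparr>"
 let ?T = "tensor ?V ?W"
 note V' = vspace_sub[OF V N] and W' = vspace_sub[OF W P]
 note T = vspace_tensor[OF V' W']
 note tr = linD[OF tens_linear_right[OF V' W'], simplified]
  and tl = linD[OF tens_linear_left[OF V' W'], simplified]
 note Nc = subspD[OF N] and Pc = subspD[OF P]
 \<comment> \<open>A list of pairs stands for a sum of pure tensors, and \<open>ps\<close> computes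
   its pairings.\<close>
 define ts where "ts ys = foldr (%(v, w) s. tens ?V ?W v w +[?T] s) ys \<zero>\<^bsub>?T\<^esub>" for ys
 define ps where "ps alp ph ys = (\<Sum>(v, w)\<leftarrow>ys. alp v * ph w)" for alp :: "'v => 'k" and ph :: "'w => 'k" and ys
 have ts_simps: "ts [] = \<zero>\<^bsub>?T\<^esub>" "ts ((v, w) # ys) = tens ?V ?W v w +[?T] ts ys" for v w ys
  by (simp_all add: ts_def)
 have ts_closed: "set ys \<subseteq> N \<times> P ==> ts ys : carrier ?T" for ys
  by (induction ys) (auto simp: ts_simps vs_closed[OF T] tr(1))
 have pair: "set ys \<subseteq> N \<times> P ==> pairing alp ph (ts ys) = ps alp ph ys" if d: "alp : dual V" "ph : dual W" for ys alp ph
 proof (induction ys)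
  case Nil
  show ?case
   using linear_maps_zero[OF T vspace_scalars pairing_linear[OF V' W' dual_sub[OF N d(1)] dual_sub[OF P d(2)]]]
   by (simp add: ts_simps ps_def)
 next
  case (Cons a ys)
  obtain v w where a: "a = (v, w)" "v : N" "w : P" using Cons.prems by (cases a) auto
  show ?case
   using Cons linD(2)[OF pairing_linear[OF V' W' dual_sub[OF N d(1)] dual_sub[OF P d(2)]] tr(1)[OF a(2,3)] ts_closed[of ys]]
    pairing_tens[OF V' W' dual_sub[OF N d(1)] dual_sub[OF P d(2)], of v w] a
   by (simp add: ts_simps ps_def)
 qed
 have main: "length ys = k ==> set ys \<subseteq> N \<times> P ==> (!!alp ph. alp : dual V ==> ph : dual W ==> ps alp ph ys = 0) ==>
  ts ys = \<zero>\<^bsub>?T\<^esub>" for ys k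
 proof (induction k arbitrary: ys)
  case 0
  then show ?case by (simp add: ts_simps)
 next
  case (Suc k)
  obtain a zs where a: "ys = a # zs" using Suc.prems(1) by (cases ys) auto
  obtain v w where vw: "a = (v, w)" "v : N" "w : P" using Suc.prems(2) a by (cases a) auto
  have zs: "set zs \<subseteq> N \<times> P" "length zs = k" using Suc.prems a by auto
  have v: "v : carrier V" and w: "w : carrier W" using Nc(1) Pc(1) vw by auto
  have ps: "alp v * ph w + ps alp ph zs = 0" if "alp : dual V" "ph : dual W" for alp ph
   using Suc.prems(3)[OF that] by (simp add: a vw ps_def)
  show ?case
  proof (cases "v = \<zero>\<^bsub>V\<^esub>")
   case True
   have "tens ?V ?W v w = \<zero>\<^bsub>?T\<^esub>"
    using linear_maps_zero[OF V' T tens_linear_left[OF V' W', of w]] vw(3) True by simp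
   moreover have "ts zs = \<zero>\<^bsub>?T\<^esub>"
   proof (rule Suc.IH[OF zs(2,1)])
    fix alp ph assume d: "alp : dual V" "ph : dual W"
    show "ps alp ph zs = 0" using ps[OF d] linear_maps_zero[OF V vspace_scalars d(1)] True by simp
   qed
   ultimately show ?thesis by (simp add: a vw ts_simps vs_closed[OF T] vs_add_zero[OF T])
  next
   case False
   obtain alp where alp: "alp : dual V" "alp v = 1"
    using dual_separates_subspace[OF V subspace_of_zero[OF V] v] False by blast
   \<comment> \<open>The value that pairing with \<open>alp\<close> forces on \<open>w\<close>; it
     is a combination of elements of \<open>P\<close>.\<close>
   define ws where "ws l = foldr (%(x, y) s. (- alp x) *[W] y +[W] s) l \<zero>\<^bsub>W\<^esub>" for l
   have wsP: "set l \<subseteq> N \<times> P ==> ws l : P" for l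
    unfolding ws_def by (induction l) (auto intro: Pc(2-4))
   have ws: "set l \<subseteq> N \<times> P ==> ph (ws l) = - ps alp ph l" if ph: "ph : dual W" for l ph
   proof (induction l)
    case Nil
    then show ?case using linear_maps_zero[OF W vspace_scalars ph] by (simp add: ws_def ps_def)
   next
    case (Cons b l)
    obtain x y where b: "b = (x, y)" "x : N" "y : P" using Cons.prems by (cases b) auto
    have c: "y : carrier W" "ws l : carrier W" using wsP[of l] Cons.prems b Pc(1) by auto
    have e: "ws (b # l) = (- alp x) *[W] y +[W] ws l" by (simp add: ws_def b)
    show ?case
     unfolding e linD(2)[OF ph vs_smult_closed[OF W c(1)] c(2)] linD(3)[OF ph c(1)]
     using Cons b by (simp add: ps_def)
   qed
   have w_eq: "w = ws zs"
   proof (rule dual_separates[OF W w])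
    show "ws zs : carrier W" using wsP[OF zs(1)] Pc(1) by blast
    show "ph w = ph (ws zs)" if d: "ph : dual W" for ph
    proof -
     have "ps alp ph zs = - ph w" using ps[OF alp(1) d] alp(2) by (simp add: eq_neg_iff_add_eq_0 add.commute)
     then show ?thesis unfolding ws[OF d zs(1)] by simp
    qed
   qed
   \<comment> \<open>Each remaining left factor is corrected by a multiple of \<open>v\<close>, so
     that v \<otimes> w disappears from the sum.\<close>
   let ?f = "%(x, y). (x +[V] (- alp x) *[V] v, y)"
   have f: "set (map ?f l) \<subseteq> N \<times> P" if "set l \<subseteq> N \<times> P" for l
    using that by (induction l) (use vw(2) in \<open>auto intro!: Nc(3,4)\<close>)
   have "set l \<subseteq> N \<times> P ==> tens ?V ?W v (ws l) +[?T] ts l = ts (map ?f l)" for l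
   proof (induction l)
    case Nil
    then show ?case
     using linear_maps_zero[OF W' T tens_linear_right[OF V' W', of v]] vw(2)
     by (simp add: ws_def ts_simps vs_closed[OF T] vs_add_zero[OF T])
   next
    case (Cons b l)
    obtain x y where b: "b = (x, y)" "x : N" "y : P" using Cons.prems by (cases b) auto
    have l: "set l \<subseteq> N \<times> P" using Cons.prems by auto
    have e: "ws (b # l) = (- alp x) *[W] y +[W] ws l" by (simp add: ws_def b)
    have "tens ?V ?W v (ws (b # l)) = (- alp x) *[?T] tens ?V ?W v y +[?T] tens ?V ?W v (ws l)"
     unfolding e using tr(2)[OF vw(2) Pc(4)[OF b(3)] wsP[OF l]] tr(3)[OF vw(2) b(3)] by simp
    moreover have "tens ?V ?W (x +[V] (- alp x) *[V] v) y = tens ?V ?W x y +[?T] (- alp x) *[?T] tens ?V ?W v y"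
     using tl(2)[OF b(3,2) Nc(4)[OF vw(2)]] tl(3)[OF b(3) vw(2)] by simp
    ultimately show ?case
     using Cons.IH[OF l, symmetric] tr(1) b vw(2) wsP[OF l] ts_closed[OF l]
     by (simp add: ts_simps vs_closed[OF T] vs_assoc[OF T] vs_commute[OF T] vs_lcommute[OF T])
   qed
   from this[OF zs(1)] have "ts ys = ts (map ?f zs)" by (simp add: a vw ts_simps w_eq[symmetric])
   also have "... = \<zero>\<^bsub>?T\<^esub>"
   proof (rule Suc.IH)
    fix be ph assume be: "be : dual V" and ph: "ph : dual W"
    \<comment> \<open>The correction subtracts be(v) times the pairing with \<open>alp\<close>,
      which equals - ph(w). What remains is be(v) ph(w) plus the old pairing, and this is 0 by
      \<open>ps\<close>.\<close>
    have "set l \<subseteq> N \<times> P ==> ps be ph (map ?f l) = ps be ph l - be v * ps alp ph l" for l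
    proof (induction l)
     case (Cons b l)
     obtain x y where b: "b = (x, y)" "x : carrier V" using Cons.prems Nc(1) by (cases b) auto
     have e: "be (x +[V] (- alp x) *[V] v) = be x - alp x * be v"
      using linD(2)[OF be b(2) vs_smult_closed[OF V v, of "- alp x"]] linD(3)[OF be v, of "- alp x"] by simp
     have IH: "ps be ph (map ?f l) = ps be ph l - be v * ps alp ph l" using Cons by simp
     have c: "ps \<gamma> ph ((x', y) # l') = \<gamma> x' * ph y + ps \<gamma> ph l'" for \<gamma> x' y l' by (simp add: ps_def)
     show ?case unfolding b(1) list.map prod.case c e IH by (simp add: algebra_simps)
    qed (simp add: ps_def)
    note e = this[OF zs(1)]
    have "ps alp ph zs = - ph w" using ps[OF alp(1) ph] alp(2) by (simp add: eq_neg_iff_add_eq_0 add.commute)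
    then show "ps be ph (map ?f zs) = 0" unfolding e using ps[OF be ph] by (simp add: add.commute)
   qed (use zs f[OF zs(1)] in auto)
   finally show ?thesis .
  qed
 qed
 have "\<exists>ys. set ys \<subseteq> N \<times> P & t = ts ys"
  using t
 proof (induction t rule: tensor_induct[OF V' W', consumes 1, case_names zero add])
  case zero
  show ?case by (intro exI[of _ "[]"]) (simp add: ts_simps)
 next
  case (add v w t)
  then obtain ys where "set ys \<subseteq> N \<times> P" "t = ts ys" by auto
  then show ?case using add(1,2) by (intro exI[of _ "(v, w) # ys"]) (simp add: ts_simps)
 qed
 then obtain ys where ys: "set ys \<subseteq> N \<times> P" "t = ts ys" by blast
 show ?thesis unfolding ys(2) by (rule main[OF refl ys(1)]) (use pair[OF _ _ ys(1)] eq ys(2) in auto)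
qed

text \<open>The functionals live on \<open>V\<close> and \<open>W\<close> and not on the subspaces,
  so one family of tests serves all subspaces.\<close>

lemma tensor_sub_eqI:
 assumes V: "vspace V" and W: "vspace W" and N: "subspace_of V N" and P: "subspace_of W P"
  and s: "s : carrier (tensor (V\<lparr>carrier := N\<rparr>) (W\<lparr>carrier := P\<rparr>))"
  and t: "t : carrier (tensor (V\<lparr>carrier := N\<rparr>) (W\<lparr>carrier := P\<rparr>))"
  and eq: "!!alp ph. alp : dual V ==> ph : dual W ==> pairing alp ph s = pairing alp ph t"
 shows "s = t"
proof -
 let ?T = "tensor (V\<lparr>carrier := N\<rparr>) (W\<lparr>carrier := P\<rparr>)"
 note V' = vspace_sub[OF V N] and W' = vspace_sub[OF W P]
 have T: "vspace ?T" by (rule vspace_tensor[OF V' W'])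
 have "s +[?T] (-1) *[?T] t = \<zero>\<^bsub>?T\<^esub>"
 proof (rule tensor_zeroI[OF V W N P])
  show "s +[?T] (-1) *[?T] t : carrier ?T"
   by (intro vs_add_closed[OF T] vs_smult_closed[OF T] s t)
  fix alp ph assume d: "alp : dual V" "ph : dual W"
  note p = pairing_linear[OF V' W' dual_sub[OF N d(1)] dual_sub[OF P d(2)]]
  show "pairing alp ph (s +[?T] (-1) *[?T] t) = 0"
   using eq[OF d] by (simp add: dual_add[OF p] dual_smult[OF p] s t vs_smult_closed[OF T])
 qed
 then show ?thesis
  using vs_eq_iff_diff[OF T s t] by simp
qed

lemma tensor_eqI:
 assumes "vspace V" "vspace W" "s : carrier (tensor V W)" "t : carrier (tensor V W)"
  and "!!alp ph. alp : dual V ==> ph : dual W ==> pairing alp ph s = pairing alp ph t"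
 shows "s = t"
 using tensor_sub_eqI[OF assms(1,2) subspace_of_carrier[OF assms(1)] subspace_of_carrier[OF assms(2)]] assms(3-)
 by simp

lemma tensor_map_incl_pairing:
 assumes V: "vspace V" and W: "vspace W" and N: "subspace_of V N" and P: "subspace_of W P"
  and t: "t : carrier (tensor (V\<lparr>carrier := N\<rparr>) (W\<lparr>carrier := P\<rparr>))"
  and d: "alp : dual V" "ph : dual W"
 shows "pairing alp ph (tensor_map V W (%v. v) (%w. w) t) = pairing alp ph t"
 by (rule pairing_tensor_map[OF vspace_sub[OF V N] vspace_sub[OF W P] V W incl_linear[OF N] incl_linear[OF P] d t])

lemma tensor_map_incl_inj:
 assumes V: "vspace V" and W: "vspace W" and N: "subspace_of V N" and P: "subspace_of W P"
 shows "inj_on (tensor_map V W (%v. v) (%w. w)) (carrier (tensor (V\<lparr>carrier := N\<rparr>) (W\<lparr>carrier := P\<rparr>)))"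
proof (rule inj_onI)
 fix s t assume st: "s : carrier (tensor (V\<lparr>carrier := N\<rparr>) (W\<lparr>carrier := P\<rparr>))"
  "t : carrier (tensor (V\<lparr>carrier := N\<rparr>) (W\<lparr>carrier := P\<rparr>))"
  and "tensor_map V W (%v. v) (%w. w) s = tensor_map V W (%v. v) (%w. w) t"
 then show "s = t"
  using tensor_map_incl_pairing[OF V W N P] by (intro tensor_sub_eqI[OF V W N P st]) metis
qed

text \<open>A projection of \<open>V\<close> onto \<open>N\<close>, applied to the first factor, fixes \<open>t\<close>.\<close>

lemma mem_tensor_sub_if_rslices:
 fixes V :: "('k::field, 'v, 'm) module_scheme" and W :: "('k, 'w, 'l) module_scheme"
 assumes V: "vspace V" and W: "vspace W" and N: "subspace_of V N" and P: "subspace_of W P"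
  and t: "t : carrier (tensor V (W\<lparr>carrier := P\<rparr>))"
  and slices: "!!ph. ph : dual W ==> rslice V ph t : N"
 shows "t : tensor_map V (W\<lparr>carrier := P\<rparr>) (%v. v) (%w. w) ` carrier (tensor (V\<lparr>carrier := N\<rparr>) (W\<lparr>carrier := P\<rparr>))"
proof -
 let ?N = "V\<lparr>carrier := N\<rparr>" and ?P = "W\<lparr>carrier := P\<rparr>"
 note N' = vspace_sub[OF V N] and P' = vspace_sub[OF W P]
 obtain p where p: "p : linear_maps V V" "!!x. x : carrier V ==> p x : N" "!!x. x : N ==> p x = x"
  using subspace_projection[OF V N] by blast
 have pN: "p : linear_maps V ?N" by (rule linear_mapsI) (use p(2) linD[OF p(1)] in auto)
 let ?s = "tensor_map ?N ?P p (%w. w) t"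
 have s: "?s : carrier (tensor ?N ?P)"
  by (rule linD(1)[OF tensor_map_linear[OF V P' N' P' pN linear_maps_id] t])
 have "t = tensor_map V ?P (%v. v) (%w. w) ?s"
 proof (rule tensor_sub_eqI[OF V W subspace_of_carrier[OF V] P, unfolded carrier_update_id, OF t])
  show "tensor_map V ?P (%v. v) (%w. w) ?s : carrier (tensor V ?P)"
   by (rule linD(1)[OF tensor_map_linear[OF N' P' V P' incl_linear[OF N] linear_maps_id] s])
  fix alp ph assume alp: "alp : dual V" and ph: "ph : dual W"
  note ph' = dual_sub[OF P ph]
  have "pairing alp ph (tensor_map V ?P (%v. v) (%w. w) ?s) = pairing (%v. alp (p v)) ph t"
   using pairing_tensor_map[OF N' P' V P' incl_linear[OF N] linear_maps_id alp ph' s]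
    pairing_tensor_map[OF V P' N' P' pN linear_maps_id dual_sub[OF N alp] ph' t] by simp
  also have "... = alp (p (rslice V ph t))" by (rule dual_rslice[OF V P' lin_comp[OF p(1) alp] ph' t, symmetric])
  also have "... = pairing alp ph t" unfolding p(3)[OF slices[OF ph]] by (rule dual_rslice[OF V P' alp ph' t])
  finally show "pairing alp ph t = pairing alp ph (tensor_map V ?P (%v. v) (%w. w) ?s)" by simp
 qed
 then show ?thesis using s by blast
qed

text \<open>With projections p and g onto \<open>N\<close> and \<open>P\<close>, the map p \<otimes>
  g fixes \<open>t\<close>: inside a pairing p may be dropped because right slices lie in
  \<open>N\<close>, then g because left slices lie in \<open>P\<close>.\<close>

lemma mem_tensor_sub_if_slices:
 assumes V: "vspace V" and W: "vspace W" and N: "subspace_of V N" and P: "subspace_of W P"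
  and t: "t : carrier (tensor V W)"
  and r: "!!ph. ph : dual W ==> rslice V ph t : N"
  and l: "!!alp. alp : dual V ==> lslice W alp t : P"
 shows "t : tensor_map V W (%v. v) (%w. w) ` carrier (tensor (V\<lparr>carrier := N\<rparr>) (W\<lparr>carrier := P\<rparr>))"
proof -
 let ?N = "V\<lparr>carrier := N\<rparr>" and ?P = "W\<lparr>carrier := P\<rparr>"
 note N' = vspace_sub[OF V N] and P' = vspace_sub[OF W P]
 obtain p where p: "p : linear_maps V V" "!!x. x : carrier V ==> p x : N" "!!x. x : N ==> p x = x"
  using subspace_projection[OF V N] by blast
 obtain g where g: "g : linear_maps W W" "!!x. x : carrier W ==> g x : P" "!!x. x : P ==> g x = x"
  using subspace_projection[OF W P] by blast
 have pN: "p : linear_maps V ?N" by (rule linear_mapsI) (use p(2) linD[OF p(1)] in auto)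
 have gP: "g : linear_maps W ?P" by (rule linear_mapsI) (use g(2) linD[OF g(1)] in auto)
 let ?s = "tensor_map ?N ?P p g t"
 have s: "?s : carrier (tensor ?N ?P)"
  by (rule linD(1)[OF tensor_map_linear[OF V W N' P' pN gP] t])
 have "t = tensor_map V W (%v. v) (%w. w) ?s"
 proof (rule tensor_eqI[OF V W t])
  show "tensor_map V W (%v. v) (%w. w) ?s : carrier (tensor V W)"
   by (rule linD(1)[OF tensor_map_linear[OF N' P' V W incl_linear[OF N] incl_linear[OF P]] s])
  fix alp ph assume a: "alp : dual V" "ph : dual W"
  note ap = lin_comp[OF p(1) a(1)] and ag = lin_comp[OF g(1) a(2)]
  have "pairing alp ph (tensor_map V W (%v. v) (%w. w) ?s) = pairing (%v. alp (p v)) (%w. ph (g w)) t"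
   unfolding tensor_map_incl_pairing[OF V W N P s a]
   by (rule pairing_tensor_map[OF V W N' P' pN gP dual_sub[OF N a(1)] dual_sub[OF P a(2)] t])
  also have "... = alp (p (rslice V (%w. ph (g w)) t))" by (rule dual_rslice[OF V W ap ag t, symmetric])
  also have "... = pairing alp (%w. ph (g w)) t" unfolding p(3)[OF r[OF ag]] by (rule dual_rslice[OF V W a(1) ag t])
  also have "... = ph (g (lslice W alp t))" by (rule dual_lslice[OF V W a(1) ag t, symmetric])
  also have "... = pairing alp ph t" unfolding g(3)[OF l[OF a(1)]] by (rule dual_lslice[OF V W a t])
  finally show "pairing alp ph t = pairing alp ph (tensor_map V W (%v. v) (%w. w) ?s)" by simp
 qed
 then show ?thesis using s by blast
qed

section \<open>Comodules as modules over the dual algebra\<close>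

text \<open>Modules, coalgebras and comodules are records of different types, so agreement of their
  module parts cannot be an equation. Multiplication and unit are included because
  \<open>formal_tensors\<close> copies them.\<close>

definition same_module :: "('k::field, 'v, 'm) module_scheme => ('k, 'v, 'l) module_scheme => bool" where
 "same_module V V' \<longleftrightarrow> carrier V = carrier V' & (\<otimes>\<^bsub>V\<^esub>) = (\<otimes>\<^bsub>V'\<^esub>) & \<one>\<^bsub>V\<^esub> = \<one>\<^bsub>V'\<^esub> &
   \<zero>\<^bsub>V\<^esub> = \<zero>\<^bsub>V'\<^esub> & (\<oplus>\<^bsub>V\<^esub>) = (\<oplus>\<^bsub>V'\<^esub>) & (\<odot>\<^bsub>V\<^esub>) = (\<odot>\<^bsub>V'\<^esub>)"

lemma same_moduleD:
 assumes "same_module V V'"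
 shows "carrier V = carrier V'" "(\<otimes>\<^bsub>V\<^esub>) = (\<otimes>\<^bsub>V'\<^esub>)" "\<one>\<^bsub>V\<^esub> = \<one>\<^bsub>V'\<^esub>"
  "\<zero>\<^bsub>V\<^esub> = \<zero>\<^bsub>V'\<^esub>" "(\<oplus>\<^bsub>V\<^esub>) = (\<oplus>\<^bsub>V'\<^esub>)" "(\<odot>\<^bsub>V\<^esub>) = (\<odot>\<^bsub>V'\<^esub>)"
 using assms by (simp_all add: same_module_def)

lemma same_module_refl: "same_module V V"
 and same_module_sym: "same_module V V' ==> same_module V' V"
 by (simp_all add: same_module_def)

lemma same_module_vspace:
 assumes s: "same_module V V'" and V: "vspace V"
 shows "vspace V'"
 by (rule vspaceI)
  (simp_all only: same_moduleD[OF same_module_sym[OF s]] vs_closed[OF V] vs_assoc[OF V] vs_add_zero[OF V]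
   vs_distrib_left[OF V] vs_distrib_right[OF V] vs_smult_smult[OF V] vs_one[OF V] vs_zero_smult[OF V], rule vs_commute[OF V])

lemma same_module_linear_maps:
 "same_module V V' ==> same_module W W' ==> linear_maps V W = linear_maps V' W'"
 by (simp add: linear_maps_def same_moduleD)

lemma bilinear_relations_mono:
 assumes V: "same_module V V'" and W: "same_module W W'"
 shows "bilinear_relations V W \<subseteq> bilinear_relations V' W'"
proof
 fix x assume "x : bilinear_relations V W"
 then show "x : bilinear_relations V' W'"
  by cases (simp_all add: same_moduleD[OF V] same_moduleD[OF W] bilinear_relations.intros)
qed

lemma same_module_formal_tensors:
 assumes V: "same_module V V'" and W: "same_module W W'"
 shows "formal_tensors V W = formal_tensors V' W'" "tensor_kernel V W = tensor_kernel V' W'"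
  "tensor V W = tensor V' W'" "tens V W = tens V' W'"
proof -
 show 1: "formal_tensors V W = formal_tensors V' W'"
  by (simp add: formal_tensors_def same_moduleD[OF V] same_moduleD[OF W])
 show 2: "tensor_kernel V W = tensor_kernel V' W'"
  unfolding tensor_kernel_def
  using bilinear_relations_mono[OF V W] bilinear_relations_mono[OF same_module_sym[OF V] same_module_sym[OF W]]
  by (metis subset_antisym)
 show "tensor V W = tensor V' W'" "tens V W = tens V' W'"
  by (auto simp: tensor_def tens_def 1 2 fun_eq_iff)
qed

lemma same_module_linext:
 assumes "same_module V V'"
 shows "linext V b = linext V' b"
 by (simp add: linext_def[abs_def] finsum_def finprod_def same_moduleD[OF assms])

lemma same_module_rslice:
 assumes V: "same_module V V'"
 shows "rslice V ph = rslice V' ph"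
 unfolding rslice_def tensor_lift_def[abs_def] same_module_linext[OF V] same_moduleD(6)[OF V] by (rule refl)

lemma same_module_tensor_map:
 assumes V: "same_module V V'" and W: "same_module W W'"
 shows "tensor_map V W f g = tensor_map V' W' f g"
 by (simp add: tensor_map_def same_module_formal_tensors[OF V W])

text \<open>A right comodule is a left module over the dual algebra, \<open>ph\<close> acting as id
  \<otimes> ph after the coaction.\<close>

definition act :: "('k::field, 'c, 'v) comod => ('c => 'k) => 'v => 'v" where
 "act V ph v = rslice V ph (coact V v)"

definition conv :: "('k::field, 'c) coalg => ('c => 'k) => ('c => 'k) => 'c => 'k" where
 "conv C ph psi x = pairing ph psi (comult C x)"

text \<open>Only a linear coaction, so that sub- and quotient constructions can be analysed through
  \<open>act\<close> before the comodule axioms are known for them.\<close>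

definition precomodule :: "('k::field, 'c) coalg => ('k, 'c, 'v) comod => bool" where
 "precomodule C V \<longleftrightarrow> vspace V & coact V : linear_maps V (tensor V C)"

text \<open>An isomorphism onto \<open>W\<close> from the comodule \<open>V\<close> with its
  coaction pushed forward along \<open>tht\<close>.\<close>

definition semi_iso :: "('k::field, 'c) coalg => ('c => 'c) => ('k, 'c, 'v) comod => ('k, 'c, 'w) comod => ('v => 'w) => bool" where
 "semi_iso C tht V W f \<longleftrightarrow> f : linear_maps V W & bij_betw f (carrier V) (carrier W) &
   (\<forall>ph\<in>dual C. \<forall>v\<in>carrier V. act W ph (f v) = f (act V (%c. ph (tht c)) v))"

text \<open>Compatibility with the comultiplication is put in dual form: composition with
  \<open>tht\<close> is multiplicative for convolution. Product functionals separate tensors, so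
  nothing is lost.\<close>

definition coalg_auto :: "('k::field, 'c) coalg => ('c => 'c) => bool" where
 "coalg_auto C tht \<longleftrightarrow> tht : linear_maps C C & bij_betw tht (carrier C) (carrier C) &
   (\<forall>c\<in>carrier C. counit C (tht c) = counit C c) &
   (\<forall>ph\<in>dual C. \<forall>psi\<in>dual C. \<forall>c\<in>carrier C.
    conv C ph psi (tht c) = conv C (%c. ph (tht c)) (%c. psi (tht c)) c)"

definition subquot :: "('k::field, 'c) coalg => ('k, 'c, 'v) comod => 'v set => 'v set => ('k, 'c, 'v set) comod" where
 "subquot C V Z Y = quot_comod C (sub_comod C V Z) Y"

lemma linear_maps_inv_into:
 assumes V: "vspace V" and f: "f : linear_maps V W" and b: "bij_betw f (carrier V) (carrier W)"
 shows "inv_into (carrier V) f : linear_maps W V"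
proof (rule linear_mapsI)
 let ?g = "inv_into (carrier V) f"
 have g: "?g w : carrier V" "f (?g w) = w" if "w : carrier W" for w
  using that b by (auto simp: bij_betw_def inv_into_into f_inv_into_f)
 have gf: "?g (f v) = v" if "v : carrier V" for v
  using that b by (auto simp: bij_betw_def)
 fix x y a assume x: "x : carrier W"
 show "?g x : carrier V" by (rule g(1)[OF x])
 show "?g (a *[W] x) = a *[V] ?g x"
  using gf[OF vs_smult_closed[OF V g(1)[OF x], of a]] linD(3)[OF f g(1)[OF x]] g(2)[OF x] by simp
 assume y: "y : carrier W"
 show "?g (x +[W] y) = ?g x +[V] ?g y"
  using gf[OF vs_add_closed[OF V g(1)[OF x] g(1)[OF y]]] linD(2)[OF f g(1)[OF x] g(1)[OF y]] g(2)[OF x] g(2)[OF y]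
  by simp
qed

text \<open>Coassociativity enters as associativity of convolution, the form in which it can be
  checked on words.\<close>

locale coalgebra =
 fixes C :: "('k::field, 'c) coalg"
 assumes C: "vspace C"
  and comult_linear: "comult C : linear_maps C (tensor C C)"
  and counit_dual: "counit C : dual C"
  and conv_assoc: "ph : dual C ==> psi : dual C ==> chi : dual C ==> x : carrier C ==>
   conv C (conv C ph psi) chi x = conv C ph (conv C psi chi) x"
begin

lemma conv_dual: "ph : dual C ==> psi : dual C ==> conv C ph psi : dual C"
 unfolding conv_def using lin_comp[OF comult_linear pairing_linear[OF C C]] .

lemma precomoduleD:
 assumes "precomodule C V"
 shows "vspace V" "coact V : linear_maps V (tensor V C)"
 using assms by (simp_all add: precomodule_def)

lemma coact_closed: "precomodule C V ==> v : carrier V ==> coact V v : carrier (tensor V C)"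
 using precomoduleD(2) linD(1) by metis

lemma act_linear:
 assumes V: "precomodule C V" and "ph : dual C"
 shows "act V ph : linear_maps V V"
 unfolding act_def using lin_comp[OF precomoduleD(2)[OF V] rslice_linear[OF precomoduleD(1)[OF V] C assms(2)]] .

lemma act_closed: "precomodule C V ==> ph : dual C ==> v : carrier V ==> act V ph v : carrier V"
 using linD(1)[OF act_linear] .

lemma dual_act:
 assumes "precomodule C V" "ph : dual C" "v : carrier V" "alp : dual V"
 shows "alp (act V ph v) = pairing alp ph (coact V v)"
 unfolding act_def using dual_rslice[OF precomoduleD(1)[OF assms(1)] C assms(4,2) coact_closed[OF assms(1,3)]] .

lemma act_cong:
 assumes V: "precomodule C V" and "ph : dual C" "psi : dual C" "v : carrier V"
  and eq: "!!c. c : carrier C ==> ph c = psi c"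
 shows "act V ph v = act V psi v"
 unfolding act_def
 by (rule tensor_linear_eqI[OF precomoduleD(1)[OF V] C precomoduleD(1)[OF V] rslice_linear[OF precomoduleD(1)[OF V] C assms(2)]
   rslice_linear[OF precomoduleD(1)[OF V] C assms(3)] _ coact_closed[OF V assms(4)]])
  (simp add: rslice_tens[OF precomoduleD(1)[OF V] C] assms eq)

text \<open>Stability under all \<open>act\<close> means that the right slices of the coaction stay
  in \<open>N\<close>, and a tensor with such slices comes from N \<otimes> C. Subcomodules thus
  become submodules over the dual algebra.\<close>

lemma subcomodule_iff:
 assumes V: "precomodule C V"
 shows "subcomodule C V N \<longleftrightarrow> subspace_of V N & (\<forall>ph\<in>dual C. \<forall>x\<in>N. act V ph x : N)"
proof -
 note V' = precomoduleD(1)[OF V]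
 have "(\<forall>x\<in>N. coact V x : tensor_map V C (%v. v) (%c. c) ` carrier (tensor (V\<lparr>carrier := N\<rparr>) C)) \<longleftrightarrow>
  (\<forall>ph\<in>dual C. \<forall>x\<in>N. act V ph x : N)" if N: "subspace_of V N"
 proof (intro iffI ballI)
  fix ph x assume *: "\<forall>x\<in>N. coact V x : tensor_map V C (%v. v) (%c. c) ` carrier (tensor (V\<lparr>carrier := N\<rparr>) C)"
   and ph: "ph : dual C" and x: "x : N"
  obtain s where s: "s : carrier (tensor (V\<lparr>carrier := N\<rparr>) C)" "coact V x = tensor_map V C (%v. v) (%c. c) s"
   using * x by auto
  have "act V ph x = rslice (V\<lparr>carrier := N\<rparr>) ph s"
   unfolding act_def s(2)
   by (rule rslice_tensor_map[OF vspace_sub[OF V' N] C V' C incl_linear[OF N] linear_maps_id ph s(1)])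
  also have "... : carrier (V\<lparr>carrier := N\<rparr>)"
   by (rule linD(1)[OF rslice_linear[OF vspace_sub[OF V' N] C ph] s(1)])
  finally show "act V ph x : N" by simp
 next
  fix x assume *: "\<forall>ph\<in>dual C. \<forall>x\<in>N. act V ph x : N" and x: "x : N"
  show "coact V x : tensor_map V C (%v. v) (%c. c) ` carrier (tensor (V\<lparr>carrier := N\<rparr>) C)"
   using mem_tensor_sub_if_rslices[OF V' C N subspace_of_carrier[OF C], of "coact V x"]
    coact_closed[OF V subspD(1)[OF N x]] * x by (simp add: act_def)
 qed
 then show ?thesis
  unfolding subcomodule_def submodule_iff_subspace_of[OF V'] by auto
qed

lemma subcomoduleD:
 assumes "precomodule C V" "subcomodule C V N"
 shows "subspace_of V N" "ph : dual C ==> x : N ==> act V ph x : N"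
 using assms by (simp_all add: subcomodule_iff)

lemma sub_comod_same: "same_module (sub_comod C V N) (V\<lparr>carrier := N\<rparr>)"
 by (simp add: sub_comod_def same_module_def)

lemma sub_comod_simps [simp]:
 "carrier (sub_comod C V N) = N" "(\<oplus>\<^bsub>sub_comod C V N\<^esub>) = (\<oplus>\<^bsub>V\<^esub>)" "\<zero>\<^bsub>sub_comod C V N\<^esub> = \<zero>\<^bsub>V\<^esub>"
 "(\<odot>\<^bsub>sub_comod C V N\<^esub>) = (\<odot>\<^bsub>V\<^esub>)"
 using same_moduleD[OF sub_comod_same] by simp_all

lemma vspace_sub_comod: "vspace V ==> subspace_of V N ==> vspace (sub_comod C V N)"
 by (rule same_module_vspace[OF same_module_sym[OF sub_comod_same] vspace_sub])

lemma coact_sub: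
 assumes V: "precomodule C V" and N: "subcomodule C V N" and x: "x : N"
 shows "coact (sub_comod C V N) x : carrier (tensor (V\<lparr>carrier := N\<rparr>) C)"
  "tensor_map V C (%v. v) (%c. c) (coact (sub_comod C V N) x) = coact V x"
proof -
 have "coact V x : tensor_map V C (%v. v) (%c. c) ` carrier (tensor (V\<lparr>carrier := N\<rparr>) C)"
  using N x by (simp add: subcomodule_def)
 from inv_into_into[OF this] f_inv_into_f[OF this]
 show "coact (sub_comod C V N) x : carrier (tensor (V\<lparr>carrier := N\<rparr>) C)"
  "tensor_map V C (%v. v) (%c. c) (coact (sub_comod C V N) x) = coact V x"
  by (simp_all add: sub_comod_def)
qed

text \<open>The coaction of \<open>sub_comod\<close> is a chosen preimage, known only through its
  image; pairings with ambient functionals do not see the difference.\<close>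

lemma pairing_coact_sub:
 assumes V: "precomodule C V" and N: "subcomodule C V N" and x: "x : N" and a: "alp : dual V" "ph : dual C"
 shows "pairing alp ph (coact (sub_comod C V N) x) = pairing alp ph (coact V x)"
 using tensor_map_incl_pairing[OF precomoduleD(1)[OF V] C subcomoduleD(1)[OF V N] subspace_of_carrier[OF C] _ a,
   of "coact (sub_comod C V N) x"] coact_sub[OF V N x] by simp

text \<open>Pairings with ambient functionals determine the chosen preimages, hence these depend
  linearly on the argument.\<close>

lemma precomodule_sub:
 assumes V: "precomodule C V" and N: "subcomodule C V N"
 shows "precomodule C (sub_comod C V N)"
proof -
 note V' = precomoduleD(1)[OF V] and N' = subcomoduleD(1)[OF V N]
 let ?N = "V\<lparr>carrier := N\<rparr>" and ?S = "sub_comod C V N"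
 note NV = vspace_sub[OF V' N']
 have eqI: "s = t" if "s : carrier (tensor ?N C)" "t : carrier (tensor ?N C)"
  "!!alp ph. alp : dual V ==> ph : dual C ==> pairing alp ph s = pairing alp ph t" for s t
  using tensor_sub_eqI[OF V' C N' subspace_of_carrier[OF C], of s t] that by simp
 note p = pairing_linear[OF NV C dual_sub[OF N']]
 note T = vspace_tensor[OF NV C]
 have "coact ?S : linear_maps ?N (tensor ?N C)"
 proof (rule linear_mapsI)
  fix x y a assume x: "x : carrier ?N"
  show cx: "coact ?S x : carrier (tensor ?N C)" using coact_sub(1)[OF V N] x by simp
  show "coact ?S (a *[?N] x) = a *[tensor ?N C] coact ?S x"
  proof (rule eqI)
   fix alp ph assume a: "alp : dual V" "ph : dual C"
   show "pairing alp ph (coact ?S (a *[?N] x)) = pairing alp ph (a *[tensor ?N C] coact ?S x)"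
    using x subspD[OF N']
    by (simp add: pairing_coact_sub[OF V N _ a] dual_smult[OF p[OF a] cx]
     linD(3)[OF precomoduleD(2)[OF V]] dual_smult[OF pairing_linear[OF V' C a]] coact_closed[OF V])
  qed (use x subspD[OF N'] coact_sub(1)[OF V N] vs_smult_closed[OF T] in auto)
  assume y: "y : carrier ?N"
  have cy: "coact ?S y : carrier (tensor ?N C)" using coact_sub(1)[OF V N] y by simp
  show "coact ?S (x +[?N] y) = coact ?S x +[tensor ?N C] coact ?S y"
  proof (rule eqI)
   fix alp ph assume a: "alp : dual V" "ph : dual C"
   show "pairing alp ph (coact ?S (x +[?N] y)) = pairing alp ph (coact ?S x +[tensor ?N C] coact ?S y)"
    using x y subspD[OF N']
    by (simp add: pairing_coact_sub[OF V N _ a] dual_add[OF p[OF a] cx cy]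
     linD(2)[OF precomoduleD(2)[OF V]] dual_add[OF pairing_linear[OF V' C a]] coact_closed[OF V])
  qed (use x y subspD[OF N'] coact_sub(1)[OF V N] vs_add_closed[OF T] in auto)
 qed
 then show ?thesis
  unfolding precomodule_def
  using vspace_sub_comod[OF V' N'] same_module_formal_tensors(3)[OF sub_comod_same same_module_refl, of V N C]
   same_module_linear_maps[OF sub_comod_same same_module_refl, of V N "tensor ?N C"] by simp
qed

lemma act_sub:
 assumes V: "precomodule C V" and N: "subcomodule C V N" and x: "x : N" and ph: "ph : dual C"
 shows "act (sub_comod C V N) ph x = act V ph x"
proof (rule dual_separates[OF precomoduleD(1)[OF V]])
 note N' = subcomoduleD(1)[OF V N] and S = precomodule_sub[OF V N]
 have "act (sub_comod C V N) ph x : N"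
  using act_closed[OF S ph] x by simp
 then show "act (sub_comod C V N) ph x : carrier V" using subspD(1)[OF N'] by auto
 show "act V ph x : carrier V" using act_closed[OF V ph] subspD(1)[OF N' x] by simp
 fix alp assume alp: "alp : dual V"
 have "alp : dual (sub_comod C V N)"
  using dual_sub[OF N' alp] same_module_linear_maps[OF sub_comod_same same_module_refl, of V N scalars] by simp
 then show "alp (act (sub_comod C V N) ph x) = alp (act V ph x)"
  using dual_act[OF S ph _ ] x pairing_coact_sub[OF V N x alp ph] dual_act[OF V ph subspD(1)[OF N' x] alp] by simp
qed

lemma quot_comod_same: "same_module (quot_comod C V Y) (quot_mod V Y)"
 by (simp add: quot_comod_def same_module_def module.extend_def comod.fields_def)

text \<open>Well-definedness: a pairing of the mapped coaction of \<open>x\<close> depends only on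
  the class of \<open>act V ph x\<close>, and the action preserves \<open>Y\<close>.\<close>

lemma coact_quot:
 assumes V: "precomodule C V" and Y: "subcomodule C V Y" and x: "x : carrier V"
 shows "coact (quot_comod C V Y) (Y +>\<^bsub>V\<^esub> x) = tensor_map (quot_mod V Y) C (%v. Y +>\<^bsub>V\<^esub> v) (%c. c) (coact V x)"
proof -
 note V' = precomoduleD(1)[OF V] and Y' = subcomoduleD(1)[OF V Y]
 let ?Q = "quot_mod V Y" and ?p = "%v. Y +>\<^bsub>V\<^esub> v"
 note Q = vspace_quot_mod[OF V' Y'] and p = coset_linear[OF V' Y']
 note m = tensor_map_linear[OF V' C Q C p linear_maps_id]
 let ?f = "%x. tensor_map ?Q C ?p (%c. c) (coact V x)"
 have "?f y = ?f x" if y: "y : Y +>\<^bsub>V\<^esub> x" for y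
 proof (rule tensor_eqI[OF Q C])
  have yc: "y : carrier V" using coset_subset[OF V' Y' x] y by auto
  show "?f y : carrier (tensor ?Q C)" "?f x : carrier (tensor ?Q C)"
   using linD(1)[OF m] coact_closed[OF V] x yc by auto
  fix alp ph assume a: "alp : dual ?Q" "ph : dual C"
  have *: "pairing alp ph (?f z) = alp (?p (act V ph z))" if z: "z : carrier V" for z
   using pairing_tensor_map[OF V' C Q C p linear_maps_id a coact_closed[OF V z]]
    dual_act[OF V a(2) z lin_comp[OF p a(1)]] by simp
  note al = linD[OF act_linear[OF V a(2)]]
  have "act V ph (y +[V] (-1) *[V] x) : Y"
   using subcomoduleD(2)[OF V Y a(2)] y coset_mem_iff[OF V' Y' x yc] by simp
  then have "act V ph y +[V] (-1) *[V] act V ph x : Y"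
   by (simp add: al x yc vs_closed[OF V'])
  then have "?p (act V ph y) = ?p (act V ph x)"
   using coset_eq_iff[OF V' Y' al(1)[OF yc] al(1)[OF x]] by simp
  then show "pairing alp ph (?f y) = pairing alp ph (?f x)" using * x yc by simp
 qed
 then have "?f ` (Y +>\<^bsub>V\<^esub> x) = {?f x}"
  using coset_self[OF V' Y' x] by blast
 then show ?thesis
  by (simp add: quot_comod_def module.extend_def comod.fields_def)
qed

lemma precomodule_quot:
 assumes V: "precomodule C V" and Y: "subcomodule C V Y"
 shows "precomodule C (quot_comod C V Y)"
proof -
 note V' = precomoduleD(1)[OF V] and Y' = subcomoduleD(1)[OF V Y]
 let ?Q = "quot_mod V Y" and ?p = "%v. Y +>\<^bsub>V\<^esub> v"
 note Q = vspace_quot_mod[OF V' Y'] and p = coset_linear[OF V' Y']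
 note m = linD[OF tensor_map_linear[OF V' C Q C p linear_maps_id]]
 note cl = linD[OF precomoduleD(2)[OF V]]
 have "coact (quot_comod C V Y) : linear_maps ?Q (tensor ?Q C)"
 proof (rule linear_mapsI)
  fix x y a assume "x : carrier ?Q"
  then obtain x' where x: "x = ?p x'" "x' : carrier V" by (auto simp: carrier_quot_mod)
  show "coact (quot_comod C V Y) x : carrier (tensor ?Q C)"
   using x by (simp add: coact_quot[OF V Y] m cl)
  show "coact (quot_comod C V Y) (a *[?Q] x) = a *[tensor ?Q C] coact (quot_comod C V Y) x"
   using x by (simp add: coact_quot[OF V Y] m cl smult_quot_mod[OF V' Y'] vs_closed[OF V'])
  assume "y : carrier ?Q"
  then obtain y' where y: "y = ?p y'" "y' : carrier V" by (auto simp: carrier_quot_mod)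
  show "coact (quot_comod C V Y) (x +[?Q] y) = coact (quot_comod C V Y) x +[tensor ?Q C] coact (quot_comod C V Y) y"
   using x y by (simp add: coact_quot[OF V Y] m cl add_quot_mod[OF V' Y'] vs_closed[OF V'])
 qed
 then show ?thesis
  unfolding precomodule_def
  using same_module_vspace[OF same_module_sym[OF quot_comod_same] Q]
   same_module_formal_tensors(3)[OF quot_comod_same same_module_refl, of V Y C]
   same_module_linear_maps[OF quot_comod_same same_module_refl, of V Y "tensor ?Q C"] by simp
qed

lemma act_quot:
 assumes V: "precomodule C V" and Y: "subcomodule C V Y" and x: "x : carrier V" and ph: "ph : dual C"
 shows "act (quot_comod C V Y) ph (Y +>\<^bsub>V\<^esub> x) = Y +>\<^bsub>V\<^esub> act V ph x"
 unfolding act_def coact_quot[OF V Y x] same_module_rslice[OF quot_comod_same]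
 by (rule rslice_tensor_map[OF precomoduleD(1)[OF V] C vspace_quot_mod[OF precomoduleD(1)[OF V] subcomoduleD(1)[OF V Y]] C
  coset_linear[OF precomoduleD(1)[OF V] subcomoduleD(1)[OF V Y]] linear_maps_id ph coact_closed[OF V x]])

lemma subcomodule_sub_iff:
 assumes V: "precomodule C V" and N: "subcomodule C V N"
 shows "subcomodule C (sub_comod C V N) Y \<longleftrightarrow> subcomodule C V Y & Y \<subseteq> N"
 unfolding subcomodule_iff[OF precomodule_sub[OF V N]] subcomodule_iff[OF V]
 using act_sub[OF V N] subspD(1)[OF subcomoduleD(1)[OF V N]]
 by (auto simp: subspace_of_def subset_iff)

section \<open>Subquotients and isomorphisms twisted by a coalgebra automorphism\<close>

context
 fixes V :: "('k, 'c, 'v) comod" and Z Y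
 assumes V: "precomodule C V" and Z: "subcomodule C V Z" and Y: "subcomodule C V Y" and YZ: "Y \<subseteq> Z"
begin

lemma subquot_sub: "subcomodule C (sub_comod C V Z) Y"
 using subcomodule_sub_iff[OF V Z] Y YZ by simp

lemma precomodule_subquot: "precomodule C (subquot C V Z Y)"
 unfolding subquot_def by (rule precomodule_quot[OF precomodule_sub[OF V Z] subquot_sub])

abbreviation "cls x \<equiv> Y +>\<^bsub>sub_comod C V Z\<^esub> x"

lemma subquot_vs: "vspace (sub_comod C V Z)" "subspace_of (sub_comod C V Z) Y"
 using precomoduleD(1)[OF precomodule_sub[OF V Z]] subcomoduleD(1)[OF precomodule_sub[OF V Z] subquot_sub] .

lemma carrier_subquot: "carrier (subquot C V Z Y) = cls ` Z"
 unfolding subquot_def same_moduleD(1)[OF quot_comod_same] carrier_quot_mod by auto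

lemma subquot_eq_iff: "x : Z ==> y : Z ==> cls x = cls y \<longleftrightarrow> x +[V] (-1) *[V] y : Y"
 using coset_eq_iff[OF subquot_vs, of x y] by simp

lemma subquot_zero_iff: "x : Z ==> cls x = \<zero>\<^bsub>subquot C V Z Y\<^esub> \<longleftrightarrow> x : Y"
 using coset_zero_iff[OF subquot_vs, of x] by (simp add: subquot_def same_moduleD(4)[OF quot_comod_same])

lemma subquot_add: "x : Z ==> y : Z ==> cls x +[subquot C V Z Y] cls y = cls (x +[V] y)"
 using add_quot_mod[OF subquot_vs, of x y] by (simp add: subquot_def same_moduleD(5)[OF quot_comod_same])

lemma subquot_smult: "x : Z ==> a *[subquot C V Z Y] cls x = cls (a *[V] x)"
 using smult_quot_mod[OF subquot_vs, of x a] by (simp add: subquot_def same_moduleD(6)[OF quot_comod_same])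

lemma act_subquot: "x : Z ==> ph : dual C ==> act (subquot C V Z Y) ph (cls x) = cls (act V ph x)"
 unfolding subquot_def
 using act_quot[OF precomodule_sub[OF V Z] subquot_sub, of x ph] act_sub[OF V Z, of x ph] by simp

end

text \<open>One twisted isomorphism theorem behind the later comparisons of Z'/Y' with Z/Y:
  \<open>g\<close> pulls \<open>Y\<close> back to \<open>Y'\<close>, which gives injectivity, and
  its image together with \<open>Y\<close> fills \<open>Z\<close>. It is used both for inclusions
  and for maps that are equivariant only up to an automorphism.\<close>

lemma semi_iso_subquot:
 fixes V :: "('k, 'c, 'v) comod" and V' :: "('k, 'c, 'w) comod"
 assumes V: "precomodule C V" "subcomodule C V Z" "subcomodule C V Y" "Y \<subseteq> Z"
  and V': "precomodule C V'" "subcomodule C V' Z'" "subcomodule C V' Y'" "Y' \<subseteq> Z'"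
  and g: "g : linear_maps (V'\<lparr>carrier := Z'\<rparr>) V" "!!x. x : Z' ==> g x : Z"
  and Y': "!!x. x : Z' ==> g x : Y \<longleftrightarrow> x : Y'"
  and onto: "!!z. z : Z ==> \<exists>x\<in>Z'. z +[V] (-1) *[V] g x : Y"
  and tht: "tht : linear_maps C C"
  and equi: "!!ph x. ph : dual C ==> x : Z' ==> act V ph (g x) = g (act V' (%c. ph (tht c)) x)"
 shows "\<exists>f. semi_iso C tht (subquot C V' Z' Y') (subquot C V Z Y) f"
proof -
 let ?c = "%x. Y +>\<^bsub>sub_comod C V Z\<^esub> x" and ?c' = "%x. Y' +>\<^bsub>sub_comod C V' Z'\<^esub> x"
 \<comment> \<open>A map on cosets through an arbitrary representative; by \<open>eq\<close> below
   the choice does not matter.\<close>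
 define f where "f A = ?c (g (SOME x. x : Z' & A = ?c' x))" for A
 note gD = linD[OF g(1), simplified]
 note Z's = subspD[OF subcomoduleD(1)[OF V'(1,2)]]
 have diff: "g (x +[V'] (-1) *[V'] y) = g x +[V] (-1) *[V] g y" if "x : Z'" "y : Z'" for x y
  unfolding gD(2)[OF that(1) Z's(4)[OF that(2)]] gD(3)[OF that(2)] by (rule refl)
 have eq: "?c (g x) = ?c (g y) \<longleftrightarrow> ?c' x = ?c' y" if x: "x : Z'" and y: "y : Z'" for x y
  unfolding subquot_eq_iff[OF V' x y] subquot_eq_iff[OF V g(2)[OF x] g(2)[OF y]]
  unfolding diff[OF x y, symmetric] by (rule Y'[OF Z's(3)[OF x Z's(4)[OF y]]])
 have f: "f (?c' x) = ?c (g x)" if x: "x : Z'" for x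
 proof -
  define s where "s = (SOME y. y : Z' & ?c' x = ?c' y)"
  have "s : Z' & ?c' x = ?c' s"
   unfolding s_def by (rule someI[of _ x]) (use x in simp)
  then have "?c (g x) = ?c (g s)"
   using eq[OF x, of s] by blast
  then show ?thesis unfolding f_def s_def[symmetric] by (rule sym)
 qed
 have "semi_iso C tht (subquot C V' Z' Y') (subquot C V Z Y) f"
  unfolding semi_iso_def
 proof (intro conjI ballI)
  show "f : linear_maps (subquot C V' Z' Y') (subquot C V Z Y)"
  proof (rule linear_mapsI)
   fix A B a assume "A : carrier (subquot C V' Z' Y')"
   then obtain x where x: "A = ?c' x" "x : Z'" unfolding carrier_subquot[OF V'] by (rule imageE)
   show "f A : carrier (subquot C V Z Y)"
    unfolding x(1) f[OF x(2)] carrier_subquot[OF V] by (rule imageI[OF g(2)[OF x(2)]])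
   show "f (a *[subquot C V' Z' Y'] A) = a *[subquot C V Z Y] f A"
    unfolding x(1) subquot_smult[OF V' x(2)] f[OF x(2)] f[OF Z's(4)[OF x(2)]] subquot_smult[OF V g(2)[OF x(2)]] gD(3)[OF x(2)]
    by (rule refl)
   assume "B : carrier (subquot C V' Z' Y')"
   then obtain y where y: "B = ?c' y" "y : Z'" unfolding carrier_subquot[OF V'] by (rule imageE)
   show "f (A +[subquot C V' Z' Y'] B) = f A +[subquot C V Z Y] f B"
    unfolding x(1) y(1) subquot_add[OF V' x(2) y(2)] f[OF x(2)] f[OF y(2)] f[OF Z's(3)[OF x(2) y(2)]]
     subquot_add[OF V g(2)[OF x(2)] g(2)[OF y(2)]] gD(2)[OF x(2) y(2)]
    by (rule refl)
  qed
  show "bij_betw f (carrier (subquot C V' Z' Y')) (carrier (subquot C V Z Y))"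
   unfolding bij_betw_def
  proof
   show "inj_on f (carrier (subquot C V' Z' Y'))"
    unfolding carrier_subquot[OF V']
   proof (rule inj_onI, elim imageE)
    fix A B x y assume *: "f A = f B" "A = ?c' x" "x : Z'" "B = ?c' y" "y : Z'"
    have "?c (g x) = ?c (g y)" using *(1) unfolding *(2,4) f[OF *(3)] f[OF *(5)] .
    then show "A = B" unfolding *(2,4) eq[OF *(3,5)] .
   qed
   have 1: "?c z : f ` ?c' ` Z'" if z: "z : Z" for z
   proof -
    obtain x where x: "x : Z'" "z +[V] (-1) *[V] g x : Y" using onto[OF z] by (rule bexE)
    have "?c z = ?c (g x)" unfolding subquot_eq_iff[OF V z g(2)[OF x(1)]] by (rule x(2))
    then show ?thesis unfolding f[OF x(1), symmetric] using x(1) by simp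
   qed
   have 2: "f (?c' x) : ?c ` Z" if x: "x : Z'" for x
    unfolding f[OF x] by (rule imageI[OF g(2)[OF x]])
   show "f ` carrier (subquot C V' Z' Y') = carrier (subquot C V Z Y)"
    unfolding carrier_subquot[OF V] carrier_subquot[OF V']
   proof (rule subset_antisym)
    show "f ` ?c' ` Z' \<subseteq> ?c ` Z" unfolding image_image[of f] image_subset_iff by (intro ballI 2)
    show "?c ` Z \<subseteq> f ` ?c' ` Z'" unfolding image_subset_iff by (intro ballI 1)
   qed
  qed
  fix ph v assume ph: "ph : dual C" and "v : carrier (subquot C V' Z' Y')"
  then obtain x where x: "v = ?c' x" "x : Z'" unfolding carrier_subquot[OF V'] by (elim imageE)
  note phtht = lin_comp[OF tht ph]
  show "act (subquot C V Z Y) ph (f v) = f (act (subquot C V' Z' Y') (%c. ph (tht c)) v)"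
   unfolding x(1) f[OF x(2)] act_subquot[OF V g(2)[OF x(2)] ph] act_subquot[OF V' x(2) phtht]
    f[OF subcomoduleD(2)[OF V'(1,2) phtht x(2)]] equi[OF ph x(2)] by (rule refl)
 qed
 then show ?thesis by (intro exI[of _ f])
qed

lemma semi_isoD:
 assumes "semi_iso C tht V W f"
 shows "f : linear_maps V W" "bij_betw f (carrier V) (carrier W)"
  "ph : dual C ==> v : carrier V ==> act W ph (f v) = f (act V (%c. ph (tht c)) v)"
 using assms by (auto simp: semi_iso_def)

lemma coalg_autoD:
 assumes "coalg_auto C tht"
 shows "tht : linear_maps C C" "bij_betw tht (carrier C) (carrier C)" "c : carrier C ==> counit C (tht c) = counit C c"
  "ph : dual C ==> psi : dual C ==> c : carrier C ==>
    conv C ph psi (tht c) = conv C (%c. ph (tht c)) (%c. psi (tht c)) c"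
 using assms by (auto simp: coalg_auto_def)

lemma coalg_auto_id: "coalg_auto C (%c. c)"
 by (simp add: coalg_auto_def linear_maps_id bij_betw_def)

lemma coalg_auto_inv:
 assumes tht: "coalg_auto C tht"
 shows "coalg_auto C (inv_into (carrier C) tht)"
proof -
 let ?i = "inv_into (carrier C) tht"
 have i: "?i c : carrier C" "tht (?i c) = c" if "c : carrier C" for c
  using that coalg_autoD(2)[OF tht] by (auto simp: bij_betw_def inv_into_into f_inv_into_f)
 have i': "?i (tht c) = c" if "c : carrier C" for c
  using that coalg_autoD(2)[OF tht] by (auto simp: bij_betw_def)
 note il = linear_maps_inv_into[OF C coalg_autoD(1,2)[OF tht]]
 note tl = coalg_autoD(1)[OF tht]
 \<comment> \<open>\<open>inv_into\<close> inverts \<open>tht\<close> on the carrier only, so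
   functionals are exchanged for others that agree there.\<close>
 have cong: "conv C ph psi c = conv C ph' psi' c" if "c : carrier C" "ph : dual C" "psi : dual C" "ph' : dual C" "psi' : dual C"
  "!!c. c : carrier C ==> ph c = ph' c" "!!c. c : carrier C ==> psi c = psi' c" for ph psi ph' psi' c
  unfolding conv_def
  by (rule tensor_linear_eqI[OF C C vspace_scalars pairing_linear[OF C C that(2,3)] pairing_linear[OF C C that(4,5)] _
    linD(1)[OF comult_linear that(1)]])
   (simp add: pairing_tens[OF C C] that)
 show ?thesis
  unfolding coalg_auto_def
 proof (intro conjI ballI)
  show "bij_betw ?i (carrier C) (carrier C)" by (rule bij_betw_inv_into[OF coalg_autoD(2)[OF tht]])
  fix c assume c: "c : carrier C"
  show "counit C (?i c) = counit C c" using coalg_autoD(3)[OF tht i(1)[OF c]] i(2)[OF c] by simp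
  fix ph psi assume d: "ph : dual C" "psi : dual C"
  note d' = lin_comp[OF il d(1)] lin_comp[OF il d(2)]
  have "conv C ph psi (?i c) = conv C (%c. ph (?i (tht c))) (%c. psi (?i (tht c))) (?i c)"
   by (rule cong) (use d i(1)[OF c] i' lin_comp[OF tl d'(1)] lin_comp[OF tl d'(2)] in auto)
  also have "... = conv C (%c. ph (?i c)) (%c. psi (?i c)) (tht (?i c))"
   by (rule coalg_autoD(4)[OF tht d' i(1)[OF c], symmetric])
  finally show "conv C ph psi (?i c) = conv C (%c. ph (?i c)) (%c. psi (?i c)) c"
   using i(2)[OF c] by simp
 qed (rule il)
qed

lemma semi_iso_inv:
 assumes V: "precomodule C V" and tht: "coalg_auto C tht" and f: "semi_iso C tht V W f"
 shows "semi_iso C (inv_into (carrier C) tht) W V (inv_into (carrier V) f)"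
proof -
 let ?i = "inv_into (carrier C) tht" and ?g = "inv_into (carrier V) f"
 have g: "?g w : carrier V" "f (?g w) = w" if "w : carrier W" for w
  using that semi_isoD(2)[OF f] by (auto simp: bij_betw_def inv_into_into f_inv_into_f)
 have gf: "?g (f v) = v" if "v : carrier V" for v
  using that semi_isoD(2)[OF f] by (auto simp: bij_betw_def)
 have i': "?i (tht c) = c" if "c : carrier C" for c
  using that coalg_autoD(2)[OF tht] by (auto simp: bij_betw_def)
 note il = linear_maps_inv_into[OF C coalg_autoD(1,2)[OF tht]]
 show ?thesis
  unfolding semi_iso_def
 proof (intro conjI ballI)
  show "?g : linear_maps W V" by (rule linear_maps_inv_into[OF precomoduleD(1)[OF V] semi_isoD(1,2)[OF f]])
  show "bij_betw ?g (carrier W) (carrier V)" by (rule bij_betw_inv_into[OF semi_isoD(2)[OF f]])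
  fix ph w assume ph: "ph : dual C" and w: "w : carrier W"
  note phi = lin_comp[OF il ph]
  have "act V ph (?g w) = act V (%c. ph (?i (tht c))) (?g w)"
   by (rule act_cong[OF V ph lin_comp[OF coalg_autoD(1)[OF tht] phi] g(1)[OF w]]) (simp add: i')
  also have "... = ?g (f (act V (%c. ph (?i (tht c))) (?g w)))"
   by (rule gf[symmetric], rule act_closed[OF V lin_comp[OF coalg_autoD(1)[OF tht] phi] g(1)[OF w]])
  also have "... = ?g (act W (%c. ph (?i c)) w)"
   using semi_isoD(3)[OF f phi g(1)[OF w]] g(2)[OF w] by simp
  finally show "act V ph (?g w) = ?g (act W (%c. ph (?i c)) w)" .
 qed
qed

end

text \<open>Slicing off the first factor reduces this to the tensor product of two spaces.\<close>

lemma tensor3_eqI: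
 assumes V: "vspace V" and W: "vspace W" and U: "vspace U"
  and s: "s : carrier (tensor V (tensor W U))" and t: "t : carrier (tensor V (tensor W U))"
  and eq: "!!alp ph psi. alp : dual V ==> ph : dual W ==> psi : dual U ==>
   pairing alp (pairing ph psi) s = pairing alp (pairing ph psi) t"
 shows "s = t"
proof (rule tensor_eqI[OF V vspace_tensor[OF W U] s t])
 note T = vspace_tensor[OF W U]
 fix alp be assume alp: "alp : dual V" and be: "be : dual (tensor W U)"
 have "lslice (tensor W U) alp s = lslice (tensor W U) alp t"
 proof (rule tensor_eqI[OF W U])
  show "lslice (tensor W U) alp s : carrier (tensor W U)" "lslice (tensor W U) alp t : carrier (tensor W U)"
   using linD(1)[OF lslice_linear[OF V T alp]] s t by auto
  show "pairing ph psi (lslice (tensor W U) alp s) = pairing ph psi (lslice (tensor W U) alp t)"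
   if d: "ph : dual W" "psi : dual U" for ph psi
   using dual_lslice[OF V T alp pairing_linear[OF W U d]] s t eq[OF alp d] by simp
 qed
 then show "pairing alp be s = pairing alp be t"
  using dual_lslice[OF V T alp be s] dual_lslice[OF V T alp be t] by simp
qed

lemma linear_maps_add:
 assumes W: "vspace W" and f: "f : linear_maps V W" and g: "g : linear_maps V W"
 shows "(%x. f x +[W] g x) : linear_maps V W"
proof (rule linear_mapsI)
 note fD = linD[OF f] and gD = linD[OF g]
 fix x y a assume x: "x : carrier V"
 show "f x +[W] g x : carrier W" by (rule vs_add_closed[OF W fD(1)[OF x] gD(1)[OF x]])
 show "f (a *[V] x) +[W] g (a *[V] x) = a *[W] (f x +[W] g x)"
  using x by (simp add: fD gD vs_distrib_left[OF W])
 assume y: "y : carrier V"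
 show "f (x +[V] y) +[W] g (x +[V] y) = (f x +[W] g x) +[W] (f y +[W] g y)"
  unfolding fD(2)[OF x y] gD(2)[OF x y]
  by (simp add: fD gD x y vs_assoc[OF W] vs_closed[OF W] vs_lcommute[OF W, of "f y"])
qed

lemma linear_maps_smult:
 assumes W: "vspace W" and f: "f : linear_maps V W"
 shows "(%x. a *[W] f x) : linear_maps V W"
 using linD[OF f]
 by (intro linear_mapsI) (simp_all add: vs_closed[OF W] vs_distrib_left[OF W] vs_smult_smult[OF W] mult.commute)

context
 fixes V :: "('k::field, 'v, 'm) module_scheme" and W :: "('k, 'w, 'l) module_scheme" and U :: "('k, 'u, 'h) module_scheme"
 assumes V: "vspace V" and W: "vspace W" and U: "vspace U"
begin

text \<open>\<open>tensor_assoc\<close> is a lift of a lift, so the inner lift must be bilinear in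
  its tensor and in the last factor.\<close>

lemma tensor_assoc_bilinear:
 shows "u : carrier U ==> bilinear_on V W (tensor V (tensor W U)) (%(v, w). tens V (tensor W U) v (tens W U w u))"
  and "bilinear_on (tensor V W) U (tensor V (tensor W U))
   (%(x, u). tensor_lift (tensor V (tensor W U)) (%(v, w). tens V (tensor W U) v (tens W U w u)) x)"
proof -
 let ?T = "tensor V (tensor W U)" and ?b = "%u (v, w). tens V (tensor W U) v (tens W U w u)"
 note WU = vspace_tensor[OF W U] and VW = vspace_tensor[OF V W]
 note T = vspace_tensor[OF V WU]
 show b: "bilinear_on V W ?T (?b u)" if u: "u : carrier U" for u
  using lin_comp[OF tens_linear_left[OF W U u] tens_linear_right[OF V WU]]
   tens_linear_left[OF V WU tens_closed[OF W U _ u]]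
  by (intro bilinear_onI) simp_all
 note lt = tensor_lift_tens[OF V W T b, simplified] and ll = tensor_lift_linear[OF V W T b]
 show "bilinear_on (tensor V W) U ?T (%(x, u). tensor_lift ?T (?b u) x)"
 proof (rule bilinear_onI)
  fix x assume x: "x : carrier (tensor V W)"
  have "(%u. tensor_lift ?T (?b u) x) : linear_maps U ?T"
  proof (rule linear_mapsI)
   fix u u' a assume u: "u : carrier U"
   show "tensor_lift ?T (?b u) x : carrier ?T" by (rule linD(1)[OF ll[OF u] x])
   note au = vs_smult_closed[OF U u, of a]
   show "tensor_lift ?T (?b (a *[U] u)) x = a *[?T] tensor_lift ?T (?b u) x"
    by (rule tensor_linear_eqI[OF V W T ll[OF au] linear_maps_smult[OF T ll[OF u]] _ x])
     (simp add: lt[OF u] lt[OF au] linD(3)[OF tens_linear_right[OF W U] u] tens_closed[OF W U]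
      linD(3)[OF tens_linear_right[OF V WU]] u)
   assume u': "u' : carrier U"
   note uu' = vs_add_closed[OF U u u']
   show "tensor_lift ?T (?b (u +[U] u')) x = tensor_lift ?T (?b u) x +[?T] tensor_lift ?T (?b u') x"
    by (rule tensor_linear_eqI[OF V W T ll[OF uu'] linear_maps_add[OF T ll[OF u] ll[OF u']] _ x])
     (simp add: lt[OF u] lt[OF u'] lt[OF uu'] linD(2)[OF tens_linear_right[OF W U] u u'] tens_closed[OF W U]
      linD(2)[OF tens_linear_right[OF V WU]] u u')
  qed
  then show "(%u. (%(x, u). tensor_lift ?T (?b u) x) (x, u)) : linear_maps U ?T" by simp
 next
  fix u assume u: "u : carrier U"
  show "(%x. (%(x, u). tensor_lift ?T (?b u) x) (x, u)) : linear_maps (tensor V W) ?T"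
   using ll[OF u] by simp
 qed
qed

lemma tensor_assoc_linear: "tensor_assoc V W U : linear_maps (tensor (tensor V W) U) (tensor V (tensor W U))"
 unfolding tensor_assoc_def
 by (rule tensor_lift_linear[OF vspace_tensor[OF V W] U vspace_tensor[OF V vspace_tensor[OF W U]] tensor_assoc_bilinear(2)])

lemma tensor_assoc_tens:
 assumes "v : carrier V" "w : carrier W" "u : carrier U"
 shows "tensor_assoc V W U (tens (tensor V W) U (tens V W v w) u) = tens V (tensor W U) v (tens W U w u)"
 unfolding tensor_assoc_def
 using tensor_lift_tens[OF vspace_tensor[OF V W] U vspace_tensor[OF V vspace_tensor[OF W U]] tensor_assoc_bilinear(2)
   tens_closed[OF V W assms(1,2)] assms(3)]
  tensor_lift_tens[OF V W vspace_tensor[OF V vspace_tensor[OF W U]] tensor_assoc_bilinear(1)[OF assms(3)] assms(1,2)]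
 by simp

end

lemma pairing_tensor_assoc:
 assumes V: "vspace V" and W: "vspace W" and U: "vspace U"
  and s: "s : carrier (tensor (tensor V W) U)"
  and d: "alp : dual V" "ph : dual W" "psi : dual U"
 shows "pairing alp (pairing ph psi) (tensor_assoc V W U s) = pairing (pairing alp ph) psi s"
proof -
 note WU = vspace_tensor[OF W U] and VW = vspace_tensor[OF V W]
 note p1 = pairing_linear[OF V W d(1,2)] and p2 = pairing_linear[OF W U d(2,3)]
 note F = lin_comp[OF tensor_assoc_linear[OF V W U] pairing_linear[OF V WU d(1) p2]]
 note G = pairing_linear[OF VW U p1 d(3)]
 show ?thesis
 proof (rule tensor_linear_eqI[OF VW U vspace_scalars F G _ s])
  fix x u assume x: "x : carrier (tensor V W)" and u: "u : carrier U"
  show "pairing alp (pairing ph psi) (tensor_assoc V W U (tens (tensor V W) U x u)) = pairing (pairing alp ph) psi (tens (tensor V W) U x u)"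
   by (rule tensor_linear_eqI[OF V W vspace_scalars lin_comp[OF tens_linear_left[OF VW U u] F]
     lin_comp[OF tens_linear_left[OF VW U u] G] _ x])
    (simp add: tensor_assoc_tens[OF V W U _ _ u] pairing_tens[OF V WU d(1) p2] pairing_tens[OF W U d(2,3)]
     pairing_tens[OF VW U p1 d(3)] pairing_tens[OF V W d(1,2)] u tens_closed[OF W U] tens_closed[OF V W])
 qed
qed

context coalgebra
begin

text \<open>Pairing both sides of the coassociativity axiom with alp \<otimes> ph \<otimes> psi
  gives alp of both sides of the module law, and such pairings separate. The counit axiom is
  literally the action of the counit.\<close>

lemma comodule_iff:
 "comodule C V \<longleftrightarrow> precomodule C V & (\<forall>v\<in>carrier V. act V (counit C) v = v) &
   (\<forall>v\<in>carrier V. \<forall>ph\<in>dual C. \<forall>psi\<in>dual C. act V ph (act V psi v) = act V (conv C ph psi) v)"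
proof -
 have counit: "tensor_lift V (%(u, c). counit C c *[V] u) (coact V v) = act V (counit C) v" for v
  by (simp add: act_def rslice_def)
 have "tensor_assoc V C C (tensor_map (tensor V C) C (coact V) (%c. c) (coact V v)) =
   tensor_map V (tensor C C) (%u. u) (comult C) (coact V v) \<longleftrightarrow>
  (\<forall>ph\<in>dual C. \<forall>psi\<in>dual C. act V ph (act V psi v) = act V (conv C ph psi) v)" (is "?s = ?t \<longleftrightarrow> _")
  if V: "precomodule C V" and v: "v : carrier V" for v
 proof -
  note V' = precomoduleD(1)[OF V] and r = precomoduleD(2)[OF V]
  note VC = vspace_tensor[OF V' C] and CC = vspace_tensor[OF C C]
  note t1 = tensor_map_linear[OF V' C VC C r linear_maps_id]
  note t2 = tensor_map_linear[OF V' C V' CC linear_maps_id comult_linear]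
  note cv = coact_closed[OF V v]
  have s: "?s : carrier (tensor V (tensor C C))"
   by (rule linD(1)[OF tensor_assoc_linear[OF V' C C] linD(1)[OF t1 cv]])
  have t: "?t : carrier (tensor V (tensor C C))"
   by (rule linD(1)[OF t2 cv])
  have ps: "pairing alp (pairing ph psi) ?s = alp (act V ph (act V psi v))"
   if d: "alp : dual V" "ph : dual C" "psi : dual C" for alp ph psi
  proof -
   have "pairing alp (pairing ph psi) ?s = pairing (pairing alp ph) psi (tensor_map (tensor V C) C (coact V) (%c. c) (coact V v))"
    by (rule pairing_tensor_assoc[OF V' C C linD(1)[OF t1 cv] d])
   also have "... = pairing (%x. pairing alp ph (coact V x)) psi (coact V v)"
    by (rule pairing_tensor_map[OF V' C VC C r linear_maps_id pairing_linear[OF V' C d(1,2)] d(3) cv])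
   also have "... = pairing alp ph (coact V (act V psi v))"
    by (rule dual_act[OF V d(3) v lin_comp[OF r pairing_linear[OF V' C d(1,2)]], symmetric])
   also have "... = alp (act V ph (act V psi v))"
    by (rule dual_act[OF V d(2) act_closed[OF V d(3) v] d(1), symmetric])
   finally show ?thesis .
  qed
  have pt: "pairing alp (pairing ph psi) ?t = alp (act V (conv C ph psi) v)"
   if d: "alp : dual V" "ph : dual C" "psi : dual C" for alp ph psi
  proof -
   have "pairing alp (pairing ph psi) ?t = pairing alp (conv C ph psi) (coact V v)"
    unfolding conv_def[abs_def]
    by (rule pairing_tensor_map[OF V' C V' CC linear_maps_id comult_linear d(1) pairing_linear[OF C C d(2,3)] cv])
   also have "... = alp (act V (conv C ph psi) v)"
    by (rule dual_act[OF V conv_dual[OF d(2,3)] v d(1), symmetric])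
   finally show ?thesis .
  qed
  show ?thesis
  proof (intro iffI ballI)
   fix ph psi assume eq: "?s = ?t" and d: "ph : dual C" "psi : dual C"
   show "act V ph (act V psi v) = act V (conv C ph psi) v"
   proof (rule dual_separates[OF V' act_closed[OF V d(1) act_closed[OF V d(2) v]] act_closed[OF V conv_dual[OF d] v]])
    fix alp assume alp: "alp : dual V"
    show "alp (act V ph (act V psi v)) = alp (act V (conv C ph psi) v)"
     using ps[OF alp d] pt[OF alp d] unfolding eq by simp
   qed
  next
   assume eq: "\<forall>ph\<in>dual C. \<forall>psi\<in>dual C. act V ph (act V psi v) = act V (conv C ph psi) v"
   show "?s = ?t"
    by (rule tensor3_eqI[OF V' C C s t]) (simp add: ps pt eq)
  qed
 qed
 then show ?thesis
  unfolding comodule_def counit precomodule_def by blast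
qed

lemma comodule_transport:
 assumes tht: "coalg_auto C tht" and f: "semi_iso C tht V W f" and V: "comodule C V" and W: "precomodule C W"
 shows "comodule C W"
 unfolding comodule_iff
proof (intro conjI ballI W)
 have V': "precomodule C V" using V by (simp add: comodule_iff)
 note fD = semi_isoD[OF f] and tl = coalg_autoD(1)[OF tht]
 fix w assume "w : carrier W"
 then obtain v where v: "v : carrier V" "w = f v"
  using fD(2) by (auto simp: bij_betw_def)
 have "act V (%c. counit C (tht c)) v = act V (counit C) v"
  by (rule act_cong[OF V' lin_comp[OF tl counit_dual] counit_dual v(1)]) (rule coalg_autoD(3)[OF tht])
 then show "act W (counit C) w = w"
  using V v fD(3)[OF counit_dual v(1)] by (simp add: comodule_iff)
 fix ph psi assume d: "ph : dual C" "psi : dual C"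
 note d' = lin_comp[OF tl d(1)] lin_comp[OF tl d(2)]
 have "act W ph (act W psi w) = f (act V (%c. ph (tht c)) (act V (%c. psi (tht c)) v))"
  unfolding v(2) fD(3)[OF d(2) v(1)] by (rule fD(3)[OF d(1) act_closed[OF V' d'(2) v(1)]])
 also have "... = f (act V (conv C (%c. ph (tht c)) (%c. psi (tht c))) v)"
  using V v d' by (simp add: comodule_iff)
 also have "act V (conv C (%c. ph (tht c)) (%c. psi (tht c))) v = act V (%c. conv C ph psi (tht c)) v"
  by (rule act_cong[OF V' conv_dual[OF d'] lin_comp[OF tl conv_dual[OF d]] v(1)])
   (rule coalg_autoD(4)[OF tht d, symmetric])
 also have "f ... = act W (conv C ph psi) w"
  unfolding v(2) by (rule fD(3)[OF conv_dual[OF d] v(1), symmetric])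
 finally show "act W ph (act W psi w) = act W (conv C ph psi) w" .
qed

text \<open>Preimages of subcomodules under \<open>f\<close> are subcomodules, so a nontrivial one
  in \<open>W\<close> would give one in \<open>V\<close>.\<close>

lemma simple_transport:
 assumes tht: "coalg_auto C tht" and f: "semi_iso C tht V W f" and V: "simple_comodule C V" and W: "precomodule C W"
 shows "simple_comodule C W"
proof -
 have V': "precomodule C V" "comodule C V" using V by (simp_all add: simple_comodule_def comodule_iff)
 note vV = precomoduleD(1)[OF V'(1)] and vW = precomoduleD(1)[OF W]
 note fD = semi_isoD[OF f] and tl = coalg_autoD(1)[OF tht]
 let ?i = "inv_into (carrier C) tht"
 note il = linear_maps_inv_into[OF C coalg_autoD(1,2)[OF tht]]
 have i': "?i (tht c) = c" if "c : carrier C" for c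
  using that coalg_autoD(2)[OF tht] by (auto simp: bij_betw_def)
 have fz: "f \<zero>\<^bsub>V\<^esub> = \<zero>\<^bsub>W\<^esub>" by (rule linear_maps_zero[OF vV vW fD(1)])
 have fW: "f ` carrier V = carrier W" and inj: "inj_on f (carrier V)"
  using fD(2) by (simp_all add: bij_betw_def)
 have "carrier W ~= {\<zero>\<^bsub>W\<^esub>}"
 proof
  assume eq: "carrier W = {\<zero>\<^bsub>W\<^esub>}"
  have "v = \<zero>\<^bsub>V\<^esub>" if "v : carrier V" for v
   using inj_onD[OF inj _ that vs_zero_closed[OF vV]] fz linD(1)[OF fD(1) that] eq by simp
  then show False using V vs_zero_closed[OF vV] unfolding simple_comodule_def by blast
 qed
 moreover have "N = {\<zero>\<^bsub>W\<^esub>} \<or> N = carrier W" if N: "subcomodule C W N" for N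
 proof -
  note Ns = subcomoduleD(1)[OF W N]
  define M where "M = {v : carrier V. f v : N}"
  have fM: "N = f ` M"
  proof (intro subset_antisym subsetI)
   fix x assume x: "x : N"
   then obtain v where "v : carrier V" "x = f v"
    using subspD(1)[OF Ns x] unfolding fW[symmetric] by (elim imageE)
   then show "x : f ` M" using x by (simp add: M_def)
  qed (auto simp: M_def)
  have "subcomodule C V M"
   unfolding subcomodule_iff[OF V'(1)]
  proof (intro conjI ballI)
   show "subspace_of V M" unfolding M_def by (rule subspace_of_ker[OF vV vW fD(1) Ns])
   fix ph v assume ph: "ph : dual C" and v: "v : M"
   then have vc: "v : carrier V" and fv: "f v : N" by (simp_all add: M_def)
   note phi = lin_comp[OF il ph]
   \<comment> \<open>On the carrier every functional is a composite with \<open>tht\<close>, namely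
     of \<open>ph\<close> after the inverse of \<open>tht\<close>; this makes the equivariance of
     \<open>f\<close> applicable.\<close>
   have "act V ph v = act V (%c. ph (?i (tht c))) v"
    by (rule act_cong[OF V'(1) ph lin_comp[OF tl phi] vc]) (simp add: i')
   then have "f (act V ph v) = act W (%c. ph (?i c)) (f v)"
    using fD(3)[OF phi vc] by simp
   then show "act V ph v : M"
    using subcomoduleD(2)[OF W N phi fv] act_closed[OF V'(1) ph vc] by (simp add: M_def)
  qed
  then have "M = {\<zero>\<^bsub>V\<^esub>} \<or> M = carrier V" using V unfolding simple_comodule_def by blast
  then show ?thesis using fM fz fW by auto
 qed
 ultimately show ?thesis
  unfolding simple_comodule_def using comodule_transport[OF tht f V'(2) W] by blast
qed

end

section \<open>Weights and highest weights under an automorphism\<close>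

lemma laurent_simps:
 "carrier (laurent n) = {p. keys p \<subseteq> weight_lattice n}"
 "x +[laurent n] y = x + y" "x \<otimes>\<^bsub>laurent n\<^esub> y = x * y" "\<zero>\<^bsub>laurent n\<^esub> = 0" "\<one>\<^bsub>laurent n\<^esub> = 1"
 "a *[laurent n] x = pscale a x"
 by (simp_all add: laurent_def ring.extend_def module.fields_def ring_of_type_algebra_def)

lemma vspace_laurent: "vspace (laurent n :: ('k::field, _) module)"
proof (rule vspaceI)
 fix x y :: "(nat => int) \<Rightarrow>\<^sub>0 'k" and a
 assume x: "x : carrier (laurent n)"
 show "a *[laurent n] x : carrier (laurent n)"
  using x keys_pscale[of a x] by (auto simp: laurent_simps)
 assume "y : carrier (laurent n)"
 with x show "x +[laurent n] y : carrier (laurent n)"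
  using Poly_Mapping.keys_add[of x y] by (auto simp: laurent_simps)
qed (simp_all add: laurent_simps pscale_simps add_ac)

lemma single_mem_laurent: "mu : weight_lattice n ==> single mu a : carrier (laurent n)"
 by (simp add: laurent_simps)

text \<open>\<open>s\<close> is the effect of \<open>tht\<close> on the torus coordinates. Only
  linearity is asked of it, since for a \<open>sig\<close> with a translation part it is not
  multiplicative. Preservation of dominance carries highest weights to highest weights.\<close>

definition torus_auto :: "nat => 'k::field => ((gen_word \<Rightarrow>\<^sub>0 'k) set => (gen_word \<Rightarrow>\<^sub>0 'k) set) =>
  ((nat => int) => (nat => int)) => bool" where
 "torus_auto n q tht sig \<longleftrightarrow> coalg_auto (kG n q) tht & bij_betw sig (weight_lattice n) (weight_lattice n) &
   (\<forall>mu\<in>weight_lattice n. \<forall>nu\<in>weight_lattice n. dominated n (sig mu) (sig nu) \<longleftrightarrow> dominated n mu nu) &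
   (\<exists>s. s : linear_maps (laurent n) (laurent n) & bij_betw s (carrier (laurent n :: ('k, _) module)) (carrier (laurent n)) &
    (\<forall>mu\<in>weight_lattice n. s (single mu 1) = single (sig mu) 1) &
    (\<forall>c\<in>carrier (kG n q). torus_restrict n (tht c) = s (torus_restrict n c)))"

locale quantum_gl = coalgebra "kG n q" for n :: nat and q :: "'k::field" +
 assumes restrict_linear: "torus_restrict n : linear_maps (kG n q) (laurent n)"
begin

lemma restrict_dual: "psi : dual (laurent n) ==> (%c. psi (torus_restrict n c)) : dual (kG n q)"
 by (rule lin_comp[OF restrict_linear])

text \<open>The tensor identity defining a weight space is tested by slicing with functionals on the
  Laurent polynomials.\<close>

lemma weight_space_iff:
 assumes V: "precomodule (kG n q) V" and mu: "mu : weight_lattice n"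
 shows "v : weight_space n V mu \<longleftrightarrow> v : carrier V &
  (\<forall>psi\<in>dual (laurent n). act V (%c. psi (torus_restrict n c)) v = psi (single mu 1) *[V] v)"
proof -
 note V' = precomoduleD(1)[OF V]
 note m = tensor_map_linear[OF V' C V' vspace_laurent linear_maps_id restrict_linear]
 have "tensor_map V (laurent n) (%u. u) (torus_restrict n) (coact V v) = tens V (laurent n) v (single mu 1) \<longleftrightarrow>
  (\<forall>psi\<in>dual (laurent n). act V (%c. psi (torus_restrict n c)) v = psi (single mu 1) *[V] v)" (is "?s = ?t \<longleftrightarrow> _")
  if v: "v : carrier V"
 proof -
  have s: "?s : carrier (tensor V (laurent n))" by (rule linD(1)[OF m coact_closed[OF V v]])
  have t: "?t : carrier (tensor V (laurent n))" by (rule tens_closed[OF V' vspace_laurent v single_mem_laurent[OF mu]])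
  have rs: "rslice V psi ?s = act V (%c. psi (torus_restrict n c)) v" if "psi : dual (laurent n)" for psi
   unfolding act_def
   by (rule rslice_tensor_map[OF V' C V' vspace_laurent linear_maps_id restrict_linear that coact_closed[OF V v]])
  have rt: "rslice V psi ?t = psi (single mu 1) *[V] v" if "psi : dual (laurent n)" for psi
   by (rule rslice_tens[OF V' vspace_laurent that v single_mem_laurent[OF mu]])
  show ?thesis
  proof
   assume "?s = ?t"
   then show "\<forall>psi\<in>dual (laurent n). act V (%c. psi (torus_restrict n c)) v = psi (single mu 1) *[V] v"
    using rs rt by metis
  next
   assume *: "\<forall>psi\<in>dual (laurent n). act V (%c. psi (torus_restrict n c)) v = psi (single mu 1) *[V] v"
   show "?s = ?t"
   proof (rule tensor_eqI[OF V' vspace_laurent s t])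
    fix alp and psi :: "((nat => int) \<Rightarrow>\<^sub>0 'k) => 'k"
    assume d: "alp : dual V" "psi : dual (laurent n)"
    show "pairing alp psi ?s = pairing alp psi ?t"
     using dual_rslice[OF V' vspace_laurent d s] dual_rslice[OF V' vspace_laurent d t] rs[OF d(2)] rt[OF d(2)] * d(2) by simp
   qed
  qed
 qed
 then show ?thesis unfolding weight_space_def by blast
qed

lemma weights_iff:
 assumes V: "precomodule (kG n q) V"
 shows "mu : weights n V \<longleftrightarrow> mu : weight_lattice n & (\<exists>v\<in>weight_space n V mu. v ~= \<zero>\<^bsub>V\<^esub>)"
proof -
 note V' = precomoduleD(1)[OF V]
 have "\<zero>\<^bsub>V\<^esub> : weight_space n V mu" if mu: "mu : weight_lattice n"
  unfolding weight_space_iff[OF V mu]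
  using linear_maps_zero[OF V' V' act_linear[OF V restrict_dual]] vs_zero_closed[OF V'] vs_smult_zero[OF V'] by simp
 then show ?thesis unfolding weights_def by blast
qed

text \<open>A torus functional psi acts on f v as psi after \<open>s\<close> acts on
  \<open>v\<close>, hence by the value of psi at the monomial with exponent
  \<open>sig mu\<close>.\<close>

lemma weights_transport:
 assumes tht: "torus_auto n q tht sig" and f: "semi_iso (kG n q) tht V W f"
  and V: "precomodule (kG n q) V" and W: "precomodule (kG n q) W" and mu: "mu : weights n V"
 shows "sig mu : weights n W"
proof -
 note V' = precomoduleD(1)[OF V] and W' = precomoduleD(1)[OF W]
 note fD = semi_isoD[OF f]
 have tht': "coalg_auto (kG n q) tht" using tht by (simp add: torus_auto_def)
 obtain s where s: "s : linear_maps (laurent n) (laurent n :: ('k, _) module)"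
  "!!mu. mu : weight_lattice n ==> s (single mu 1) = single (sig mu) 1"
  "!!c. c : carrier (kG n q) ==> torus_restrict n (tht c) = s (torus_restrict n c)"
  using tht unfolding torus_auto_def by blast
 obtain v where v: "v : weight_space n V mu" "v ~= \<zero>\<^bsub>V\<^esub>" and mul: "mu : weight_lattice n"
  using mu weights_iff[OF V] by auto
 have sigmu: "sig mu : weight_lattice n"
  using tht mul by (auto simp: torus_auto_def bij_betw_def)
 have vc: "v : carrier V"
  and va: "!!psi. psi : dual (laurent n) ==> act V (%c. psi (torus_restrict n c)) v = psi (single mu 1) *[V] v"
  using v(1) unfolding weight_space_iff[OF V mul] by auto
 have "f v : weight_space n W (sig mu)"
  unfolding weight_space_iff[OF W sigmu]
 proof (intro conjI ballI)
  show "f v : carrier W" by (rule linD(1)[OF fD(1) vc])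
  fix psi :: "((nat => int) \<Rightarrow>\<^sub>0 'k) => 'k" assume psi: "psi : dual (laurent n)"
  note psis = lin_comp[OF s(1) psi]
  have "act W (%c. psi (torus_restrict n c)) (f v) = f (act V (%c. psi (torus_restrict n (tht c))) v)"
   by (rule fD(3)[OF restrict_dual[OF psi] vc])
  also have "act V (%c. psi (torus_restrict n (tht c))) v = act V (%c. psi (s (torus_restrict n c))) v"
   by (rule act_cong[OF V lin_comp[OF coalg_autoD(1)[OF tht'] restrict_dual[OF psi]] restrict_dual[OF psis] vc])
    (simp add: s(3))
  also have "... = psi (single (sig mu) 1) *[V] v"
   using va[OF psis] s(2)[OF mul] by simp
  finally show "act W (%c. psi (torus_restrict n c)) (f v) = psi (single (sig mu) 1) *[W] f v"
   using linD(3)[OF fD(1) vc] by simp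
 qed
 moreover have "f v ~= \<zero>\<^bsub>W\<^esub>"
  using inj_onD[OF bij_betw_imp_inj_on[OF fD(2)] _ vc vs_zero_closed[OF V']] linear_maps_zero[OF V' W' fD(1)] v(2) by metis
 ultimately show ?thesis
  using weights_iff[OF W] sigmu by blast
qed

lemma torus_auto_inv:
 assumes tht: "torus_auto n q tht sig"
 shows "torus_auto n q (inv_into (carrier (kG n q)) tht) (inv_into (weight_lattice n) sig)"
proof -
 let ?L = "weight_lattice n" and ?i = "inv_into (carrier (kG n q)) tht" and ?j = "inv_into (weight_lattice n) sig"
 have tht': "coalg_auto (kG n q) tht" and sig: "bij_betw sig ?L ?L"
  and dom: "!!mu nu. mu : ?L ==> nu : ?L ==> dominated n (sig mu) (sig nu) \<longleftrightarrow> dominated n mu nu"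
  using tht by (auto simp: torus_auto_def)
 obtain s where s: "s : linear_maps (laurent n) (laurent n :: ('k, _) module)"
  "bij_betw s (carrier (laurent n)) (carrier (laurent n))"
  "!!mu. mu : ?L ==> s (single mu 1) = single (sig mu) 1"
  "!!c. c : carrier (kG n q) ==> torus_restrict n (tht c) = s (torus_restrict n c)"
  using tht unfolding torus_auto_def by blast
 have j: "?j mu : ?L" "sig (?j mu) = mu" if "mu : ?L" for mu
  using that sig by (auto simp: bij_betw_def inv_into_into f_inv_into_f)
 have i: "?i c : carrier (kG n q)" "tht (?i c) = c" if "c : carrier (kG n q)" for c
  using that coalg_autoD(2)[OF tht'] by (auto simp: bij_betw_def inv_into_into f_inv_into_f)
 let ?t = "inv_into (carrier (laurent n)) s"
 have t: "?t (s p) = p" if "p : carrier (laurent n)" for p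
  using that s(2) by (auto simp: bij_betw_def)
 show ?thesis
  unfolding torus_auto_def
 proof (intro conjI exI[of _ ?t] ballI)
  show "coalg_auto (kG n q) ?i" by (rule coalg_auto_inv[OF tht'])
  show "bij_betw ?j ?L ?L" by (rule bij_betw_inv_into[OF sig])
  show "dominated n (?j mu) (?j nu) \<longleftrightarrow> dominated n mu nu" if "mu : ?L" "nu : ?L" for mu nu
   using dom[of "?j mu" "?j nu"] j that by simp
  show "?t : linear_maps (laurent n) (laurent n)" by (rule linear_maps_inv_into[OF vspace_laurent s(1,2)])
  show "bij_betw ?t (carrier (laurent n)) (carrier (laurent n))" by (rule bij_betw_inv_into[OF s(2)])
  show "?t (single mu 1) = single (?j mu) 1" if "mu : ?L" for mu
   using s(3)[of "?j mu"] t[OF single_mem_laurent[OF j(1)[OF that], of 1]] j[OF that] by simp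
  show "torus_restrict n (?i c) = ?t (torus_restrict n c)" if "c : carrier (kG n q)" for c
   using s(4)[OF i(1)[OF that]] i[OF that] t[OF linD(1)[OF restrict_linear i(1)[OF that]]] by simp
 qed
qed

text \<open>The weight \<open>l\<close> is moved by \<open>f\<close>; that its image dominates is
  seen by moving an arbitrary weight of \<open>W\<close> back with the inverse isomorphism.\<close>

lemma is_L_transport:
 assumes tht: "torus_auto n q tht sig" and f: "semi_iso (kG n q) tht V W f"
  and V: "is_L n q l V" and W: "precomodule (kG n q) W"
 shows "is_L n q (sig l) W"
proof -
 have tht': "coalg_auto (kG n q) tht" and sig: "bij_betw sig (weight_lattice n) (weight_lattice n)"
  and dom: "!!mu nu. mu : weight_lattice n ==> nu : weight_lattice n ==> dominated n (sig mu) (sig nu) \<longleftrightarrow> dominated n mu nu"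
  using tht by (auto simp: torus_auto_def)
 have V': "precomodule (kG n q) V" "simple_comodule (kG n q) V" "l : weights n V" "!!mu. mu : weights n V ==> dominated n mu l"
  using V by (simp_all add: is_L_def simple_comodule_def comodule_iff)
 have wl: "mu : weight_lattice n" if "mu : weights n X'" for mu and X' :: "('k, (gen_word \<Rightarrow>\<^sub>0 'k) set, 'z) comod"
  using that by (simp add: weights_def)
 show ?thesis
  unfolding is_L_def
 proof (intro conjI ballI)
  show "simple_comodule (kG n q) W" by (rule simple_transport[OF tht' f V'(2) W])
  show "sig l : weights n W" by (rule weights_transport[OF tht f V'(1) W V'(3)])
  fix nu assume nu: "nu : weights n W"
  have nul: "nu : weight_lattice n" using nu by (simp add: weights_def)
  have ll: "l : weight_lattice n" using V'(3) by (simp add: weights_def)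
  let ?j = "inv_into (weight_lattice n) sig"
  have "?j nu : weights n V"
   by (rule weights_transport[OF torus_auto_inv[OF tht] semi_iso_inv[OF V'(1) tht' f] W V'(1) nu])
  then have "dominated n (?j nu) l" by (rule V'(4))
  moreover have "?j nu : weight_lattice n" "sig (?j nu) = nu"
   using nul sig by (auto simp: bij_betw_def inv_into_into f_inv_into_f)
  ultimately show "dominated n nu (sig l)"
   using dom[OF _ ll, of "?j nu"] by simp
 qed
qed

end

section \<open>Truncations\<close>

context coalgebra
begin

lemma regular_comod_same: "same_module (regular_comod C) C"
 by (simp add: regular_comod_def same_module_def module.extend_def comod.fields_def module.truncate_def)

lemma coact_regular [simp]: "coact (regular_comod C) = comult C"
 by (simp add: regular_comod_def module.extend_def comod.fields_def)

lemma carrier_regular [simp]: "carrier (regular_comod C) = carrier C"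
 by (rule same_moduleD(1)[OF regular_comod_same])

lemma linear_maps_regular: "linear_maps (regular_comod C) W = linear_maps C W"
 "linear_maps V (regular_comod C) = linear_maps V C"
 by (rule same_module_linear_maps, rule regular_comod_same same_module_refl, rule regular_comod_same same_module_refl)+

lemma precomodule_regular: "precomodule C (regular_comod C)"
 unfolding precomodule_def linear_maps_regular coact_regular same_module_formal_tensors(3)[OF regular_comod_same same_module_refl]
 using same_module_vspace[OF same_module_sym[OF regular_comod_same] C] comult_linear by simp

lemma dual_act_regular: "alp : dual C ==> ph : dual C ==> x : carrier C ==> alp (act (regular_comod C) ph x) = conv C alp ph x"
 using dual_act[OF precomodule_regular, of ph x alp] by (simp add: linear_maps_regular conv_def)

lemma act_regular_closed: "ph : dual C ==> x : carrier C ==> act (regular_comod C) ph x : carrier C"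
 using act_closed[OF precomodule_regular, of ph x] by simp

text \<open>Left translation: the left slice of the comultiplication, an endomorphism of the regular
  comodule.\<close>

definition lact :: "('c => 'k) => 'c => 'c" where
 "lact alp x = lslice C alp (comult C x)"

lemma comult_closed: "x : carrier C ==> comult C x : carrier (tensor C C)"
 by (rule linD(1)[OF comult_linear])

lemma lact_linear: "alp : dual C ==> lact alp : linear_maps C C"
 unfolding lact_def[abs_def] by (rule lin_comp[OF comult_linear lslice_linear[OF C C]])

lemma dual_lact: "alp : dual C ==> ph : dual C ==> x : carrier C ==> ph (lact alp x) = conv C alp ph x"
 unfolding lact_def conv_def by (rule dual_lslice[OF C C _ _ comult_closed])

text \<open>Coassociativity says that left and right translations commute. This will make
  truncations stable under left slices too.\<close>

lemma act_lact:
 assumes d: "alp : dual C" "ph : dual C" and x: "x : carrier C"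
 shows "act (regular_comod C) ph (lact alp x) = lact alp (act (regular_comod C) ph x)"
proof (rule dual_separates[OF C])
 note lc = linD(1)[OF lact_linear[OF d(1)]] and ac = act_regular_closed[OF d(2)]
 show "act (regular_comod C) ph (lact alp x) : carrier C" by (rule ac[OF lc[OF x]])
 show "lact alp (act (regular_comod C) ph x) : carrier C" by (rule lc[OF ac[OF x]])
 fix psi assume p: "psi : dual C"
 have "psi (act (regular_comod C) ph (lact alp x)) = conv C alp (conv C psi ph) x"
  using dual_act_regular[OF p d(2) lc[OF x]] dual_lact[OF d(1) conv_dual[OF p d(2)] x] by simp
 also have "... = conv C (conv C alp psi) ph x" by (rule conv_assoc[OF d(1) p d(2) x, symmetric])
 also have "... = psi (lact alp (act (regular_comod C) ph x))"
  using dual_lact[OF d(1) p ac[OF x]] dual_act_regular[OF conv_dual[OF d(1) p] d(2) x] by simp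
 finally show "psi (act (regular_comod C) ph (lact alp x)) = psi (lact alp (act (regular_comod C) ph x))" .
qed

lemma act_coalg_auto:
 assumes tht: "coalg_auto C tht" and ph: "ph : dual C" and x: "x : carrier C"
 shows "act (regular_comod C) ph (tht x) = tht (act (regular_comod C) (%c. ph (tht c)) x)"
proof (rule dual_separates[OF C])
 note tl = coalg_autoD(1)[OF tht]
 note tc = linD(1)[OF tl] and phtht = lin_comp[OF tl ph]
 show "act (regular_comod C) ph (tht x) : carrier C" by (rule act_regular_closed[OF ph tc[OF x]])
 show "tht (act (regular_comod C) (%c. ph (tht c)) x) : carrier C" by (rule tc[OF act_regular_closed[OF phtht x]])
 fix psi assume p: "psi : dual C"
 show "psi (act (regular_comod C) ph (tht x)) = psi (tht (act (regular_comod C) (%c. ph (tht c)) x))"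
  using dual_act_regular[OF p ph tc[OF x]] coalg_autoD(4)[OF tht p ph x]
   dual_act_regular[OF lin_comp[OF tl p] phtht x] by simp
qed

lemma subcomodule_preimage:
 assumes tht: "coalg_auto C tht" and V: "precomodule C V" and W: "precomodule C W"
  and g: "g : linear_maps V W" and equi: "!!ph x. ph : dual C ==> x : carrier V ==> act W ph (g x) = g (act V (%c. ph (tht c)) x)"
  and N: "subcomodule C V N" and Z: "subcomodule C W Z"
 shows "subcomodule C V {x : N. g x : Z}"
 unfolding subcomodule_iff[OF V]
proof (intro conjI ballI)
 let ?i = "inv_into (carrier C) tht"
 note il = linear_maps_inv_into[OF C coalg_autoD(1,2)[OF tht]]
 have i': "?i (tht c) = c" if "c : carrier C" for c
  using that coalg_autoD(2)[OF tht] by (auto simp: bij_betw_def)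
 note Ns = subcomoduleD[OF V N] and Zs = subcomoduleD[OF W Z]
 have eq: "{x : N. g x : Z} = N \<inter> {x : carrier V. g x : Z}"
  using subspD(1)[OF Ns(1)] by auto
 show "subspace_of V {x : N. g x : Z}"
  unfolding eq by (rule subspace_of_inter[OF Ns(1) subspace_of_ker[OF precomoduleD(1)[OF V] precomoduleD(1)[OF W] g Zs(1)]])
 fix ph v assume ph: "ph : dual C" and "v : {x : N. g x : Z}"
 then have v: "v : N" "g v : Z" by simp_all
 note vc = subspD(1)[OF Ns(1) v(1)]
 note phi = lin_comp[OF il ph]
 have "act V ph v = act V (%c. ph (?i (tht c))) v"
  by (rule act_cong[OF V ph lin_comp[OF coalg_autoD(1)[OF tht] phi] vc]) (simp add: i')
 then have "g (act V ph v) = act W (%c. ph (?i c)) (g v)"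
  using equi[OF phi vc] by simp
 then show "act V ph v : {x : N. g x : Z}"
  using Zs(2)[OF phi v(2)] Ns(2)[OF ph v(1)] by simp
qed

lemma subcomodule_inter:
 assumes V: "precomodule C V" and N: "subcomodule C V N" and M: "subcomodule C V M"
 shows "subcomodule C V (N \<inter> M)"
 using N M unfolding subcomodule_iff[OF V] using subspace_of_inter by blast

lemma subcomodule_sum:
 assumes V: "precomodule C V" and N: "subcomodule C V N" and M: "subcomodule C V M"
 shows "subcomodule C V (subspace_sum V N M)"
 unfolding subcomodule_iff[OF V]
proof (intro conjI ballI)
 note Ns = subcomoduleD[OF V N] and Ms = subcomoduleD[OF V M]
 show "subspace_of V (subspace_sum V N M)" by (rule subspace_of_sum(1)[OF precomoduleD(1)[OF V] Ns(1) Ms(1)])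
 fix ph x assume ph: "ph : dual C" and "x : subspace_sum V N M"
 then obtain y z where x: "x = y +[V] z" "y : N" "z : M" by (auto simp: subspace_sum_def)
 have "act V ph x = act V ph y +[V] act V ph z"
  unfolding x(1) by (rule linD(2)[OF act_linear[OF V ph] subspD(1)[OF Ns(1) x(2)] subspD(1)[OF Ms(1) x(3)]])
 then show "act V ph x : subspace_sum V N M"
  unfolding subspace_sum_def using Ns(2)[OF ph x(2)] Ms(2)[OF ph x(3)] by blast
qed

lemma subcomodule_image:
 assumes tht: "tht : linear_maps C C" and V: "precomodule C V" and W: "precomodule C W"
  and g: "g : linear_maps V W" and equi: "!!ph x. ph : dual C ==> x : carrier V ==> act W ph (g x) = g (act V (%c. ph (tht c)) x)"
  and N: "subcomodule C V N"
 shows "subcomodule C W (g ` N)"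
 unfolding subcomodule_iff[OF W]
proof (intro conjI ballI)
 note Ns = subcomoduleD[OF V N]
 show "subspace_of W (g ` N)" by (rule subspace_of_image[OF precomoduleD(1)[OF V] precomoduleD(1)[OF W] g Ns(1)])
 fix ph w assume ph: "ph : dual C" and "w : g ` N"
 then obtain x where x: "w = g x" "x : N" by auto
 show "act W ph w : g ` N"
  unfolding x(1) equi[OF ph subspD(1)[OF Ns(1) x(2)]] by (rule imageI[OF Ns(2)[OF lin_comp[OF tht ph] x(2)]])
qed

lemma simple_subquot_nonzero:
 assumes V: "precomodule C V" "subcomodule C V Z" "subcomodule C V Y" "Y \<subseteq> Z"
  and s: "simple_comodule C (subquot C V Z Y)"
 shows "\<exists>z\<in>Z. z \<notin> Y"
proof (rule ccontr)
 assume "\<not> (\<exists>z\<in>Z. z \<notin> Y)"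
 then have z: "(Y +>\<^bsub>sub_comod C V Z\<^esub> z) = \<zero>\<^bsub>subquot C V Z Y\<^esub>" if "z : Z" for z
  using subquot_zero_iff[OF V that] that by blast
 have "\<zero>\<^bsub>V\<^esub> : Z" by (rule subspD(2)[OF subcomoduleD(1)[OF V(1,2)]])
 then have "carrier (subquot C V Z Y) = {\<zero>\<^bsub>subquot C V Z Y\<^esub>}"
  unfolding carrier_subquot[OF V] using z by (auto simp: image_iff)
 then show False using s by (simp add: simple_comodule_def)
qed

text \<open>The image of \<open>M\<close> in the simple quotient Z/Y is a nonzero subcomodule, hence
  everything.\<close>

lemma simple_subquot_onto:
 assumes V: "precomodule C V" "subcomodule C V Z" "subcomodule C V Y" "Y \<subseteq> Z"
  and s: "simple_comodule C (subquot C V Z Y)"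
  and M: "subcomodule C V M" "M \<subseteq> Z" and x: "x : M" "x \<notin> Y" and z: "z : Z"
 shows "\<exists>x\<in>M. z +[V] (-1) *[V] x : Y"
proof -
 let ?c = "%x. Y +>\<^bsub>sub_comod C V Z\<^esub> x" and ?Q = "subquot C V Z Y"
 note Q = precomodule_subquot[OF V] and Ms = subcomoduleD[OF V(1) M(1)]
 have MZ: "m : Z" if "m : M" for m using that M(2) by auto
 have "subcomodule C ?Q (?c ` M)"
  unfolding subcomodule_iff[OF Q]
 proof (intro conjI ballI)
  show "subspace_of ?Q (?c ` M)"
   unfolding subspace_of_def
  proof (intro conjI ballI allI)
   show "?c ` M \<subseteq> carrier ?Q" unfolding carrier_subquot[OF V] using M(2) by auto
   show "\<zero>\<^bsub>?Q\<^esub> : ?c ` M"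
    using subquot_zero_iff[OF V MZ[OF subspD(2)[OF Ms(1)]]] subspD(2)[OF subcomoduleD(1)[OF V(1,3)]]
     imageI[OF subspD(2)[OF Ms(1)], of ?c] by simp
   fix A B a assume "A : ?c ` M"
   then obtain y where y: "A = ?c y" "y : M" by (elim imageE)
   show "a *[?Q] A : ?c ` M"
    unfolding y(1) subquot_smult[OF V MZ[OF y(2)]] by (rule imageI[OF subspD(4)[OF Ms(1) y(2)]])
   assume "B : ?c ` M"
   then obtain y' where y': "B = ?c y'" "y' : M" by (elim imageE)
   show "A +[?Q] B : ?c ` M"
    unfolding y(1) y'(1) subquot_add[OF V MZ[OF y(2)] MZ[OF y'(2)]] by (rule imageI[OF subspD(3)[OF Ms(1) y(2) y'(2)]])
  qed
  fix ph A assume ph: "ph : dual C" and "A : ?c ` M"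
  then obtain y where y: "A = ?c y" "y : M" by (elim imageE)
  show "act ?Q ph A : ?c ` M"
   unfolding y(1) act_subquot[OF V MZ[OF y(2)] ph] by (rule imageI[OF Ms(2)[OF ph y(2)]])
 qed
 then have "?c ` M = {\<zero>\<^bsub>?Q\<^esub>} \<or> ?c ` M = carrier ?Q" using s unfolding simple_comodule_def by blast
 moreover have "?c x ~= \<zero>\<^bsub>?Q\<^esub>" using subquot_zero_iff[OF V MZ[OF x(1)]] x(2) by simp
 ultimately have "?c ` M = carrier ?Q" using x(1) by blast
 then have "?c z : ?c ` M" unfolding carrier_subquot[OF V] using z by simp
 then obtain m where m: "?c z = ?c m" "m : M" by (elim imageE)
 then have "z +[V] (-1) *[V] m : Y" using subquot_eq_iff[OF V z MZ[OF m(2)]] by simp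
 then show ?thesis using m(2) by (intro bexI[of _ m])
qed

definition subcoalgebra :: "'c set => bool" where
 "subcoalgebra B \<longleftrightarrow> subspace_of C B &
   (\<forall>x\<in>B. comult C x : tensor_map C C (%b. b) (%b. b) ` carrier (tensor (C\<lparr>carrier := B\<rparr>) (C\<lparr>carrier := B\<rparr>)))"

lemma sub_coalg_same: "same_module (sub_coalg C B) (C\<lparr>carrier := B\<rparr>)"
 by (simp add: sub_coalg_def same_module_def)

lemma comult_sub_coalg:
 assumes B: "subcoalgebra B" and x: "x : B"
 shows "comult (sub_coalg C B) x : carrier (tensor (C\<lparr>carrier := B\<rparr>) (C\<lparr>carrier := B\<rparr>))"
  and "ph : dual C ==> psi : dual C ==> pairing ph psi (comult (sub_coalg C B) x) = conv C ph psi x"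
proof -
 have Bs: "subspace_of C B" using B by (simp add: subcoalgebra_def)
 have *: "comult C x : tensor_map C C (%b. b) (%b. b) ` carrier (tensor (C\<lparr>carrier := B\<rparr>) (C\<lparr>carrier := B\<rparr>))"
  using B x by (simp add: subcoalgebra_def)
 have 1: "comult (sub_coalg C B) x : carrier (tensor (C\<lparr>carrier := B\<rparr>) (C\<lparr>carrier := B\<rparr>))"
  and 2: "tensor_map C C (%b. b) (%b. b) (comult (sub_coalg C B) x) = comult C x"
  using inv_into_into[OF *] f_inv_into_f[OF *] by (simp_all add: sub_coalg_def)
 show "comult (sub_coalg C B) x : carrier (tensor (C\<lparr>carrier := B\<rparr>) (C\<lparr>carrier := B\<rparr>))" by (rule 1)
 show "pairing ph psi (comult (sub_coalg C B) x) = conv C ph psi x" if d: "ph : dual C" "psi : dual C"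
  using tensor_map_incl_pairing[OF C C Bs Bs 1 d] unfolding 2 conv_def by simp
qed

text \<open>The comultiplications of the subcoalgebras are chosen preimages; both sides are
  therefore compared through ambient product functionals, where \<open>coalg_auto\<close>
  applies.\<close>

lemma sub_coalg_isomorphic:
 assumes tht: "coalg_auto C tht" and B: "subcoalgebra B" and B': "subcoalgebra B'" and eq: "tht ` B = B'"
 shows "coalgebra_isomorphic (sub_coalg C B) (sub_coalg C B')"
proof -
 let ?B = "C\<lparr>carrier := B\<rparr>" and ?B' = "C\<lparr>carrier := B'\<rparr>"
 have Bs: "subspace_of C B" and Bs': "subspace_of C B'" using B B' by (simp_all add: subcoalgebra_def)
 note vB = vspace_sub[OF C Bs] and vB' = vspace_sub[OF C Bs']
 note tl = coalg_autoD(1)[OF tht]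
 have BC: "x : carrier C" if "x : B" for x using subspD(1)[OF Bs that] .
 have t: "tht : linear_maps ?B ?B'"
  using linD[OF tl] BC eq by (intro linear_mapsI) auto
 note m = tensor_map_linear[OF vB vB vB' vB' t t]
 note same = same_module_tensor_map[OF sub_coalg_same sub_coalg_same, of B' B']
 show ?thesis
  unfolding coalgebra_isomorphic_def
 proof (intro exI[of _ tht] conjI ballI)
  show "tht : linear_maps (sub_coalg C B) (sub_coalg C B')"
   using t same_module_linear_maps[OF sub_coalg_same sub_coalg_same] by blast
  show "bij_betw tht (carrier (sub_coalg C B)) (carrier (sub_coalg C B'))"
   using inj_on_subset[OF bij_betw_imp_inj_on[OF coalg_autoD(2)[OF tht]], of B] BC eq
   unfolding same_moduleD(1)[OF sub_coalg_same] by (auto simp: bij_betw_def)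
  fix x assume "x : carrier (sub_coalg C B)"
  then have x: "x : B" unfolding same_moduleD(1)[OF sub_coalg_same] by simp
  then have tx: "tht x : B'" using eq by auto
  show "counit (sub_coalg C B') (tht x) = counit (sub_coalg C B) x"
   using coalg_autoD(3)[OF tht BC[OF x]] by (simp add: sub_coalg_def)
  show "tensor_map (sub_coalg C B') (sub_coalg C B') tht tht (comult (sub_coalg C B) x) = comult (sub_coalg C B') (tht x)"
   unfolding same
  proof (rule tensor_sub_eqI[OF C C Bs' Bs' linD(1)[OF m comult_sub_coalg(1)[OF B x]] comult_sub_coalg(1)[OF B' tx]])
   fix ph psi assume d: "ph : dual C" "psi : dual C"
   have "pairing ph psi (tensor_map ?B' ?B' tht tht (comult (sub_coalg C B) x)) =
    pairing (%c. ph (tht c)) (%c. psi (tht c)) (comult (sub_coalg C B) x)"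
    by (rule pairing_tensor_map[OF vB vB vB' vB' t t dual_sub[OF Bs' d(1)] dual_sub[OF Bs' d(2)] comult_sub_coalg(1)[OF B x]])
   also have "... = pairing ph psi (comult (sub_coalg C B') (tht x))"
    using comult_sub_coalg(2)[OF B x lin_comp[OF tl d(1)] lin_comp[OF tl d(2)]]
     comult_sub_coalg(2)[OF B' tx d] coalg_autoD(4)[OF tht d BC[OF x]] by simp
   finally show "pairing ph psi (tensor_map ?B' ?B' tht tht (comult (sub_coalg C B) x)) = pairing ph psi (comult (sub_coalg C B') (tht x))" .
  qed
 qed
qed

end

text \<open>The isomorphism is the transpose of the inverse coalgebra map.\<close>

lemma dual_algebra_isomorphic:
 fixes C :: "('k::field, 'c) coalg" and D :: "('k, 'd) coalg"
 assumes C: "vspace C" and D: "vspace D"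
  and comult: "!!x. x : carrier C ==> comult C x : carrier (tensor C C)"
  and iso: "coalgebra_isomorphic C D"
 shows "algebra_isomorphic (dual_algebra C) (dual_algebra D)"
proof -
 obtain f where f: "f : linear_maps C D" "bij_betw f (carrier C) (carrier D)"
  and fcomult: "!!x. x : carrier C ==> tensor_map D D f f (comult C x) = comult D (f x)"
  and fcounit: "!!x. x : carrier C ==> counit D (f x) = counit C x"
  using iso unfolding coalgebra_isomorphic_def by blast
 let ?i = "inv_into (carrier C) f"
 note il = linear_maps_inv_into[OF C f]
 have i: "?i y : carrier C" "f (?i y) = y" if "y : carrier D" for y
  using that f(2) by (auto simp: bij_betw_def inv_into_into f_inv_into_f)
 have i': "?i (f x) = x" if "x : carrier C" for x
  using that f(2) by (auto simp: bij_betw_def)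
 have fc: "f x : carrier D" if "x : carrier C" for x by (rule linD(1)[OF f(1) that])
 \<comment> \<open>Restricted to the carrier, since elements of the dual algebra are
   \<open>undefined\<close> outside.\<close>
 define F where "F g = (\<lambda>y\<in>carrier D. g (?i y))" for g :: "'c => 'k"
 define G where "G h = (\<lambda>x\<in>carrier C. h (f x))" for h :: "'d => 'k"
 have Fd: "F g : dual D" if "g : dual C" for g
  using linD[OF il] linD[OF that] vs_closed[OF D]
  by (intro dualI) (simp_all add: F_def)
 have Gd: "G h : dual C" if "h : dual D" for h
  using linD[OF f(1)] linD[OF that] vs_closed[OF C]
  by (intro dualI) (simp_all add: G_def)
 have Ff: "F g (f x) = g x" if "x : carrier C" for g x using that fc i' by (simp add: F_def)
 have FD: "F g : carrier (dual_algebra D)" if "g : carrier (dual_algebra C)" for g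
  using that Fd by (simp add: dual_algebra_def) (simp add: F_def)
 have GC: "G h : carrier (dual_algebra C)" if "h : carrier (dual_algebra D)" for h
  using that Gd by (simp add: dual_algebra_def) (simp add: G_def)
 have eqD: "h = h'" if "h : extensional (carrier D)" "h' : extensional (carrier D)"
  "!!x. x : carrier C ==> h (f x) = h' (f x)" for h h' :: "'d => 'k"
  using that(3)[OF i(1)] i(2) by (intro extensionalityI[OF that(1,2)]) metis
 have FG: "F (G h) = h" if "h : carrier (dual_algebra D)" for h
  using that by (intro eqD) (simp_all add: dual_algebra_def F_def G_def i' fc)
 have GF: "G (F g) = g" if "g : carrier (dual_algebra C)" for g
  using that by (intro extensionalityI[of _ "carrier C"]) (simp_all add: dual_algebra_def F_def G_def i' fc)
 have mult: "F (g \<otimes>\<^bsub>dual_algebra C\<^esub> h) = F g \<otimes>\<^bsub>dual_algebra D\<^esub> F h"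
  if "g : carrier (dual_algebra C)" "h : carrier (dual_algebra C)" for g h
 proof (rule eqD)
  fix x assume x: "x : carrier C"
  have gh: "g : dual C" "h : dual C" using that by (simp_all add: dual_algebra_def)
  have "(F g \<otimes>\<^bsub>dual_algebra D\<^esub> F h) (f x) = pairing (F g) (F h) (tensor_map D D f f (comult C x))"
   using fc[OF x] fcomult[OF x] by (simp add: dual_algebra_def pairing_def)
  also have "... = pairing (%x. F g (f x)) (%x. F h (f x)) (comult C x)"
   by (rule pairing_tensor_map[OF C C D D f(1) f(1) Fd[OF gh(1)] Fd[OF gh(2)] comult[OF x]])
  also have "... = pairing g h (comult C x)"
   by (rule tensor_linear_eqI[OF C C vspace_scalars pairing_linear[OF C C lin_comp[OF f(1) Fd[OF gh(1)]]
     lin_comp[OF f(1) Fd[OF gh(2)]]] pairing_linear[OF C C gh] _ comult[OF x]])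
    (simp add: pairing_tens[OF C C lin_comp[OF f(1) Fd[OF gh(1)]]
     lin_comp[OF f(1) Fd[OF gh(2)]]] pairing_tens[OF C C gh] Ff)
  also have "... = F (g \<otimes>\<^bsub>dual_algebra C\<^esub> h) (f x)"
   using x by (simp add: Ff dual_algebra_def pairing_def)
  finally show "F (g \<otimes>\<^bsub>dual_algebra C\<^esub> h) (f x) = (F g \<otimes>\<^bsub>dual_algebra D\<^esub> F h) (f x)" by (rule sym)
 qed (simp_all add: F_def dual_algebra_def)
 have "F : ring_hom (dual_algebra C) (dual_algebra D)"
 proof (rule ring_hom_memI)
  show "F \<one>\<^bsub>dual_algebra C\<^esub> = \<one>\<^bsub>dual_algebra D\<^esub>"
   by (rule eqD) (simp_all add: dual_algebra_def F_def fc i' fcounit)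
  show "F (g +[dual_algebra C] h) = F g +[dual_algebra D] F h" for g h
   by (rule eqD) (simp_all add: dual_algebra_def F_def fc i')
 qed (rule FD mult; assumption)+
 moreover have "bij_betw F (carrier (dual_algebra C)) (carrier (dual_algebra D))"
  by (rule bij_betw_byWitness[of _ G]) (use FG GF FD GC in auto)
 moreover have "F : linear_maps (dual_algebra C) (dual_algebra D)"
 proof (rule linear_mapsI)
  show "F (g +[dual_algebra C] h) = F g +[dual_algebra D] F h" for g h
   by (rule eqD) (simp_all add: dual_algebra_def F_def fc i')
  show "F (a *[dual_algebra C] h) = a *[dual_algebra D] F h" for a h
   by (rule eqD) (simp_all add: dual_algebra_def F_def fc i')
 qed (rule FD)
 ultimately show ?thesis
  unfolding algebra_isomorphic_def ring_iso_def by blast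
qed

section \<open>Composition factors and the largest submodule belonging to a set of weights\<close>

context quantum_gl
begin

abbreviation (input) "G \<equiv> kG n q"

text \<open>Subquotients are formed inside \<open>V\<close> and not inside a
  \<open>sub_comod\<close>, so that different submodules of \<open>V\<close> can be
  compared.\<close>

definition belongs_sub :: "(nat => int) set => ('k, (gen_word \<Rightarrow>\<^sub>0 'k) set, 'v) comod => 'v set => bool" where
 "belongs_sub P V N \<longleftrightarrow> (\<forall>Z Y. subcomodule G V Z & subcomodule G V Y & Y \<subseteq> Z & Z \<subseteq> N &
   simple_comodule G (subquot G V Z Y) --> (\<exists>l\<in>P. is_L n q l (subquot G V Z Y)))"

lemma belongs_subD:
 assumes "belongs_sub P V N" "subcomodule G V Z" "subcomodule G V Y" "Y \<subseteq> Z" "Z \<subseteq> N"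
  "simple_comodule G (subquot G V Z Y)"
 shows "\<exists>l\<in>P. is_L n q l (subquot G V Z Y)"
 using assms unfolding belongs_sub_def by blast

lemma torus_auto_id: "torus_auto n q (%c. c) (%mu. mu)"
 unfolding torus_auto_def using coalg_auto_id
 by (intro conjI exI[of _ "%p. p"]) (simp_all add: linear_maps_id bij_betw_def)

lemma subquot_compare:
 fixes V :: "('k, (gen_word \<Rightarrow>\<^sub>0 'k) set, 'v) comod" and V' :: "('k, (gen_word \<Rightarrow>\<^sub>0 'k) set, 'w) comod"
 assumes tht: "torus_auto n q tht sig"
  and V: "precomodule G V" "subcomodule G V Z" "subcomodule G V Y" "Y \<subseteq> Z"
  and V': "precomodule G V'" "subcomodule G V' Z'" "subcomodule G V' Y'" "Y' \<subseteq> Z'"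
  and g: "g : linear_maps (V'\<lparr>carrier := Z'\<rparr>) V" "!!x. x : Z' ==> g x : Z"
  and Y': "!!x. x : Z' ==> g x : Y \<longleftrightarrow> x : Y'"
  and onto: "!!z. z : Z ==> \<exists>x\<in>Z'. z +[V] (-1) *[V] g x : Y"
  and equi: "!!ph x. ph : dual G ==> x : Z' ==> act V ph (g x) = g (act V' (%c. ph (tht c)) x)"
 shows "simple_comodule G (subquot G V Z Y) ==> simple_comodule G (subquot G V' Z' Y')"
  and "is_L n q l (subquot G V' Z' Y') ==> is_L n q (sig l) (subquot G V Z Y)"
proof -
 have tht': "coalg_auto G tht" using tht by (simp add: torus_auto_def)
 obtain f where f: "semi_iso G tht (subquot G V' Z' Y') (subquot G V Z Y) f"
  using semi_iso_subquot[OF V V' g Y' onto coalg_autoD(1)[OF tht'] equi] by blast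
 note Q = precomodule_subquot[OF V] and Q' = precomodule_subquot[OF V']
 show "simple_comodule G (subquot G V Z Y) ==> simple_comodule G (subquot G V' Z' Y')"
  by (rule simple_transport[OF coalg_auto_inv[OF tht'] semi_iso_inv[OF Q' tht' f] _ Q'])
 show "is_L n q l (subquot G V' Z' Y') ==> is_L n q (sig l) (subquot G V Z Y)"
  by (rule is_L_transport[OF tht f _ Q])
qed

lemma subquot_compare_incl:
 assumes V: "precomodule G V" "subcomodule G V Z" "subcomodule G V Y" "Y \<subseteq> Z"
  and V': "subcomodule G V Z'" "subcomodule G V Y'" "Y' \<subseteq> Z'"
  and Z': "Z' \<subseteq> Z" and Y': "!!x. x : Z' ==> x : Y \<longleftrightarrow> x : Y'"
  and onto: "!!z. z : Z ==> \<exists>x\<in>Z'. z +[V] (-1) *[V] x : Y"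
 shows "simple_comodule G (subquot G V Z Y) ==> simple_comodule G (subquot G V Z' Y')"
  and "is_L n q l (subquot G V Z' Y') ==> is_L n q l (subquot G V Z Y)"
proof -
 note i = incl_linear[OF subcomoduleD(1)[OF V(1) V'(1)]]
 show "simple_comodule G (subquot G V Z Y) ==> simple_comodule G (subquot G V Z' Y')"
  by (rule subquot_compare(1)[OF torus_auto_id V V(1) V' i _ Y' onto]) (use Z' in auto)
 show "is_L n q l (subquot G V Z' Y') ==> is_L n q l (subquot G V Z Y)"
  by (rule subquot_compare(2)[OF torus_auto_id V V(1) V' i _ Y' onto]) (use Z' in auto)
qed

text \<open>The subquotients Z/Y formed in \<open>V\<close> and in the subcomodule may be different
  records but carry the same action; the identity map compares them in both directions.\<close>

lemma belongs_to_sub_iff: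
 assumes V: "precomodule G V" and N: "subcomodule G V N"
 shows "belongs_to n q P (sub_comod G V N) \<longleftrightarrow> belongs_sub P V N"
proof -
 let ?S = "sub_comod G V N"
 note S = precomodule_sub[OF V N] and Ns = subcomoduleD(1)[OF V N]
 have cmp: "(simple_comodule G (subquot G ?S Z Y) \<longleftrightarrow> simple_comodule G (subquot G V Z Y)) &
  (is_L n q l (subquot G ?S Z Y) \<longleftrightarrow> is_L n q l (subquot G V Z Y))"
  if Z: "subcomodule G V Z" and Y: "subcomodule G V Y" and YZ: "Y \<subseteq> Z" and ZN: "Z \<subseteq> N" for Z Y l
 proof -
  have ZS: "subcomodule G ?S Z" and YS: "subcomodule G ?S Y"
   using subcomodule_sub_iff[OF V N] Z Y YZ ZN by auto
  note Zs = subcomoduleD(1)[OF V Z]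
  have i1: "(%x. x) : linear_maps (?S\<lparr>carrier := Z\<rparr>) V"
   using subspD(1)[OF Zs] by (intro linear_mapsI) simp_all
  have i2: "(%x. x) : linear_maps (V\<lparr>carrier := Z\<rparr>) ?S"
   using ZN by (intro linear_mapsI) auto
  have e1: "\<exists>x\<in>Z. z +[V] (-1) *[V] x : Y" if "z : Z" for z
   using vs_add_minus[OF precomoduleD(1)[OF V] subspD(1)[OF Zs that]] subspD(2)[OF subcomoduleD(1)[OF V Y]] that
   by (intro bexI[of _ z]) simp_all
  have e2: "\<exists>x\<in>Z. z +[?S] (-1) *[?S] x : Y" if "z : Z" for z
   using e1[OF that] by simp
  have a: "act ?S ph x = act V ph x" if "ph : dual G" "x : Z" for ph x
   by (rule act_sub[OF V N _ that(1)]) (use that ZN in auto)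
  note c1 = subquot_compare[OF torus_auto_id V Z Y YZ S ZS YS YZ i1 _ refl e1]
   and c2 = subquot_compare[OF torus_auto_id S ZS YS YZ V Z Y YZ i2 _ refl e2]
  have "simple_comodule G (subquot G V Z Y) ==> simple_comodule G (subquot G ?S Z Y)"
   by (rule c1(1)) (auto simp: a)
  moreover have "simple_comodule G (subquot G ?S Z Y) ==> simple_comodule G (subquot G V Z Y)"
   by (rule c2(1)) (auto simp: a)
  moreover have "is_L n q l (subquot G ?S Z Y) ==> is_L n q l (subquot G V Z Y)"
   by (rule c1(2)) (auto simp: a)
  moreover have "is_L n q l (subquot G V Z Y) ==> is_L n q l (subquot G ?S Z Y)"
   by (rule c2(2)) (auto simp: a)
  ultimately show ?thesis by blast
 qed
 have sc: "subcomodule G ?S X' \<longleftrightarrow> subcomodule G V X' & X' \<subseteq> N" for X'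
  by (rule subcomodule_sub_iff[OF V N])
 show ?thesis
 proof
  assume *: "belongs_to n q P ?S"
  show "belongs_sub P V N"
   unfolding belongs_sub_def
  proof (intro allI impI, elim conjE)
   fix Z Y assume Z: "subcomodule G V Z" and Y: "subcomodule G V Y" and YZ: "Y \<subseteq> Z" and ZN: "Z \<subseteq> N"
    and s: "simple_comodule G (subquot G V Z Y)"
   note cm = cmp[OF Z Y YZ ZN]
   have "subcomodule G ?S Z" "subcomodule G ?S Y" unfolding sc using Z Y YZ ZN by simp_all
   moreover have "simple_comodule G (subquot G ?S Z Y)" using cm s by simp
   ultimately have "\<exists>l\<in>P. is_L n q l (subquot G ?S Z Y)"
    using *[unfolded belongs_to_def subquot_def[symmetric], rule_format, of Z Y] YZ by simp
   then obtain l where "l : P" "is_L n q l (subquot G ?S Z Y)" by (rule bexE)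
   then show "\<exists>l\<in>P. is_L n q l (subquot G V Z Y)" using cm by (intro bexI[of _ l]) simp_all
  qed
 next
  assume *: "belongs_sub P V N"
  show "belongs_to n q P ?S"
   unfolding belongs_to_def subquot_def[symmetric] sc
  proof (intro allI impI, elim conjE)
   fix Z Y assume Z: "subcomodule G V Z" and Y: "subcomodule G V Y" and YZ: "Y \<subseteq> Z" and ZN: "Z \<subseteq> N"
    and s: "simple_comodule G (subquot G ?S Z Y)"
   note cm = cmp[OF Z Y YZ ZN]
   have sZ: "simple_comodule G (subquot G V Z Y)" using cm s by simp
   obtain l where "l : P" "is_L n q l (subquot G V Z Y)"
    using belongs_subD[OF * Z Y YZ ZN sZ] by (rule bexE)
   then show "\<exists>l\<in>P. is_L n q l (subquot G ?S Z Y)" using cm by (intro bexI[of _ l]) simp_all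
  qed
 qed
qed

text \<open>A subquotient Z/Y of the image is a twisted copy of the subquotient of \<open>N\<close>
  formed by the preimages of \<open>Z\<close> and \<open>Y\<close>. The map \<open>g\<close> may
  have a kernel, as left translations do.\<close>

lemma belongs_image:
 assumes tht: "torus_auto n q tht sig" and V: "precomodule G V" and W: "precomodule G W"
  and g: "g : linear_maps V W" and equi: "!!ph x. ph : dual G ==> x : carrier V ==> act W ph (g x) = g (act V (%c. ph (tht c)) x)"
  and N: "subcomodule G V N" "belongs_sub P V N"
 shows "belongs_sub (sig ` P) W (g ` N)"
 unfolding belongs_sub_def
proof (intro allI impI, elim conjE)
 fix Z Y assume Z: "subcomodule G W Z" and Y: "subcomodule G W Y" and YZ: "Y \<subseteq> Z" and ZN: "Z \<subseteq> g ` N"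
  and s: "simple_comodule G (subquot G W Z Y)"
 have tht': "coalg_auto G tht" using tht by (simp add: torus_auto_def)
 let ?Z = "{x : N. g x : Z}" and ?Y = "{x : N. g x : Y}"
 have Z': "subcomodule G V ?Z" and Y': "subcomodule G V ?Y"
  using subcomodule_preimage[OF tht' V W g equi N(1)] Z Y by blast+
 have YZ': "?Y \<subseteq> ?Z" using YZ by auto
 note Zs = subcomoduleD(1)[OF W Z]
 have N_sub: "x : carrier V" if "x : N" for x using subspD(1)[OF subcomoduleD(1)[OF V N(1)] that] .
 have gl: "g : linear_maps (V\<lparr>carrier := ?Z\<rparr>) W"
  by (rule linear_maps_sub[OF g]) (use N_sub in auto)
 have onto: "\<exists>x\<in>?Z. z +[W] (-1) *[W] g x : Y" if z: "z : Z" for z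
 proof -
  obtain x where x: "x : N" "z = g x" using ZN z by auto
  then show ?thesis
   using vs_add_minus[OF precomoduleD(1)[OF W] subspD(1)[OF Zs z]] subspD(2)[OF subcomoduleD(1)[OF W Y]] z
   by (intro bexI[of _ x]) simp_all
 qed
 note c = subquot_compare[OF tht W Z Y YZ V Z' Y' YZ' gl _ _ onto equi]
 have sZ: "simple_comodule G (subquot G V ?Z ?Y)"
  by (rule c(1)[OF _ _ _ _ _ s]) (use N_sub in auto)
 have ZsubN: "?Z \<subseteq> N" by auto
 obtain l where l: "l : P" "is_L n q l (subquot G V ?Z ?Y)"
  using belongs_subD[OF N(2) Z' Y' YZ' ZsubN sZ] by (rule bexE)
 have "is_L n q (sig l) (subquot G W Z Y)"
  by (rule c(2)[OF _ _ _ _ _ l(2)]) (use N_sub in auto)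
 then show "\<exists>l\<in>sig ` P. is_L n q l (subquot G W Z Y)" using l(1) by blast
qed

text \<open>By simplicity Z \<inter> N covers Z/Y, so Z/Y is isomorphic to a subquotient of
  \<open>N\<close>.\<close>

lemma belongs_sub_if_meets:
 assumes V: "precomodule G V" and ZY: "subcomodule G V Z" "subcomodule G V Y" "Y \<subseteq> Z"
  and s: "simple_comodule G (subquot G V Z Y)" and N: "subcomodule G V N" "belongs_sub P V N"
  and z: "z : Z" "z : N" "z \<notin> Y"
 shows "\<exists>l\<in>P. is_L n q l (subquot G V Z Y)"
proof -
 have Z': "subcomodule G V (Z \<inter> N)" and Y': "subcomodule G V (Y \<inter> N)"
  using subcomodule_inter[OF V _ N(1)] ZY by blast+
 have YZ': "Y \<inter> N \<subseteq> Z \<inter> N" using ZY(3) by auto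
 have onto: "\<exists>x\<in>Z \<inter> N. w +[V] (-1) *[V] x : Y" if "w : Z" for w
  by (rule simple_subquot_onto[OF V ZY s Z' _ _ z(3) that]) (use z in auto)
 note c = subquot_compare_incl[OF V ZY Z' Y' YZ' _ _ onto]
 have sZ: "simple_comodule G (subquot G V (Z \<inter> N) (Y \<inter> N))"
  by (rule c(1)[OF _ _ _ s]) auto
 obtain l where l: "l : P" "is_L n q l (subquot G V (Z \<inter> N) (Y \<inter> N))"
  using belongs_subD[OF N(2) Z' Y' YZ' Int_lower2 sZ] by (rule bexE)
 have "is_L n q l (subquot G V Z Y)"
  by (rule c(2)[OF _ _ _ l(2)]) auto
 then show ?thesis using l(1) by blast
qed

text \<open>If Z \<inter> N is not inside \<open>Y\<close>, the factor Z/Y already occurs in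
  \<open>N\<close>. Otherwise it is isomorphic to (Z + N)/(Y + N); as \<open>Z\<close> lies in N +
  M, the classes of this quotient have representatives in \<open>M\<close>, so it occurs in
  \<open>M\<close>.\<close>

lemma belongs_sub_sum:
 assumes V: "precomodule G V" and N: "subcomodule G V N" "belongs_sub P V N" and M: "subcomodule G V M" "belongs_sub P V M"
 shows "belongs_sub P V (subspace_sum V N M)"
 unfolding belongs_sub_def
proof (intro allI impI, elim conjE)
 fix Z Y assume Z: "subcomodule G V Z" and Y: "subcomodule G V Y" and YZ: "Y \<subseteq> Z" and ZN: "Z \<subseteq> subspace_sum V N M"
  and s: "simple_comodule G (subquot G V Z Y)"
 note V' = precomoduleD(1)[OF V]
 note Ns = subcomoduleD(1)[OF V N(1)] and Ms = subcomoduleD(1)[OF V M(1)]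
  and Zs = subcomoduleD(1)[OF V Z] and Ys = subcomoduleD(1)[OF V Y]
 show "\<exists>l\<in>P. is_L n q l (subquot G V Z Y)"
 proof (cases "Z \<inter> N \<subseteq> Y")
  case False
  then show ?thesis using belongs_sub_if_meets[OF V Z Y YZ s N] by blast
 next
  case True
  let ?ZN = "subspace_sum V Z N" and ?YN = "subspace_sum V Y N"
  note ZNc = subcomodule_sum[OF V Z N(1)] and YNc = subcomodule_sum[OF V Y N(1)]
  note ZNs = subcomoduleD(1)[OF V ZNc] and YNs = subcomoduleD(1)[OF V YNc]
  note sumZ = subspace_of_sum(2,3)[OF V' Zs Ns] and sumY = subspace_of_sum(2,3)[OF V' Ys Ns]
  have YZN: "?YN \<subseteq> ?ZN" using YZ by (auto simp: subspace_sum_def)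
  note c = subspD(1)[OF Ns] subspD(1)[OF Ms] subspD(1)[OF Zs] subspD(1)[OF Ys]
  have cancel: "(x +[V] y) +[V] (-1) *[V] x = y" if "x : carrier V" "y : carrier V" for x y
  proof -
   have "(x +[V] y) +[V] (-1) *[V] x = y +[V] (x +[V] (-1) *[V] x)"
    using that by (simp add: vs_assoc[OF V'] vs_lcommute[OF V', of x y] vs_closed[OF V'])
   then show ?thesis using that by (simp add: vs_add_minus[OF V'] vs_add_zero[OF V'])
  qed
  \<comment> \<open>Here Z \<inter> N \<subseteq> Y enters: it makes the map from Z/Y to (Z + N)/(Y
    + N) injective.\<close>
  have iff1: "x : ?YN \<longleftrightarrow> x : Y" if x: "x : Z" for x
  proof
   assume "x : ?YN"
   then obtain y m where ym: "x = y +[V] m" "y : Y" "m : N" by (auto simp: subspace_sum_def)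
   have "m = x +[V] (-1) *[V] y" unfolding ym(1) using cancel[of y m] c ym by simp
   then have "m : Z" using subspD(3,4)[OF Zs] x ym(2) YZ by auto
   then have "m : Y" using True ym(3) by auto
   then show "x : Y" unfolding ym(1) using ym(2) by (intro subspD(3)[OF Ys])
  qed (use sumY in auto)
  have onto1: "\<exists>x\<in>Z. w +[V] (-1) *[V] x : ?YN" if w: "w : ?ZN" for w
  proof -
   obtain z m where zm: "w = z +[V] m" "z : Z" "m : N" using w by (auto simp: subspace_sum_def)
   then have "w +[V] (-1) *[V] z = m" using cancel[of z m] c by simp
   then show ?thesis using zm(2,3) sumY(2) by (intro bexI[of _ z]) auto
  qed
  let ?Z' = "M \<inter> ?ZN" and ?Y' = "M \<inter> ?YN"
  note Z'c = subcomodule_inter[OF V M(1) ZNc] and Y'c = subcomodule_inter[OF V M(1) YNc]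
  \<comment> \<open>An element of Z + N is m + k with m in \<open>N\<close> and k in
    \<open>M\<close>; then k lies in Z + N as well and represents the same class.\<close>
  have onto2: "\<exists>x\<in>?Z'. w +[V] (-1) *[V] x : ?YN" if w: "w : ?ZN" for w
  proof -
   have "?ZN \<subseteq> subspace_sum V N M"
   proof
    fix u assume "u : ?ZN"
    then obtain z m where zm: "u = z +[V] m" "z : Z" "m : N" by (auto simp: subspace_sum_def)
    show "u : subspace_sum V N M"
     unfolding zm(1) using zm(2,3) ZN subspace_of_sum(2)[OF V' Ns Ms]
     by (intro subspD(3)[OF subspace_of_sum(1)[OF V' Ns Ms]]) auto
   qed
   then have "w : subspace_sum V N M" using w by auto
   then obtain m k where mk: "w = m +[V] k" "m : N" "k : M" by (auto simp: subspace_sum_def)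
   have "k = w +[V] (-1) *[V] m" using cancel[of m k] mk c by simp
   then have "k : ?ZN" using subspD(3,4)[OF ZNs] w mk(2) sumZ(2) by auto
   moreover have "w +[V] (-1) *[V] k = m"
    using cancel[of k m] mk c by (simp add: vs_commute[OF V', of m k])
   ultimately show ?thesis using mk sumY(2) by (intro bexI[of _ k]) auto
  qed
  have id: "\<exists>x\<in>Z. z +[V] (-1) *[V] x : Y" if "z : Z" for z
   using that vs_add_minus[OF V' c(3)[OF that]] subspD(2)[OF Ys] by (intro bexI[of _ z]) simp_all
  note Q1 = semi_iso_subquot[OF V ZNc YNc YZN V Z Y YZ incl_linear[OF Zs] _ iff1 onto1 linear_maps_id]
  obtain f where f: "semi_iso G (%c. c) (subquot G V Z Y) (subquot G V ?ZN ?YN) f"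
   using Q1 sumZ(1) by blast
  note pZ = precomodule_subquot[OF V Z Y YZ] and pZN = precomodule_subquot[OF V ZNc YNc YZN]
  have "simple_comodule G (subquot G V ?ZN ?YN)"
   by (rule simple_transport[OF coalg_auto_id f s pZN])
  note c2 = subquot_compare_incl[OF V ZNc YNc YZN Z'c Y'c _ _ _ onto2]
  have sZ': "simple_comodule G (subquot G V ?Z' ?Y')"
   by (rule c2(1)[OF _ _ _ _ \<open>simple_comodule G (subquot G V ?ZN ?YN)\<close>]) (use YZN in auto)
  have YZ': "?Y' \<subseteq> ?Z'" using YZN by auto
  obtain l where l: "l : P" "is_L n q l (subquot G V ?Z' ?Y')"
   using belongs_subD[OF M(2) Z'c Y'c YZ' Int_lower1 sZ'] by (rule bexE)
  have "is_L n q l (subquot G V ?ZN ?YN)"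
   by (rule c2(2)[OF _ _ _ _ l(2)]) (use YZN in auto)
  \<comment> \<open>\<open>semi_iso_inv\<close> twists by \<open>inv_into\<close> of the identity,
    which is the identity on the carrier only.\<close>
  moreover have fi: "semi_iso G (%c. c) (subquot G V ?ZN ?YN) (subquot G V Z Y) (inv_into (carrier (subquot G V Z Y)) f)"
  proof -
   have fi: "semi_iso G (inv_into (carrier G) (%c. c)) (subquot G V ?ZN ?YN) (subquot G V Z Y) (inv_into (carrier (subquot G V Z Y)) f)"
    by (rule semi_iso_inv[OF pZ coalg_auto_id f])
   have inv: "inv_into (carrier G) (%c. c) c = c" if "c : carrier G" for c
    using inv_into_f_f[of "%c. c" "carrier G" c] that by simp
   show ?thesis
    unfolding semi_iso_def
   proof (intro conjI ballI semi_isoD(1,2)[OF fi])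
    fix ph v assume ph: "ph : dual G" and v: "v : carrier (subquot G V ?ZN ?YN)"
    have il: "inv_into (carrier G) (%c. c) : linear_maps G G"
     by (rule coalg_autoD(1)[OF coalg_auto_inv[OF coalg_auto_id]])
    have "act (subquot G V ?ZN ?YN) (%c. ph (inv_into (carrier G) (%c. c) c)) v = act (subquot G V ?ZN ?YN) ph v"
     by (rule act_cong[OF pZN lin_comp[OF il ph] ph v]) (simp add: inv)
    then show "act (subquot G V Z Y) ph (inv_into (carrier (subquot G V Z Y)) f v) =
      inv_into (carrier (subquot G V Z Y)) f (act (subquot G V ?ZN ?YN) ph v)"
     using semi_isoD(3)[OF fi ph v] by simp
   qed
  qed
  ultimately have "is_L n q l (subquot G V Z Y)"
   using is_L_transport[OF torus_auto_id fi _ pZ] by blast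
  then show ?thesis using l(1) by blast
 qed
qed

lemma belongs_sub_zero:
 assumes V: "precomodule G V"
 shows "subcomodule G V {\<zero>\<^bsub>V\<^esub>}" "belongs_sub P V {\<zero>\<^bsub>V\<^esub>}"
proof -
 note V' = precomoduleD(1)[OF V]
 show "subcomodule G V {\<zero>\<^bsub>V\<^esub>}"
  unfolding subcomodule_iff[OF V]
  using subspace_of_zero[OF V'] linear_maps_zero[OF V' V' act_linear[OF V]] by blast
 show "belongs_sub P V {\<zero>\<^bsub>V\<^esub>}"
  unfolding belongs_sub_def
 proof (intro allI impI, elim conjE)
  fix Z Y assume Z: "subcomodule G V Z" and Y: "subcomodule G V Y" "Y \<subseteq> Z" "Z \<subseteq> {\<zero>\<^bsub>V\<^esub>}"
   "simple_comodule G (subquot G V Z Y)"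
  then show "\<exists>l\<in>P. is_L n q l (subquot G V Z Y)"
   using simple_subquot_nonzero[OF V Z Y(1,2,4)] subspD(2)[OF subcomoduleD(1)[OF V Y(1)]] by blast
 qed
qed

text \<open>A plain union suffices, since by \<open>belongs_sub_sum\<close> the family is
  directed.\<close>

definition trunc :: "(nat => int) set => ('k, (gen_word \<Rightarrow>\<^sub>0 'k) set, 'v) comod => 'v set" where
 "trunc P V = \<Union>{N. subcomodule G V N & belongs_sub P V N}"

lemma subcomodule_trunc:
 assumes V: "precomodule G V"
 shows "subcomodule G V (trunc P V)"
 unfolding subcomodule_iff[OF V] subspace_of_def
proof (intro conjI ballI allI)
 note V' = precomoduleD(1)[OF V]
 let ?\<N> = "{N. subcomodule G V N & belongs_sub P V N}"
 have sub: "subspace_of V N" if "N : ?\<N>" for N using that subcomoduleD(1)[OF V] by blast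
 have mem: "x : trunc P V" if "N : ?\<N>" "x : N" for x N unfolding trunc_def using that by (rule UnionI)
 show "trunc P V \<subseteq> carrier V" unfolding trunc_def using subspD(1)[OF sub] by (intro Union_least subsetI)
 show "\<zero>\<^bsub>V\<^esub> : trunc P V"
  by (rule mem[of "{\<zero>\<^bsub>V\<^esub>}"]) (use belongs_sub_zero[OF V] in auto)
 fix x assume "x : trunc P V"
 then obtain N where N: "N : ?\<N>" "x : N" unfolding trunc_def by (rule UnionE)
 show "a *[V] x : trunc P V" for a by (rule mem[OF N(1) subspD(4)[OF sub[OF N(1)] N(2)]])
 show "act V ph x : trunc P V" if "ph : dual G" for ph
  by (rule mem[OF N(1)]) (use N subcomoduleD(2)[OF V _ that] in blast)
 fix y assume "y : trunc P V"
 then obtain M where M: "M : ?\<N>" "y : M" unfolding trunc_def by (rule UnionE)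
 have "subspace_sum V N M : ?\<N>"
  using N(1) M(1) subcomodule_sum[OF V, of N M] belongs_sub_sum[OF V, of N P M] by simp
 moreover have "x +[V] y : subspace_sum V N M" unfolding subspace_sum_def using N(2) M(2) by blast
 ultimately show "x +[V] y : trunc P V" by (rule mem)
qed

text \<open>A simple Z/Y contains some z outside \<open>Y\<close>, and this single element already
  lies in one member of the union.\<close>

lemma belongs_trunc:
 assumes V: "precomodule G V"
 shows "belongs_sub P V (trunc P V)"
 unfolding belongs_sub_def
proof (intro allI impI, elim conjE)
 fix Z Y assume Z: "subcomodule G V Z" and Y: "subcomodule G V Y" "Y \<subseteq> Z" and ZT: "Z \<subseteq> trunc P V"
  and s: "simple_comodule G (subquot G V Z Y)"
 obtain z where z: "z : Z" "z \<notin> Y" using simple_subquot_nonzero[OF V Z Y s] by (rule bexE)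
 then obtain N where "subcomodule G V N" "belongs_sub P V N" "z : N" using ZT unfolding trunc_def by auto
 then show "\<exists>l\<in>P. is_L n q l (subquot G V Z Y)"
  using belongs_sub_if_meets[OF V Z Y s _ _ z(1) _ z(2)] by blast
qed

text \<open>The union itself belongs to \<open>P\<close>, so the \<open>GREATEST\<close> in
  \<open>O_trunc\<close> is attained.\<close>

lemma O_trunc_eq:
 assumes V: "precomodule G V"
 shows "O_trunc n q P V = trunc P V"
 unfolding O_trunc_def
proof (rule Greatest_equality)
 show "subcomodule G V (trunc P V) & belongs_to n q P (sub_comod G V (trunc P V))"
  using subcomodule_trunc[OF V] belongs_trunc[OF V] belongs_to_sub_iff[OF V] by blast
 fix N assume "subcomodule G V N & belongs_to n q P (sub_comod G V N)"
 then show "N \<le> trunc P V"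
  unfolding trunc_def using belongs_to_sub_iff[OF V] by blast
qed

lemma trunc_image:
 assumes tht: "torus_auto n q tht sig" and V: "precomodule G V" and W: "precomodule G W"
  and g: "g : linear_maps V W" and equi: "!!ph x. ph : dual G ==> x : carrier V ==> act W ph (g x) = g (act V (%c. ph (tht c)) x)"
 shows "g ` trunc P V \<subseteq> trunc (sig ` P) W"
proof -
 have tht': "tht : linear_maps G G" using tht coalg_autoD(1) by (simp add: torus_auto_def)
 have "subcomodule G W (g ` trunc P V)"
  by (rule subcomodule_image[OF tht' V W g equi subcomodule_trunc[OF V]])
 moreover have "belongs_sub (sig ` P) W (g ` trunc P V)"
  by (rule belongs_image[OF tht V W g equi subcomodule_trunc[OF V] belongs_trunc[OF V]])
 ultimately show ?thesis unfolding trunc_def[of "sig ` P" W] by (intro Union_upper) simp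
qed

text \<open>Right slices stay inside because the truncation is a subcomodule, left slices because
  left translations are comodule endomorphisms and map the truncation into itself.\<close>

lemma subcoalgebra_trunc: "subcoalgebra (trunc P (regular_comod G))"
proof -
 let ?R = "regular_comod G" and ?T = "trunc P (regular_comod G)"
 note R = precomodule_regular
 note T = subcomoduleD[OF R subcomodule_trunc[OF R]]
 have Ts: "subspace_of G ?T"
  using T(1) by (simp add: subspace_of_def same_moduleD[OF regular_comod_same])
 have "comult G x : tensor_map G G (%b. b) (%b. b) ` carrier (tensor (G\<lparr>carrier := ?T\<rparr>) (G\<lparr>carrier := ?T\<rparr>))"
  if x: "x : ?T" for x
 proof (rule mem_tensor_sub_if_slices[OF C C Ts Ts])
  note xc = subspD(1)[OF Ts x]
  show "comult G x : carrier (tensor G G)" by (rule comult_closed[OF xc])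
  show "rslice G ph (comult G x) : ?T" if "ph : dual G" for ph
   using T(2)[OF that x] by (simp add: act_def same_module_rslice[OF regular_comod_same])
  show "lslice G alp (comult G x) : ?T" if alp: "alp : dual G" for alp
  proof -
   have "lact alp ` ?T \<subseteq> trunc ((%mu. mu) ` P) ?R"
    by (rule trunc_image[OF torus_auto_id R R])
     (use lact_linear[OF alp] act_lact[OF alp] in \<open>auto simp: linear_maps_regular\<close>)
   then show ?thesis using x by (auto simp: lact_def)
  qed
 qed
 then show ?thesis using Ts by (simp add: subcoalgebra_def)
qed

theorem trunc_isomorphic:
 assumes tht: "torus_auto n q tht sig" and P: "P \<subseteq> weight_lattice n"
 shows "coalgebra_isomorphic (A_trunc n q P) (A_trunc n q (sig ` P)) &
  algebra_isomorphic (S_trunc n q P) (S_trunc n q (sig ` P))"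
proof -
 let ?R = "regular_comod G" and ?i = "inv_into (carrier G) tht" and ?j = "inv_into (weight_lattice n) sig"
 note R = precomodule_regular
 have img: "tht ` trunc P ?R \<subseteq> trunc (sig ` P) ?R" if "torus_auto n q tht sig" for tht sig P
 proof -
  have a: "coalg_auto G tht" using that by (simp add: torus_auto_def)
  show ?thesis
   by (rule trunc_image[OF that R R])
    (use coalg_autoD(1)[OF a] act_coalg_auto[OF a] in \<open>auto simp: linear_maps_regular\<close>)
 qed
 have tht': "coalg_auto G tht" and sig: "bij_betw sig (weight_lattice n) (weight_lattice n)"
  using tht by (auto simp: torus_auto_def)
 have "?j ` sig ` P = P"
  using bij_betw_imp_inj_on[OF sig] P by (rule inv_into_image_cancel)
 \<comment> \<open>The reverse inclusion comes from the inverse automorphism, whose weight map takes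
   the image of \<open>P\<close> back to \<open>P\<close>.\<close>
 then have i: "?i ` trunc (sig ` P) ?R \<subseteq> trunc P ?R"
  using img[OF torus_auto_inv[OF tht], of "sig ` P"] by simp
 have c: "x : carrier G" if "x : trunc Q ?R" for x Q
  using subspD(1)[OF subcomoduleD(1)[OF R subcomodule_trunc[OF R]] that] by simp
 have "tht ` trunc P ?R = trunc (sig ` P) ?R"
 proof (intro subset_antisym subsetI)
  fix x assume x: "x : trunc (sig ` P) ?R"
  have "tht (?i x) = x" using c[OF x] coalg_autoD(2)[OF tht'] by (auto simp: bij_betw_def f_inv_into_f)
  moreover have "?i x : trunc P ?R" using i x by auto
  ultimately show "x : tht ` trunc P ?R" by (metis imageI)
 qed (use img[OF tht, of P] in auto)
 then have iso: "coalgebra_isomorphic (A_trunc n q P) (A_trunc n q (sig ` P))"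
  unfolding A_trunc_def O_trunc_eq[OF R]
  by (rule sub_coalg_isomorphic[OF tht' subcoalgebra_trunc subcoalgebra_trunc])
 have v: "vspace (A_trunc n q Q)" for Q
  unfolding A_trunc_def O_trunc_eq[OF R]
  by (rule same_module_vspace[OF same_module_sym[OF sub_coalg_same] vspace_sub[OF C]])
   (use subcoalgebra_trunc in \<open>simp add: subcoalgebra_def\<close>)
 have "algebra_isomorphic (S_trunc n q P) (S_trunc n q (sig ` P))"
  unfolding S_trunc_def
 proof (rule dual_algebra_isomorphic[OF v v _ iso])
  fix x assume "x : carrier (A_trunc n q P)"
  then show "comult (A_trunc n q P) x : carrier (tensor (A_trunc n q P) (A_trunc n q P))"
   unfolding A_trunc_def O_trunc_eq[OF R] same_module_formal_tensors(3)[OF sub_coalg_same sub_coalg_same]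
    same_moduleD(1)[OF sub_coalg_same]
   by (intro comult_sub_coalg(1)[OF subcoalgebra_trunc]) simp
 qed
 with iso show ?thesis ..
qed

end

section \<open>Functionals on the free algebra\<close>

type_synonym 'k free = "gen_word \<Rightarrow>\<^sub>0 'k"

definition wd :: "gen list => 'k::field free" where
 "wd w = single (Word w) 1"

definition ev :: "(gen list => 'k) => 'k::field free => 'k" where
 "ev ph z = (\<Sum>w\<in>keys z. lookup z w * ph (letters w))"

lemma ev_superset: "finite A ==> keys z \<subseteq> A ==> ev ph z = (\<Sum>w\<in>A. lookup z w * ph (letters w))"
 unfolding ev_def by (rule sum.mono_neutral_left) (auto simp: in_keys_iff)

lemma ev_add: "ev ph (x + y) = ev ph x + ev ph y"
proof -
 let ?A = "keys x \<union> keys y"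
 have "ev ph (x + y) = (\<Sum>w\<in>?A. lookup (x + y) w * ph (letters w))"
  by (rule ev_superset) (simp_all add: Poly_Mapping.keys_add)
 then show ?thesis
  using ev_superset[of ?A x ph] ev_superset[of ?A y ph] by (simp add: lookup_add sum.distrib distrib_right)
qed

lemma ev_pscale: "ev ph (pscale a x) = a * ev ph x"
 using ev_superset[of "keys x" "pscale a x" ph] keys_pscale[of a x]
 by (simp add: ev_def sum_distrib_left mult.assoc)

lemma ev_zero [simp]: "ev ph 0 = 0" by (simp add: ev_def)

lemma ev_uminus: "ev ph (- x) = - ev ph x"
 using ev_pscale[of ph "-1" x] by (simp add: pscale_simps(8))

lemma ev_diff: "ev ph (x - y) = ev ph x - ev ph y"
 using ev_add[of ph x "- y"] by (simp add: ev_uminus)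

lemma ev_sum: "ev ph (\<Sum>i\<in>I. f i) = (\<Sum>i\<in>I. ev ph (f i))"
 by (induction I rule: infinite_finite_induct) (simp_all add: ev_add)

lemma ev_single: "ev ph (single (Word w) a) = a * ph w"
 using ev_superset[of "{Word w}" "single (Word w) a" ph] by simp

lemma ev_wd [simp]: "ev ph (wd w) = ph w" by (simp add: wd_def ev_single)

lemma wd_Nil: "wd [] = 1"
 by (metis wd_def single_one zero_gen_word_def)

lemma wd_append: "wd (u @ v) = wd u * wd v"
 by (simp add: wd_def mult_single plus_gen_word_def)

lemma gen_elt_wd: "gen_elt x = wd [x]"
 by (simp add: gen_elt_def wd_def)

lemma single_wd: "single (Word w) a = pscale a (wd w)"
 by (simp add: wd_def)

lemma free_induct [case_names zero add]:
 assumes "P 0" "!!w a f. P f ==> P (pscale a (wd w) + f)"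
 shows "P (f :: 'k::field free)"
proof (rule poly_mapping_induct_on[of f UNIV])
 fix p a and f :: "'k free" assume "P f"
 then show "P (single p a + f)"
  using assms(2)[of f a "letters p"] by (simp add: wd_def)
qed (use assms in simp_all)

lemma pscale_mult_left: "pscale a x * y = pscale a (x * y :: 'k::field free)"
 by (simp add: pscale_def mult_map_scale_conv_mult mult.assoc)

lemma pscale_mult_right: "x * pscale a y = pscale a (x * y :: 'a::field free)"
proof (induction x rule: free_induct)
 case (add w b f)
 have "wd w * pscale a y = pscale a (wd w * y)"
 proof (induction y rule: free_induct)
  case (add v c g)
  have "wd w * pscale c' (wd v) = pscale c' (wd w * wd v)" for c' :: 'a
   unfolding single_wd[symmetric] wd_append[symmetric] by (simp add: wd_def mult_single plus_gen_word_def)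
  then show ?case
   using add by (simp add: pscale_simps distrib_left mult.commute)
 qed (simp add: pscale_simps)
 then show ?case
  using add by (simp add: distrib_right pscale_mult_left pscale_simps mult.commute)
qed (simp add: pscale_simps)

lemmas pscale_mult = pscale_mult_left pscale_mult_right

text \<open>A product is evaluated one factor at a time, the inner evaluation being that of a
  translated functional.\<close>

lemma ev_mult: "ev ph (x * y) = ev (%u. ev (%v. ph (u @ v)) y) x"
proof (induction x rule: free_induct)
 case (add w a f)
 have "ev ph (wd w * y) = ev (%v. ph (w @ v)) y"
  by (induction y rule: free_induct)
   (simp_all add: distrib_left pscale_mult ev_add ev_pscale wd_append[symmetric])
 then show ?case using add by (simp add: distrib_right ev_add pscale_mult ev_pscale)
qed simp

text \<open>Closure under translation makes the common kernel of the functionals a two-sided ideal,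
  so \<open>cong_free\<close> respects products and relations can be used without forming a
  quotient.\<close>

locale shift_closed =
 fixes \<Phi> :: "(gen list => 'k::field) set"
 assumes shift: "ph : \<Phi> ==> (%w. ph (u @ w @ v)) : \<Phi>"
begin

definition cong_free :: "'k free => 'k free => bool" (infix "\<asymp>" 50) where
 "x \<asymp> y \<longleftrightarrow> (\<forall>ph\<in>\<Phi>. ev ph x = ev ph y)"

lemma cong_refl [simp]: "x \<asymp> x" by (simp add: cong_free_def)
lemma cong_sym: "x \<asymp> y ==> y \<asymp> x" by (simp add: cong_free_def)
lemma cong_trans [trans]: "x \<asymp> y ==> y \<asymp> z ==> x \<asymp> z" by (simp add: cong_free_def)
lemma cong_eq_trans [trans]: "x = y ==> y \<asymp> z ==> x \<asymp> z" "x \<asymp> y ==> y = z ==> x \<asymp> z" by simp_all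
lemma cong_add: "x \<asymp> y ==> x' \<asymp> y' ==> x + x' \<asymp> y + y'" by (simp add: cong_free_def ev_add)
lemma cong_pscale: "x \<asymp> y ==> pscale a x \<asymp> pscale a y" by (simp add: cong_free_def ev_pscale)
lemma cong_sum: "(!!i. i : I ==> f i \<asymp> g i) ==> (\<Sum>i\<in>I. f i) \<asymp> (\<Sum>i\<in>I. g i)"
 unfolding cong_free_def ev_sum by (intro ballI sum.cong) auto

lemma cong_mult_left:
 assumes "x \<asymp> y" shows "a * x \<asymp> a * y"
 unfolding cong_free_def
proof
 fix ph assume "ph : \<Phi>"
 then have "ev (%v. ph (u @ v)) x = ev (%v. ph (u @ v)) y" for u
  using assms shift[of ph u "[]"] by (simp add: cong_free_def)
 then show "ev ph (a * x) = ev ph (a * y)" by (simp add: ev_mult)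
qed

lemma cong_mult_right:
 assumes "x \<asymp> y" shows "x * b \<asymp> y * b"
 unfolding cong_free_def
proof
 fix ph assume ph: "ph : \<Phi>"
 have eq: "ev ph (z * b) = ev (%v. ev (%u. ph (u @ v)) z) b" for z
 proof (induction b rule: free_induct)
  case (add w a f)
  have "ev ph (z * wd w) = ev (%u. ph (u @ w)) z" by (simp add: ev_mult)
  then show ?case using add by (simp add: distrib_left ev_add pscale_mult ev_pscale)
 qed simp
 have "ev (%u. ph (u @ v)) x = ev (%u. ph (u @ v)) y" for v
  using assms shift[OF ph, of "[]" v] by (simp add: cong_free_def)
 then show "ev ph (x * b) = ev ph (y * b)" by (simp add: eq)
qed

lemma cong_mult: "x \<asymp> y ==> x' \<asymp> y' ==> x * x' \<asymp> y * y'"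
 using cong_mult_left cong_mult_right cong_trans by blast

lemma cong_pscale_cancel: "a ~= 0 ==> pscale a x \<asymp> pscale a y ==> x \<asymp> y"
 by (simp add: cong_free_def ev_pscale)

end

section \<open>Quantum determinants\<close>

text \<open>Expansion along the first listed row, with a factor \<open>t\<close> for each smaller
  remaining column. For \<open>t = -1\<close> it gives the quantum determinant by rows; for
  \<open>t = -1/q\<close> and the transposed matrix it gives the expansion by columns.\<close>

primrec skew_det :: "'k => (nat => nat => 'k::field free) => nat list => nat set => 'k free" where
 "skew_det t x [] S = 1"
| "skew_det t x (i # I) S = (\<Sum>r\<in>S. pscale (t ^ card {s : S. s < r}) (x i r * skew_det t x I (S - {r})))"

text \<open>The parameter \<open>t\<close> to the number of inversions if the entries are distinct,
  and 0 if one is repeated.\<close>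

primrec inv_sign :: "'k::field => nat list => 'k" where
 "inv_sign t [] = 1"
| "inv_sign t (x # xs) = prod_list (map (%y. if x < y then 1 else if y < x then t else 0) xs) * inv_sign t xs"

lemma sum_off_diagonal:
 fixes g :: "nat => nat => 'a::comm_monoid_add"
 assumes S: "finite S"
 shows "(\<Sum>r\<in>S. \<Sum>s\<in>S - {r}. g r s) = (\<Sum>(r, s)\<in>{(r, s) : S \<times> S. r < s}. g r s + g s r)"
proof -
 let ?L = "{(r, s) : S \<times> S. r < s}" and ?U = "{(r, s) : S \<times> S. s < r}"
 have f: "finite ?L" "finite ?U"
  by (rule finite_subset[OF _ finite_cartesian_product[OF S S]]; blast)+
 have "(\<Sum>r\<in>S. \<Sum>s\<in>S - {r}. g r s) = (\<Sum>(r, s)\<in>Sigma S (%r. S - {r}). g r s)"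
  using S by (simp add: sum.Sigma)
 also have "Sigma S (%r. S - {r}) = ?L \<union> ?U" by (auto simp: neq_iff)
 also have "(\<Sum>(r, s)\<in>?L \<union> ?U. g r s) = (\<Sum>(r, s)\<in>?L. g r s) + (\<Sum>(r, s)\<in>?U. g r s)"
 proof (rule sum.union_disjoint[OF f])
  show "?L \<inter> ?U = {}" by auto
 qed
 also have "(\<Sum>(r, s)\<in>?U. g r s) = (\<Sum>(r, s)\<in>?L. g s r)"
  by (rule sum.reindex_bij_witness[of _ "%(r, s). (s, r)" "%(r, s). (s, r)"]) auto
 also have "(\<Sum>(r, s)\<in>?L. g r s) + (\<Sum>(r, s)\<in>?L. g s r) =
   (\<Sum>p\<in>?L. (case p of (r, s) => g r s) + (case p of (r, s) => g s r))"
  by (rule sum.distrib[symmetric])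
 also have "... = (\<Sum>(r, s)\<in>?L. g r s + g s r)"
  by (rule sum.cong[OF refl]) (simp add: case_prod_beta)
 finally show ?thesis .
qed

lemma card_less_remove:
 fixes S :: "nat set"
 assumes "finite S" "r : S"
 shows "card {u : S. u < s} = card {u : S - {r}. u < s} + (if r < s then 1 else 0)"
proof (cases "r < s")
 case True
 have "{u : S. u < s} = insert r {u : S - {r}. u < s}" using assms True by auto
 then show ?thesis using assms True by simp
next
 case False
 then have "{u : S. u < s} = {u : S - {r}. u < s}" by auto
 then show ?thesis using False by simp
qed

lemma card_greater_remove:
 fixes S :: "nat set"
 assumes "finite S" "r : S"
 shows "card {u : S. s < u} = card {u : S - {r}. s < u} + (if s < r then 1 else 0)"
proof (cases "s < r")
 case True
 have "{u : S. s < u} = insert r {u : S - {r}. s < u}" using assms True by auto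
 then show ?thesis using assms True by simp
next
 case False
 then have "{u : S. s < u} = {u : S - {r}. s < u}" by auto
 then show ?thesis using False by simp
qed

text \<open>The first two rows use columns r < s in either order, and choosing s before r costs one
  more factor \<open>t\<close>. This isolates the 2 by 2 minors on which the commutation relations
  act.\<close>

lemma skew_det_two:
 assumes S: "finite S"
 shows "skew_det t x (a # b # v) S = (\<Sum>(r, s)\<in>{(r, s) : S \<times> S. r < s}.
  pscale (t ^ (card {u : S. u < r} + card {u : S - {r}. u < s}))
   ((x a r * x b s + pscale t (x a s * x b r)) * skew_det t x v (S - {r, s})))"
proof -
 let ?c = "%S r. card {u : S. u < (r :: nat)}"
 let ?g = "%r s. pscale (t ^ (?c S r + ?c (S - {r}) s)) (x a r * x b s * skew_det t x v (S - {r, s}))"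
 have "skew_det t x (a # b # v) S = (\<Sum>r\<in>S. \<Sum>s\<in>S - {r}. ?g r s)"
  by (simp add: sum_distrib_left pscale_sum pscale_mult pscale_simps power_add mult.assoc Diff_insert2[symmetric])
 also have "... = (\<Sum>(r, s)\<in>{(r, s) : S \<times> S. r < s}. ?g r s + ?g s r)"
  by (rule sum_off_diagonal[OF S])
 also have "... = (\<Sum>(r, s)\<in>{(r, s) : S \<times> S. r < s}. pscale (t ^ (?c S r + ?c (S - {r}) s))
   ((x a r * x b s + pscale t (x a s * x b r)) * skew_det t x v (S - {r, s})))"
 proof (rule sum.cong[OF refl], clarify)
  fix r s assume rs: "r : S" "s : S" "r < s"
  have "?c S s + ?c (S - {s}) r = Suc (?c S r + ?c (S - {r}) s)"
   using card_less_remove[OF S rs(1), of s] card_less_remove[OF S rs(2), of r] rs(3) by simp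
  moreover have "S - {s, r} = S - {r, s}" by auto
  ultimately show "?g r s + ?g s r = pscale (t ^ (?c S r + ?c (S - {r}) s))
   ((x a r * x b s + pscale t (x a s * x b r)) * skew_det t x v (S - {r, s}))"
   by (simp add: pscale_mult pscale_simps distrib_right mult_ac)
 qed
 finally show ?thesis .
qed

text \<open>A column chosen in the last row forms an inversion with every larger column, so the
  exponent counts larger instead of smaller ones.\<close>

lemma skew_det_last:
 "finite S ==> card S = Suc (length I) ==>
  skew_det t x (I @ [i]) S = (\<Sum>r\<in>S. pscale (t ^ card {s : S. r < s}) (skew_det t x I (S - {r}) * x i r))"
proof (induction I arbitrary: S)
 case Nil
 then obtain r where S: "S = {r}" by (auto simp: card_1_singleton_iff)
 have e: "{s. s = r & s < r} = {}" "{s. s = r & r < s} = {}" by auto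
 show ?case by (simp add: S e)
next
 case (Cons a I)
 note S = Cons.prems(1)
 let ?c = "%S r. card {u : S. u < (r :: nat)}" and ?d = "%S r. card {u : S. (r :: nat) < u}"
 let ?g = "%r s. x a r * skew_det t x I (S - {r, s}) * x i s"
 have "skew_det t x ((a # I) @ [i]) S =
  (\<Sum>r\<in>S. \<Sum>s\<in>S - {r}. pscale (t ^ (?c S r + ?d (S - {r}) s)) (?g r s))"
 proof -
  have "skew_det t x (I @ [i]) (S - {r}) =
   (\<Sum>s\<in>S - {r}. pscale (t ^ ?d (S - {r}) s) (skew_det t x I (S - {r} - {s}) * x i s))" if "r : S" for r
   by (rule Cons.IH) (use Cons.prems that in auto)
  then show ?thesis
   by (simp add: sum_distrib_left pscale_sum pscale_mult pscale_simps power_add mult.assoc Diff_insert2[symmetric])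
 qed
 also have "... = (\<Sum>r\<in>S. \<Sum>s\<in>S - {r}. pscale (t ^ (?d S s + ?c (S - {s}) r)) (?g r s))"
 proof (intro sum.cong refl)
  fix r s assume r: "r : S" and s: "s : S - {r}"
  \<comment> \<open>On both sides the pair r, s itself is counted exactly when s < r.\<close>
  have "?c S r + ?d (S - {r}) s = ?d S s + ?c (S - {s}) r"
   using card_less_remove[OF S, of s r] card_greater_remove[OF S r, of s] s by auto
  then show "pscale (t ^ (?c S r + ?d (S - {r}) s)) (?g r s) = pscale (t ^ (?d S s + ?c (S - {s}) r)) (?g r s)" by simp
 qed
 also have "... = (\<Sum>s\<in>S. \<Sum>r\<in>S - {s}. pscale (t ^ (?d S s + ?c (S - {s}) r)) (?g r s))"
 proof -
  have "(\<Sum>r\<in>S. \<Sum>s\<in>S - {r}. f r s) = (\<Sum>s\<in>S. \<Sum>r\<in>S - {s}. f r s)" for f :: "nat => nat => 'a free"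
   unfolding sum_off_diagonal[OF S] by (simp add: add.commute)
  then show ?thesis .
 qed
 also have "... = (\<Sum>s\<in>S. pscale (t ^ ?d S s) (skew_det t x (a # I) (S - {s}) * x i s))"
  by (simp add: sum_distrib_right pscale_sum pscale_mult pscale_simps power_add mult.assoc Diff_insert2[symmetric] insert_commute)
 finally show ?case .
qed

lemma alternating_sort_aux:
 fixes G :: "nat list => 'k::field"
 assumes swap: "!!u a b v. a : A ==> b : A ==> b < a ==> G (u @ a # b # v) = t * G (u @ b # a # v)"
  and eq: "!!u a v. a : A ==> G (u @ a # a # v) = 0"
 shows "sorted ys ==> distinct ys ==> x : A ==> set ys \<subseteq> A ==>
  G (u @ x # ys) = prod_list (map (%y. if x < y then 1 else if y < x then t else 0) ys) * G (u @ insort x ys)"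
proof (induction ys arbitrary: u)
 case (Cons y ys)
 consider "x < y" | "x = y" | "y < x" by linarith
 then show ?case
 proof cases
  case 1
  then have "\<forall>z\<in>set ys. x < z" using Cons.prems(1) by auto
  then have "map (%y. if x < y then 1 else if y < x then t else 0) ys = map (%_. 1) ys" by (intro map_cong) auto
  then have "prod_list (map (%y. if x < y then 1 else if y < x then t else 0) ys) = 1" by (simp add: map_replicate_const)
  then show ?thesis using 1 by simp
 next
  case 2
  then show ?thesis using eq[of x u ys] Cons.prems by simp
 next
  case 3
  have "G (u @ x # y # ys) = t * G ((u @ [y]) @ x # ys)"
   using swap[of x y u ys] Cons.prems 3 by simp
  also have "... = t * (prod_list (map (%y. if x < y then 1 else if y < x then t else 0) ys) * G ((u @ [y]) @ insort x ys))"
   using Cons.IH[of "u @ [y]"] Cons.prems by simp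
  finally show ?thesis using 3 by (simp add: mult.assoc)
 qed
qed simp

text \<open>Insertion sort: each exchange of an adjacent descent costs \<open>t\<close>, and a
  repetition meets its twin and gives 0. The prefix \<open>u\<close> is carried along because the
  induction works at the end of a longer list.\<close>

lemma alternating_sort:
 fixes G :: "nat list => 'k::field"
 assumes swap: "!!u a b v. a : A ==> b : A ==> b < a ==> G (u @ a # b # v) = t * G (u @ b # a # v)"
  and eq: "!!u a v. a : A ==> G (u @ a # a # v) = 0"
 shows "set l \<subseteq> A ==> G (u @ l) = inv_sign t l * G (u @ sort l)"
proof (induction l arbitrary: u)
 case (Cons x xs)
 have IH: "G (u @ x # xs) = inv_sign t xs * G (u @ x # sort xs)"
  using Cons.IH[of "u @ [x]"] Cons.prems by simp
 show ?case
 proof (cases "distinct xs")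
  case True
  let ?f = "%y. if x < y then 1 else if y < x then t else 0"
  have "G (u @ x # sort xs) = prod_list (map ?f (sort xs)) * G (u @ insort x (sort xs))"
   by (rule alternating_sort_aux[where A = A and G = G and t = t, OF swap eq]) (use True Cons.prems in auto)
  moreover have "prod_list (map ?f (sort xs)) = prod_list (map ?f xs)"
   unfolding prod_mset_prod_list[symmetric] by simp
  ultimately show ?thesis using IH by (simp add: insort_key_def[symmetric] mult_ac)
 next
  case False
  have "inv_sign t l = 0" if "\<not> distinct l" for l
   using that
  proof (induction l)
   case (Cons y l)
   then show ?case by (auto simp: prod_list_zero_iff)
  qed simp
  then show ?thesis using IH False by simp
 qed
qed simp

lemma inv_sign_sorted: "sorted l ==> distinct l ==> inv_sign t l = 1"
proof (induction l)
 case (Cons x l)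
 then have "map (%y. if x < y then 1 else if y < x then t else 0) l = map (%_. 1) l"
  by (intro map_cong) (auto simp: order.strict_iff_order)
 then show ?case using Cons by (simp add: map_replicate_const)
qed simp

context shift_closed
begin

text \<open>Expanding along the rows of \<open>u\<close> first leaves \<open>l\<close> and
  \<open>l'\<close> facing subsets of the columns, hence the quantification over
  \<open>S\<close>.\<close>

lemma skew_det_cong_append:
 assumes "!!S. finite S ==> S \<subseteq> B ==> skew_det t x l S \<asymp> pscale c (skew_det t x l' S)"
 shows "finite S ==> S \<subseteq> B ==> skew_det t x (u @ l) S \<asymp> pscale c (skew_det t x (u @ l') S)"
proof (induction u arbitrary: S)
 case (Cons a u)
 have "skew_det t x ((a # u) @ l) S \<asymp> (\<Sum>r\<in>S. pscale (t ^ card {s : S. s < r}) (x a r * pscale c (skew_det t x (u @ l') (S - {r}))))"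
  unfolding append_Cons skew_det.simps
  by (intro cong_sum cong_pscale cong_mult_left Cons.IH) (use Cons.prems in auto)
 also have "... = pscale c (skew_det t x ((a # u) @ l') S)"
  by (simp add: pscale_sum pscale_mult pscale_simps mult.commute)
 finally show ?case .
qed (use assms in simp)

text \<open>By \<open>skew_det_two\<close>, the effect of exchanging adjacent rows is decided on 2
  by 2 minors; \<open>alternating_sort\<close> then handles arbitrary orders and repetitions of
  rows.\<close>

lemma skew_det_sort:
 assumes swap: "!!a b r s. a : A ==> b : A ==> r : B ==> s : B ==> b < a ==> r < s ==>
   x a r * x b s + pscale t (x a s * x b r) \<asymp> pscale t (x b r * x a s + pscale t (x b s * x a r))"
  and eq: "!!a r s. a : A ==> r : B ==> s : B ==> r < s ==> x a r * x a s + pscale t (x a s * x a r) \<asymp> 0"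
  and B: "finite B" and l: "set l \<subseteq> A"
 shows "skew_det t x l B \<asymp> pscale (inv_sign t l) (skew_det t x (sort l) B)"
 unfolding cong_free_def ev_pscale
proof
 fix ph assume ph: "ph : \<Phi>"
 have sw: "skew_det t x (u @ a # b # v) B \<asymp> pscale t (skew_det t x (u @ b # a # v) B)"
  if ab: "a : A" "b : A" "b < a" for u a b v
 proof (rule skew_det_cong_append[OF _ B order_refl])
  fix S assume S: "finite S" "S \<subseteq> B"
  show "skew_det t x (a # b # v) S \<asymp> pscale t (skew_det t x (b # a # v) S)"
   unfolding skew_det_two[OF S(1)] pscale_sum
  proof (intro cong_sum, clarify)
   fix r s assume rs: "r : S" "s : S" "r < s"
   let ?e = "t ^ (card {u : S. u < r} + card {u : S - {r}. u < s})"
   have "pscale ?e ((x a r * x b s + pscale t (x a s * x b r)) * skew_det t x v (S - {r, s})) \<asymp>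
    pscale ?e (pscale t (x b r * x a s + pscale t (x b s * x a r)) * skew_det t x v (S - {r, s}))"
    by (intro cong_pscale cong_mult_right swap) (use ab rs S in auto)
   also have "... = pscale t (pscale ?e ((x b r * x a s + pscale t (x b s * x a r)) * skew_det t x v (S - {r, s})))"
    by (simp add: pscale_mult pscale_simps mult_ac distrib_right)
   finally show "pscale ?e ((x a r * x b s + pscale t (x a s * x b r)) * skew_det t x v (S - {r, s})) \<asymp>
    pscale t (pscale ?e ((x b r * x a s + pscale t (x b s * x a r)) * skew_det t x v (S - {r, s})))" .
  qed
 qed
 have eq0: "skew_det t x (u @ a # a # v) B \<asymp> pscale 0 (skew_det t x (u @ a # a # v) B)" if a: "a : A" for u a v
 proof (rule skew_det_cong_append[OF _ B order_refl])
  fix S assume S: "finite S" "S \<subseteq> B"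
  have "skew_det t x (a # a # v) S \<asymp> (\<Sum>(r, s)\<in>{(r, s) : S \<times> S. r < s}. 0)"
   unfolding skew_det_two[OF S(1)]
  proof (intro cong_sum, clarify)
   fix r s assume rs: "r : S" "s : S" "r < s"
   let ?e = "t ^ (card {u : S. u < r} + card {u : S - {r}. u < s})"
   have "pscale ?e ((x a r * x a s + pscale t (x a s * x a r)) * skew_det t x v (S - {r, s})) \<asymp>
    pscale ?e (0 * skew_det t x v (S - {r, s}))"
    by (intro cong_pscale cong_mult_right eq) (use a rs S in auto)
   then show "pscale ?e ((x a r * x a s + pscale t (x a s * x a r)) * skew_det t x v (S - {r, s})) \<asymp> 0"
    by (simp add: pscale_simps)
  qed
  then show "skew_det t x (a # a # v) S \<asymp> pscale 0 (skew_det t x (a # a # v) S)"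
   by (simp add: pscale_simps)
 qed
 have "ev ph (skew_det t x ([] @ l) B) = inv_sign t l * ev ph (skew_det t x ([] @ sort l) B)"
  by (rule alternating_sort[where A = A and G = "%l. ev ph (skew_det t x l B)"])
   (use sw eq0 l ph in \<open>auto simp: cong_free_def ev_pscale\<close>)
 then show "ev ph (skew_det t x l B) = inv_sign t l * ev ph (skew_det t x (sort l) B)" by simp
qed

end

lemma skew_det_prod_lists:
 "finite S ==> card S = length I ==> skew_det t x I S =
  (\<Sum>L | set L = S & distinct L. pscale (inv_sign t L) (prod_list (map2 x I L)))"
proof (induction I arbitrary: S)
 case Nil
 then have "{L. set L = S & distinct L} = {[]}" by auto
 then show ?case using Nil by (simp add: pscale_simps)
next
 case (Cons i I)
 note S = Cons.prems(1)
 have fin: "finite {L. set L = S' & distinct L}" if "finite S'" for S' :: "nat set"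
  by (rule finite_subset[OF _ finite_lists_length_eq[OF that, of "card S'"]]) (auto simp: distinct_card)
 have set_eq: "{L. set L = S & distinct L} = (\<Union>r\<in>S. (#) r ` {L. set L = S - {r} & distinct L})" (is "?A = ?B")
 proof (intro subset_antisym subsetI)
  fix L assume L: "L : ?A"
  then have "L ~= []" using Cons.prems(2) by auto
  then obtain r L' where L': "L = r # L'" by (cases L) auto
  have r: "r : S" and "set L' = S - {r}" "distinct L'" using L unfolding L' by auto
  then have "L : (#) r ` {L. set L = S - {r} & distinct L}" unfolding L' by simp
  then show "L : ?B" using r by (rule UN_I[rotated])
 next
  fix L assume "L : ?B"
  then obtain r L' where "r : S" "L = r # L'" "set L' = S - {r}" "distinct L'" by (elim UN_E imageE) simp
  then show "L : ?A" by (simp add: insert_absorb)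
 qed
 have "(\<Sum>L\<in>?A. pscale (inv_sign t L) (prod_list (map2 x (i # I) L) :: 'a free)) =
  (\<Sum>r\<in>S. \<Sum>L\<in>(#) r ` {L. set L = S - {r} & distinct L}. pscale (inv_sign t L) (prod_list (map2 x (i # I) L)))"
  unfolding set_eq
 proof (rule sum.UNION_disjoint[OF S])
  show "\<forall>r\<in>S. finite ((#) r ` {L. set L = S - {r} & distinct L})" using fin S by simp
 qed auto
 also have "... = (\<Sum>r\<in>S. \<Sum>L | set L = S - {r} & distinct L. pscale (inv_sign t (r # L)) (x i r * prod_list (map2 x I L)))"
  by (rule sum.cong[OF refl], subst sum.reindex) (simp_all add: inj_on_def)
 also have "... = (\<Sum>r\<in>S. pscale (t ^ card {s : S. s < r}) (x i r * skew_det t x I (S - {r})))"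
 proof (rule sum.cong[OF refl])
  fix r assume r: "r : S"
  have sg: "inv_sign t (r # L) = t ^ card {s : S. s < r} * inv_sign t L" if L: "set L = S - {r}" "distinct L" for L
  proof -
   have "prod_list (map (%y. if r < y then 1 else if y < r then t else 0) L) = (\<Prod>y\<in>S - {r}. if r < y then 1 else if y < r then t else 0)"
    unfolding L(1)[symmetric] by (rule prod.distinct_set_conv_list[OF L(2), symmetric])
   also have "... = (\<Prod>y\<in>{s : S. s < r}. t)"
    by (rule prod.mono_neutral_cong_right) (use S in auto)
   finally show ?thesis by simp
  qed
  have IH: "skew_det t x I (S - {r}) = (\<Sum>L | set L = S - {r} & distinct L. pscale (inv_sign t L) (prod_list (map2 x I L) :: 'a free))"
   by (rule Cons.IH) (use S Cons.prems r in auto)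
  show "(\<Sum>L | set L = S - {r} & distinct L. pscale (inv_sign t (r # L)) (x i r * prod_list (map2 x I L) :: 'a free)) =
   pscale (t ^ card {s : S. s < r}) (x i r * skew_det t x I (S - {r}))"
   unfolding IH sum_distrib_left pscale_sum
  proof (rule sum.cong[OF refl])
   fix L assume "L : {L. set L = S - {r} & distinct L}"
   then have L: "set L = S - {r}" "distinct L" by simp_all
   show "pscale (inv_sign t (r # L)) (x i r * prod_list (map2 x I L) :: 'a free) =
    pscale (t ^ card {s : S. s < r}) (x i r * pscale (inv_sign t L) (prod_list (map2 x I L)))"
    unfolding sg[OF L] by (simp add: pscale_mult pscale_simps)
  qed
 qed
 finally show ?case by simp
qed



lemma wd_Cons: "wd (x # w) = gen_elt x * wd w"
 using wd_append[of "[x]" w] by (simp add: gen_elt_wd)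

lemma wd_map2: "length L = length P ==> wd (map2 Gen L P) = prod_list (map2 (%i r. gc i r) L P)"
 by (induction L P rule: list_induct2) (simp_all add: wd_Nil wd_Cons)

lemma skew_det_lists:
 assumes "finite S" "card S = length I"
 shows "skew_det t (%i r. gc i r) I S = (\<Sum>L | set L = S & distinct L. pscale (inv_sign t L) (wd (map2 Gen I L)))"
 unfolding skew_det_prod_lists[OF assms]
 by (intro sum.cong refl) (use assms(2) in \<open>auto simp: distinct_card wd_map2\<close>)

text \<open>Extended by 0 to lists that are not permutations, the sign satisfies the hypotheses of
  \<open>alternating_sort\<close>, since exchanging adjacent values is composition with a
  transposition of positions.\<close>

lemma sign_eq_inv_sign:
 assumes p: "p permutes {1..n}"
 shows "of_int (sign p) = (inv_sign (-1) (map p [1..<Suc n]) :: 'k::field)"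
proof -
 let ?N = "[1..<Suc n]"
 have set_N: "set ?N = {1..n}" by auto
 define G where "G l = (if \<exists>p. p permutes {1..n} & l = map p ?N
  then of_int (sign (THE p. p permutes {1..n} & l = map p ?N)) else (0 :: 'k))" for l
 have uniq: "p = p'" if "p permutes {1..n}" "p' permutes {1..n}" "map p ?N = map p' ?N" for p p'
 proof
  fix i show "p i = p' i"
  proof (cases "i : {1..n}")
   case True
   then have "i : set ?N" by auto
   then show ?thesis using that(3) by (simp only: map_eq_conv)
  next
   case False
   then show ?thesis using permutes_not_in[OF that(1)] permutes_not_in[OF that(2)] by simp
  qed
 qed
 have G: "G (map p ?N) = of_int (sign p)" if "p permutes {1..n}" for p
 proof -
  have "(THE p'. p' permutes {1..n} & map p ?N = map p' ?N) = p"
   by (rule the_equality) (use that uniq in auto)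
  then show ?thesis unfolding G_def using that by auto
 qed
 have G0: "G l = 0" if "\<not> distinct l" for l
 proof -
  have "distinct (map p ?N)" if "p permutes {1..n}" for p
   using permutes_inj[OF that] by (simp add: distinct_map inj_on_def)
  then show ?thesis unfolding G_def using that by auto
 qed
 have swap1: "\<exists>p'. p' permutes {1..n} & u @ b # a # v = map p' ?N & sign p' = - sign p"
  if p: "p permutes {1..n}" and l: "u @ a # b # v = map p ?N" for u a b v p
 proof -
  let ?i = "Suc (length u)" and ?j = "Suc (Suc (length u))"
  have len: "length u + 2 + length v = n" using arg_cong[OF l, of length] by simp
  define p' where "p' = p \<circ> transpose ?i ?j"
  have t: "transpose ?i ?j permutes {1..n}" by (rule permutes_swap_id) (use len in auto)
  have "p' permutes {1..n}" unfolding p'_def by (rule permutes_compose[OF t p])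
  moreover have "sign p' = - sign p"
   unfolding p'_def using sign_compose[OF permutation_permutes[THEN iffD2, OF exI[of _ "{1..n}"]] permutation_swap_id, of p ?i ?j] p
   by (simp add: sign_swap_id)
  moreover have "u @ b # a # v = map p' ?N"
  proof (rule nth_equalityI)
   show "length (u @ b # a # v) = length (map p' ?N)" using len by simp
   fix k assume k: "k < length (u @ b # a # v)"
   have nth: "(u @ a # b # v) ! k' = p (Suc k')" if "k' < n" for k'
    unfolding l using that by (simp add: nth_upt del: upt_Suc)
   have kn: "k < n" using k len by simp
   consider "k = length u" | "k = Suc (length u)" | "k ~= length u" "k ~= Suc (length u)" by blast
   then show "(u @ b # a # v) ! k = map p' ?N ! k"
   proof cases
    case 1
    have "b = p (Suc (Suc (length u)))" using nth[of "Suc (length u)"] len by (simp add: nth_append)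
    then show ?thesis using 1 kn by (simp add: p'_def nth_append nth_upt del: upt_Suc)
   next
    case 2
    have "a = p (Suc (length u))" using nth[of "length u"] len by (simp add: nth_append)
    then show ?thesis using 2 kn by (simp add: p'_def nth_append nth_upt del: upt_Suc)
   next
    case 3
    have "(u @ b # a # v) ! k = (u @ a # b # v) ! k"
    proof (cases "k < length u")
     case False
     then have "k - length u \<ge> 2" using 3 by linarith
     then obtain m where "k - length u = Suc (Suc m)" by (metis add_2_eq_Suc le_Suc_ex)
     then show ?thesis using False by (simp add: nth_append)
    qed (simp add: nth_append)
    then show ?thesis using 3 kn nth[OF kn] by (simp add: p'_def transpose_def nth_upt del: upt_Suc)
   qed
  qed
  ultimately show ?thesis by blast
 qed
 have "G ([] @ map p ?N) = inv_sign (-1) (map p ?N) * G ([] @ sort (map p ?N))"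
 proof (rule alternating_sort[where A = UNIV])
  fix u a b v
  show "G (u @ a # b # v) = - 1 * G (u @ b # a # v)"
  proof (cases "\<exists>p. p permutes {1..n} & u @ a # b # v = map p ?N")
   case True
   then obtain p where p: "p permutes {1..n}" "u @ a # b # v = map p ?N" by blast
   obtain p' where p': "p' permutes {1..n}" "u @ b # a # v = map p' ?N" "sign p' = - sign p"
    using swap1[OF p] by blast
   show ?thesis unfolding p(2) p'(2) G[OF p(1)] G[OF p'(1)] p'(3) by simp
  next
   case False
   then have "\<not> (\<exists>p. p permutes {1..n} & u @ b # a # v = map p ?N)" using swap1 by blast
   then have "G (u @ b # a # v) = 0" unfolding G_def by (rule if_not_P)
   moreover have "G (u @ a # b # v) = 0" unfolding G_def by (rule if_not_P[OF False])
   ultimately show ?thesis by simp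
  qed
 qed (auto intro: G0)
 moreover have "sort (map p ?N) = map id ?N"
 proof -
  have "set (map p ?N) = {1..n}" using permutes_image[OF p] set_N by simp
  moreover have "distinct (map p ?N)" using permutes_inj[OF p] by (simp add: distinct_map inj_on_def)
  ultimately have "sort (map p ?N) = sorted_list_of_set {1..n}"
   by (metis sorted_list_of_set_sort_remdups distinct_remdups_id)
  also have "... = ?N" using set_N by (metis distinct_upt sorted_list_of_set.idem_if_sorted_distinct sorted_upt)
  finally show ?thesis by simp
 qed
 moreover have "G (map id ?N) = 1" using G[OF permutes_id] by simp
 ultimately show ?thesis using G[OF p] by simp
qed

lemma sorted_list_of_set_upto: "sorted_list_of_set {1..n} = [1..<Suc n]"
 by (rule sorted_list_of_set_unique[THEN iffD1]) (auto simp del: upt_Suc)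

lemma qdet_eq_skew_det: "qdet n = skew_det (-1) (%i r. gc i r) [1..<Suc n] {1..n}"
proof -
 let ?N = "[1..<Suc n]"
 have len: "map2 Gen ?N (map p ?N) = map (%i. Gen i (p i)) ?N" for p
  by (rule nth_equalityI) (auto simp: nth_upt simp del: upt_Suc)
 have "skew_det (-1) (%i r. gc i r) ?N {1..n} = (\<Sum>L | set L = {1..n} & distinct L. pscale (inv_sign (-1) L) (wd (map2 Gen ?N L) :: 'a free))"
  by (rule skew_det_lists) auto
 also have "... = (\<Sum>p | p permutes {1..n}. pscale (inv_sign (-1) (map p ?N)) (wd (map2 Gen ?N (map p ?N))))"
 proof (rule sum.reindex_bij_betw[symmetric])
  show "bij_betw (%p. map p ?N) {p. p permutes {1..n}} {L. set L = {1..n} & distinct L}"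
   unfolding bij_betw_def
  proof
   show "inj_on (%p. map p ?N) {p. p permutes {1..n}}"
   proof (rule inj_onI, rule ext)
    fix p p' i assume *: "p : {p. p permutes {1..n}}" "p' : {p. p permutes {1..n}}" "map p ?N = map p' ?N"
    show "p i = p' i"
    proof (cases "i : {1..n}")
     case True
     then have "i : set ?N" by auto
     then show ?thesis using *(3) by (simp only: map_eq_conv)
    next
     case False
     then show ?thesis using permutes_not_in[of p] permutes_not_in[of p'] * by simp
    qed
   qed
   show "(%p. map p ?N) ` {p. p permutes {1..n}} = {L. set L = {1..n} & distinct L}" (is "?f ` ?P = ?Q")
   proof (intro subset_antisym subsetI)
    fix L assume "L : ?f ` ?P"
    then obtain p where p: "p permutes {1..n}" "L = map p ?N" by auto
    have "set ?N = {1..n}" by auto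
    then show "L : ?Q"
     using p permutes_image[OF p(1)] permutes_inj[OF p(1)] by (simp add: distinct_map inj_on_def)
   next
    fix L assume L: "L : ?Q"
    then have n: "length L = n" using distinct_card[of L] by auto
    define p where "p i = (if i : {1..n} then L ! (i - 1) else i)" for i
    have Lp: "L = map p ?N"
     by (rule nth_equalityI) (auto simp: n p_def nth_upt simp del: upt_Suc)
    have "p ` {1..n} = {1..n}"
    proof -
     have "set ?N = {1..n}" by auto
     then have "p ` {1..n} = set L" using arg_cong[OF Lp, of set] by simp
     then show ?thesis using L by simp
    qed
    then have "bij_betw p {1..n} {1..n}"
     by (simp add: bij_betw_def eq_card_imp_inj_on)
    then have "p permutes {1..n}"
     by (rule bij_imp_permutes) (auto simp: p_def)
    then show "L : ?f ` ?P" using Lp by blast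
   qed
  qed
 qed
 also have "... = qdet n"
  unfolding qdet_def len by (rule sum.cong[OF refl]) (simp add: sign_eq_inv_sign single_wd)
 finally show ?thesis by simp
qed

context shift_closed
begin

text \<open>Associativity: a left inverse and a right inverse of the same matrix agree.\<close>

lemma matrix_cong_unique:
 assumes Q: "finite Q" and i: "i : Q" "k : Q"
  and ZX: "!!b. b : Q ==> (\<Sum>a\<in>Q. Z i a * X' a b) \<asymp> (if i = b then 1 else 0)"
  and XY: "!!a. a : Q ==> (\<Sum>b\<in>Q. X' a b * Y b k) \<asymp> (if a = k then 1 else 0)"
 shows "Z i k \<asymp> Y i k"
proof -
 have "Z i k = (\<Sum>a\<in>Q. Z i a * (if a = k then 1 else 0))"
  using Q i by (simp add: if_distrib[of "%x. _ * x"] cong: if_cong)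
 also have "... \<asymp> (\<Sum>a\<in>Q. Z i a * (\<Sum>b\<in>Q. X' a b * Y b k))"
  by (intro cong_sum cong_mult_left cong_sym[OF XY])
 also have "... = (\<Sum>b\<in>Q. (\<Sum>a\<in>Q. Z i a * X' a b) * Y b k)"
  by (simp add: sum_distrib_left sum_distrib_right mult.assoc) (rule sum.swap)
 also have "... \<asymp> (\<Sum>b\<in>Q. (if i = b then 1 else 0) * Y b k)"
  by (intro cong_sum cong_mult_right ZX)
 also have "... = Y i k"
  using Q i by (simp add: if_distrib[of "%x. x * _"] cong: if_cong)
 finally show ?thesis .
qed

text \<open>A scalar matrix that commutes with a matrix commutes with its inverse: insert
  \<open>Z\<close> times \<open>X'\<close> on the left, move \<open>T\<close> past
  \<open>X'\<close>, then cancel \<open>X'\<close> against \<open>Z\<close> on the right.\<close>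

lemma matrix_cong_commute:
 assumes Q: "finite Q" and i: "i : Q" "k : Q"
  and ZX: "!!a b. a : Q ==> b : Q ==> (\<Sum>c\<in>Q. Z a c * X' c b) \<asymp> (if a = b then 1 else 0)"
  and XZ: "!!a b. a : Q ==> b : Q ==> (\<Sum>c\<in>Q. X' a c * Z c b) \<asymp> (if a = b then 1 else 0)"
  and TX: "!!a b. a : Q ==> b : Q ==> (\<Sum>c\<in>Q. pscale (T a c) (X' c b)) \<asymp> (\<Sum>c\<in>Q. pscale (T c b) (X' a c))"
 shows "(\<Sum>c\<in>Q. pscale (T i c) (Z c k)) \<asymp> (\<Sum>c\<in>Q. pscale (T c k) (Z i c))"
proof -
 have "(\<Sum>c\<in>Q. pscale (T i c) (Z c k)) = (\<Sum>b\<in>Q. (if i = b then 1 else 0) * (\<Sum>c\<in>Q. pscale (T b c) (Z c k)))"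
  using Q i by (simp add: if_distrib[of "%x. x * _"] cong: if_cong)
 also have "... \<asymp> (\<Sum>b\<in>Q. (\<Sum>a\<in>Q. Z i a * X' a b) * (\<Sum>c\<in>Q. pscale (T b c) (Z c k)))"
  by (intro cong_sum cong_mult_right cong_sym[OF ZX] i)
 also have "... = (\<Sum>b\<in>Q. \<Sum>c\<in>Q. \<Sum>a\<in>Q. pscale (T b c) (Z i a * (X' a b * Z c k)))"
  by (simp add: sum_distrib_left sum_distrib_right pscale_mult pscale_sum mult.assoc)
 also have "... = (\<Sum>a\<in>Q. \<Sum>c\<in>Q. \<Sum>b\<in>Q. pscale (T b c) (Z i a * (X' a b * Z c k)))"
 proof -
  have "(\<Sum>b\<in>Q. \<Sum>c\<in>Q. \<Sum>a\<in>Q. f a b c) = (\<Sum>a\<in>Q. \<Sum>c\<in>Q. \<Sum>b\<in>Q. f a b c)" for f :: "_ => _ => _ => 'k free"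
  proof -
   have "(\<Sum>b\<in>Q. \<Sum>c\<in>Q. \<Sum>a\<in>Q. f a b c) = (\<Sum>b\<in>Q. \<Sum>a\<in>Q. \<Sum>c\<in>Q. f a b c)"
    by (rule sum.cong[OF refl sum.swap])
   also have "... = (\<Sum>a\<in>Q. \<Sum>b\<in>Q. \<Sum>c\<in>Q. f a b c)" by (rule sum.swap)
   also have "... = (\<Sum>a\<in>Q. \<Sum>c\<in>Q. \<Sum>b\<in>Q. f a b c)" by (rule sum.cong[OF refl sum.swap])
   finally show ?thesis .
  qed
  then show ?thesis .
 qed
 also have "... = (\<Sum>a\<in>Q. \<Sum>c\<in>Q. Z i a * ((\<Sum>b\<in>Q. pscale (T b c) (X' a b)) * Z c k))"
  by (simp add: sum_distrib_left sum_distrib_right pscale_mult pscale_sum mult.assoc)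
 also have "... \<asymp> (\<Sum>a\<in>Q. \<Sum>c\<in>Q. Z i a * ((\<Sum>b\<in>Q. pscale (T a b) (X' b c)) * Z c k))"
  by (intro cong_sum cong_mult_left cong_mult_right cong_sym[OF TX])
 also have "... = (\<Sum>a\<in>Q. \<Sum>c\<in>Q. \<Sum>b\<in>Q. pscale (T a b) (Z i a * (X' b c * Z c k)))"
  by (simp add: sum_distrib_left sum_distrib_right pscale_mult pscale_sum mult.assoc)
 also have "... = (\<Sum>a\<in>Q. \<Sum>b\<in>Q. \<Sum>c\<in>Q. pscale (T a b) (Z i a * (X' b c * Z c k)))"
  by (rule sum.cong[OF refl sum.swap])
 also have "... = (\<Sum>a\<in>Q. \<Sum>b\<in>Q. pscale (T a b) (Z i a * (\<Sum>c\<in>Q. X' b c * Z c k)))"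
  by (simp add: sum_distrib_left pscale_sum)
 also have "... \<asymp> (\<Sum>a\<in>Q. \<Sum>b\<in>Q. pscale (T a b) (Z i a * (if b = k then 1 else 0)))"
  by (intro cong_sum cong_pscale cong_mult_left XZ i)
 also have "... = (\<Sum>a\<in>Q. \<Sum>b\<in>Q. (if b = k then pscale (T a b) (Z i a) else 0))"
  by (intro sum.cong refl) (simp add: pscale_simps)
 also have "... = (\<Sum>c\<in>Q. pscale (T c k) (Z i c))"
  using Q i by simp
 finally show ?thesis .
qed

end

lemma inv_sign_Cons:
 assumes "distinct L"
 shows "inv_sign t (r # L) = (if r : set L then 0 else t ^ card {s : set L. s < r} * inv_sign t L)"
proof -
 have "prod_list (map (%y. if r < y then 1 else if y < r then t else 0) L) = (\<Prod>y\<in>set L. if r < y then 1 else if y < r then t else 0)"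
  by (rule prod.distinct_set_conv_list[OF assms, symmetric])
 also have "... = (if r : set L then 0 else t ^ card {s : set L. s < r})"
 proof (cases "r : set L")
  case True
  then show ?thesis by (auto intro!: prod_zero bexI[of _ r])
 next
  case False
  have "(\<Prod>y\<in>set L. if r < y then 1 else if y < r then t else 0) = (\<Prod>y\<in>{s : set L. s < r}. t)"
   by (rule prod.mono_neutral_cong_right) (use False in \<open>auto simp: not_less le_less\<close>)
  then show ?thesis using False by simp
 qed
 finally show ?thesis by simp
qed

lemma inv_sign_snoc:
 "inv_sign t (l @ [i]) = prod_list (map (%y. if y < i then 1 else if i < y then t else 0) l) * inv_sign t l"
 by (induction l) auto

lemma inv_sign_last:
 assumes "distinct L"
 shows "inv_sign t (L @ [r]) = (if r : set L then 0 else t ^ card {s : set L. r < s} * inv_sign t L)"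
proof -
 have "prod_list (map (%y. if y < r then 1 else if r < y then t else 0) L) = (\<Prod>y\<in>set L. if y < r then 1 else if r < y then t else 0)"
  by (rule prod.distinct_set_conv_list[OF assms, symmetric])
 also have "... = (if r : set L then 0 else t ^ card {s : set L. r < s})"
 proof (cases "r : set L")
  case True
  then show ?thesis by (auto intro!: prod_zero bexI[of _ r])
 next
  case False
  have "(\<Prod>y\<in>set L. if y < r then 1 else if r < y then t else 0) = (\<Prod>y\<in>{s : set L. r < s}. t)"
   by (rule prod.mono_neutral_cong_right) (use False in \<open>auto simp: not_less le_less\<close>)
  then show ?thesis using False by simp
 qed
 finally show ?thesis by (simp add: inv_sign_snoc)
qed

text \<open>The Hecke operator T, with (T - q)(T + 1) = 0, on the tensor square of the n-dimensional
  space. The quadratic relations of A(n) say that T commutes with the matrix of products c_ia c_jb,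
  a form that survives both inversion and comultiplication.\<close>

definition hecke :: "'k::field => nat \<times> nat => nat \<times> nat => 'k" where
 "hecke q = (%(i, j) (a, b). (if a = j & b = i then (if i < j then 1 else q) else 0) +
   (if j < i & a = i & b = j then q - 1 else 0))"

lemma hecke_row_sum:
 assumes "finite N" "i : N" "j : N"
 shows "(\<Sum>p\<in>N \<times> N. pscale (hecke q (i, j) p) (f p)) =
  (if i < j then f (j, i) else if i = j then pscale q (f (i, i)) else pscale (q - 1) (f (i, j)) + pscale q (f (j, i)))"
proof -
 have "(\<Sum>p\<in>N \<times> N. pscale (hecke q (i, j) p) (f p)) =
  (\<Sum>p\<in>{(j, i), (i, j)}. pscale (hecke q (i, j) p) (f p))"
  by (rule sum.mono_neutral_right) (use assms in \<open>auto simp: hecke_def pscale_simps split: if_splits\<close>)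
 then show ?thesis by (cases "i = j") (auto simp: hecke_def pscale_simps)
qed

lemma hecke_col_sum:
 assumes "finite N" "r : N" "s : N"
 shows "(\<Sum>p\<in>N \<times> N. pscale (hecke q p (r, s)) (f p)) =
  (if s < r then f (s, r) + pscale (q - 1) (f (r, s)) else pscale q (f (s, r)))"
proof -
 have "(\<Sum>p\<in>N \<times> N. pscale (hecke q p (r, s)) (f p)) =
  (\<Sum>p\<in>{(s, r), (r, s)}. pscale (hecke q p (r, s)) (f p))"
  by (rule sum.mono_neutral_right) (use assms in \<open>auto simp: hecke_def pscale_simps split: if_splits\<close>)
 then show ?thesis by (cases "s = r") (auto simp: hecke_def pscale_simps)
qed

lemma power_mult_inverse_neg:
 assumes "q ~= (0 :: 'k::field)"
 shows "(- 1 / q) ^ m * (- q) ^ m = 1" "q ^ m * (-1 / q) ^ m = (-1) ^ m"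
proof -
 have "(- 1 / q) ^ m * (- q) ^ m = ((- 1 / q) * (- q)) ^ m" by (rule power_mult_distrib[symmetric])
 then show "(- 1 / q) ^ m * (- q) ^ m = 1" using assms by simp
 have "q ^ m * (- 1 / q) ^ m = (q * (- 1 / q)) ^ m" by (rule power_mult_distrib[symmetric])
 then show "q ^ m * (-1 / q) ^ m = (-1) ^ m" using assms by simp
qed

locale qgl_functionals = shift_closed \<Phi> for \<Phi> :: "(gen list => 'k::field) set" +
 fixes n :: nat and q :: 'k
 assumes q: "q ~= 0"
  and rel_row: "i : {1..n} ==> r : {1..n} ==> s : {1..n} ==> gc i r * gc i s \<asymp> gc i s * gc i r"
  and rel_q: "i : {1..n} ==> j : {1..n} ==> r : {1..n} ==> s : {1..n} ==> i < j ==> r \<le> s ==>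
   gc j r * gc i s \<asymp> pscale q (gc i s * gc j r)"
  and rel_cross: "i : {1..n} ==> j : {1..n} ==> r : {1..n} ==> s : {1..n} ==> i < j ==> r < s ==>
   gc j s * gc i r \<asymp> gc i r * gc j s + pscale (q - 1) (gc i s * gc j r)"
  and det_Dinv: "qdet n * gen_elt Dinv \<asymp> 1" and Dinv_det: "gen_elt Dinv * qdet n \<asymp> 1"
begin

abbreviation "N \<equiv> {1..n}"
text \<open>Within a column, entries q-commute, so exchanging two columns of a determinant expanded
  by columns gives -1/q in place of -1.\<close>

abbreviation "t \<equiv> - 1 / q"
abbreviation "gcT \<equiv> %r i. gc i r :: 'k free"
abbreviation "sl \<equiv> sorted_list_of_set :: nat set => nat list"
abbreviation "row_det A B \<equiv> skew_det (-1) (%i r. gc i r :: 'k free) (sl A) B"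
abbreviation "col_det A B \<equiv> skew_det t gcT (sl B) A"

lemma row_det_sort: "set l \<subseteq> N ==> skew_det (-1) (%i r. gc i r) l N \<asymp>
  pscale (inv_sign (-1) l) (skew_det (-1) (%i r. gc i r) (sort l) N)"
proof (rule skew_det_sort[where A = N])
 fix a b r s assume *: "a : N" "b : N" "r : N" "s : N" "b < a" "r < s"
 show "gc a r * gc b s + pscale (- 1) (gc a s * gc b r) \<asymp> pscale (- 1) (gc b r * gc a s + pscale (- 1) (gc b s * gc a r))"
  unfolding cong_free_def
 proof
  fix ph assume ph: "ph : \<Phi>"
  have "ev ph (gc a r * gc b s) = q * ev ph (gc b s * gc a r)"
   using rel_q[of b a r s] * ph unfolding cong_free_def by (simp add: ev_pscale)
  moreover have "ev ph (gc a s * gc b r) = ev ph (gc b r * gc a s) + (q - 1) * ev ph (gc b s * gc a r)"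
   using rel_cross[of b a r s] * ph unfolding cong_free_def by (simp add: ev_pscale ev_add ev_diff ev_uminus)
  ultimately show "ev ph (gc a r * gc b s + pscale (- 1) (gc a s * gc b r)) = ev ph (pscale (- 1) (gc b r * gc a s + pscale (- 1) (gc b s * gc a r)))"
   by (simp add: ev_add ev_pscale ev_diff ev_uminus algebra_simps)
 qed
next
 fix a r s assume *: "a : N" "r : N" "s : N" "r < s"
 show "gc a r * gc a s + pscale (- 1) (gc a s * gc a r) \<asymp> 0"
  using rel_row[of a r s] * unfolding cong_free_def by (simp add: ev_add ev_pscale ev_diff ev_uminus)
qed simp

lemma col_det_sort: "set l \<subseteq> N ==> skew_det t gcT l N \<asymp> pscale (inv_sign t l) (skew_det t gcT (sort l) N)"
proof (rule skew_det_sort[where A = N])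
 fix a b r s assume *: "a : N" "b : N" "r : N" "s : N" "b < a" "r < s"
 show "gc r a * gc s b + pscale t (gc s a * gc r b) \<asymp> pscale t (gc r b * gc s a + pscale t (gc s b * gc r a))"
  unfolding cong_free_def
 proof
  fix ph assume ph: "ph : \<Phi>"
  have e1: "ev ph (gc s b * gc r a) = q * ev ph (gc r a * gc s b)"
   using rel_q[of r s b a] * ph unfolding cong_free_def by (simp add: ev_pscale)
  have e2: "ev ph (gc s a * gc r b) = ev ph (gc r b * gc s a) + (q - 1) * ev ph (gc r a * gc s b)"
   using rel_cross[of r s b a] * ph unfolding cong_free_def by (simp add: ev_pscale ev_add ev_diff ev_uminus)
  show "ev ph (gc r a * gc s b + pscale t (gc s a * gc r b)) = ev ph (pscale t (gc r b * gc s a + pscale t (gc s b * gc r a)))"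
   using q by (simp add: ev_add ev_pscale ev_diff ev_uminus e1 e2) (simp add: field_simps)
 qed
next
 fix a r s assume *: "a : N" "r : N" "s : N" "r < s"
 show "gc r a * gc s a + pscale t (gc s a * gc r a) \<asymp> 0"
  unfolding cong_free_def
 proof
  fix ph assume ph: "ph : \<Phi>"
  have e1: "ev ph (gc s a * gc r a) = q * ev ph (gc r a * gc s a)"
   using rel_q[of r s a a] * ph unfolding cong_free_def by (simp add: ev_pscale)
  show "ev ph (gc r a * gc s a + pscale t (gc s a * gc r a)) = ev ph 0"
   using q by (simp add: ev_add ev_pscale ev_diff ev_uminus e1)
 qed
qed simp

text \<open>The smallest column \<open>j0\<close> is separated; every other column has
  \<open>j0\<close> below it, hence the exponent raised by one.\<close>

lemma skew_det_first:
 assumes A: "finite A" "A ~= {}" and B: "finite B" "j0 : B" "!!b. b : B ==> j0 \<le> b"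
 shows "skew_det u x (sl A) B = x (Min A) j0 * skew_det u x (sl (A - {Min A})) (B - {j0}) +
  (\<Sum>r\<in>B - {j0}. pscale (u ^ Suc (card {s : B - {j0}. s < r})) (x (Min A) r * skew_det u x (sl (A - {Min A})) (B - {r})))"
proof -
 have "{s : B. s < j0} = {}" by (metis (no_types, lifting) B(3) Collect_empty_eq leD)
 then have 0: "card {s : B. s < j0} = 0" by simp
 have "skew_det u x (sl A) B = skew_det u x (Min A # sl (A - {Min A})) B"
  by (simp only: sorted_list_of_set_nonempty[OF A])
 also have "... = x (Min A) j0 * skew_det u x (sl (A - {Min A})) (B - {j0}) +
  (\<Sum>r\<in>B - {j0}. pscale (u ^ card {s : B. s < r}) (x (Min A) r * skew_det u x (sl (A - {Min A})) (B - {r})))"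
  unfolding skew_det.simps sum.remove[OF B(1,2)] 0 by (simp add: pscale_simps)
 also have "(\<Sum>r\<in>B - {j0}. pscale (u ^ card {s : B. s < r}) (x (Min A) r * skew_det u x (sl (A - {Min A})) (B - {r}))) =
  (\<Sum>r\<in>B - {j0}. pscale (u ^ Suc (card {s : B - {j0}. s < r})) (x (Min A) r * skew_det u x (sl (A - {Min A})) (B - {r})))"
 proof (rule sum.cong[OF refl])
  fix r assume "r : B - {j0}"
  then have "j0 < r" using B(3)[of r] by auto
  then have "card {s : B. s < r} = Suc (card {s : B - {j0}. s < r})"
   using card_less_remove[OF B(1,2), of r] by simp
  then show "pscale (u ^ card {s : B. s < r}) (x (Min A) r * skew_det u x (sl (A - {Min A})) (B - {r})) =
   pscale (u ^ Suc (card {s : B - {j0}. s < r})) (x (Min A) r * skew_det u x (sl (A - {Min A})) (B - {r}))" by (simp only:)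
 qed
 finally show ?thesis .
qed

text \<open>Induction on the size. One side is expanded by the first row, the other by the first
  column, and each remaining minor is expanded the other way, which the induction hypothesis allows.
  The corner terms agree at once; the others contain c_(i0,r) and c_(i,j0) in opposite orders, and
  the exchange costs \<open>q\<close>, which accounts for -1/q on one side and -1 on the
  other.\<close>

lemma row_det_cong_col_det:
 "A \<subseteq> N ==> B \<subseteq> N ==> card A = card B ==> row_det A B \<asymp> col_det A B"
proof (induction "card A" arbitrary: A B rule: less_induct)
 case less
 have fA: "finite A" and fB: "finite B" using less.prems by (auto intro: finite_subset)
 show ?case
 proof (cases "A = {}")
  case True
  then have "B = {}" using less.prems(3) fB by simp
  then show ?thesis using True by simp
 next
  case False
  then have "B ~= {}" using less.prems(3) fA by auto
  define i0 where "i0 = Min A"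
  define j0 where "j0 = Min B"
  have i0: "i0 : A" "!!i. i : A ==> i0 \<le> i" unfolding i0_def using fA False by auto
  have j0: "j0 : B" "!!b. b : B ==> j0 \<le> b" unfolding j0_def using fB \<open>B ~= {}\<close> by auto
  define A' where "A' = A - {i0}"
  define B' where "B' = B - {j0}"
  have cA: "card A = Suc (card A')" and cB: "card B = Suc (card B')"
   unfolding A'_def B'_def using card_Suc_Diff1[OF fA i0(1)] card_Suc_Diff1[OF fB j0(1)] by simp_all
  have sub: "A' \<subseteq> N" "B' \<subseteq> N" "finite A'" "finite B'" using less.prems fA fB by (auto simp: A'_def B'_def)
  have minB: "Min (B - {r}) = j0" "B - {r} ~= {}" "(B - {r}) - {j0} = B' - {r}" if "r : B'" for r
   using that j0 fB by (auto simp: B'_def intro!: Min_eqI)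
  have minA: "Min (A - {i}) = i0" "A - {i} ~= {}" "(A - {i}) - {i0} = A' - {i}" if "i : A'" for i
   using that i0 fA by (auto simp: A'_def intro!: Min_eqI)
  define cb where "cb r = card {s : B'. s < r}" for r
  define ca where "ca i = card {s : A'. s < i}" for i
  define Z where "Z i r = col_det (A' - {i}) (B' - {r})" for i r
  have c1: "card (A' - {i}) = card (B' - {r})" if "i : A'" "r : B'" for i r
   using cA cB less.prems(3) that by simp
  have row: "row_det A' (B - {r}) \<asymp> (\<Sum>i\<in>A'. pscale (t ^ ca i) (gc i j0 * Z i r))" if r: "r : B'" for r
  proof -
   have "row_det A' (B - {r}) \<asymp> col_det A' (B - {r})"
    by (rule less.hyps) (use cA cB less.prems sub r in \<open>auto simp: B'_def\<close>)
   also have "col_det A' (B - {r}) = skew_det t gcT (j0 # sl (B' - {r})) A'"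
    using sorted_list_of_set_nonempty[of "B - {r}"] fB minB[OF r] by simp
   also have "... = (\<Sum>i\<in>A'. pscale (t ^ ca i) (gc i j0 * Z i r))"
    by (simp add: ca_def Z_def)
   finally show ?thesis .
  qed
  have col: "col_det (A - {i}) B' \<asymp> (\<Sum>r\<in>B'. pscale ((-1) ^ cb r) (gc i0 r * Z i r))" if i: "i : A'" for i
  proof -
   have "row_det (A - {i}) B' \<asymp> col_det (A - {i}) B'"
    by (rule less.hyps) (use cA cB less.prems sub i fA in \<open>auto simp: A'_def\<close>)
   then have "col_det (A - {i}) B' \<asymp> row_det (A - {i}) B'" by (rule cong_sym)
   also have "row_det (A - {i}) B' = skew_det (-1) (%i r. gc i r) (i0 # sl (A' - {i})) B'"
    using sorted_list_of_set_nonempty[of "A - {i}"] fA minA[OF i] by simp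
   also have "... = (\<Sum>r\<in>B'. pscale ((-1) ^ cb r) (gc i0 r * row_det (A' - {i}) (B' - {r})))"
    by (simp add: cb_def)
   also have "... \<asymp> (\<Sum>r\<in>B'. pscale ((-1) ^ cb r) (gc i0 r * Z i r))"
    unfolding Z_def
   proof (intro cong_sum cong_pscale cong_mult_left)
    fix r assume r: "r : B'"
    have "card (A' - {i}) < card A" using cA card_Diff1_le[of A' i] by simp
    then show "row_det (A' - {i}) (B' - {r}) \<asymp> col_det (A' - {i}) (B' - {r})"
     by (rule less.hyps[OF _ _ _ c1[OF i r]]) (use sub in auto)
   qed
   finally show ?thesis .
  qed
  have base: "row_det A' B' \<asymp> col_det A' B'"
   by (rule less.hyps) (use cA cB less.prems sub in auto)
  have "row_det A B = gc i0 j0 * row_det A' B' + (\<Sum>r\<in>B'. pscale ((-1) ^ Suc (cb r)) (gc i0 r * row_det A' (B - {r})))"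
   using skew_det_first[OF fA False fB j0(1) j0(2), of "-1" "%i r. gc i r"] by (simp add: i0_def A'_def B'_def cb_def)
  also have "... \<asymp> gc i0 j0 * col_det A' B' + (\<Sum>r\<in>B'. pscale ((-1) ^ Suc (cb r)) (gc i0 r * (\<Sum>i\<in>A'. pscale (t ^ ca i) (gc i j0 * Z i r))))"
   by (intro cong_add cong_sum cong_pscale cong_mult_left base row)
  also have "... = gc i0 j0 * col_det A' B' + (\<Sum>r\<in>B'. \<Sum>i\<in>A'. pscale ((-1) ^ Suc (cb r) * t ^ ca i) (gc i0 r * gc i j0 * Z i r))"
   by (simp add: sum_distrib_left pscale_sum pscale_mult pscale_simps mult.assoc)
  also have "... = gc i0 j0 * col_det A' B' + (\<Sum>i\<in>A'. \<Sum>r\<in>B'. pscale ((-1) ^ Suc (cb r) * t ^ ca i) (gc i0 r * gc i j0 * Z i r))"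
   by (subst sum.swap) (rule refl)
  \<comment> \<open>\<open>rel_q\<close> applies because i0 < i and j0 \<le> r, and \<open>t\<close>
    times \<open>q\<close> is -1.\<close>
  also have "... \<asymp> gc i0 j0 * col_det A' B' + (\<Sum>i\<in>A'. \<Sum>r\<in>B'. pscale (t ^ Suc (ca i) * (-1) ^ cb r) (gc i j0 * gc i0 r * Z i r))"
  proof (intro cong_add cong_refl cong_sum)
   fix i r assume i: "i : A'" and r: "r : B'"
   have "i0 < i" "j0 \<le> r" "i0 : N" "j0 : N" "i : N" "r : N"
    using i r i0 j0 less.prems by (auto simp: A'_def B'_def order.strict_iff_order)
   then have "gc i j0 * gc i0 r \<asymp> pscale q (gc i0 r * gc i j0)" by (intro rel_q)
   then have "pscale (t ^ Suc (ca i) * (-1) ^ cb r) (gc i j0 * gc i0 r * Z i r) \<asymp>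
    pscale (t ^ Suc (ca i) * (-1) ^ cb r) (pscale q (gc i0 r * gc i j0) * Z i r)"
    by (intro cong_pscale cong_mult_right)
   also have "... = pscale ((-1) ^ Suc (cb r) * t ^ ca i) (gc i0 r * gc i j0 * Z i r)"
    using q by (simp add: pscale_mult pscale_simps mult.commute)
   finally show "pscale ((-1) ^ Suc (cb r) * t ^ ca i) (gc i0 r * gc i j0 * Z i r) \<asymp>
    pscale (t ^ Suc (ca i) * (-1) ^ cb r) (gc i j0 * gc i0 r * Z i r)" by (rule cong_sym)
  qed
  also have "... = gc i0 j0 * col_det A' B' + (\<Sum>i\<in>A'. pscale (t ^ Suc (ca i)) (gc i j0 * (\<Sum>r\<in>B'. pscale ((-1) ^ cb r) (gc i0 r * Z i r))))"
   by (simp add: sum_distrib_left pscale_sum pscale_mult pscale_simps mult.assoc)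
  also have "... \<asymp> gc i0 j0 * col_det A' B' + (\<Sum>i\<in>A'. pscale (t ^ Suc (ca i)) (gc i j0 * col_det (A - {i}) B'))"
   by (intro cong_add cong_refl cong_sum cong_pscale cong_mult_left cong_sym[OF col])
  also have "... = col_det A B"
   using skew_det_first[OF fB \<open>B ~= {}\<close> fA i0(1) i0(2), of t gcT] by (simp add: j0_def A'_def B'_def ca_def)
  finally show ?thesis .
 qed
qed

section \<open>Laplace expansions and the two-sided inverse matrix\<close>

definition minor :: "nat => nat => 'k free" where
 "minor a b = row_det (N - {a}) (N - {b})"

lemma minor_col: "a : N ==> b : N ==> minor a b \<asymp> col_det (N - {a}) (N - {b})"
 unfolding minor_def by (rule row_det_cong_col_det) auto

lemma qdet_row: "row_det N N = qdet n"
 unfolding qdet_eq_skew_det sorted_list_of_set_upto ..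

lemma qdet_col: "col_det N N \<asymp> qdet n"
 using cong_sym[OF row_det_cong_col_det[of N N]] qdet_row by simp

lemma card_less_N: "r : N ==> card {s : N. s < r} = r - 1" "r : N ==> card {s : N. r < s} = n - r"
proof -
 assume r: "r : N"
 have "{s : N. s < r} = {1..<r}" "{s : N. r < s} = {Suc r..n}" using r by auto
 then show "card {s : N. s < r} = r - 1" "card {s : N. r < s} = n - r" by simp_all
qed

text \<open>Adding row i in front of or behind all rows but k repeats a row unless i = k; in that
  case moving it into place passes k - 1 or n - k rows.\<close>

lemma laplace_sign:
 assumes k: "k : N" and i: "i : N"
 shows "inv_sign u (i # sl (N - {k})) = (if i = k then u ^ (k - 1) else 0)"
  "inv_sign u (sl (N - {k}) @ [i]) = (if i = k then u ^ (n - k) else 0)"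
  "sort (k # sl (N - {k})) = sl N" "sort (sl (N - {k}) @ [k]) = sl N"
proof -
 have d: "distinct (sl (N - {k}))" and s: "set (sl (N - {k})) = N - {k}" by simp_all
 have e: "inv_sign u (sl (N - {k})) = 1" by (rule inv_sign_sorted) simp_all
 have c1: "card {s : N - {k}. s < k} = k - 1" using card_less_N(1)[OF k] card_less_remove[OF _ k, of k] by simp
 have c2: "card {s : N - {k}. k < s} = n - k" using card_less_N(2)[OF k] card_greater_remove[OF _ k, of k] by simp
 show "inv_sign u (i # sl (N - {k})) = (if i = k then u ^ (k - 1) else 0)"
  unfolding inv_sign_Cons[OF d] s e using i c1 by auto
 show "inv_sign u (sl (N - {k}) @ [i]) = (if i = k then u ^ (n - k) else 0)"
  unfolding inv_sign_last[OF d] s e using i c2 by auto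
 have "sl N = insort k (sl (N - {k}))"
  using sorted_list_of_set_insert_remove[of N k] unfolding insert_absorb[OF k] by (simp only: finite_atLeastAtMost simp_thms)
 then show "sort (k # sl (N - {k})) = sl N"
  by (simp only: sort_key_simps sorted_sort_id[OF sorted_sorted_list_of_set])
 then show "sort (sl (N - {k}) @ [k]) = sl N"
  by (metis mset.simps(2) mset_append append.right_neutral add_mset_add_single mset.simps(1) properties_for_sort sorted_sort mset_sort)
qed

text \<open>This expands the determinant with rows i followed by all rows but k, which repeats a row
  unless i = k. The two variants after it do the same with columns.\<close>

lemma laplace_row_front:
 assumes "i : N" "k : N"
 shows "(\<Sum>r\<in>N. pscale ((-1) ^ (r - 1)) (gc i r * minor k r)) \<asymp> (if i = k then pscale ((-1) ^ (k - 1)) (qdet n) else 0)"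
proof -
 have "(\<Sum>r\<in>N. pscale ((-1) ^ (r - 1)) (gc i r * minor k r)) = skew_det (-1) (%i r. gc i r) (i # sl (N - {k})) N"
  unfolding skew_det.simps minor_def by (intro sum.cong refl) (simp only: card_less_N)
 also have "... \<asymp> pscale (inv_sign (-1) (i # sl (N - {k}))) (skew_det (-1) (%i r. gc i r) (sort (i # sl (N - {k}))) N)"
  by (rule row_det_sort) (use assms in auto)
 also have "... = (if i = k then pscale ((-1) ^ (k - 1)) (qdet n) else 0)"
  unfolding laplace_sign(1)[OF assms(2,1)] using laplace_sign(3)[OF assms(2,1)] qdet_row
  by (auto simp: pscale_simps simp del: skew_det.simps)
 finally show ?thesis .
qed

lemma laplace_col_front:
 assumes "j : N" "k : N"
 shows "(\<Sum>i\<in>N. pscale (t ^ (i - 1)) (gc i j * minor i k)) \<asymp> (if j = k then pscale (t ^ (k - 1)) (qdet n) else 0)"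
proof -
 have "(\<Sum>i\<in>N. pscale (t ^ (i - 1)) (gc i j * minor i k)) \<asymp> (\<Sum>i\<in>N. pscale (t ^ (i - 1)) (gc i j * col_det (N - {i}) (N - {k})))"
  by (intro cong_sum cong_pscale cong_mult_left minor_col assms)
 also have "... = skew_det t gcT (j # sl (N - {k})) N"
  unfolding skew_det.simps by (intro sum.cong refl) (simp only: card_less_N)
 also have "... \<asymp> pscale (inv_sign t (j # sl (N - {k}))) (skew_det t gcT (sort (j # sl (N - {k}))) N)"
  by (rule col_det_sort) (use assms in auto)
 also have "... = (if j = k then pscale (t ^ (k - 1)) (col_det N N) else 0)"
  unfolding laplace_sign(1)[OF assms(2,1)] using laplace_sign(3)[OF assms(2,1)]
  by (auto simp: pscale_simps simp del: skew_det.simps)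
 also have "... \<asymp> (if j = k then pscale (t ^ (k - 1)) (qdet n) else 0)"
  by (cases "j = k") (simp_all only: if_True if_False simp_thms cong_refl cong_pscale[OF qdet_col])
 finally show ?thesis .
qed

text \<open>Expansion along the last column puts the generator to the right of the minor, as a left
  inverse of the matrix requires.\<close>

lemma laplace_col_back:
 assumes "j : N" "k : N"
 shows "(\<Sum>i\<in>N. pscale (t ^ (n - i)) (minor i k * gc i j)) \<asymp> (if j = k then pscale (t ^ (n - k)) (qdet n) else 0)"
proof -
 have c: "card N = Suc (length (sl (N - {k})))" using assms(2) by simp
 have "(\<Sum>i\<in>N. pscale (t ^ (n - i)) (minor i k * gc i j)) \<asymp> (\<Sum>i\<in>N. pscale (t ^ (n - i)) (col_det (N - {i}) (N - {k}) * gc i j))"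
  by (intro cong_sum cong_pscale cong_mult_right minor_col assms)
 also have "... = skew_det t gcT (sl (N - {k}) @ [j]) N"
  unfolding skew_det_last[OF finite_atLeastAtMost c] by (intro sum.cong refl) (simp only: card_less_N)
 also have "... \<asymp> pscale (inv_sign t (sl (N - {k}) @ [j])) (skew_det t gcT (sort (sl (N - {k}) @ [j])) N)"
  by (rule col_det_sort) (use assms in auto)
 also have "... = (if j = k then pscale (t ^ (n - k)) (col_det N N) else 0)"
  unfolding laplace_sign(2)[OF assms(2,1)] using laplace_sign(4)[OF assms(2,1)]
  by (auto simp: pscale_simps simp del: skew_det.simps)
 also have "... \<asymp> (if j = k then pscale (t ^ (n - k)) (qdet n) else 0)"
  by (cases "j = k") (simp_all only: if_True if_False simp_thms cong_refl cong_pscale[OF qdet_col])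
 finally show ?thesis .
qed

text \<open>The inverse of the matrix of generators, i.e. the values of the antipode on the generators.\<close>

definition y :: "nat => nat => 'k free" where
 "y r k = pscale ((-1) ^ (r + k)) (minor k r * gen_elt Dinv)"

lemma gc_y:
 assumes "i : N" "k : N"
 shows "(\<Sum>r\<in>N. gc i r * y r k) \<asymp> (if i = k then 1 else 0)"
proof -
 \<comment> \<open>Natural subtraction is harmless because r and k are at least 1; the surplus 2
   does not affect the sign.\<close>
 have "(-1) ^ (r + k) = ((-1) ^ (k - 1) * (-1) ^ (r - 1) :: 'k)" if "r : N" for r
 proof -
  have "r + k = (k - 1) + (r - 1) + 2" using that assms by auto
  then show ?thesis by (simp only: power_add) simp
 qed
 then have "(\<Sum>r\<in>N. gc i r * y r k) = pscale ((-1) ^ (k - 1)) ((\<Sum>r\<in>N. pscale ((-1) ^ (r - 1)) (gc i r * minor k r)) * gen_elt Dinv)"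
  unfolding y_def sum_distrib_right pscale_sum by (intro sum.cong refl) (simp add: pscale_mult pscale_simps mult.assoc)
 also have "... \<asymp> pscale ((-1) ^ (k - 1)) ((if i = k then pscale ((-1) ^ (k - 1)) (qdet n) else 0) * gen_elt Dinv)"
  by (intro cong_pscale cong_mult_right laplace_row_front assms)
 also have "... = (if i = k then qdet n * gen_elt Dinv else 0)"
  by (simp add: pscale_mult pscale_simps power_mult_distrib[symmetric])
 also have "... \<asymp> (if i = k then 1 else 0)" by (simp add: det_Dinv)
 finally show ?thesis .
qed

text \<open>A second candidate for the inverse, with \<open>Dinv\<close> on the left. The power of
  -q undoes the power of -1/q left by \<open>laplace_col_back\<close>.\<close>

lemma left_inverse_aux:
 assumes "k : N" "j : N"
 shows "(\<Sum>i\<in>N. pscale (t ^ (n - i) * (- q) ^ (n - k)) (gen_elt Dinv * minor i k) * gc i j) \<asymp> (if k = j then 1 else 0)"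
proof -
 have "(\<Sum>i\<in>N. pscale (t ^ (n - i) * (- q) ^ (n - k)) (gen_elt Dinv * minor i k) * gc i j) =
  pscale ((- q) ^ (n - k)) (gen_elt Dinv * (\<Sum>i\<in>N. pscale (t ^ (n - i)) (minor i k * gc i j)))"
  unfolding sum_distrib_left pscale_sum by (intro sum.cong refl) (simp add: pscale_mult pscale_simps mult.assoc mult.commute)
 also have "... \<asymp> pscale ((- q) ^ (n - k)) (gen_elt Dinv * (if j = k then pscale (t ^ (n - k)) (qdet n) else 0))"
  by (intro cong_pscale cong_mult_left laplace_col_back assms)
 also have "... = (if k = j then gen_elt Dinv * qdet n else 0)"
  using power_mult_inverse_neg(1)[OF q, of "n - k"] by (auto simp: pscale_mult pscale_simps mult.commute)
 also have "... \<asymp> (if k = j then 1 else 0)" by (simp add: Dinv_det)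
 finally show ?thesis .
qed

text \<open>Left and right inverse coincide, and so \<open>Dinv\<close> passes a minor up to sign
  and a power of \<open>q\<close>, without any centrality of the determinant.\<close>

lemma y_left:
 assumes "k : N" "i : N"
 shows "y k i \<asymp> pscale (t ^ (n - i) * (- q) ^ (n - k)) (gen_elt Dinv * minor i k)"
 by (rule cong_sym, rule matrix_cong_unique[where Q = N and Z = "%k i. pscale (t ^ (n - i) * (- q) ^ (n - k)) (gen_elt Dinv * minor i k)"
   and X' = "%i r. gc i r"])
  ((rule finite_atLeastAtMost assms left_inverse_aux gc_y | assumption)+)

lemma y_gc:
 assumes "k : N" "j : N"
 shows "(\<Sum>i\<in>N. y k i * gc i j) \<asymp> (if k = j then 1 else 0)"
proof -
 have "(\<Sum>i\<in>N. y k i * gc i j) \<asymp> (\<Sum>i\<in>N. pscale (t ^ (n - i) * (- q) ^ (n - k)) (gen_elt Dinv * minor i k) * gc i j)"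
  by (intro cong_sum cong_mult_right y_left assms)
 also note left_inverse_aux[OF assms]
 finally show ?thesis .
qed

text \<open>In transposed order the matrices are inverse only up to the diagonal weights q^(n-i),
  which reflects that the square of the antipode is conjugation by this diagonal matrix. The weights
  come from the powers of -1/q in \<open>laplace_col_front\<close>, and the powers of
  \<open>q\<close> in \<open>tg\<close> and \<open>th_y\<close> compensate them.\<close>

lemma gc_y_transposed:
 assumes "j : N" "k : N"
 shows "(\<Sum>i\<in>N. pscale (q ^ (n - i)) (gc i j * y k i)) \<asymp> (if j = k then pscale (q ^ (n - k)) 1 else 0)"
proof -
 have e0: "q ^ (n - i) = q ^ (n - 1) * (-1) ^ (i - 1) * t ^ (i - 1)" if "i : N" for i
 proof -
  have "q ^ (n - 1) = q ^ (n - i) * q ^ (i - 1)" using that by (simp add: power_add[symmetric])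
  then have "q ^ (n - 1) * (-1) ^ (i - 1) * t ^ (i - 1) = q ^ (n - i) * (q ^ (i - 1) * t ^ (i - 1)) * (-1) ^ (i - 1)"
   by (simp add: mult_ac)
  also have "... = q ^ (n - i)" unfolding power_mult_inverse_neg(2)[OF q] by (simp add: power_mult_distrib[symmetric])
  finally show ?thesis by simp
 qed
 have sg: "(-1) ^ (k + i) = ((-1) ^ (k - 1) * (-1) ^ (i - 1) :: 'k)" if "i : N" for i
 proof -
  have "k + i = (k - 1) + (i - 1) + 2" using that assms by auto
  then show ?thesis by (simp only: power_add) simp
 qed
 have e: "q ^ (n - i) * (-1) ^ (k + i) = q ^ (n - 1) * (-1) ^ (k - 1) * t ^ (i - 1)" if "i : N" for i
 proof -
  have "(-1) ^ (i - 1) * (-1) ^ (i - 1) = (1 :: 'k)" by (simp add: power_mult_distrib[symmetric])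
  then show ?thesis unfolding e0[OF that] sg[OF that] by (simp add: mult_ac)
 qed
 have e': "q ^ (n - 1) * (-1) ^ (k - 1) * t ^ (k - 1) = q ^ (n - k)" using e0[OF assms(2)] by simp
 have "(\<Sum>i\<in>N. pscale (q ^ (n - i)) (gc i j * y k i)) = (\<Sum>i\<in>N. pscale (q ^ (n - 1) * (-1) ^ (k - 1) * t ^ (i - 1)) (gc i j * minor i k * gen_elt Dinv))"
  unfolding y_def by (intro sum.cong refl) (simp only: pscale_mult pscale_simps(4) e mult.assoc)
 also have "... = pscale (q ^ (n - 1) * (-1) ^ (k - 1)) ((\<Sum>i\<in>N. pscale (t ^ (i - 1)) (gc i j * minor i k)) * gen_elt Dinv)"
  unfolding sum_distrib_right pscale_sum by (simp add: pscale_mult pscale_simps)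
 also have "... \<asymp> pscale (q ^ (n - 1) * (-1) ^ (k - 1)) ((if j = k then pscale (t ^ (k - 1)) (qdet n) else 0) * gen_elt Dinv)"
  by (intro cong_pscale cong_mult_right laplace_col_front assms)
 also have "... = (if j = k then pscale (q ^ (n - k)) (qdet n * gen_elt Dinv) else 0)"
  by (simp only: pscale_mult pscale_simps(4) e' if_distrib[of "%x. x * _"] if_distrib[of "pscale _"] mult_zero_left pscale_simps(7))
 also have "... \<asymp> (if j = k then pscale (q ^ (n - k)) 1 else 0)" by (simp add: cong_pscale[OF det_Dinv])
 finally show ?thesis .
qed

text \<open>Case by case this is one of the three families of relations, or a combination of the
  last two.\<close>

lemma gc_hecke:
 assumes "i : N" "j : N" "r : N" "s : N"
 shows "(\<Sum>p\<in>N \<times> N. pscale (hecke q (i, j) p) (gc (fst p) r * gc (snd p) s)) \<asymp>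
  (\<Sum>p\<in>N \<times> N. pscale (hecke q p (r, s)) (gc i (fst p) * gc j (snd p)))"
 unfolding hecke_row_sum[OF finite_atLeastAtMost assms(1,2)] hecke_col_sum[OF finite_atLeastAtMost assms(3,4)] fst_conv snd_conv
 unfolding cong_free_def
proof
 fix ph assume ph: "ph : \<Phi>"
 have R: "ev ph (gc i r * gc i s) = ev ph (gc i s * gc i r)" if "i : N" "r : N" "s : N" for i r s
  using rel_row[OF that] ph by (simp add: cong_free_def)
 have Q: "ev ph (gc j r * gc i s) = q * ev ph (gc i s * gc j r)" if "i : N" "j : N" "r : N" "s : N" "i < j" "r \<le> s" for i j r s
  using rel_q[OF that] ph by (simp add: cong_free_def ev_pscale)
 have X: "ev ph (gc j s * gc i r) = ev ph (gc i r * gc j s) + (q - 1) * ev ph (gc i s * gc j r)" if "i : N" "j : N" "r : N" "s : N" "i < j" "r < s" for i j r s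
  using rel_cross[OF that] ph by (simp add: cong_free_def ev_pscale ev_add ev_diff ev_uminus)
 consider "i < j" "s < r" | "i < j" "r \<le> s" | "i = j" | "j < i" "s < r" | "j < i" "r = s" | "j < i" "r < s" by linarith
 then show "ev ph (if i < j then gc j r * gc i s else if i = j then pscale q (gc i r * gc i s)
   else pscale (q - 1) (gc i r * gc j s) + pscale q (gc j r * gc i s)) =
  ev ph (if s < r then gc i s * gc j r + pscale (q - 1) (gc i r * gc j s) else pscale q (gc i s * gc j r))"
 proof cases
  case 1
  then show ?thesis using X[of i j s r] assms by (simp add: ev_add ev_pscale ev_diff ev_uminus)
 next
  case 2
  then show ?thesis using Q[of i j r s] assms by (simp add: ev_add ev_pscale ev_diff ev_uminus)
 next
  case 3
  then show ?thesis using R[of i r s] assms by (simp add: ev_add ev_pscale ev_diff ev_uminus algebra_simps)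
 next
  case 4
  then show ?thesis using Q[of j i s r] assms by (simp add: ev_add ev_pscale ev_diff ev_uminus algebra_simps)
 next
  case 5
  then show ?thesis using Q[of j i r r] assms by (simp add: ev_add ev_pscale ev_diff ev_uminus algebra_simps)
 next
  case 6
  then show ?thesis using assms by (simp add: X[of j i r s] Q[of j i r s] ev_add ev_pscale ev_diff ev_uminus algebra_simps)
 qed
qed

text \<open>The inverse of the matrix of products c_ia c_jb has as entries products of two
  \<open>y\<close> in reversed order; by \<open>matrix_cong_commute\<close> it commutes with the
  Hecke operator as well. The commutation rules of the \<open>y\<close> are read off from
  this.\<close>

lemma y_hecke:
 assumes "i : N" "j : N" "r : N" "s : N"
 shows "(\<Sum>p\<in>N \<times> N. pscale (hecke q (i, j) p) (y (snd p) s * y (fst p) r)) \<asymp>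
  (\<Sum>p\<in>N \<times> N. pscale (hecke q p (r, s)) (y j (snd p) * y i (fst p)))"
proof -
 let ?X = "%p p'. gc (fst p) (fst p') * gc (snd p) (snd p') :: 'k free"
 let ?Z = "%p p'. y (snd p) (snd p') * y (fst p) (fst p')"
 have ZX: "(\<Sum>c\<in>N \<times> N. ?Z a c * ?X c b) \<asymp> (if a = b then 1 else 0)" if ab: "a : N \<times> N" "b : N \<times> N" for a b
 proof -
  have m: "fst a : N" "snd a : N" "fst b : N" "snd b : N" using ab by auto
  have "(\<Sum>c\<in>N \<times> N. ?Z a c * ?X c b) = (\<Sum>c\<in>N. \<Sum>d\<in>N. ?Z a (c, d) * ?X (c, d) b)"
   by (simp add: sum.cartesian_product case_prod_beta)
  also have "... = (\<Sum>d\<in>N. \<Sum>c\<in>N. ?Z a (c, d) * ?X (c, d) b)" by (rule sum.swap)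
  also have "... = (\<Sum>d\<in>N. y (snd a) d * ((\<Sum>c\<in>N. y (fst a) c * gc c (fst b)) * gc d (snd b)))"
   by (simp add: sum_distrib_left sum_distrib_right mult.assoc)
  also have "... \<asymp> (\<Sum>d\<in>N. y (snd a) d * ((if fst a = fst b then 1 else 0) * gc d (snd b)))"
   by (intro cong_sum cong_mult_left cong_mult_right y_gc m)
  also have "... = (if fst a = fst b then (\<Sum>d\<in>N. y (snd a) d * gc d (snd b)) else 0)" by simp
  also have "... \<asymp> (if fst a = fst b then if snd a = snd b then 1 else 0 else 0)"
   using y_gc[OF m(2,4)] by simp
  also have "... = (if a = b then 1 else 0)" by (auto simp: prod_eq_iff)
  finally show ?thesis .
 qed
 have XZ: "(\<Sum>c\<in>N \<times> N. ?X a c * ?Z c b) \<asymp> (if a = b then 1 else 0)" if ab: "a : N \<times> N" "b : N \<times> N" for a b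
 proof -
  have m: "fst a : N" "snd a : N" "fst b : N" "snd b : N" using ab by auto
  have "(\<Sum>c\<in>N \<times> N. ?X a c * ?Z c b) = (\<Sum>c\<in>N. \<Sum>d\<in>N. ?X a (c, d) * ?Z (c, d) b)"
   by (simp add: sum.cartesian_product case_prod_beta)
  also have "... = (\<Sum>c\<in>N. gc (fst a) c * ((\<Sum>d\<in>N. gc (snd a) d * y d (snd b)) * y c (fst b)))"
   by (simp add: sum_distrib_left sum_distrib_right mult.assoc)
  also have "... \<asymp> (\<Sum>c\<in>N. gc (fst a) c * ((if snd a = snd b then 1 else 0) * y c (fst b)))"
   by (intro cong_sum cong_mult_left cong_mult_right gc_y m)
  also have "... = (if snd a = snd b then (\<Sum>c\<in>N. gc (fst a) c * y c (fst b)) else 0)" by simp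
  also have "... \<asymp> (if snd a = snd b then if fst a = fst b then 1 else 0 else 0)"
   using gc_y[OF m(1,3)] by simp
  also have "... = (if a = b then 1 else 0)" by (auto simp: prod_eq_iff)
  finally show ?thesis .
 qed
 have TX: "(\<Sum>c\<in>N \<times> N. pscale (hecke q a c) (?X c b)) \<asymp> (\<Sum>c\<in>N \<times> N. pscale (hecke q c b) (?X a c))"
  if ab: "a : N \<times> N" "b : N \<times> N" for a b
  using gc_hecke[of "fst a" "snd a" "fst b" "snd b"] ab by (auto simp: mem_Times_iff)
 have "(\<Sum>c\<in>N \<times> N. pscale (hecke q (i, j) c) (?Z c (r, s))) \<asymp> (\<Sum>c\<in>N \<times> N. pscale (hecke q c (r, s)) (?Z (i, j) c))"
  by (rule matrix_cong_commute[where Q = "N \<times> N" and X' = ?X and Z = ?Z]) (use assms ZX XZ TX in auto)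
 then show ?thesis by simp
qed

text \<open>For i = j and r \<le> s the Hecke identity is this exchange multiplied by
  \<open>q\<close>, which is cancelled; the other order of r and s follows by symmetry.\<close>

lemma y_same_row:
 assumes "i : N" "r : N" "s : N"
 shows "y i r * y i s \<asymp> y i s * y i r"
proof -
 have "y i s * y i r \<asymp> y i r * y i s" if "r : N" "s : N" "r \<le> s" for r s
  using y_hecke[OF assms(1,1) that(1,2)] that(3) q
  unfolding hecke_row_sum[OF finite_atLeastAtMost assms(1,1)] hecke_col_sum[OF finite_atLeastAtMost that(1,2)]
  by (auto intro: cong_pscale_cancel)
 then show ?thesis using assms cong_sym by (metis linorder_le_cases)
qed

lemma y_q:
 assumes "i : N" "j : N" "r : N" "s : N" "i < j" "r \<le> s"
 shows "y i s * y j r \<asymp> pscale q (y j r * y i s)"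
 using y_hecke[OF assms(1-4)] assms(5,6)
 unfolding hecke_row_sum[OF finite_atLeastAtMost assms(1,2)] hecke_col_sum[OF finite_atLeastAtMost assms(3,4)] by simp

lemma y_cross:
 assumes "i : N" "j : N" "r : N" "s : N" "i < j" "s < r"
 shows "y i s * y j r \<asymp> y j r * y i s + pscale (q - 1) (y j s * y i r)"
 using y_hecke[OF assms(1-4)] assms(5,6)
 unfolding hecke_row_sum[OF finite_atLeastAtMost assms(1,2)] hecke_col_sum[OF finite_atLeastAtMost assms(3,4)] by simp

end

section \<open>Convolution of functionals on words\<close>

text \<open>The terms of the comultiplication of a generator. A set suffices, since no pair occurs
  twice.\<close>

fun gsplits :: "nat => gen => (gen \<times> gen) set" where
 "gsplits n (Gen i j) = (%l. (Gen i l, Gen l j)) ` {1..n}"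
| "gsplits n Dinv = {(Dinv, Dinv)}"

primrec splits :: "nat => gen list => (gen list \<times> gen list) set" where
 "splits n [] = {([], [])}"
| "splits n (x # w) = (%((a, b), (u, v)). (a # u, b # v)) ` (gsplits n x \<times> splits n w)"

definition cw :: "nat => (gen list => gen list => 'k::field) => gen list => 'k" where
 "cw n tht w = (\<Sum>(u, v)\<in>splits n w. tht u v)"

text \<open>Convolution for the free algebra, before any relation is imposed.\<close>

definition cv :: "nat => (gen list => 'k::field) => (gen list => 'k) => gen list => 'k" where
 "cv n ph psi = cw n (%u v. ph u * psi v)"

lemma cw_Nil [simp]: "cw n tht [] = tht [] []" by (simp add: cw_def)

lemma cw_Cons: "cw n tht (x # w) = (\<Sum>(a, b)\<in>gsplits n x. cw n (%u v. tht (a # u) (b # v)) w)"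
proof -
 have inj: "inj_on (%((a, b), (u, v)). (a # u, b # v)) (gsplits n x \<times> splits n w)"
  by (auto simp: inj_on_def)
 have "cw n tht (x # w) = (\<Sum>z\<in>gsplits n x \<times> splits n w. tht (fst (fst z) # fst (snd z)) (snd (fst z) # snd (snd z)))"
  unfolding cw_def splits.simps sum.reindex[OF inj] by (intro sum.cong refl) (simp add: case_prod_beta)
 also have "... = (\<Sum>p\<in>gsplits n x. \<Sum>r\<in>splits n w. tht (fst p # fst r) (snd p # snd r))"
  by (simp add: sum.cartesian_product case_prod_beta)
 finally show ?thesis unfolding cw_def by (simp add: case_prod_beta)
qed

lemma cw_Gen: "cw n tht (Gen i j # w) = (\<Sum>l\<in>{1..n}. cw n (%u v. tht (Gen i l # u) (Gen l j # v)) w)"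
proof -
 have "inj_on (%l. (Gen i l, Gen l j)) {1..n}" by (auto simp: inj_on_def)
 then show ?thesis unfolding cw_Cons gsplits.simps by (simp add: sum.reindex)
qed

lemma cw_Dinv: "cw n tht (Dinv # w) = cw n (%u v. tht (Dinv # u) (Dinv # v)) w"
 by (simp add: cw_Cons)

lemma cw_sum: "cw n (%u v. \<Sum>i\<in>I. tht i u v) w = (\<Sum>i\<in>I. cw n (tht i) w)"
 unfolding cw_def case_prod_beta by (rule sum.swap)

lemma cw_mult: "cw n (%u v. c * tht u v) w = c * cw n tht w"
 unfolding cw_def case_prod_beta by (simp add: sum_distrib_left)

lemma cw_zero [simp]: "cw n (%u v. 0) w = 0" by (simp add: cw_def case_prod_beta)

lemma cw_cong: "(!!u v. (u, v) : splits n w ==> tht u v = tht' u v) ==> cw n tht w = cw n tht' w"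
 unfolding cw_def by (intro sum.cong) auto

lemma cw_append: "cw n tht (u @ v) = cw n (%a b. cw n (%a' b'. tht (a @ a') (b @ b')) v) u"
 by (induction u arbitrary: tht) (simp_all add: cw_Cons)

lemma cw_swap: "cw n (%a b. cw n (tht a b) v) u = cw n (%a' b'. cw n (%a b. tht a b a' b') u) v"
 unfolding cw_def case_prod_beta by (rule sum.swap)

lemma cw_assoc: "cw n (%a c. cw n (%a' b. tht a' b c) a) w = cw n (%a b. cw n (%b' c. tht a b' c) b) w"
proof (induction w arbitrary: tht)
 case (Cons x w)
 show ?case
 proof (cases x)
  case (Gen i j)
  have "cw n (%a c. cw n (%a' b. tht a' b c) a) (x # w) =
   (\<Sum>l\<in>{1..n}. \<Sum>m\<in>{1..n}. cw n (%a c. cw n (%a' b. tht (Gen i m # a') (Gen m l # b) (Gen l j # c)) a) w)"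
   unfolding Gen cw_Gen cw_sum ..
  also have "... = (\<Sum>m\<in>{1..n}. \<Sum>l\<in>{1..n}. cw n (%a b. cw n (%b' c. tht (Gen i m # a) (Gen m l # b') (Gen l j # c)) b) w)"
   unfolding Cons.IH by (rule sum.swap)
  also have "... = cw n (%a b. cw n (%b' c. tht a b' c) b) (x # w)"
   unfolding Gen cw_Gen cw_sum ..
  finally show ?thesis .
 qed (simp add: cw_Dinv Cons.IH)
qed simp

lemma cv_assoc: "cv n (cv n ph psi) chi w = cv n ph (cv n psi chi) w"
 unfolding cv_def cw_mult[symmetric] mult.commute[of "cw _ _ _" "chi _"]
 using cw_assoc[of n "%a b c. chi c * (ph a * psi b)" w] by (simp add: mult_ac)

lemma ev_fun_sum: "ev (%w. \<Sum>i\<in>I. f i w) z = (\<Sum>i\<in>I. ev (f i) z)"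
 unfolding ev_def sum_distrib_left by (rule sum.swap)

lemma ev_fun_mult: "ev (%w. c * f w) z = c * ev f z" "ev (%w. f w * c) z = ev f z * c"
 unfolding ev_def by (simp_all add: sum_distrib_left sum_distrib_right mult_ac)

lemma ev_cw: "ev (%w. cw n (tht w) u) z = cw n (%a b. ev (%w. tht w a b) z) u"
 unfolding cw_def case_prod_beta by (rule ev_fun_sum)

lemma ev_sandwich: "ev (%w. ev ph (x * wd w * y)) z = ev ph (x * z * y)"
proof (induction z rule: free_induct)
 case (add w a f)
 then show ?case by (simp add: ev_add ev_pscale distrib_left distrib_right pscale_mult)
qed simp

lemma ev_shift: "ev (%w. ph (u @ w @ v)) z = ev ph (wd u * z * wd v)"
 using ev_sandwich[of ph "wd u" "wd v" z] by (simp add: wd_append[symmetric])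

lemma cv_append: "cv n ph psi (u @ v) = cw n (%a b. cv n (%w. ph (a @ w)) (%w. psi (b @ w)) v) u"
 "cv n ph psi (u @ v) = cw n (%a b. cv n (%w. ph (w @ a)) (%w. psi (w @ b)) u) v"
 unfolding cv_def cw_append by (rule refl) (rule cw_swap)

text \<open>Multiplicativity of the comultiplication in dual form; the two versions differ in which
  factor is evaluated innermost.\<close>

lemma ev_cv_mult:
 "ev (cv n ph psi) (x * y) = ev (cw n (%a b. ev (cv n (%w. ph (a @ w)) (%w. psi (b @ w))) y)) x"
 "ev (cv n ph psi) (x * y) = ev (cw n (%a b. ev (cv n (%w. ph (w @ a)) (%w. psi (w @ b))) x)) y"
proof -
 show "ev (cv n ph psi) (x * y) = ev (cw n (%a b. ev (cv n (%w. ph (a @ w)) (%w. psi (b @ w))) y)) x"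
  unfolding ev_mult cv_append(1) ev_cw ..
 have "ev (cv n ph psi) (x * y) = ev (%u. ev (%v. cw n (%a b. cv n (%w. ph (w @ a)) (%w. psi (w @ b)) u) v) y) x"
  unfolding ev_mult cv_append(2) ..
 also have "... = ev (%v. ev (%u. cw n (%a b. cv n (%w. ph (w @ a)) (%w. psi (w @ b)) u) v) x) y"
  unfolding ev_def sum_distrib_left mult.left_commute[of "lookup x _"] by (rule sum.swap)
 finally show "ev (cv n ph psi) (x * y) = ev (cw n (%a b. ev (cv n (%w. ph (w @ a)) (%w. psi (w @ b))) x)) y"
  unfolding ev_cw .
qed

definition functionals :: "nat => 'k::field => (gen list => 'k) set" where
 "functionals n q = {psi. \<forall>u v. \<forall>r\<in>relations n q. ev psi (wd u * r * wd v) = 0}"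

lemma functionalsI:
 "(!!u v r. r : relations n q ==> ev (%w. psi (u @ w @ v)) r = 0) ==> psi : functionals n q"
 by (simp add: functionals_def ev_shift)

lemma functionals_shift: "psi : functionals n q ==> (%w. psi (u @ w @ v)) : functionals n q"
proof (rule functionalsI)
 fix a b r assume "psi : functionals n q" "r : relations n q"
 then have "ev (%w. psi ((u @ a) @ w @ (b @ v))) r = 0" unfolding ev_shift functionals_def by blast
 then show "ev (%w. psi (u @ (a @ w @ b) @ v)) r = 0" by simp
qed

lemma functionals_relation: "psi : functionals n q ==> r : relations n q ==> ev psi r = 0"
 unfolding functionals_def using wd_Nil by (metis (mono_tags, lifting) mem_Collect_eq mult.left_neutral mult.right_neutral)

lemma shift_closed_functionals: "shift_closed (functionals n q)"
 by unfold_locales (rule functionals_shift)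

locale qgl =
 fixes n :: nat and q :: "'k::field"
 assumes q_nonzero: "q ~= 0"

sublocale qgl \<subseteq> qgl_functionals "functionals n q" n q
proof (intro qgl_functionals.intro shift_closed_functionals qgl_functionals_axioms.intro q_nonzero)
 interpret shift_closed "functionals n q" by (rule shift_closed_functionals)
 have *: "cong_free (x) (y)" if "x - y : relations n q" for x y :: "'k free"
  using functionals_relation[OF _ that] by (simp add: cong_free_def ev_diff)
 show "cong_free (gc i r * gc i s) (gc i s * gc i r)" if "i : {1..n}" "r : {1..n}" "s : {1..n}" for i r s
  by (rule *, unfold relations_def, rule UnI1, rule UnI1, rule UnI1, rule CollectI, intro exI conjI, rule refl) (use that in simp)
 show "cong_free (gc j r * gc i s) (pscale q (gc i s * gc j r))"
  if "i : {1..n}" "j : {1..n}" "r : {1..n}" "s : {1..n}" "i < j" "r \<le> s" for i j r s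
  by (rule *, unfold relations_def, rule UnI1, rule UnI1, rule UnI2, rule CollectI, intro exI conjI, rule refl) (use that in simp_all)
 show "cong_free (gc j s * gc i r) (gc i r * gc j s + pscale (q - 1) (gc i s * gc j r))"
  if "i : {1..n}" "j : {1..n}" "r : {1..n}" "s : {1..n}" "i < j" "r < s" for i j r s
  by (rule *, unfold relations_def, rule UnI1, rule UnI2, rule CollectI, intro exI conjI, rule refl) (use that in simp_all)
 show "cong_free (qdet n * gen_elt Dinv) (1)" "cong_free (gen_elt Dinv * qdet n) (1)"
  by (rule *, simp add: relations_def)+
qed

lemma relations_cases [consumes 1, case_names row qrel cross det Dinv]:
 assumes "r : relations n q"
  and "!!i a b. i : {1..n} ==> a : {1..n} ==> b : {1..n} ==> P (gc i a * gc i b - gc i b * gc i a)"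
  and "!!i j a b. i : {1..n} ==> j : {1..n} ==> a : {1..n} ==> b : {1..n} ==> i < j ==> a \<le> b ==>
   P (gc j a * gc i b - pscale q (gc i b * gc j a))"
  and "!!i j a b. i : {1..n} ==> j : {1..n} ==> a : {1..n} ==> b : {1..n} ==> i < j ==> a < b ==>
   P (gc j b * gc i a - (gc i a * gc j b + pscale (q - 1) (gc i b * gc j a)))"
  and "P (qdet n * gen_elt Dinv - 1)" "P (gen_elt Dinv * qdet n - 1)"
 shows "P r"
 using assms(1) unfolding relations_def Un_iff mem_Collect_eq insert_iff empty_iff
 by (elim disjE exE conjE) (simp_all only: insert_subset assms(2-))

lemma inv_sign_not_distinct: "\<not> distinct L ==> inv_sign t L = 0"
 by (induction L) (auto simp: prod_list_zero_iff image_iff)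

lemma cw_map2:
 "length I = length L ==> cw n tht (map2 Gen I L) =
  (\<Sum>M | set M \<subseteq> {1..n} & length M = length I. tht (map2 Gen I M) (map2 Gen M L))"
proof (induction I L arbitrary: tht rule: list_induct2)
 case Nil
 have "{M. set M \<subseteq> {1..n} & length M = length ([] :: nat list)} = {[]}" by auto
 then show ?case by simp
next
 case (Cons i I l L)
 have inj: "inj_on (%(xs, m). m # xs) (A \<times> B)" for A :: "nat list set" and B by (auto simp: inj_on_def)
 have "(\<Sum>M | set M \<subseteq> {1..n} & length M = length (i # I). tht (map2 Gen (i # I) M) (map2 Gen M (l # L))) =
  (\<Sum>(M, m)\<in>{M. set M \<subseteq> {1..n} & length M = length I} \<times> {1..n}. tht (map2 Gen (i # I) (m # M)) (map2 Gen (m # M) (l # L)))"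
  unfolding list.size lists_length_Suc_eq add_Suc_right add_0_right sum.reindex[OF inj] by (intro sum.cong refl) auto
 also have "... = (\<Sum>m\<in>{1..n}. \<Sum>M | set M \<subseteq> {1..n} & length M = length I. tht (map2 Gen (i # I) (m # M)) (map2 Gen (m # M) (l # L)))"
  unfolding sum.cartesian_product[symmetric] by (rule sum.swap)
 finally show ?case by (simp add: cw_Gen Cons.IH)
qed

context qgl
begin

lemma cv_gc_gc: "ev (cv n ph psi) (gc i r * gc j s) = (\<Sum>m\<in>N \<times> N. ev ph (gc i (fst m) * gc j (snd m)) * ev psi (gc (fst m) r * gc (snd m) s))"
 by (simp add: gen_elt_wd wd_append[symmetric] cv_def cw_Gen sum.cartesian_product case_prod_beta)

text \<open>The comultiplication turns the matrix of products into a product of two such matrices,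
  and the Hecke operator passes one factor after the other.\<close>

lemma cv_hecke:
 assumes ph: "ph : functionals n q" and psi: "psi : functionals n q"
  and N: "i : N" "j : N" "r : N" "s : N"
 shows "ev (cv n ph psi) (\<Sum>p\<in>N \<times> N. pscale (hecke q (i, j) p) (gc (fst p) r * gc (snd p) s)) =
  ev (cv n ph psi) (\<Sum>p\<in>N \<times> N. pscale (hecke q p (r, s)) (gc i (fst p) * gc j (snd p)))"
proof -
 let ?P = "%p p'. gc (fst p) (fst p') * gc (snd p) (snd p') :: 'k free"
 have H: "(\<Sum>p\<in>N \<times> N. hecke q a p * ev chi (?P p b)) = (\<Sum>p\<in>N \<times> N. hecke q p b * ev chi (?P a p))"
  if "chi : functionals n q" "a : N \<times> N" "b : N \<times> N" for a b chi
 proof -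
  have "fst a : N" "snd a : N" "fst b : N" "snd b : N" using that by auto
  from gc_hecke[OF this] that(1) show ?thesis by (simp add: cong_free_def ev_sum ev_pscale)
 qed
 have ij: "(i, j) : N \<times> N" "(r, s) : N \<times> N" using N by auto
 have "ev (cv n ph psi) (\<Sum>p\<in>N \<times> N. pscale (hecke q (i, j) p) (gc (fst p) r * gc (snd p) s)) =
  (\<Sum>p\<in>N \<times> N. \<Sum>m\<in>N \<times> N. hecke q (i, j) p * ev ph (?P p m) * ev psi (?P m (r, s)))"
  by (simp add: ev_sum ev_pscale cv_gc_gc sum_distrib_left mult.assoc)
 also have "... = (\<Sum>m\<in>N \<times> N. (\<Sum>p\<in>N \<times> N. hecke q (i, j) p * ev ph (?P p m)) * ev psi (?P m (r, s)))"
  unfolding sum_distrib_right by (rule sum.swap)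
 also have "... = (\<Sum>m\<in>N \<times> N. (\<Sum>p\<in>N \<times> N. hecke q p m * ev ph (?P (i, j) p)) * ev psi (?P m (r, s)))"
  by (intro sum.cong refl) (simp only: H[OF ph ij(1)])
 also have "... = (\<Sum>p\<in>N \<times> N. ev ph (?P (i, j) p) * (\<Sum>m\<in>N \<times> N. hecke q p m * ev psi (?P m (r, s))))"
  unfolding sum_distrib_right sum_distrib_left by (subst sum.swap) (simp add: mult_ac)
 also have "... = (\<Sum>p\<in>N \<times> N. ev ph (?P (i, j) p) * (\<Sum>m\<in>N \<times> N. hecke q m (r, s) * ev psi (?P p m)))"
  by (intro sum.cong refl) (simp only: H[OF psi _ ij(2)])
 also have "... = (\<Sum>m\<in>N \<times> N. hecke q m (r, s) * (\<Sum>p\<in>N \<times> N. ev ph (?P (i, j) p) * ev psi (?P p m)))"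
  unfolding sum_distrib_left by (subst sum.swap) (simp add: mult_ac)
 also have "... = ev (cv n ph psi) (\<Sum>p\<in>N \<times> N. pscale (hecke q p (r, s)) (gc i (fst p) * gc j (snd p)))"
  by (simp add: ev_sum ev_pscale cv_gc_gc)
 finally show ?thesis .
qed

text \<open>As in the Cauchy-Binet formula: after summing over the columns, a list \<open>M\<close>
  of middle indices contributes its inversion sign times the determinant, so lists with a repetition
  drop out and the sum factors.\<close>

lemma cv_qdet:
 assumes ph: "ph : functionals n q" and psi: "psi : functionals n q"
 shows "ev (cv n ph psi) (qdet n) = ev ph (qdet n) * ev psi (qdet n)"
proof -
 let ?I = "[1..<Suc n]" and ?D = "{L. set L = N & distinct L}" and ?M = "{M. set M \<subseteq> N & length M = n}"
 have len: "length L = n" if "L : ?D" for L using that distinct_card[of L] by auto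
 have fin: "finite ?M" by (rule finite_lists_length_eq) simp
 have D: "?D \<subseteq> ?M" using len by auto
 have qd: "qdet n = (\<Sum>L\<in>?D. pscale (inv_sign (-1) L) (wd (map2 Gen ?I L) :: 'k free))"
  unfolding qdet_eq_skew_det by (rule skew_det_lists) auto
 have row: "(\<Sum>L\<in>?D. inv_sign (-1) L * psi (map2 Gen M L)) = inv_sign (-1) M * ev psi (qdet n)" if M: "M : ?M" for M
 proof -
  have "ev psi (skew_det (-1) (%i r. gc i r) M N) = (\<Sum>L\<in>?D. inv_sign (-1) L * psi (map2 Gen M L))"
   using M by (subst skew_det_lists) (simp_all add: ev_sum ev_pscale)
  moreover have "ev psi (skew_det (-1) (%i r. gc i r) M N) = inv_sign (-1) M * ev psi (skew_det (-1) (%i r. gc i r) (sort M) N)"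
   using row_det_sort[of M] M psi by (simp add: cong_free_def ev_pscale)
  moreover have "sort M = ?I" if "distinct M"
  proof -
   have "set M = N" using M that by (intro card_subset_eq) (auto simp: distinct_card)
   then show ?thesis using that by (metis sorted_list_of_set_sort_remdups distinct_remdups_id sorted_list_of_set_upto)
  qed
  ultimately show ?thesis
   by (cases "distinct M") (simp_all add: inv_sign_not_distinct qdet_eq_skew_det del: upt_Suc)
 qed
 have "ev (cv n ph psi) (qdet n) = (\<Sum>L\<in>?D. inv_sign (-1) L * (\<Sum>M\<in>?M. ph (map2 Gen ?I M) * psi (map2 Gen M L)))"
  unfolding qd ev_sum ev_pscale ev_wd cv_def
  by (intro sum.cong refl) (use len in \<open>simp add: cw_map2 del: upt_Suc\<close>)
 also have "... = (\<Sum>M\<in>?M. ph (map2 Gen ?I M) * (\<Sum>L\<in>?D. inv_sign (-1) L * psi (map2 Gen M L)))"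
  unfolding sum_distrib_left by (subst sum.swap) (simp add: mult_ac del: upt_Suc)
 also have "... = (\<Sum>M\<in>?M. ph (map2 Gen ?I M) * (inv_sign (-1) M * ev psi (qdet n)))"
  by (intro sum.cong refl) (simp only: row)
 also have "... = (\<Sum>M\<in>?D. ph (map2 Gen ?I M) * (inv_sign (-1) M * ev psi (qdet n)))"
 proof (rule sum.mono_neutral_right[OF fin D], rule ballI)
  fix M assume M: "M : ?M - ?D"
  have "\<not> distinct M"
  proof
   assume "distinct M"
   then have "set M = N" using M by (intro card_subset_eq) (auto simp: distinct_card)
   then show False using M \<open>distinct M\<close> by simp
  qed
  then show "ph (map2 Gen ?I M) * (inv_sign (-1) M * ev psi (qdet n)) = 0" by (simp add: inv_sign_not_distinct)
 qed
 also have "... = ev ph (qdet n) * ev psi (qdet n)"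
 proof -
  have "ev ph (qdet n) = (\<Sum>L\<in>?D. inv_sign (-1) L * ph (map2 Gen ?I L))"
   by (simp only: qd ev_sum ev_pscale ev_wd)
  then show ?thesis by (simp only: sum_distrib_right) (intro sum.cong refl, simp only: mult_ac)
 qed
 finally show ?thesis .
qed

lemma cv_Dinv: "ev (cv n ph psi) (x * gen_elt Dinv) = ev (cv n (%w. ph (w @ [Dinv])) (%w. psi (w @ [Dinv]))) x"
 "ev (cv n ph psi) (gen_elt Dinv * x) = ev (cv n (%w. ph (Dinv # w)) (%w. psi (Dinv # w))) x"
 unfolding ev_cv_mult(2)[of n ph psi x "gen_elt Dinv"] ev_cv_mult(1)[of n ph psi "gen_elt Dinv" x]
 by (simp_all add: gen_elt_wd cw_Dinv)

lemma ev_mult_wd: "ev (%w. ph (w @ v)) z = ev ph (z * wd v)" "ev (%w. ph (u @ w)) z = ev ph (wd u * z)"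
 using ev_shift[of ph "[]" v z] ev_shift[of ph u "[]" z] by (simp_all add: wd_Nil)

text \<open>The quadratic relations are read off from \<open>cv_hecke\<close>; the two relations for
  \<open>Dinv\<close> hold because the determinant and \<open>Dinv\<close> are group-like.\<close>

lemma cv_relation:
 assumes ph: "ph : functionals n q" and psi: "psi : functionals n q" and r: "r : relations n q"
 shows "ev (cv n ph psi) r = 0"
 using r
proof (induction rule: relations_cases)
 case (row i a b)
 have *: "ev (cv n ph psi) (gc i a * gc i b) = ev (cv n ph psi) (gc i b * gc i a)" if "a : N" "b : N" "a \<le> b" for a b
  using cv_hecke[OF ph psi row(1,1) that(1,2)] that(3) q
  unfolding hecke_row_sum[OF finite_atLeastAtMost row(1,1)] hecke_col_sum[OF finite_atLeastAtMost that(1,2)]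
  by (simp add: ev_pscale)
 have "ev (cv n ph psi) (gc i a * gc i b) = ev (cv n ph psi) (gc i b * gc i a)"
  using *[of a b] *[of b a] row by (cases "a \<le> b") auto
 then show ?case by (simp add: ev_diff)
next
 case (qrel i j a b)
 show ?case
  using cv_hecke[OF ph psi qrel(1-4)] qrel(5,6)
  unfolding hecke_row_sum[OF finite_atLeastAtMost qrel(1,2)] hecke_col_sum[OF finite_atLeastAtMost qrel(3,4)]
  by (simp add: ev_diff ev_pscale)
next
 case (cross i j a b)
 show ?case
  using cv_hecke[OF ph psi cross(1,2,4,3)] cross(5,6)
  unfolding hecke_row_sum[OF finite_atLeastAtMost cross(1,2)] hecke_col_sum[OF finite_atLeastAtMost cross(4,3)]
  by (simp add: ev_diff ev_pscale ev_add)
next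
 case det
 have "ev (cv n ph psi) (qdet n * gen_elt Dinv) = ev ph (qdet n * gen_elt Dinv) * ev psi (qdet n * gen_elt Dinv)"
  unfolding cv_Dinv using cv_qdet[OF functionals_shift[OF ph, of "[]" "[Dinv]"] functionals_shift[OF psi, of "[]" "[Dinv]"]]
  by (simp add: ev_mult_wd gen_elt_wd)
 then show ?case using det_Dinv ph psi
  by (simp add: cong_free_def ev_diff wd_Nil[symmetric] cv_def)
next
 case Dinv
 have e: "ev (%w. chi (Dinv # w)) z = ev chi (wd [Dinv] * z)" for chi and z :: "'k free"
  using ev_mult_wd(2)[of chi "[Dinv]" z] by simp
 have "ev (cv n ph psi) (gen_elt Dinv * qdet n) = ev ph (gen_elt Dinv * qdet n) * ev psi (gen_elt Dinv * qdet n)"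
  unfolding cv_Dinv using cv_qdet[OF functionals_shift[OF ph, of "[Dinv]" "[]"] functionals_shift[OF psi, of "[Dinv]" "[]"]]
  by (simp add: gen_elt_wd e)
 then show ?case using Dinv_det ph psi
  by (simp add: cong_free_def ev_diff wd_Nil[symmetric] cv_def)
qed

text \<open>Peeling off the outer words only translates the functionals, so
  \<open>cv_relation\<close> suffices. In dual form this says that the comultiplication is well
  defined on k[G].\<close>

lemma cv_functionals:
 assumes ph: "ph : functionals n q" and psi: "psi : functionals n q"
 shows "cv n ph psi : functionals n q"
proof (rule functionalsI)
 fix u v r assume r: "r : relations n q"
 have "ev (%w. cv n ph psi (u @ w @ v)) r =
  cw n (%a b. cw n (%a' b'. ev (cv n (%w. ph (a @ w @ a')) (%w. psi (b @ w @ b'))) r) v) u"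
  unfolding cv_append(1)[of n ph psi u] unfolding cv_append(2) ev_cw append_assoc ..
 also have "... = 0" by (simp add: cv_relation[OF functionals_shift[OF ph] functionals_shift[OF psi] r])
 finally show "ev (%w. cv n ph psi (u @ w @ v)) r = 0" .
qed

end

section \<open>Restriction to the torus\<close>

fun diag_gen :: "gen => bool" where
 "diag_gen (Gen i j) = (i = j)"
| "diag_gen Dinv = True"

fun gen_weight :: "nat => gen => (nat => int)" where
 "gen_weight n (Gen i j) = (%l. if l = i then 1 else 0)"
| "gen_weight n Dinv = - omega n"

definition word_weight :: "nat => gen list => (nat => int)" where
 "word_weight n w = sum_list (map (gen_weight n) w)"

text \<open>On the torus a word restricts to 0 or to a monomial; \<open>h\<close> assigns a scalar
  to its exponent.\<close>

definition torus_fun :: "nat => ((nat => int) => 'k::field) => gen list => 'k" where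
 "torus_fun n h w = (if list_all diag_gen w then h (word_weight n w) else 0)"

lemma sum_list_apply: "sum_list (map f xs) l = sum_list (map (%i. f i l) xs)" for f :: "'i => 'b => int"
 by (induction xs) auto

lemma word_weight_diag: "word_weight n (map (%i. Gen i i) [1..<Suc n]) = omega n"
proof
 fix l :: nat
 have "distinct xs ==> sum_list (map (%i. if l = i then 1 else 0 :: int) xs) = (if l : set xs then 1 else 0)" for xs
  by (induction xs) auto
 then show "word_weight n (map (%i. Gen i i) [1..<Suc n]) l = omega n l"
  by (simp add: word_weight_def sum_list_apply o_def omega_def less_Suc_eq_le del: upt_Suc)
qed

lemma ev_torus_qdet: "ev (torus_fun n h) (qdet n * wd v) = torus_fun n (%mu. h (omega n + mu)) v"
 "ev (torus_fun n h) (wd v * qdet n) = torus_fun n (%mu. h (omega n + mu)) v"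
proof -
 let ?w = "%p. map (%i. Gen i (p i)) [1..<Suc n]"
 have d: "list_all diag_gen (?w p) \<longleftrightarrow> p = id" if "p permutes {1..n}" for p
 proof
  assume "list_all diag_gen (?w p)"
  then have "p i = i" if "i : {1..n}" for i using that by (auto simp: list_all_iff simp del: upt_Suc)
  then show "p = id" using that permutes_not_in by fastforce
 qed (auto simp: list_all_iff)
 have d0: "list_all diag_gen (?w (%i. i))" by (simp add: list_all_iff)
 have e: "(\<Sum>p | p permutes {1..n}. of_int (sign p) * (if p = id then c p else 0)) = c id" for c :: "_ => 'a"
 proof -
  have "(\<Sum>p | p permutes {1..n}. of_int (sign p) * (if p = id then c p else 0)) = (\<Sum>p\<in>{id}. of_int (sign p) * (if p = id then c p else 0))"
   by (rule sum.mono_neutral_right) (auto simp: finite_permutations permutes_id)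
  then show ?thesis by simp
 qed
 have eq: "qdet n = (\<Sum>p | p permutes {1..n}. pscale (of_int (sign p)) (wd (?w p) :: 'a free))"
  unfolding qdet_def by (simp only: single_wd)
 have "ev (torus_fun n h) (qdet n * wd v) = (\<Sum>p | p permutes {1..n}. of_int (sign p) * (if p = id then torus_fun n h (?w p @ v) else 0))"
  unfolding eq sum_distrib_right pscale_mult ev_sum ev_pscale wd_append[symmetric] ev_wd
  by (intro sum.cong refl) (use d d0 in \<open>simp add: torus_fun_def del: upt_Suc\<close>)
 then show "ev (torus_fun n h) (qdet n * wd v) = torus_fun n (%mu. h (omega n + mu)) v"
  unfolding e using word_weight_diag[of n] by (auto simp: torus_fun_def word_weight_def list_all_iff simp del: upt_Suc)
 have "ev (torus_fun n h) (wd v * qdet n) = (\<Sum>p | p permutes {1..n}. of_int (sign p) * (if p = id then torus_fun n h (v @ ?w p) else 0))"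
  unfolding eq sum_distrib_left pscale_mult ev_sum ev_pscale wd_append[symmetric] ev_wd
  by (intro sum.cong refl) (use d d0 in \<open>simp add: torus_fun_def del: upt_Suc\<close>)
 then show "ev (torus_fun n h) (wd v * qdet n) = torus_fun n (%mu. h (omega n + mu)) v"
  unfolding e using word_weight_diag[of n] by (auto simp: torus_fun_def word_weight_def list_all_iff add.commute simp del: upt_Suc)
qed

lemma torus_fun_relation:
 assumes "r : relations n q"
 shows "ev (torus_fun n h) r = 0"
 using assms
proof (induction rule: relations_cases)
 case (row i a b)
 then show ?case by (simp add: ev_diff gen_elt_wd wd_append[symmetric]) (auto simp: torus_fun_def)
next
 case (qrel i j a b)
 then show ?case by (simp add: ev_diff ev_pscale gen_elt_wd wd_append[symmetric]) (auto simp: torus_fun_def)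
next
 case (cross i j a b)
 then show ?case by (simp add: ev_diff ev_pscale ev_add gen_elt_wd wd_append[symmetric])
   (auto simp: torus_fun_def word_weight_def add.commute)
next
 case det
 show ?case unfolding ev_diff gen_elt_wd ev_torus_qdet
  by (simp add: torus_fun_def word_weight_def wd_Nil[symmetric])
next
 case Dinv
 show ?case unfolding ev_diff gen_elt_wd ev_torus_qdet
  by (simp add: torus_fun_def word_weight_def wd_Nil[symmetric])
qed

text \<open>Translation by words shifts \<open>h\<close> by their weights, or gives 0 when a letter
  is off the diagonal, so it is enough to check single relations.\<close>

lemma torus_fun_functionals: "torus_fun n h : functionals n q"
proof (rule functionalsI)
 fix u v r assume r: "r : relations n q"
 have "(%w. torus_fun n h (u @ w @ v)) =
  torus_fun n (%mu. if list_all diag_gen u & list_all diag_gen v then h (word_weight n u + (mu + word_weight n v)) else 0)"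
  by (auto simp: torus_fun_def word_weight_def fun_eq_iff)
 then show "ev (%w. torus_fun n h (u @ w @ v)) r = 0"
  using torus_fun_relation[OF r] by simp
qed

section \<open>The coordinate algebra\<close>

definition good :: "nat => gen list => bool" where
 "good n w \<longleftrightarrow> set w \<subseteq> generators n"

lemma good_simps [simp]: "good n []" "good n (x # w) \<longleftrightarrow> x : generators n & good n w"
 "good n (u @ v) \<longleftrightarrow> good n u & good n v"
 by (auto simp: good_def)

lemma free_algebra_simps:
 "FA n = {p. \<forall>w\<in>keys p. good n (letters w)}"
 "x +[free_algebra n] y = x + y" "x \<otimes>\<^bsub>free_algebra n\<^esub> y = x * y" "\<zero>\<^bsub>free_algebra n\<^esub> = 0" "\<one>\<^bsub>free_algebra n\<^esub> = 1"
 "a *[free_algebra n] x = pscale a x"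
 by (simp_all add: free_algebra_def ring.extend_def module.fields_def ring_of_type_algebra_def good_def)

lemma free_closed:
 fixes x y :: "'k::field free"
 shows "wd w : carrier (free_algebra n :: ('k, _) module) \<longleftrightarrow> good n w"
  and "(0 :: 'k free) : FA n" "(1 :: 'k free) : FA n"
  and "x : FA n ==> y : FA n ==> x + y : FA n"
  and "x : FA n ==> pscale a x : FA n"
  and "x : FA n ==> y : FA n ==> x * y : FA n"
proof -
 show *: "wd w : carrier (free_algebra n :: ('k, _) module) \<longleftrightarrow> good n w" for w
  by (simp add: free_algebra_simps wd_def)
 show "(0 :: 'k free) : FA n" by (simp add: free_algebra_simps)
 show "(1 :: 'k free) : FA n" using *[of "[]"] by (simp add: wd_Nil)
 show "x : FA n ==> y : FA n ==> x + y : FA n"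
  using Poly_Mapping.keys_add[of x y] by (auto simp: free_algebra_simps)
 show "x : FA n ==> pscale a x : FA n"
  using keys_pscale[of a x] by (auto simp: free_algebra_simps)
 show "x : FA n ==> y : FA n ==> x * y : FA n"
  using keys_mult[of x y] by (auto simp: free_algebra_simps plus_gen_word_def)
qed

lemma free_carrier_sum:
 "(!!i. i : I ==> f i : FA n) ==> (\<Sum>i\<in>I. f i) : FA n"
 by (induction I rule: infinite_finite_induct) (simp_all add: free_closed)

lemma free_carrier_diff:
 "x : FA n ==> y : FA n ==> x - y : FA n"
 using free_closed(4)[of x n "pscale (-1) y"] free_closed(5)[of y n "-1"] by (simp add: pscale_simps)

lemma free_carrier_induct [consumes 1, case_names zero add]:
 assumes "z : FA n" "P 0"
  and "!!w a f. good n w ==> f : FA n ==> P f ==> P (pscale a (wd w) + f)"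
 shows "P (z :: 'k::field free)"
proof (rule poly_mapping_induct_on[of z "{w. good n (letters w)}"])
 show "keys z \<subseteq> {w. good n (letters w)}" using assms(1) by (auto simp: free_algebra_simps)
 fix p a and f :: "'k free"
 assume "p : {w. good n (letters w)}" "keys f \<subseteq> {w. good n (letters w)}" "P f"
 then show "P (single p a + f)"
  using assms(3)[of "letters p" f a] by (auto simp: wd_def free_algebra_simps)
qed (rule assms(2))

lemma vspace_free_algebra: "vspace (free_algebra n :: ('k::field, _) module)"
 by (rule vspaceI) (simp_all only: free_algebra_simps(2-) free_closed pscale_simps add_ac add_0_left add_0_right)

lemma ring_free_algebra: "ring (free_algebra n :: ('k::field, _) module)"
proof (rule ringI)
 show "abelian_group (free_algebra n :: ('k, _) module)"
  using vspace_free_algebra by (rule module.axioms(2))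
 show "monoid (free_algebra n :: ('k, _) module)"
  by (rule monoidI) (simp_all only: free_algebra_simps(2-) free_closed mult.assoc mult_1_left mult_1_right)
qed (simp_all only: free_algebra_simps(2-) distrib_left distrib_right)

lemma gen_elt_carrier: "x : generators n ==> gen_elt x : carrier (free_algebra n :: ('k::field, _) module)"
 by (simp add: gen_elt_wd free_closed)

lemma gc_carrier: "i : {1..n} ==> j : {1..n} ==> gc i j : carrier (free_algebra n :: ('k::field, _) module)"
 by (rule gen_elt_carrier) (simp add: generators_def)

lemma qdet_carrier: "qdet n : carrier (free_algebra n :: ('k::field, _) module)"
 unfolding qdet_def
proof (rule free_carrier_sum)
 fix p assume "p : {p. p permutes {1..n}}"
 then have "good n (map (%i. Gen i (p i)) [1..<Suc n])"
  using permutes_in_image[of p "{1..n}"] by (auto simp: good_def generators_def simp del: upt_Suc)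
 then show "single (Word (map (%i. Gen i (p i)) [1..<Suc n])) (of_int (sign p)) : carrier (free_algebra n :: ('k, _) module)"
  unfolding single_wd by (intro free_closed(5)) (simp only: free_closed(1))
qed

lemma relations_carrier: "relations n q \<subseteq> carrier (free_algebra n :: ('k::field, _) module)"
proof
 fix r assume "r : relations n q"
 then show "r : FA n"
  by (induction rule: relations_cases)
   (intro free_carrier_diff free_closed gc_carrier qdet_carrier gen_elt_carrier;
    simp add: generators_def; fail)+
qed

lemma ideal_qgl: "ideal (qgl_ideal n q) (free_algebra n)"
 unfolding qgl_ideal_def by (rule ring.genideal_ideal[OF ring_free_algebra relations_carrier])

lemma relations_qgl_ideal: "relations n q \<subseteq> qgl_ideal n q"
 unfolding qgl_ideal_def by (rule ring.genideal_self[OF ring_free_algebra relations_carrier])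

lemma qgl_ideal_carrier: "x : qgl_ideal n q ==> x : FA n"
 using ideal.Icarr[OF ideal_qgl] .

lemma qgl_ideal_mult:
 assumes "x : qgl_ideal n q" "y : FA n"
 shows "y * x : qgl_ideal n q" "x * y : qgl_ideal n q"
 using ideal.I_l_closed[OF ideal_qgl assms] ideal.I_r_closed[OF ideal_qgl assms] by (simp_all only: free_algebra_simps)

lemma subspace_qgl_ideal: "subspace_of (free_algebra n) (qgl_ideal n q)"
 unfolding subspace_of_def
proof (intro conjI ballI allI subsetI)
 have as: "additive_subgroup (qgl_ideal n q) (free_algebra n)" using ideal_qgl by (rule ideal.axioms(1))
 show "\<zero>\<^bsub>free_algebra n\<^esub> : qgl_ideal n q" by (rule additive_subgroup.zero_closed[OF as])
 fix x assume x: "x : qgl_ideal n q"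
 show "x : FA n" by (rule qgl_ideal_carrier[OF x])
 show "a *[free_algebra n] x : qgl_ideal n q" for a
  using qgl_ideal_mult(1)[OF x free_closed(5)[OF free_closed(3), of a]]
  by (simp add: free_algebra_simps pscale_mult)
 fix y assume "y : qgl_ideal n q"
 then show "x +[free_algebra n] y : qgl_ideal n q" by (rule additive_subgroup.a_closed[OF as x])
qed

lemma functional_qgl_ideal:
 fixes q :: "'k::field"
 assumes psi: "psi : functionals n q" and x: "x : qgl_ideal n q"
 shows "ev psi x = 0"
proof -
 interpret shift_closed "functionals n q" by (rule shift_closed_functionals)
 define J where "J = {x : FA n. \<forall>psi\<in>functionals n q. ev psi x = 0}"
 have s: "subspace_of (free_algebra n) J"
  unfolding subspace_of_def J_def by (auto simp: free_algebra_simps(2-) free_closed ev_add ev_pscale)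
 have "ideal J (free_algebra n)"
 proof (rule idealI[OF ring_free_algebra])
  show "subgroup J (add_monoid (free_algebra n))"
   using abelian_subgroup_subspace[OF vspace_free_algebra s] abelian_subgroup.axioms(1) additive_subgroup.a_subgroup by blast
  fix a x :: "'k free" assume a: "a : J" and x: "x : FA n"
  have "cong_free (x * a) (x * 0)" "cong_free (a * x) (0 * x)"
   using a by (intro cong_mult_left cong_mult_right; simp add: J_def cong_free_def)+
  then show "x \<otimes>\<^bsub>free_algebra n\<^esub> a : J" "a \<otimes>\<^bsub>free_algebra n\<^esub> x : J"
   using a x by (auto simp: J_def free_algebra_simps(3) free_closed cong_free_def)
 qed
 moreover have "relations n q \<subseteq> J"
  using relations_carrier functionals_relation unfolding J_def by blast
 ultimately have "qgl_ideal n q \<subseteq> J"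
  unfolding qgl_ideal_def by (rule ring.genideal_minimal[OF ring_free_algebra])
 then show ?thesis using x psi by (auto simp: J_def)
qed

text \<open>A functional on the carrier says nothing about words with illegal letters; the extension
  by 0 is stable under translation, because a translate by an illegal word is 0.\<close>

definition restrict_good :: "nat => (gen list => 'k::field) => gen list => 'k" where
 "restrict_good n psi w = (if good n w then psi w else 0)"

lemma ev_restrict_good:
 assumes ph: "ph : dual (free_algebra n)" and "!!w. good n w ==> ph (wd w) = psi w" and z: "z : FA n"
 shows "ph z = ev psi z"
 using z
proof (induction rule: free_carrier_induct)
 case zero
 then show ?case using linear_maps_zero[OF vspace_free_algebra vspace_scalars ph] by (simp add: free_algebra_simps)
next
 case (add w a f)
 then show ?case
  using linD(2)[OF ph, of "pscale a (wd w)" f] linD(3)[OF ph, of "wd w" a] assms(2)[of w]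
  by (simp add: free_algebra_simps(2,6) free_closed ev_add ev_pscale)
qed

lemma functionals_of_dual:
 assumes ph: "ph : dual (free_algebra n)" and 0: "!!x. x : qgl_ideal n q ==> ph x = 0"
 shows "restrict_good n (%w. ph (wd w)) : functionals n q"
proof (rule functionalsI)
 fix u v r assume r: "r : relations n q"
 let ?psi = "restrict_good n (%w. ph (wd w))"
 show "ev (%w. ?psi (u @ w @ v)) r = 0"
 proof (cases "good n u & good n v")
  case True
  have m: "wd u * r * wd v : qgl_ideal n q"
   using relations_qgl_ideal[of n q] r True by (intro qgl_ideal_mult) (auto simp: free_closed)
  have "ph (wd u * r * wd v) = ev ?psi (wd u * r * wd v)"
   by (rule ev_restrict_good[OF ph _ qgl_ideal_carrier[OF m]]) (simp add: restrict_good_def)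
  then show ?thesis unfolding ev_shift using 0[OF m] by simp
 next
  case False
  then have "(%w. ?psi (u @ w @ v)) = (%w. 0)" by (auto simp: restrict_good_def)
  then show ?thesis by (simp add: ev_def)
 qed
qed

text \<open>A functional of the free algebra separates an element outside the ideal from it. Hence
  congruence with respect to \<open>functionals\<close> is equality in k[G].\<close>

lemma mem_qgl_ideal_iff:
 assumes x: "x : FA n"
 shows "x : qgl_ideal n q \<longleftrightarrow> (\<forall>psi\<in>functionals n q. ev psi x = 0)"
proof
 assume *: "\<forall>psi\<in>functionals n q. ev psi x = 0"
 show "x : qgl_ideal n q"
 proof (rule ccontr)
  assume "x \<notin> qgl_ideal n q"
  then obtain ph where ph: "ph : dual (free_algebra n)" "ph x = 1" "\<forall>y\<in>qgl_ideal n q. ph y = 0"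
   using dual_separates_subspace[OF vspace_free_algebra subspace_qgl_ideal x] by blast
  have "ph x = ev (restrict_good n (%w. ph (wd w))) x"
   by (rule ev_restrict_good[OF ph(1) _ x]) (simp add: restrict_good_def)
  then show False using functionals_of_dual[OF ph(1)] ph(2,3) * by simp
 qed
qed (use functional_qgl_ideal in blast)

definition cos :: "nat => 'k::field => 'k free => 'k free set" where
 "cos n q z = qgl_ideal n q +>\<^bsub>free_algebra n\<^esub> z"

lemma vspace_qgl: "vspace (qgl_algebra n q)"
 unfolding qgl_algebra_def by (rule vspace_quot_mod[OF vspace_free_algebra subspace_qgl_ideal])

lemma carrier_qgl_algebra: "carrier (qgl_algebra n q) = cos n q ` FA n"
 unfolding qgl_algebra_def carrier_quot_mod cos_def by auto

lemma cos_carrier: "z : FA n ==> cos n q z : carrier (qgl_algebra n q)"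
 by (auto simp: carrier_qgl_algebra)

lemma cos_linear: "cos n q : linear_maps (free_algebra n) (qgl_algebra n q)"
 unfolding qgl_algebra_def cos_def by (rule coset_linear[OF vspace_free_algebra subspace_qgl_ideal])

lemma cos_mult:
 "x : FA n ==> y : FA n ==>
  cos n q x \<otimes>\<^bsub>qgl_algebra n q\<^esub> cos n q y = cos n q (x * y)"
 unfolding qgl_algebra_def mult_quot_mod cos_def using ideal.rcoset_mult_add[OF ideal_qgl] by (simp add: free_algebra_simps(3))

lemma cos_one: "\<one>\<^bsub>qgl_algebra n q\<^esub> = cos n q 1"
 unfolding qgl_algebra_def one_quot_mod cos_def by (simp only: free_algebra_simps)

lemma cos_eq_iff:
 assumes "x : FA n" "y : FA n"
 shows "cos n q x = cos n q y \<longleftrightarrow> (\<forall>psi\<in>functionals n q. ev psi x = ev psi y)"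
proof -
 have "x +[free_algebra n] (-1) *[free_algebra n] y = x - y" by (simp add: free_algebra_simps(2,6) pscale_simps)
 then show ?thesis
  unfolding cos_def coset_eq_iff[OF vspace_free_algebra subspace_qgl_ideal assms]
  using mem_qgl_ideal_iff[OF free_carrier_diff[OF assms]] by (simp add: ev_diff)
qed

definition dualf :: "nat => 'k::field => ('k free set => 'k) => gen list => 'k" where
 "dualf n q alp = restrict_good n (%w. alp (cos n q (wd w)))"

lemma dualf_good: "good n w ==> dualf n q alp w = alp (cos n q (wd w))"
 by (simp add: dualf_def restrict_good_def)

lemma dual_cos:
 assumes "alp : dual (qgl_algebra n q)" "z : FA n"
 shows "alp (cos n q z) = ev (dualf n q alp) z"
 by (rule ev_restrict_good[OF lin_comp[OF cos_linear assms(1)] _ assms(2)]) (simp add: dualf_good)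

lemma dualf_functionals:
 assumes alp: "alp : dual (qgl_algebra n q)"
 shows "dualf n q alp : functionals n q"
 unfolding dualf_def
proof (rule functionals_of_dual[OF lin_comp[OF cos_linear alp]])
 fix x assume x: "x : qgl_ideal n q"
 have "cos n q x = cos n q 0"
  using functional_qgl_ideal[OF _ x] by (simp add: cos_eq_iff qgl_ideal_carrier[OF x] free_closed)
 then show "alp (cos n q x) = 0"
  using dual_cos[OF alp free_closed(2)] by simp
qed

lemma ev_cong_good:
 assumes "z : FA n" "!!w. good n w ==> ph w = psi w"
 shows "ev ph z = ev psi z"
 using assms(1) by (induction rule: free_carrier_induct) (simp_all add: ev_add ev_pscale assms(2))

lemma splits_good: "(u, v) : splits n w ==> good n w ==> good n u & good n v"
proof (induction w arbitrary: u v)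
 case (Cons x w)
 then show ?case by (cases x) (auto simp: generators_def)
qed auto

section \<open>Homomorphisms out of the coordinate algebra\<close>

abbreviation word_value :: "('k::field, 'b, 'm) module_scheme => (gen => 'b) => gen list => 'b" where
 "word_value B b w \<equiv> foldr (%x y. b x \<otimes>\<^bsub>B\<^esub> y) w \<one>\<^bsub>B\<^esub>"

text \<open>\<open>S\<close> is a separating set of functionals on the target whose pullbacks to
  words lie in \<open>functionals\<close>. It takes the place of a verification of the relations in
  \<open>B\<close>, of which only the vector space structure has to be known.\<close>

context
 fixes B :: "('k::field, 'b, 'm) module_scheme" and b :: "gen => 'b" and n :: nat and q :: 'k and S :: "('b => 'k) set"
 assumes B: "vspace B" and closed: "!!w. good n w ==> word_value B b w : carrier B"
  and S: "S \<subseteq> dual B" and sep: "!!x. x : carrier B ==> (!!be. be : S ==> be x = 0) ==> x = \<zero>\<^bsub>B\<^esub>"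
  and funct: "!!be. be : S ==> \<exists>psi\<in>functionals n q. \<forall>w. good n w --> be (word_value B b w) = psi w"
begin

lemma word_linext_linear: "linext B (%w. word_value B b (letters w)) : linear_maps (free_algebra n) B"
proof (rule linear_mapsI)
 fix x assume x: "x : carrier (free_algebra n :: ('k, _) module)"
 show "linext B (%w. word_value B b (letters w)) x : carrier B"
  by (rule linext_closed[OF B]) (use x closed in \<open>auto simp: free_algebra_simps\<close>)
 show "linext B (%w. word_value B b (letters w)) (a *[free_algebra n] x) = a *[B] linext B (%w. word_value B b (letters w)) x" for a
  unfolding free_algebra_simps(6) by (rule linext_pscale[OF B]) (use x closed in \<open>auto simp: free_algebra_simps\<close>)
 fix y assume y: "y : carrier (free_algebra n :: ('k, _) module)"
 show "linext B (%w. word_value B b (letters w)) (x +[free_algebra n] y) =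
   linext B (%w. word_value B b (letters w)) x +[B] linext B (%w. word_value B b (letters w)) y"
  unfolding free_algebra_simps(2) by (rule linext_add[OF B, where S = "{w. good n (letters w)}"]) (use x y closed in \<open>auto simp: free_algebra_simps\<close>)
qed

lemma word_linext_wd: "good n w ==> linext B (%w. word_value B b (letters w)) (wd w) = word_value B b w"
 unfolding wd_def using linext_single[OF B, of "%w. word_value B b (letters w)" "Word w" 1] closed[of w] vs_one[OF B] by simp

lemma functional_word_linext:
 assumes "be : dual B" "!!w. good n w ==> be (word_value B b w) = psi w" "z : FA n"
 shows "be (linext B (%w. word_value B b (letters w)) z) = ev psi z"
 by (rule ev_restrict_good[OF lin_comp[OF word_linext_linear assms(1)] _ assms(3)]) (simp add: word_linext_wd assms(2))

text \<open>The pulled back functionals vanish on the ideal and \<open>S\<close> separates, so the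
  linear extension is constant on cosets.\<close>

lemma qgl_hom_cos:
 assumes z: "z : FA n"
 shows "qgl_hom B b (cos n q z) = linext B (%w. word_value B b (letters w)) z"
proof -
 let ?L = "linext B (%w. word_value B b (letters w))"
 have 0: "?L x = \<zero>\<^bsub>B\<^esub>" if x: "x : qgl_ideal n q" for x
 proof (rule sep)
  show "?L x : carrier B" by (rule linD(1)[OF word_linext_linear qgl_ideal_carrier[OF x]])
  fix be assume be: "be : S"
  then obtain psi where psi: "psi : functionals n q" "!!w. good n w ==> be (word_value B b w) = psi w" using funct by blast
  have "be : dual B" using be S by blast
  then have "be (?L x) = ev psi x" using psi(2) qgl_ideal_carrier[OF x] by (rule functional_word_linext)
  then show "be (?L x) = 0" using functional_qgl_ideal[OF psi(1) x] by simp
 qed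
 have "?L y = ?L z" if y: "y : cos n q z" for y
 proof -
  obtain x where x: "x : qgl_ideal n q" "y = x +[free_algebra n] z"
   using y unfolding cos_def a_r_coset_def' by blast
  show ?thesis
   unfolding x(2) linD(2)[OF word_linext_linear qgl_ideal_carrier[OF x(1)] z] 0[OF x(1)]
   by (rule vs_add_zero(1)[OF B linD(1)[OF word_linext_linear z]])
 qed
 moreover have "z : cos n q z" unfolding cos_def by (rule coset_self[OF vspace_free_algebra subspace_qgl_ideal z])
 ultimately have "?L ` cos n q z = {?L z}" by blast
 then show ?thesis by (simp add: qgl_hom_def)
qed

lemma qgl_hom_linear: "qgl_hom B b : linear_maps (qgl_algebra n q) B"
proof (rule linear_mapsI)
 fix x assume "x : carrier (qgl_algebra n q)"
 then obtain z where z: "z : FA n" "x = cos n q z" unfolding carrier_qgl_algebra by (elim imageE)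
 show "qgl_hom B b x : carrier B" unfolding z(2) qgl_hom_cos[OF z(1)] by (rule linD(1)[OF word_linext_linear z(1)])
 show "qgl_hom B b (a *[qgl_algebra n q] x) = a *[B] qgl_hom B b x" for a
 proof -
  have c: "a *[free_algebra n] z : FA n" by (rule vs_smult_closed[OF vspace_free_algebra z(1)])
  show ?thesis
   unfolding z(2) linD(3)[OF cos_linear z(1), symmetric] qgl_hom_cos[OF z(1)] qgl_hom_cos[OF c]
   by (rule linD(3)[OF word_linext_linear z(1)])
 qed
 fix y assume "y : carrier (qgl_algebra n q)"
 then obtain z' where z': "z' : FA n" "y = cos n q z'" unfolding carrier_qgl_algebra by (elim imageE)
 have c: "z +[free_algebra n] z' : FA n" by (rule vs_add_closed[OF vspace_free_algebra z(1) z'(1)])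
 show "qgl_hom B b (x +[qgl_algebra n q] y) = qgl_hom B b x +[B] qgl_hom B b y"
  unfolding z(2) z'(2) linD(2)[OF cos_linear z(1) z'(1), symmetric] qgl_hom_cos[OF z(1)] qgl_hom_cos[OF z'(1)] qgl_hom_cos[OF c]
  by (rule linD(2)[OF word_linext_linear z(1) z'(1)])
qed

lemma functional_qgl_hom:
 assumes "be : dual B" "!!w. good n w ==> be (word_value B b w) = psi w" "z : FA n"
 shows "be (qgl_hom B b (cos n q z)) = ev psi z"
 unfolding qgl_hom_cos[OF assms(3)] by (rule functional_word_linext[OF assms])

end

section \<open>Multiplication in the tensor square\<close>

definition evt :: "('a => 'k) => ('a \<Rightarrow>\<^sub>0 'k::field) => 'k" where
 "evt g f = (\<Sum>p\<in>keys f. lookup f p * g p)"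

lemma evt_linext: "evt g f = linext scalars g f"
 by (simp add: evt_def linext_def finsum_scalars)

lemma evt_add: "evt g (x + y) = evt g x + evt g y"
 unfolding evt_linext using linext_add[OF vspace_scalars, where S = UNIV] by (simp add: subset_UNIV)

lemma evt_pscale: "evt g (pscale a x) = a * evt g x"
 unfolding evt_linext using linext_pscale[OF vspace_scalars] by simp

lemma evt_single: "evt g (single p a) = a * g p"
 unfolding evt_linext using linext_single[OF vspace_scalars] by simp

lemma evt_sum: "evt g (\<Sum>i\<in>I. f i) = (\<Sum>i\<in>I. evt g (f i))"
 by (induction I rule: infinite_finite_induct) (simp_all add: evt_add, simp_all add: evt_def)

lemma evt_cong: "(!!p. p : keys f ==> g p = h p) ==> evt g f = evt h f"
 unfolding evt_def by (intro sum.cong) auto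

context
 fixes n :: nat and q :: "'k::field"
begin

private abbreviation "Q \<equiv> qgl_algebra n q"
private abbreviation "T \<equiv> tensor Q Q"
private abbreviation "FT \<equiv> formal_tensors Q Q"

lemma qgl_mult_closed: "v : carrier Q ==> w : carrier Q ==> v \<otimes>\<^bsub>Q\<^esub> w : carrier Q"
 unfolding carrier_qgl_algebra by (elim imageE) (simp only: cos_mult, intro imageI free_closed(6))

lemma dual_qgl_mult:
 assumes alp: "alp : dual Q" and v: "v : carrier Q"
 shows "(%x. alp (v \<otimes>\<^bsub>Q\<^esub> x)) : dual Q" "(%x. alp (x \<otimes>\<^bsub>Q\<^esub> v)) : dual Q"
proof -
 obtain a where a: "a : FA n" "v = cos n q a" using v unfolding carrier_qgl_algebra by (elim imageE)
 have l: "cos n q (x + y) = cos n q x +[Q] cos n q y" "cos n q (pscale c x) = c *[Q] cos n q x"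
  if "x : FA n" "y : FA n" for x y c
  using linD(2)[OF cos_linear that] linD(3)[OF cos_linear that(1)] by (simp_all only: free_algebra_simps)
 note c = free_closed
 show "(%x. alp (v \<otimes>\<^bsub>Q\<^esub> x)) : dual Q"
 proof (rule linear_mapsI)
  fix x assume "x : carrier Q"
  then obtain b where b: "b : FA n" "x = cos n q b" unfolding carrier_qgl_algebra by (elim imageE)
  show "alp (v \<otimes>\<^bsub>Q\<^esub> (d *[Q] x)) = d *[scalars] alp (v \<otimes>\<^bsub>Q\<^esub> x)" for d
   using linD(3)[OF alp cos_carrier[OF c(6)[OF a(1) b(1)]]]
   by (simp add: a(2) b(2) l(2)[OF b(1) b(1), symmetric] cos_mult c a(1) b(1) pscale_mult l(2)[OF c(6)[OF a(1) b(1)] b(1)])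
  fix y assume "y : carrier Q"
  then obtain b' where b': "b' : FA n" "y = cos n q b'" unfolding carrier_qgl_algebra by (elim imageE)
  show "alp (v \<otimes>\<^bsub>Q\<^esub> (x +[Q] y)) = alp (v \<otimes>\<^bsub>Q\<^esub> x) +[scalars] alp (v \<otimes>\<^bsub>Q\<^esub> y)"
   using linD(2)[OF alp cos_carrier[OF c(6)[OF a(1) b(1)]] cos_carrier[OF c(6)[OF a(1) b'(1)]]]
   by (simp add: a(2) b(2) b'(2) l(1)[OF b(1) b'(1), symmetric] cos_mult c a(1) b(1) b'(1) distrib_left l(1)[OF c(6)[OF a(1) b(1)] c(6)[OF a(1) b'(1)]])
 qed simp
 show "(%x. alp (x \<otimes>\<^bsub>Q\<^esub> v)) : dual Q"
 proof (rule linear_mapsI)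
  fix x assume "x : carrier Q"
  then obtain b where b: "b : FA n" "x = cos n q b" unfolding carrier_qgl_algebra by (elim imageE)
  show "alp ((d *[Q] x) \<otimes>\<^bsub>Q\<^esub> v) = d *[scalars] alp (x \<otimes>\<^bsub>Q\<^esub> v)" for d
   using linD(3)[OF alp cos_carrier[OF c(6)[OF b(1) a(1)]]]
   by (simp add: a(2) b(2) l(2)[OF b(1) b(1), symmetric] cos_mult c a(1) b(1) pscale_mult l(2)[OF c(6)[OF b(1) a(1)] b(1)])
  fix y assume "y : carrier Q"
  then obtain b' where b': "b' : FA n" "y = cos n q b'" unfolding carrier_qgl_algebra by (elim imageE)
  show "alp ((x +[Q] y) \<otimes>\<^bsub>Q\<^esub> v) = alp (x \<otimes>\<^bsub>Q\<^esub> v) +[scalars] alp (y \<otimes>\<^bsub>Q\<^esub> v)"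
   using linD(2)[OF alp cos_carrier[OF c(6)[OF b(1) a(1)]] cos_carrier[OF c(6)[OF b'(1) a(1)]]]
   by (simp add: a(2) b(2) b'(2) l(1)[OF b(1) b'(1), symmetric] cos_mult c a(1) b(1) b'(1) distrib_right l(1)[OF c(6)[OF b(1) a(1)] c(6)[OF b'(1) a(1)]])
 qed simp
qed

lemma pairing_tclass:
 assumes "alp : dual Q" "be : dual Q" "f : carrier FT"
 shows "pairing alp be (tclass Q Q f) = evt (%(v, w). alp v * be w) f"
 unfolding pairing_def evt_linext
 by (rule tensor_lift_tclass[OF vspace_qgl vspace_qgl vspace_scalars bilinear_pairing[OF vspace_qgl vspace_qgl assms(1,2)] assms(3)])

lemma formal_mult_closed:
 assumes "a : carrier FT" "b : carrier FT"
 shows "a \<otimes>\<^bsub>FT\<^esub> b : carrier FT"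
proof -
 have "keys (\<Sum>i\<in>I. f i) \<subseteq> U" if "!!i. i : I ==> keys (f i) \<subseteq> U"
  for I :: "'i set" and f :: "'i => ('x \<Rightarrow>\<^sub>0 'k)" and U
  using that keys_sum[of f I] by blast
 note s = this
 have ka: "v : carrier Q & w : carrier Q" if "(v, w) : keys a" for v w
  using assms(1) that by (auto simp: ft_simps)
 have kb: "v : carrier Q & w : carrier Q" if "(v, w) : keys b" for v w
  using assms(2) that by (auto simp: ft_simps)
 show ?thesis
  unfolding formal_tensors_def monoid.simps partial_object.simps mem_Collect_eq case_prod_beta
  by (intro s) (auto dest!: ka kb intro!: qgl_mult_closed split: if_splits)
qed

lemma evt_formal_mult:
 "evt g (a \<otimes>\<^bsub>FT\<^esub> b) = evt (%(v, w). evt (%(v', w'). g (v \<otimes>\<^bsub>Q\<^esub> v', w \<otimes>\<^bsub>Q\<^esub> w')) b) a"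
 "evt g (a \<otimes>\<^bsub>FT\<^esub> b) = evt (%(v', w'). evt (%(v, w). g (v \<otimes>\<^bsub>Q\<^esub> v', w \<otimes>\<^bsub>Q\<^esub> w')) a) b"
proof -
 have *: "evt g (a \<otimes>\<^bsub>FT\<^esub> b) = (\<Sum>p\<in>keys a. \<Sum>p'\<in>keys b.
   lookup a p * lookup b p' * g (fst p \<otimes>\<^bsub>Q\<^esub> fst p', snd p \<otimes>\<^bsub>Q\<^esub> snd p'))"
  unfolding formal_tensors_def monoid.simps case_prod_beta by (simp add: evt_sum evt_single)
 show "evt g (a \<otimes>\<^bsub>FT\<^esub> b) = evt (%(v, w). evt (%(v', w'). g (v \<otimes>\<^bsub>Q\<^esub> v', w \<otimes>\<^bsub>Q\<^esub> w')) b) a"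
  unfolding * by (simp add: evt_def case_prod_beta sum_distrib_left mult.assoc)
 show "evt g (a \<otimes>\<^bsub>FT\<^esub> b) = evt (%(v', w'). evt (%(v, w). g (v \<otimes>\<^bsub>Q\<^esub> v', w \<otimes>\<^bsub>Q\<^esub> w')) a) b"
  unfolding * by (subst sum.swap) (simp add: evt_def case_prod_beta sum_distrib_left mult_ac)
qed

text \<open>The pairing of a product sees \<open>b\<close>, or in the second form \<open>a\<close>,
  only through its class; this is why the product descends to the tensor square.\<close>

lemma pairing_formal_mult:
 assumes alp: "alp : dual Q" "be : dual Q" and a: "a : carrier FT" and b: "b : carrier FT"
 shows "pairing alp be (tclass Q Q (a \<otimes>\<^bsub>FT\<^esub> b)) =
   evt (%(v, w). pairing (%x. alp (v \<otimes>\<^bsub>Q\<^esub> x)) (%x. be (w \<otimes>\<^bsub>Q\<^esub> x)) (tclass Q Q b)) a"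
  "pairing alp be (tclass Q Q (a \<otimes>\<^bsub>FT\<^esub> b)) =
   evt (%(v, w). pairing (%x. alp (x \<otimes>\<^bsub>Q\<^esub> v)) (%x. be (x \<otimes>\<^bsub>Q\<^esub> w)) (tclass Q Q a)) b"
proof -
 have k: "fst p : carrier Q" "snd p : carrier Q" if "p : keys f" "f : carrier FT" for p and f
  using that by (auto simp: ft_simps)
 show "pairing alp be (tclass Q Q (a \<otimes>\<^bsub>FT\<^esub> b)) =
   evt (%(v, w). pairing (%x. alp (v \<otimes>\<^bsub>Q\<^esub> x)) (%x. be (w \<otimes>\<^bsub>Q\<^esub> x)) (tclass Q Q b)) a"
  unfolding pairing_tclass[OF alp formal_mult_closed[OF a b]] evt_formal_mult(1) case_prod_beta
  by (rule evt_cong) (subst pairing_tclass[OF dual_qgl_mult(1)[OF alp(1) k(1)[OF _ a]] dual_qgl_mult(1)[OF alp(2) k(2)[OF _ a]] b], assumption+, simp add: split_def)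
 show "pairing alp be (tclass Q Q (a \<otimes>\<^bsub>FT\<^esub> b)) =
   evt (%(v, w). pairing (%x. alp (x \<otimes>\<^bsub>Q\<^esub> v)) (%x. be (x \<otimes>\<^bsub>Q\<^esub> w)) (tclass Q Q a)) b"
  unfolding pairing_tclass[OF alp formal_mult_closed[OF a b]] evt_formal_mult(2) case_prod_beta
  by (rule evt_cong) (subst pairing_tclass[OF dual_qgl_mult(2)[OF alp(1) k(1)[OF _ b]] dual_qgl_mult(2)[OF alp(2) k(2)[OF _ b]] a], assumption+, simp add: split_def)
qed

lemma tclass_mem: "f : carrier FT ==> tclass Q Q f : carrier T"
 unfolding carrier_tensor[OF vspace_qgl vspace_qgl] by (rule imageI)

text \<open>Representatives are exchanged one factor at a time, by the two halves of
  \<open>pairing_formal_mult\<close>.\<close>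

lemma tclass_mult:
 assumes a: "a : carrier FT" and b: "b : carrier FT"
 shows "tclass Q Q a \<otimes>\<^bsub>T\<^esub> tclass Q Q b = tclass Q Q (a \<otimes>\<^bsub>FT\<^esub> b)"
proof -
 note Q = vspace_qgl vspace_formal_tensors[of Q Q] subspace_tensor_kernel[OF vspace_qgl vspace_qgl]
 have eq: "tclass Q Q (a' \<otimes>\<^bsub>FT\<^esub> b') = tclass Q Q (a \<otimes>\<^bsub>FT\<^esub> b)" if a': "a' : tclass Q Q a" and b': "b' : tclass Q Q b" for a' b'
 proof -
  have ca: "a' : carrier FT" "b' : carrier FT"
   using coset_subset[OF Q(2,3) a] coset_subset[OF Q(2,3) b] a' b' unfolding tclass_def by blast+
  have ta: "tclass Q Q a' = tclass Q Q a" "tclass Q Q b' = tclass Q Q b"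
   using coset_of_mem[OF Q(2,3) _ a] coset_of_mem[OF Q(2,3) _ b] a' b' unfolding tclass_def by blast+
  have "tclass Q Q (a' \<otimes>\<^bsub>FT\<^esub> b') = tclass Q Q (a' \<otimes>\<^bsub>FT\<^esub> b)"
   by (rule tensor_eqI[OF Q(1) Q(1) tclass_mem[OF formal_mult_closed] tclass_mem[OF formal_mult_closed]])
    (simp_all only: ca b pairing_formal_mult(1) ta)
  also have "... = tclass Q Q (a \<otimes>\<^bsub>FT\<^esub> b)"
   by (rule tensor_eqI[OF Q(1) Q(1) tclass_mem[OF formal_mult_closed] tclass_mem[OF formal_mult_closed]])
    (simp_all only: ca a b pairing_formal_mult(2) ta)
  finally show ?thesis .
 qed
 have "a : tclass Q Q a" "b : tclass Q Q b"
  unfolding tclass_def by (rule coset_self[OF Q(2,3) a], rule coset_self[OF Q(2,3) b])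
 then have "(\<Union>x\<in>tclass Q Q a. \<Union>y\<in>tclass Q Q b. tclass Q Q (x \<otimes>\<^bsub>FT\<^esub> y)) = tclass Q Q (a \<otimes>\<^bsub>FT\<^esub> b)"
  using eq by blast
 then show ?thesis unfolding tensor_def mult_quot_mod rcoset_mult_def tclass_def .
qed

lemma tensor_mult_closed: "A : carrier T ==> B : carrier T ==> A \<otimes>\<^bsub>T\<^esub> B : carrier T"
 unfolding carrier_tensor[OF vspace_qgl vspace_qgl] by (elim imageE) (simp only: tclass_mult, intro imageI formal_mult_closed)

lemma pairing_mult_linear:
 assumes alp: "alp : dual Q" "be : dual Q" and B: "B : carrier T"
 shows "(%A. pairing alp be (A \<otimes>\<^bsub>T\<^esub> B)) : dual T"
proof -
 obtain b where b: "b : carrier FT" "B = tclass Q Q b" using B unfolding carrier_tensor[OF vspace_qgl vspace_qgl] by (elim imageE)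
 note tl = linD(2,3)[OF tclass_linear[OF vspace_qgl vspace_qgl], symmetric]
 note cl = vs_add_closed[OF vspace_formal_tensors] vs_smult_closed[OF vspace_formal_tensors]
 show ?thesis
 proof (rule linear_mapsI)
  fix x assume "x : carrier T"
  then obtain a where a: "a : carrier FT" "x = tclass Q Q a" unfolding carrier_tensor[OF vspace_qgl vspace_qgl] by (elim imageE)
  show "pairing alp be ((d *[T] x) \<otimes>\<^bsub>T\<^esub> B) = d *[scalars] pairing alp be (x \<otimes>\<^bsub>T\<^esub> B)" for d
   unfolding a(2) b(2) tl(2)[OF a(1)] tclass_mult[OF a(1) b(1)] tclass_mult[OF cl(2)[OF a(1)] b(1)]
    pairing_formal_mult(1)[OF alp a(1) b(1)] pairing_formal_mult(1)[OF alp cl(2)[OF a(1)] b(1)]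
   by (simp add: ft_simps evt_pscale)
  fix y assume "y : carrier T"
  then obtain a' where a': "a' : carrier FT" "y = tclass Q Q a'" unfolding carrier_tensor[OF vspace_qgl vspace_qgl] by (elim imageE)
  show "pairing alp be ((x +[T] y) \<otimes>\<^bsub>T\<^esub> B) = pairing alp be (x \<otimes>\<^bsub>T\<^esub> B) +[scalars] pairing alp be (y \<otimes>\<^bsub>T\<^esub> B)"
   unfolding a(2) a'(2) b(2) tl(1)[OF a(1) a'(1)] tclass_mult[OF a(1) b(1)] tclass_mult[OF a'(1) b(1)] tclass_mult[OF cl(1)[OF a(1) a'(1)] b(1)]
    pairing_formal_mult(1)[OF alp a(1) b(1)] pairing_formal_mult(1)[OF alp a'(1) b(1)] pairing_formal_mult(1)[OF alp cl(1)[OF a(1) a'(1)] b(1)]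
   by (simp add: ft_simps evt_add)
 qed simp
qed

lemma pairing_tens_mult:
 assumes alp: "alp : dual Q" "be : dual Q" and B: "B : carrier T" and v: "v : carrier Q" "w : carrier Q"
 shows "pairing alp be (tens Q Q v w \<otimes>\<^bsub>T\<^esub> B) = pairing (%x. alp (v \<otimes>\<^bsub>Q\<^esub> x)) (%x. be (w \<otimes>\<^bsub>Q\<^esub> x)) B"
proof -
 obtain b where b: "b : carrier FT" "B = tclass Q Q b" using B unfolding carrier_tensor[OF vspace_qgl vspace_qgl] by (elim imageE)
 note s = single_mem_formal_tensors[OF v, where a = 1]
 show ?thesis
  unfolding tens_eq_tclass b(2) tclass_mult[OF s b(1)] pairing_formal_mult(1)[OF alp s b(1)] by (simp add: evt_single)
qed

lemma qgl_gen_eq: "qgl_gen n q x = cos n q (wd [x])"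
 by (simp add: qgl_gen_def cos_def gen_elt_wd)

text \<open>The induction keeps the functionals arbitrary, because multiplying on the left by the
  comultiplication of a letter translates both of them by letters.\<close>

lemma comult_word:
 "good n w ==> word_value T (qgl_comult_gen n q) w : carrier T &
  (\<forall>alp\<in>dual Q. \<forall>be\<in>dual Q. pairing alp be (word_value T (qgl_comult_gen n q) w) = cv n (dualf n q alp) (dualf n q be) w)"
proof (induction w)
 case Nil
 have o: "\<one>\<^bsub>T\<^esub> = tens Q Q \<one>\<^bsub>Q\<^esub> \<one>\<^bsub>Q\<^esub>" by (simp add: tensor_def one_quot_mod tens_def formal_tensors_def)
 have c: "\<one>\<^bsub>Q\<^esub> : carrier Q" unfolding cos_one by (rule cos_carrier[OF free_closed(3)])
 have "pairing alp be \<one>\<^bsub>T\<^esub> = dualf n q alp [] * dualf n q be []" if "alp : dual Q" "be : dual Q" for alp be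
  unfolding o using pairing_tens[OF vspace_qgl vspace_qgl that c c] by (simp add: dualf_good wd_Nil cos_one)
 moreover have "\<one>\<^bsub>T\<^esub> : carrier T" unfolding o by (rule tens_closed[OF vspace_qgl vspace_qgl c c])
 ultimately show ?case by (simp add: cv_def)
next
 case (Cons x w)
 let ?B = "word_value T (qgl_comult_gen n q) w"
 have B: "?B : carrier T" and IH: "!!alp be. alp : dual Q ==> be : dual Q ==> pairing alp be ?B = cv n (dualf n q alp) (dualf n q be) w"
  using Cons by auto
 have w: "good n w" and x: "x : generators n" using Cons.prems by auto
 have g: "qgl_gen n q y : carrier Q" if "y : generators n" for y
  unfolding qgl_gen_eq using that by (intro cos_carrier) (simp add: free_closed)
 have step: "pairing alp be (tens Q Q (qgl_gen n q y) (qgl_gen n q y') \<otimes>\<^bsub>T\<^esub> ?B) = cw n (%u v. dualf n q alp (y # u) * dualf n q be (y' # v)) w"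
  if alp: "alp : dual Q" "be : dual Q" and y: "y : generators n" "y' : generators n" for alp be y y'
 proof -
  have d: "dualf n q (%x. \<gamma> (qgl_gen n q z \<otimes>\<^bsub>Q\<^esub> x)) u = dualf n q \<gamma> (z # u)" if "good n u" "z : generators n" for u z and \<gamma> :: "_ => 'k"
   using that cos_mult[of "wd [z]" n "wd u" q] by (simp add: dualf_good qgl_gen_eq free_closed wd_append[symmetric])
  have "pairing alp be (tens Q Q (qgl_gen n q y) (qgl_gen n q y') \<otimes>\<^bsub>T\<^esub> ?B) =
   cv n (dualf n q (%x. alp (qgl_gen n q y \<otimes>\<^bsub>Q\<^esub> x))) (dualf n q (%x. be (qgl_gen n q y' \<otimes>\<^bsub>Q\<^esub> x))) w"
   unfolding pairing_tens_mult[OF alp B g[OF y(1)] g[OF y(2)]]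
   by (rule IH[OF dual_qgl_mult(1)[OF alp(1) g[OF y(1)]] dual_qgl_mult(1)[OF alp(2) g[OF y(2)]]])
  also have "... = cw n (%u v. dualf n q alp (y # u) * dualf n q be (y' # v)) w"
   unfolding cv_def by (rule cw_cong) (use splits_good w d y in auto)
  finally show ?thesis .
 qed
 show ?case
 proof (cases x)
  case (Gen i j)
  have ij: "i : {1..n}" "j : {1..n}" using x Gen by (auto simp: generators_def)
  then have gl: "Gen i l : generators n" "Gen l j : generators n" if "l : {1..n}" for l using that by (auto simp: generators_def)
  have tc: "tens Q Q (qgl_gen n q (Gen i l)) (qgl_gen n q (Gen l j)) : carrier T" if "l : {1..n}" for l
   by (rule tens_closed[OF vspace_qgl vspace_qgl g[OF gl(1)[OF that]] g[OF gl(2)[OF that]]])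
  have A: "qgl_comult_gen n q x : carrier T"
   unfolding Gen qgl_comult_gen.simps by (rule vs_finsum_closed[OF vspace_tensor[OF vspace_qgl vspace_qgl]]) (rule tc)
  have "pairing alp be (qgl_comult_gen n q x \<otimes>\<^bsub>T\<^esub> ?B) = cv n (dualf n q alp) (dualf n q be) (x # w)" if alp: "alp : dual Q" "be : dual Q" for alp be
  proof -
   have "pairing alp be (qgl_comult_gen n q x \<otimes>\<^bsub>T\<^esub> ?B) =
    (\<Sum>l\<in>{1..n}. pairing alp be (tens Q Q (qgl_gen n q (Gen i l)) (qgl_gen n q (Gen l j)) \<otimes>\<^bsub>T\<^esub> ?B))"
    unfolding Gen qgl_comult_gen.simps
    by (subst linear_maps_finsum[OF vspace_tensor[OF vspace_qgl vspace_qgl] vspace_scalars pairing_mult_linear[OF alp B] finite_atLeastAtMost tc])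
     (assumption, rule finsum_scalars, rule finite_atLeastAtMost)
   also have "... = cv n (dualf n q alp) (dualf n q be) (x # w)"
    unfolding Gen cv_def cw_Gen by (intro sum.cong refl step[OF alp] gl)
   finally show ?thesis .
  qed
  then show ?thesis using tensor_mult_closed[OF A B] by simp
 next
  case Dinv
  have d: "Dinv : generators n" by (simp add: generators_def)
  have A: "qgl_comult_gen n q x : carrier T"
   unfolding Dinv qgl_comult_gen.simps by (rule tens_closed[OF vspace_qgl vspace_qgl g[OF d] g[OF d]])
  show ?thesis using tensor_mult_closed[OF A B] step[OF _ _ d d] by (simp add: Dinv cv_def cw_Dinv)
 qed
qed

end

section \<open>The coordinate algebra is a coalgebra with torus restriction\<close>

lemma same_module_kG: "same_module (kG n q) (qgl_algebra n q)"
 by (simp add: same_module_def kG_def module.extend_def coalg.fields_def)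

lemmas kG_carrier = same_moduleD(1)[OF same_module_kG]

lemma kG_dual: "dual (kG n q) = dual (qgl_algebra n q)"
 by (rule same_module_linear_maps[OF same_module_kG same_module_refl])

lemma kG_comult: "comult (kG n q) = qgl_hom (tensor (qgl_algebra n q) (qgl_algebra n q)) (qgl_comult_gen n q)"
 and kG_counit: "counit (kG n q) = qgl_hom scalars qgl_counit_gen"
 by (simp_all add: kG_def module.extend_def coalg.fields_def)

text \<open>The counit is restriction to the torus followed by evaluation at the identity, whence
  the constant \<open>h\<close>.\<close>

lemma counit_word: "word_value scalars qgl_counit_gen w = torus_fun n (%_. 1) w"
proof (induction w)
 case (Cons x w)
 then show ?case by (cases x) (auto simp: torus_fun_def)
qed (simp add: torus_fun_def)

lemma torus_word:
 "word_value (laurent n) (torus_gen n) w = (if list_all diag_gen w then single (word_weight n w) 1 else 0)"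
proof (induction w)
 case Nil
 show ?case by (simp add: laurent_simps word_weight_def single_one)
next
 case (Cons x w)
 then show ?case by (cases x) (auto simp: laurent_simps word_weight_def mult_single intro!: arg_cong[where f = "%mu. single mu 1"] ext)
qed

lemma word_weight_good: "good n w ==> word_weight n w : weight_lattice n"
proof (induction w)
 case (Cons x w)
 then show ?case by (cases x) (auto simp: word_weight_def weight_lattice_def generators_def omega_def)
qed (simp add: word_weight_def weight_lattice_def)

lemma
 fixes n :: nat and q :: "'k::field"
 shows counit_cos: "z : FA n ==> counit (kG n q) (cos n q z) = ev (torus_fun n (%_. 1)) z"
 and counit_linear: "counit (kG n q) : dual (qgl_algebra n q)"
proof -
 have i: "(%x. x) : dual (scalars :: ('k, 'k) module)" by (rule linear_maps_id)
 have f: "\<exists>psi\<in>functionals n q. \<forall>w. good n w --> be (word_value scalars qgl_counit_gen w) = psi w" if "be : {%x. x}" for be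
  using that counit_word[of _ n] torus_fun_functionals[of n "%_. 1" q] by auto
 show "counit (kG n q) (cos n q z) = ev (torus_fun n (%_. 1)) z" if z: "z : FA n"
  unfolding kG_counit
  by (rule functional_qgl_hom[where S = "{%x. x}", OF vspace_scalars _ _ _ f i _ z]) (use i counit_word in auto)
 show "counit (kG n q) : dual (qgl_algebra n q)"
  unfolding kG_counit by (rule qgl_hom_linear[where S = "{%x. x}", OF vspace_scalars _ _ _ f]) (use i in auto)
qed

lemma lookup_dual_laurent: "(%p. lookup p mu) : dual (laurent n :: ('k::field, _) module)"
 by (rule linear_mapsI) (simp_all add: laurent_simps lookup_add)

lemma
 fixes n :: nat and q :: "'k::field"
 shows torus_restrict_cos: "z : FA n ==> lookup (torus_restrict n (cos n q z)) mu = ev (torus_fun n (%nu. if nu = mu then 1 else 0)) z"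
 and torus_restrict_linear: "torus_restrict n : linear_maps (qgl_algebra n q) (laurent n)"
proof -
 let ?S = "range (%mu p. lookup p mu) :: (((nat => int) \<Rightarrow>\<^sub>0 'k) => 'k) set"
 have v: "lookup (word_value (laurent n) (torus_gen n) w) mu = torus_fun n (%nu. if nu = mu then 1 else 0 :: 'k) w" for w mu
  unfolding torus_word by (simp add: torus_fun_def lookup_single when_def)
 have c: "word_value (laurent n) (torus_gen n) w : carrier (laurent n :: ('k, _) module)" if "good n w" for w
  unfolding torus_word using word_weight_good[OF that] by (simp add: laurent_simps)
 have S: "?S \<subseteq> dual (laurent n)" using lookup_dual_laurent by blast
 have sep: "x = \<zero>\<^bsub>laurent n\<^esub>" if "!!be. be : ?S ==> be x = 0" for x :: "(nat => int) \<Rightarrow>\<^sub>0 'k"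
  unfolding laurent_simps(4)
 proof (rule poly_mapping_eqI)
  fix k
  have "(%p. lookup p k) : ?S" by (rule rangeI)
  from that[OF this] show "lookup x k = lookup 0 k" by simp
 qed
 have f: "\<exists>psi\<in>functionals n q. \<forall>w. good n w --> be (word_value (laurent n) (torus_gen n) w) = psi w" if be: "be : ?S" for be
 proof -
  obtain mu where "be = (%p. lookup p mu)" using be by blast
  then show ?thesis using v torus_fun_functionals by (intro bexI[of _ "torus_fun n (%nu. if nu = mu then 1 else 0)"]) simp_all
 qed
 show "lookup (torus_restrict n (cos n q z)) mu = ev (torus_fun n (%nu. if nu = mu then 1 else 0)) z"
  if z: "z : FA n"
  unfolding torus_restrict_def
  by (rule functional_qgl_hom[OF vspace_laurent c S sep f lookup_dual_laurent v z])
 show "torus_restrict n : linear_maps (qgl_algebra n q) (laurent n)"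
  unfolding torus_restrict_def by (rule qgl_hom_linear[OF vspace_laurent c S sep f])
qed

context qgl
begin

text \<open>The separating set consists of the product functionals, whose pullbacks to words are
  convolutions.\<close>

lemma comult_facts:
 shows kG_comult_linear: "comult (kG n q) : linear_maps (qgl_algebra n q) (tensor (qgl_algebra n q) (qgl_algebra n q))"
  and conv_cos: "alp : dual (qgl_algebra n q) ==> be : dual (qgl_algebra n q) ==> z : FA n ==>
   conv (kG n q) alp be (cos n q z) = ev (cv n (dualf n q alp) (dualf n q be)) z"
proof -
 let ?Q = "qgl_algebra n q"
 let ?T = "tensor ?Q ?Q"
 let ?S = "{pairing alp be | alp be. alp : dual ?Q & be : dual ?Q}"
 have T: "vspace ?T" by (rule vspace_tensor[OF vspace_qgl vspace_qgl])
 have c: "word_value ?T (qgl_comult_gen n q) w : carrier ?T" if "good n w" for w using comult_word[OF that] by blast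
 have p: "pairing alp be (word_value ?T (qgl_comult_gen n q) w) = cv n (dualf n q alp) (dualf n q be) w"
  if "alp : dual ?Q" "be : dual ?Q" "good n w" for alp be w using comult_word[OF that(3)] that by blast
 have S: "?S \<subseteq> dual ?T" using pairing_linear[OF vspace_qgl vspace_qgl] by blast
 have sep: "x = \<zero>\<^bsub>?T\<^esub>" if x: "x : carrier ?T" and 0: "!!be. be : ?S ==> be x = 0" for x
 proof (rule tensor_eqI[OF vspace_qgl vspace_qgl x vs_zero_closed[OF T]])
  fix alp ph assume a: "alp : dual ?Q" "ph : dual ?Q"
  have "pairing alp ph \<zero>\<^bsub>?T\<^esub> = 0"
   using linear_maps_zero[OF T vspace_scalars pairing_linear[OF vspace_qgl vspace_qgl a]] by simp
  then show "pairing alp ph x = pairing alp ph \<zero>\<^bsub>?T\<^esub>" using 0[of "pairing alp ph"] a by auto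
 qed
 have f: "\<exists>psi\<in>functionals n q. \<forall>w. good n w --> be (word_value ?T (qgl_comult_gen n q) w) = psi w" if be: "be : ?S" for be
 proof -
  obtain alp \<gamma> where a: "be = pairing alp \<gamma>" "alp : dual ?Q" "\<gamma> : dual ?Q" using be by blast
  show ?thesis unfolding a(1)
   by (intro bexI[of _ "cv n (dualf n q alp) (dualf n q \<gamma>)"] cv_functionals dualf_functionals a allI impI p)
 qed
 show "comult (kG n q) : linear_maps ?Q ?T"
  unfolding kG_comult by (rule qgl_hom_linear[OF T c S sep f])
 show "conv (kG n q) alp be (cos n q z) = ev (cv n (dualf n q alp) (dualf n q be)) z"
  if "alp : dual ?Q" "be : dual ?Q" "z : FA n"
  unfolding conv_def kG_comult
  by (rule functional_qgl_hom[OF T c S sep f pairing_linear[OF vspace_qgl vspace_qgl that(1,2)] p[OF that(1,2)] that(3)])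
qed

lemma quantum_gl: "quantum_gl n q"
proof (intro quantum_gl.intro coalgebra.intro quantum_gl_axioms.intro)
 let ?Q = "qgl_algebra n q"
 show "vspace (kG n q)" by (rule same_module_vspace[OF same_module_sym[OF same_module_kG] vspace_qgl])
 show "comult (kG n q) : linear_maps (kG n q) (tensor (kG n q) (kG n q))"
  unfolding same_module_formal_tensors(3)[OF same_module_kG same_module_kG] same_module_linear_maps[OF same_module_kG same_module_refl]
  by (rule kG_comult_linear)
 show "counit (kG n q) : dual (kG n q)" unfolding kG_dual by (rule counit_linear)
 show "torus_restrict n : linear_maps (kG n q) (laurent n)"
  unfolding same_module_linear_maps[OF same_module_kG same_module_refl] by (rule torus_restrict_linear)
 fix ph psi chi x assume d: "ph : dual (kG n q)" "psi : dual (kG n q)" "chi : dual (kG n q)" and x: "x : carrier (kG n q)"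
 note d = d[unfolded kG_dual]
 obtain z where z: "z : FA n" "x = cos n q z" using x unfolding kG_carrier carrier_qgl_algebra by (elim imageE)
 have cd: "conv (kG n q) alp be : dual ?Q" if "alp : dual ?Q" "be : dual ?Q" for alp be
  unfolding conv_def using lin_comp[OF kG_comult_linear pairing_linear[OF vspace_qgl vspace_qgl that]] .
 have df: "dualf n q (conv (kG n q) alp be) w = cv n (dualf n q alp) (dualf n q be) w" if "alp : dual ?Q" "be : dual ?Q" "good n w" for alp be w
  using conv_cos[OF that(1,2), of "wd w"] that(3) by (simp add: dualf_good free_closed)
 have "ev (cv n (dualf n q (conv (kG n q) ph psi)) (dualf n q chi)) z = ev (cv n (cv n (dualf n q ph) (dualf n q psi)) (dualf n q chi)) z"
  unfolding cv_def[of n "dualf n q (conv (kG n q) ph psi)"] cv_def[of n "cv n _ _"]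
  by (intro ev_cong_good[OF z(1)] cw_cong) (use splits_good df[OF d(1,2)] in auto)
 also have "... = ev (cv n (dualf n q ph) (cv n (dualf n q psi) (dualf n q chi))) z" by (simp only: cv_assoc[abs_def])
 also have "... = ev (cv n (dualf n q ph) (dualf n q (conv (kG n q) psi chi))) z"
  unfolding cv_def[of n "dualf n q ph"]
  by (intro ev_cong_good[OF z(1)] cw_cong) (use splits_good df[OF d(2,3)] in auto)
 finally show "conv (kG n q) (conv (kG n q) ph psi) chi x = conv (kG n q) ph (conv (kG n q) psi chi) x"
  unfolding z(2) conv_cos[OF cd[OF d(1,2)] d(3) z(1)] conv_cos[OF d(1) cd[OF d(2,3)] z(1)] .
qed

end

section \<open>Bidegrees\<close>

text \<open>\<open>Dinv\<close> has degree -1 at every index because the determinant uses each row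
  and each column once.\<close>

fun row_deg :: "gen => nat => int" where
 "row_deg (Gen i j) k = of_bool (k = i)"
| "row_deg Dinv k = -1"

fun col_deg :: "gen => nat => int" where
 "col_deg (Gen i j) k = of_bool (k = j)"
| "col_deg Dinv k = -1"

definition rd :: "gen list => nat => int" where
 "rd w = (%k. sum_list (map (%x. row_deg x k) w))"

definition cd :: "gen list => nat => int" where
 "cd w = (%k. sum_list (map (%x. col_deg x k) w))"

lemma deg_append: "rd (u @ v) = (%k. rd u k + rd v k)" "cd (u @ v) = (%k. cd u k + cd v k)"
 by (simp_all add: rd_def cd_def)

lemma deg_Cons: "rd (x # w) = (%k. rd [x] k + rd w k)" "cd (x # w) = (%k. cd [x] k + cd w k)"
 by (simp_all add: rd_def cd_def)

lemma deg_Nil: "rd [] = (%k. 0)" "cd [] = (%k. 0)"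
 by (simp_all add: rd_def cd_def)

lemma deg_single: "rd [x] = row_deg x" "cd [x] = col_deg x"
 by (simp_all add: rd_def cd_def)

text \<open>The diagonal value \<open>l\<close> is a parameter: 0 serves the automorphism, 1 its
  inverse.\<close>

definition bl :: "int => nat => nat => int" where
 "bl l a b = (if a < b then 1 else if a = b then l else 0)"

text \<open>One form on column degrees minus the same form on row degrees. The difference vanishes
  when both degrees agree, as on the torus, and telescopes when the column degree of one part is the
  row degree of the next.\<close>

definition twist :: "nat => int => (nat => int) => (nat => int) => (nat => int) => (nat => int) => int" where
 "twist n l r c r' c' = (\<Sum>a\<in>{1..n}. \<Sum>b\<in>{1..n}. bl l a b * (c a * c' b - r a * r' b))"

lemma twist_add:
 "twist n l (%k. r k + r' k) (%k. c k + c' k) s d = twist n l r c s d + twist n l r' c' s d"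
 "twist n l s d (%k. r k + r' k) (%k. c k + c' k) = twist n l s d r c + twist n l s d r' c'"
 unfolding twist_def sum.distrib[symmetric] by (intro sum.cong refl, simp add: algebra_simps)+

lemma twist_zero [simp]: "twist n l (%k. 0) (%k. 0) s d = 0" "twist n l s d (%k. 0) (%k. 0) = 0"
 by (simp_all add: twist_def)

lemma twist_diag [simp]: "twist n l r r s s = 0"
 by (simp add: twist_def)

lemma twist_cong:
 assumes "!!k. k : {1..n} ==> r k = s k & c k = d k" "!!k. k : {1..n} ==> r' k = s' k & c' k = d' k"
 shows "twist n l r c r' c' = twist n l s d s' d'"
 unfolding twist_def by (intro sum.cong refl) (use assms in simp)

lemma sum_of_bool2:
 fixes g :: "nat => nat => int"
 assumes "j : {1..n}" "s : {1..n}"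
 shows "(\<Sum>a\<in>{1..n}. \<Sum>b\<in>{1..n}. g a b * (of_bool (a = j) * of_bool (b = s))) = g j s"
proof -
 have "(\<Sum>b\<in>{1..n}. g a b * (of_bool (a = j) * of_bool (b = s))) = (if a = j then g a s else 0)" for a
 proof -
  have "(\<Sum>b\<in>{1..n}. g a b * (of_bool (a = j) * of_bool (b = s))) = (\<Sum>b\<in>{1..n}. if b = s then (if a = j then g a b else 0) else 0)"
   by (intro sum.cong) auto
  then show ?thesis using assms(2) by simp
 qed
 then show ?thesis using assms(1) by simp
qed

lemma twist_delta:
 assumes "i : {1..n}" "j : {1..n}" "r : {1..n}" "s : {1..n}"
 shows "twist n l (%k. of_bool (k = i)) (%k. of_bool (k = j)) (%k. e * of_bool (k = r)) (%k. e * of_bool (k = s)) = e * (bl l j s - bl l i r)"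
proof -
 have "twist n l (%k. of_bool (k = i)) (%k. of_bool (k = j)) (%k. e * of_bool (k = r)) (%k. e * of_bool (k = s)) =
  e * ((\<Sum>a\<in>{1..n}. \<Sum>b\<in>{1..n}. bl l a b * (of_bool (a = j) * of_bool (b = s))) - (\<Sum>a\<in>{1..n}. \<Sum>b\<in>{1..n}. bl l a b * (of_bool (a = i) * of_bool (b = r))))"
  unfolding twist_def sum_subtractf[symmetric] sum_distrib_left by (intro sum.cong refl) (simp add: algebra_simps)
 then show ?thesis unfolding sum_of_bool2[OF assms(2,4)] sum_of_bool2[OF assms(1,3)] .
qed

lemma twist_Gen:
 assumes "i : {1..n}" "j : {1..n}" "r : {1..n}" "s : {1..n}"
 shows "twist n l (rd [Gen i j]) (cd [Gen i j]) (rd [Gen r s]) (cd [Gen r s]) = bl l j s - bl l i r"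
 using twist_delta[OF assms, of l 1] by (simp add: rd_def cd_def)

lemma splits_deg: "(u, v) : splits n w ==> rd u = rd w & cd v = cd w & cd u = rd v"
proof (induction w arbitrary: u v)
 case (Cons x w)
 then obtain a b u' v' where ab: "(a, b) : gsplits n x" "(u', v') : splits n w" "u = a # u'" "v = b # v'" by auto
 have "rd [a] = rd [x]" "cd [b] = cd [x]" "cd [a] = rd [b]"
  using ab(1) by (cases x; auto simp: deg_single fun_eq_iff)+
 then show ?case
  unfolding ab(3,4) deg_Cons[of a u'] deg_Cons[of b v'] deg_Cons[of x w] using Cons.IH[OF ab(2)] by simp
qed (simp add: deg_Nil)

text \<open>In a comultiplication the column degree of the left part is the row degree of the right
  part, so the inner terms cancel.\<close>

lemma twist_splits:
 assumes "(a, b) : gsplits n x" "(u, v) : splits n w"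
 shows "twist n l (rd [a]) (cd [a]) (rd u) (cd u) + twist n l (rd [b]) (cd [b]) (rd v) (cd v) = twist n l (rd [x]) (cd [x]) (rd w) (cd w)"
proof -
 have "([a], [b]) : splits n [x]" using assms(1) by force
 from splits_deg[OF this] splits_deg[OF assms(2)] show ?thesis
  unfolding twist_def sum.distrib[symmetric] by (intro sum.cong refl) (simp add: algebra_simps)
qed

text \<open>Homogeneity; degrees are compared on 1..n only, and the zero element has every
  degree.\<close>

definition has_deg :: "nat => 'k::field free => (nat => int) => (nat => int) => bool" where
 "has_deg n z r c \<longleftrightarrow> (\<forall>w\<in>keys z. good n (letters w) &
   (\<forall>k\<in>{1..n}. rd (letters w) k = r k & cd (letters w) k = c k))"

lemma has_deg_carrier: "has_deg n z r c ==> z : FA n"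
 by (simp add: has_deg_def free_algebra_simps)

lemma has_deg_wd: "good n w ==> has_deg n (wd w) (rd w) (cd w)"
 by (simp add: has_deg_def wd_def)

lemma has_deg_cong:
 "has_deg n z r c ==> (!!k. k : {1..n} ==> r k = r' k & c k = c' k) ==> has_deg n z r' c'"
 by (simp add: has_deg_def)

lemma has_deg_subset: "has_deg n x r c ==> keys z \<subseteq> keys x ==> has_deg n z r c"
 unfolding has_deg_def by blast

lemma has_deg_pscale: "has_deg n x r c ==> has_deg n (pscale a x) r c"
 by (erule has_deg_subset) (rule keys_pscale)

lemma has_deg_add:
 assumes "has_deg n x r c" "has_deg n y r c"
 shows "has_deg n (x + y) r c"
 using assms Poly_Mapping.keys_add[of x y] unfolding has_deg_def by blast

lemma has_deg_diff:
 assumes "has_deg n x r c" "has_deg n y r c"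
 shows "has_deg n (x - y) r c"
 using has_deg_add[OF assms(1) has_deg_pscale[OF assms(2), of "-1"]] by (simp add: pscale_simps)

lemma has_deg_sum: "(!!i. i : I ==> has_deg n (f i) r c) ==> has_deg n (\<Sum>i\<in>I. f i) r c"
 by (induction I rule: infinite_finite_induct) (simp_all add: has_deg_add, simp_all add: has_deg_def)

lemma has_deg_mult:
 assumes "has_deg n x r c" "has_deg n y r' c'"
 shows "has_deg n (x * y) (%k. r k + r' k) (%k. c k + c' k)"
 unfolding has_deg_def
proof
 fix w assume "w : keys (x * y)"
 then obtain a b where ab: "w = a + b" "a : keys x" "b : keys y"
  using keys_mult[of x y] by blast
 then show "good n (letters w) & (\<forall>k\<in>{1..n}. rd (letters w) k = r k + r' k & cd (letters w) k = c k + c' k)"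
  using assms by (simp add: plus_gen_word_def has_deg_def deg_append)
qed

lemma deg_map2:
 "length I = length L ==> distinct I ==> distinct L ==> rd (map2 Gen I L) k = of_bool (k : set I) & cd (map2 Gen I L) k = of_bool (k : set L)"
 by (induction I L rule: list_induct2) (auto simp: rd_def cd_def)

lemma has_deg_skew_det:
 assumes "distinct I" "set I \<subseteq> {1..n}" "S \<subseteq> {1..n}" "card S = length I"
 shows "has_deg n (skew_det u (%i r. gc i r) I S) (%k. of_bool (k : set I)) (%k. of_bool (k : S))"
proof -
 have "finite S" using assms(3) finite_subset by blast
 then have eq: "skew_det u (%i r. gc i r) I S = (\<Sum>L | set L = S & distinct L. pscale (inv_sign u L) (wd (map2 Gen I L)))"
  using assms(4) by (rule skew_det_lists)
 show ?thesis unfolding eq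
 proof (intro has_deg_sum has_deg_pscale)
  fix L assume L: "L : {L. set L = S & distinct L}"
  then have len: "length I = length L" using assms(4) distinct_card[of L] by auto
  have "good n (map2 Gen I L)"
   unfolding good_def
  proof
   fix x assume "x : set (map2 Gen I L)"
   then obtain a b where ab: "(a, b) : set (zip I L)" "x = Gen a b" by auto
   have "a : {1..n}" using set_zip_leftD[OF ab(1)] assms(2) by blast
   moreover have "b : {1..n}" using set_zip_rightD[OF ab(1)] L assms(3) by blast
   ultimately show "x : generators n" by (simp add: generators_def ab(2))
  qed
  then show "has_deg n (wd (map2 Gen I L)) (%k. of_bool (k : set I)) (%k. of_bool (k : S))"
   using L deg_map2[OF len assms(1)] by (intro has_deg_cong[OF has_deg_wd]) auto
 qed
qed

lemma has_deg_gc: "i : {1..n} ==> j : {1..n} ==> has_deg n (gc i j) (%k. of_bool (k = i)) (%k. of_bool (k = j))"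
 unfolding gen_elt_wd by (rule has_deg_cong[OF has_deg_wd]) (auto simp: generators_def deg_single)

lemma has_deg_Dinv: "has_deg n (gen_elt Dinv) (%k. -1) (%k. -1)"
 unfolding gen_elt_wd by (rule has_deg_cong[OF has_deg_wd]) (auto simp: generators_def deg_single)

lemma has_deg_one: "has_deg n 1 (%k. 0) (%k. 0)"
 using has_deg_wd[of n "[]"] by (simp add: wd_Nil deg_Nil)

lemma has_deg_qdet: "has_deg n (qdet n) (%k. 1) (%k. 1)"
 unfolding qdet_eq_skew_det by (rule has_deg_cong[OF has_deg_skew_det]) (auto simp del: upt_Suc)

lemma has_deg_gc_gc:
 assumes "i : {1..n}" "j : {1..n}" "a : {1..n}" "b : {1..n}"
 shows "has_deg n (gc i a * gc j b) (%k. of_bool (k = i) + of_bool (k = j)) (%k. of_bool (k = a) + of_bool (k = b))"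
  "has_deg n (gc j b * gc i a) (%k. of_bool (k = i) + of_bool (k = j)) (%k. of_bool (k = a) + of_bool (k = b))"
 by (rule has_deg_mult[OF has_deg_gc[OF assms(1,3)] has_deg_gc[OF assms(2,4)]])
  (rule has_deg_cong[OF has_deg_mult[OF has_deg_gc[OF assms(2,4)] has_deg_gc[OF assms(1,3)]]], simp)

lemma has_deg_relation:
 assumes "r : relations n q"
 shows "\<exists>s d. has_deg n r s d"
 using assms
proof (induction rule: relations_cases)
 case (row i a b)
 have "has_deg n (gc i b * gc i a) (%k. of_bool (k = i) + of_bool (k = i)) (%k. of_bool (k = a) + of_bool (k = b))"
  by (rule has_deg_cong[OF has_deg_gc_gc(1)[OF row(1,1,3,2)]]) simp
 from has_deg_diff[OF has_deg_gc_gc(1)[OF row(1,1,2,3)] this] show ?case by blast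
next
 case (qrel i j a b)
 from has_deg_diff[OF has_deg_gc_gc(1)[OF qrel(2,1,3,4)] has_deg_pscale[OF has_deg_gc_gc(2)[OF qrel(2,1,3,4)]]]
 show ?case by blast
next
 case (cross i j a b)
 have "has_deg n (gc i b * gc j a) (%k. of_bool (k = i) + of_bool (k = j)) (%k. of_bool (k = a) + of_bool (k = b))"
  by (rule has_deg_cong[OF has_deg_gc_gc(1)[OF cross(1,2,4,3)]]) simp
 from has_deg_diff[OF has_deg_gc_gc(2)[OF cross(1-4)] has_deg_add[OF has_deg_gc_gc(1)[OF cross(1-4)] has_deg_pscale[OF this]]]
 show ?case by blast
next
 case det
 have "has_deg n (qdet n * gen_elt Dinv) (%k. 0) (%k. 0)"
  by (rule has_deg_cong[OF has_deg_mult[OF has_deg_qdet has_deg_Dinv]]) simp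
 from has_deg_diff[OF this has_deg_one] show ?case by blast
next
 case Dinv
 have "has_deg n (gen_elt Dinv * qdet n) (%k. 0) (%k. 0)"
  by (rule has_deg_cong[OF has_deg_mult[OF has_deg_Dinv has_deg_qdet]]) simp
 from has_deg_diff[OF this has_deg_one] show ?case by blast
qed

section \<open>The twisted homomorphism\<close>

lemma free_eqI:
 assumes "!!ph. ev ph x = ev ph y"
 shows "x = (y :: 'k::field free)"
proof (rule poly_mapping_eqI)
 fix p
 have "ev (%w. if w = letters p then 1 else 0) z = lookup z p" for z :: "'k free"
 proof -
  have "(letters w = letters p) = (w = p)" for w by (cases w; cases p) simp
  then have "ev (%w. if w = letters p then 1 else 0) z = (\<Sum>w\<in>keys z. if w = p then lookup z w else 0)"
   unfolding ev_def by (intro sum.cong) auto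
  then show ?thesis by (simp add: in_keys_iff)
 qed
 then show "lookup x p = lookup y p" using assms by metis
qed

lemma ev_cong_keys: "(!!w. w : keys z ==> ph (letters w) = psi (letters w)) ==> ev ph z = ev psi z"
 unfolding ev_def by (intro sum.cong) auto

context qgl
begin

notation cong_free (infix "\<asymp>" 50)

text \<open>The factor q^(l (i - j)) is multiplicative along a comultiplication and is chosen so
  that the maps for \<open>l\<close> and \<open>1 - l\<close> become inverse to each other. Illegal
  letters go to 0, so that bad words do not count.\<close>

fun tg :: "int => gen => 'k free" where
 "tg l (Gen i j) = (if i : N & j : N then pscale (q powi (l * (int i - int j))) (y (n + 1 - j) (n + 1 - i)) else 0)"
| "tg l Dinv = qdet n"

text \<open>Each letter is twisted against the whole rest of the word; by bilinearity this gives the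
  symmetric rule \<open>tw_append\<close>.\<close>

primrec tw :: "int => gen list => 'k free" where
 "tw l [] = 1"
| "tw l (x # w) = pscale (q powi twist n l (rd [x]) (cd [x]) (rd w) (cd w)) (tg l x * tw l w)"

definition th :: "int => 'k free => 'k free" where
 "th l z = (\<Sum>w\<in>keys z. pscale (lookup z w) (tw l (letters w)))"

lemma ev_th: "ev ph (th l z) = ev (%w. ev ph (tw l w)) z"
 unfolding th_def ev_sum ev_pscale ev_def[of "%w. ev ph (tw l w)"] ..

lemma ev_th_mult: "ev ph (th l z * x) = ev (%w. ev ph (tw l w * x)) z" "ev ph (x * th l z) = ev (%w. ev ph (x * tw l w)) z"
 unfolding th_def sum_distrib_right sum_distrib_left pscale_mult ev_sum ev_pscale
  ev_def[of "%w. ev ph (tw l w * x)"] ev_def[of "%w. ev ph (x * tw l w)"] by (rule refl)+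

lemma th_linear: "th l (x + z) = th l x + th l z" "th l (pscale a x) = pscale a (th l x)" "th l (x - z) = th l x - th l z"
 "th l 0 = 0" "th l (\<Sum>i\<in>I. f i) = (\<Sum>i\<in>I. th l (f i))"
 by (rule free_eqI, simp add: ev_th ev_add ev_pscale ev_diff ev_sum)+

lemma th_wd: "th l (wd w) = tw l w" by (rule free_eqI) (simp add: ev_th)

lemma tw_append: "tw l (u @ v) = pscale (q powi twist n l (rd u) (cd u) (rd v) (cd v)) (tw l u * tw l v)"
proof (induction u)
 case (Cons x u)
 have "twist n l (rd [x]) (cd [x]) (rd (u @ v)) (cd (u @ v)) + twist n l (rd u) (cd u) (rd v) (cd v) =
  twist n l (rd (x # u)) (cd (x # u)) (rd v) (cd v) + twist n l (rd [x]) (cd [x]) (rd u) (cd u)"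
  unfolding deg_append deg_Cons[of x u] twist_add by simp
 then show ?case
  using Cons q by (simp add: pscale_mult pscale_simps power_int_add[symmetric] mult.assoc)
qed (simp add: deg_Nil pscale_simps)

lemma tw_bad: "\<not> good n w ==> tw l w = 0"
proof (induction w)
 case (Cons x w)
 then show ?case
  by (cases x) (auto simp: generators_def pscale_simps)
qed simp

text \<open>Homogeneity of both factors makes the twist constant over all pairs of words, so it can
  be pulled out.\<close>

lemma th_mult:
 assumes "has_deg n x r c" "has_deg n z r' c'"
 shows "th l (x * z) = pscale (q powi twist n l r c r' c') (th l x * th l z)"
proof (rule free_eqI)
 fix ph
 have "ev ph (th l (x * z)) = ev (%u. ev (%v. ev ph (tw l (u @ v))) z) x" by (simp add: ev_th ev_mult)
 also have "... = ev (%u. ev (%v. q powi twist n l r c r' c' * ev ph (tw l u * tw l v)) z) x"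
 proof (intro ev_cong_keys)
  fix u v assume uv: "u : keys x" "v : keys z"
  have "twist n l (rd (letters u)) (cd (letters u)) (rd (letters v)) (cd (letters v)) = twist n l r c r' c'"
   by (rule twist_cong) (use assms uv in \<open>auto simp: has_deg_def\<close>)
  then show "ev ph (tw l (letters u @ letters v)) = q powi twist n l r c r' c' * ev ph (tw l (letters u) * tw l (letters v))"
   by (simp add: tw_append ev_pscale)
 qed
 also have "... = ev ph (pscale (q powi twist n l r c r' c') (th l x * th l z))"
  unfolding ev_pscale ev_fun_mult(1) ev_th_mult(1)[where z = x] unfolding ev_th_mult(2) ..
 finally show "ev ph (th l (x * z)) = ev ph (pscale (q powi twist n l r c r' c') (th l x * th l z))" .
qed

lemma has_deg_y: "i : N ==> j : N ==> has_deg n (y i j) (%k. - of_bool (k = j)) (%k. - of_bool (k = i))"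
 unfolding y_def minor_def
 by (intro has_deg_pscale has_deg_cong[OF has_deg_mult[OF has_deg_skew_det has_deg_Dinv]]) auto

lemma reflect_N: "i : N ==> n + 1 - i : N" "i : N ==> n + 1 - (n + 1 - i) = i" by auto

text \<open>Inversion negates and interchanges row and column degree, the transposed position
  interchanges them again; negation and reflection remain.\<close>

lemma has_deg_tg: "x : generators n ==> has_deg n (tg l x) (%k. - row_deg x (n + 1 - k)) (%k. - col_deg x (n + 1 - k))"
proof (cases x)
 case (Gen i j)
 assume "x : generators n"
 then have ij: "i : N" "j : N" by (auto simp: Gen generators_def)
 have "has_deg n (tg l x) (%k. - of_bool (k = n + 1 - i)) (%k. - of_bool (k = n + 1 - j))"
 proof -
  have e: "tg l x = pscale (q powi (l * (int i - int j))) (y (n + 1 - j) (n + 1 - i))" using ij by (simp add: Gen)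
  show ?thesis unfolding e by (intro has_deg_pscale has_deg_y reflect_N(1) ij)
 qed
 then show ?thesis by (rule has_deg_cong) (use ij in \<open>auto simp: Gen\<close>)
qed (simp add: has_deg_qdet)

lemma has_deg_tw: "good n w ==> has_deg n (tw l w) (%k. - rd w (n + 1 - k)) (%k. - cd w (n + 1 - k))"
proof (induction w)
 case (Cons x w)
 then have "has_deg n (tg l x * tw l w) (%k. - row_deg x (n + 1 - k) + - rd w (n + 1 - k)) (%k. - col_deg x (n + 1 - k) + - cd w (n + 1 - k))"
  by (intro has_deg_mult has_deg_tg) auto
 then show ?case unfolding tw.simps by (intro has_deg_pscale) (simp add: rd_def cd_def)
qed (simp add: has_deg_one deg_Nil)

text \<open>Through the twist each inversion of the column list contributes 1/q, so the sign -1
  becomes -1/q. The factors q^(l (i - p)) cancel, since row indices and column indices have the same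
  sum.\<close>

lemma th_qdet_expand:
 "th l (qdet n) = (\<Sum>P | set P = N & distinct P. pscale (inv_sign t P) (prod_list (map2 (%i p. y (n + 1 - p) (n + 1 - i)) [1..<Suc n] P)))"
proof -
 have filt: "inv_sign u (p # P) = u ^ length (filter (%s. s < p) P) * inv_sign u P" if "p \<notin> set P" for u :: 'k and p P
 proof -
  have "prod_list (map (%y. if p < y then 1 else if y < p then u else 0) P) = u ^ length (filter (%s. s < p) P)"
   using that by (induction P) auto
  then show ?thesis by simp
 qed
 \<comment> \<open>As i < a, the form at the rows is 1, so a later column contributes 0, or -1 if it
   forms an inversion with p.\<close>
 have tws: "twist n l (rd [Gen i p]) (cd [Gen i p]) (rd (map2 Gen I P)) (cd (map2 Gen I P)) = - int (length (filter (%s. s < p) P))"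
  if "length I = length P" "i : N" "p : N" "set I \<subseteq> N" "set P \<subseteq> N" "\<forall>a\<in>set I. i < a" "p \<notin> set P" for i p I P
  using that
 proof (induction I P rule: list_induct2)
  case (Cons a I b P)
  have h: "twist n l (rd [Gen i p]) (cd [Gen i p]) (rd [Gen a b]) (cd [Gen a b]) = bl l p b - bl l i a"
   by (rule twist_Gen) (use Cons.prems in auto)
  have IH: "twist n l (rd [Gen i p]) (cd [Gen i p]) (rd (map2 Gen I P)) (cd (map2 Gen I P)) = - int (length (filter (%s. s < p) P))"
   by (rule Cons.IH) (use Cons.prems in auto)
  have "twist n l (rd [Gen i p]) (cd [Gen i p]) (rd (Gen a b # map2 Gen I P)) (cd (Gen a b # map2 Gen I P)) =
   (bl l p b - bl l i a) + - int (length (filter (%s. s < p) P))"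
   unfolding deg_Cons[of "Gen a b" "map2 Gen I P"] twist_add h IH ..
  moreover have "bl l p b - bl l i a = (if b < p then -1 else 0)" using Cons.prems by (auto simp: bl_def)
  ultimately show ?case by simp
 qed (simp add: deg_Nil)
 have main: "pscale (inv_sign (-1) P) (tw l (map2 Gen I P)) =
   pscale (inv_sign t P * q powi (l * (int (sum_list I) - int (sum_list P)))) (prod_list (map2 (%i p. y (n + 1 - p) (n + 1 - i)) I P))"
  if "length I = length P" "sorted_wrt (<) I" "distinct P" "set I \<subseteq> N" "set P \<subseteq> N" for I P
  using that
 proof (induction I P rule: list_induct2)
  case (Cons i I p P)
  let ?c = "length (filter (%s. s < p) P)" and ?Y = "%I P. prod_list (map2 (%i p. y (n + 1 - p) (n + 1 - i)) I P)"
  have m: "i : N" "p : N" "set I \<subseteq> N" "set P \<subseteq> N" "\<forall>a\<in>set I. i < a" "p \<notin> set P" using Cons.prems by auto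
  have "pscale (inv_sign (-1) (p # P)) (tw l (map2 Gen (i # I) (p # P))) =
   pscale ((-1) ^ ?c * q powi (- int ?c) * q powi (l * (int i - int p))) (y (n + 1 - p) (n + 1 - i) * pscale (inv_sign (-1) P) (tw l (map2 Gen I P)))"
   using m by (simp add: filt[OF m(6)] tws[OF Cons.hyps m] pscale_mult pscale_simps mult_ac del: inv_sign.simps)
  also have "... = pscale ((-1) ^ ?c * q powi (- int ?c) * q powi (l * (int i - int p)))
    (y (n + 1 - p) (n + 1 - i) * pscale (inv_sign t P * q powi (l * (int (sum_list I) - int (sum_list P)))) (?Y I P))"
   using Cons by simp
  also have "(-1) ^ ?c * q powi (- int ?c) = t ^ ?c"
   by (simp add: power_int_minus divide_inverse power_minus[of "inverse q"] power_inverse)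
  also have "pscale (t ^ ?c * q powi (l * (int i - int p))) (y (n + 1 - p) (n + 1 - i) * pscale (inv_sign t P * q powi (l * (int (sum_list I) - int (sum_list P)))) (?Y I P)) =
   pscale (t ^ ?c * inv_sign t P * (q powi (l * (int i - int p)) * q powi (l * (int (sum_list I) - int (sum_list P))))) (?Y (i # I) (p # P))"
   by (simp add: pscale_mult pscale_simps mult_ac)
  also have "q powi (l * (int i - int p)) * q powi (l * (int (sum_list I) - int (sum_list P))) = q powi (l * (int (sum_list (i # I)) - int (sum_list (p # P))))"
   using q by (simp add: power_int_add[symmetric] algebra_simps)
  also have "t ^ ?c * inv_sign t P = inv_sign t (p # P)" by (rule filt[OF m(6), symmetric])
  finally show ?case .
 qed (simp add: pscale_simps)
 let ?I = "[1..<Suc n]"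
 have "qdet n = (\<Sum>P | set P = N & distinct P. pscale (inv_sign (-1) P) (wd (map2 Gen ?I P) :: 'k free))"
  unfolding qdet_eq_skew_det by (rule skew_det_lists) auto
 then have "th l (qdet n) = (\<Sum>P | set P = N & distinct P. pscale (inv_sign (-1) P) (tw l (map2 Gen ?I P)))"
  by (simp only: th_linear th_wd)
 also have "... = (\<Sum>P | set P = N & distinct P. pscale (inv_sign t P) (prod_list (map2 (%i p. y (n + 1 - p) (n + 1 - i)) ?I P)))"
 proof (rule sum.cong[OF refl])
  fix P assume P: "P : {P. set P = N & distinct P}"
  then have len: "length ?I = length P" using distinct_card[of P] by auto
  have s: "sum_list P = sum_list ?I" using P by (simp add: distinct_sum_list_conv_Sum atLeastLessThanSuc_atLeastAtMost del: upt_Suc)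
  have "set ?I \<subseteq> N" by auto
  then show "pscale (inv_sign (-1) P) (tw l (map2 Gen ?I P)) = pscale (inv_sign t P) (prod_list (map2 (%i p. y (n + 1 - p) (n + 1 - i)) ?I P))"
   using main[OF len] P s by (simp add: sorted_wrt_upt del: upt_Suc)
 qed
 finally show ?thesis .
qed

text \<open>Reversing a list and reflecting its entries preserves inversions. The factors then stand
  in reversed order, as in the inverse of a tensor power of the matrix.\<close>

lemma th_qdet_reverse:
 "th l (qdet n) = (\<Sum>P | set P = N & distinct P. pscale (inv_sign t P) (prod_list (rev (map2 y P [1..<Suc n]))))"
 unfolding th_qdet_expand
proof (rule sum.reindex_bij_witness[where i = "%P. rev (map (%p. n + 1 - p) P)" and j = "%P. rev (map (%p. n + 1 - p) P)"])
 fix P assume P: "P : {P. set P = N & distinct P}"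
 have inv: "map (%p. n + 1 - (n + 1 - p)) P = P" by (rule map_idI) (use P in auto)
 then show inv': "rev (map (%p. n + 1 - p) (rev (map (%p. n + 1 - p) P))) = P" by (simp add: rev_map o_def)
 then show "rev (map (%p. n + 1 - p) (rev (map (%p. n + 1 - p) P))) = P" .
 have im: "(%p. n + 1 - p) ` N = N"
 proof (intro subset_antisym subsetI)
  fix k assume "k : N"
  then show "k : (%p. n + 1 - p) ` N" by (intro image_eqI[of _ _ "n + 1 - k"]) auto
 qed auto
 have inj: "inj_on (%p. n + 1 - p) N" by (auto simp: inj_on_def)
 show mem: "rev (map (%p. n + 1 - p) P) : {P. set P = N & distinct P}"
  using P im inj by (simp add: distinct_map)
 then show "rev (map (%p. n + 1 - p) P) : {P. set P = N & distinct P}" .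
 have "inv_sign t (rev (map (%p. n + 1 - p) L)) = inv_sign t L" if "set L \<subseteq> N" for L
  using that
 proof (induction L)
  case (Cons p L)
  have mp: "map ((%y. if y < n + 1 - p then 1 else if n + 1 - p < y then t else 0) \<circ> (%p. n + 1 - p)) L =
   map (%y. if p < y then 1 else if y < p then t else 0) L"
   by (rule map_cong) (use Cons.prems in auto)
  have pr: "prod_list (map F (rev (map c L))) = prod_list (map (F \<circ> c) L)" for F :: "nat => 'k" and c :: "nat => nat"
   by (simp only: rev_map[symmetric] map_map prod_list.rev)
  have IH: "inv_sign t (rev (map (%p. n + 1 - p) L)) = inv_sign t L" by (rule Cons.IH) (use Cons.prems in simp)
  show ?case by (simp only: list.map rev.simps inv_sign_snoc pr mp inv_sign.simps IH)
 qed simp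
 then have sg: "inv_sign t (rev (map (%p. n + 1 - p) P)) = inv_sign t P" using P by simp
 have len: "length P = n" using P distinct_card[of P] by auto
 have "rev (map2 y (rev (map (%p. n + 1 - p) P)) [1..<Suc n]) = map2 (%i p. y (n + 1 - p) (n + 1 - i)) [1..<Suc n] P"
  by (rule nth_equalityI) (auto simp: rev_nth nth_upt len Suc_diff_Suc simp del: upt_Suc)
 then show "pscale (inv_sign t (rev (map (%p. n + 1 - p) P))) (prod_list (rev (map2 y (rev (map (%p. n + 1 - p) P)) [1..<Suc n]))) =
  pscale (inv_sign t P) (prod_list (map2 (%i p. y (n + 1 - p) (n + 1 - i)) [1..<Suc n] P))"
  by (simp only: sg)
qed

text \<open>The products are nested, so the sums over the middle indices collapse by
  \<open>gc_y\<close> from the innermost pair outwards.\<close>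

lemma contraction:
 "length L = length M ==> set L \<subseteq> N ==> set M \<subseteq> N ==>
  (\<Sum>P | set P \<subseteq> N & length P = length L. prod_list (map2 (%i r. gc i r) L P) * prod_list (rev (map2 y P M))) \<asymp> (if L = M then 1 else 0)"
proof (induction L M rule: list_induct2)
 case Nil
 have "{P. set P \<subseteq> N & length P = length ([] :: nat list)} = {[]}" by auto
 then show ?case by simp
next
 case (Cons a L b M)
 have m: "a : N" "b : N" "set L \<subseteq> N" "set M \<subseteq> N" using Cons.prems by auto
 let ?A = "%L P. prod_list (map2 (%i r. gc i r) L P) :: 'k free" and ?B = "%P M. prod_list (rev (map2 y P M))"
 have inj: "inj_on (%(xs, m). m # xs) (A \<times> B)" for A :: "nat list set" and B by (auto simp: inj_on_def)
 have "(\<Sum>P | set P \<subseteq> N & length P = length (a # L). ?A (a # L) P * ?B P (b # M)) =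
  (\<Sum>(P, m)\<in>{P. set P \<subseteq> N & length P = length L} \<times> N. ?A (a # L) (m # P) * ?B (m # P) (b # M))"
  unfolding list.size lists_length_Suc_eq add_Suc_right add_0_right sum.reindex[OF inj] by (intro sum.cong refl) auto
 also have "... = (\<Sum>m\<in>N. \<Sum>P | set P \<subseteq> N & length P = length L. ?A (a # L) (m # P) * ?B (m # P) (b # M))"
  unfolding sum.cartesian_product[symmetric] by (rule sum.swap)
 also have "... = (\<Sum>m\<in>N. gc a m * (\<Sum>P | set P \<subseteq> N & length P = length L. ?A L P * ?B P M) * y m b)"
  by (simp add: sum_distrib_left sum_distrib_right mult.assoc)
 also have "... \<asymp> (\<Sum>m\<in>N. gc a m * (if L = M then 1 else 0) * y m b)"
  by (intro cong_sum cong_mult_left cong_mult_right Cons.IH m)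
 also have "... = (if L = M then \<Sum>m\<in>N. gc a m * y m b else 0)" by simp
 also have "... \<asymp> (if L = M then if a = b then 1 else 0 else 0)" using gc_y[OF m(1,2)] by simp
 also have "... = (if a # L = b # M then 1 else 0)" by simp
 finally show ?case .
qed

text \<open>After multiplication by the determinant from the left, each sign times determinant
  becomes a column determinant with permuted columns. Expanding it and contracting with the reversed
  products leaves the identity term only, so the image is a right inverse of the
  determinant.\<close>

lemma th_qdet: "th l (qdet n) \<asymp> gen_elt Dinv"
proof -
 let ?I = "[1..<Suc n]" and ?D = "{P. set P = N & distinct P}" and ?M = "{P. set P \<subseteq> N & length P = n}"
 let ?R = "%P. prod_list (rev (map2 y P ?I))"
 have fin: "finite ?M" by (rule finite_lists_length_eq) simp
 have lenD: "length P = n" if "P : ?D" for P using that distinct_card[of P] by auto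
 have D: "?D \<subseteq> ?M" using lenD by auto
 have "qdet n * th l (qdet n) = (\<Sum>P\<in>?D. pscale (inv_sign t P) (qdet n) * ?R P)"
  unfolding th_qdet_reverse sum_distrib_left by (simp only: pscale_mult)
 also have "... \<asymp> (\<Sum>P\<in>?D. skew_det t gcT P N * ?R P)"
 proof (intro cong_sum cong_mult_right)
  fix P assume P: "P : ?D"
  then have "sort P = ?I" by (metis (mono_tags, lifting) mem_Collect_eq sorted_list_of_set_sort_remdups distinct_remdups_id sorted_list_of_set_upto)
  then have "skew_det t gcT P N \<asymp> pscale (inv_sign t P) (col_det N N)"
   using col_det_sort[of P] P unfolding sorted_list_of_set_upto by simp
  also have "... \<asymp> pscale (inv_sign t P) (qdet n)" by (rule cong_pscale[OF qdet_col])
  finally show "pscale (inv_sign t P) (qdet n) \<asymp> skew_det t gcT P N" by (rule cong_sym)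
 qed
 \<comment> \<open>Lists with a repetition have vanishing column determinant, so the sum may be
   extended to all lists, as \<open>contraction\<close> requires.\<close>
 also have "... \<asymp> (\<Sum>P\<in>?M. skew_det t gcT P N * ?R P)"
 proof -
  have "(\<Sum>P\<in>?M. skew_det t gcT P N * ?R P) = (\<Sum>P\<in>?M - ?D. skew_det t gcT P N * ?R P) + (\<Sum>P\<in>?D. skew_det t gcT P N * ?R P)"
   by (rule sum.subset_diff[OF D fin])
  also have "... \<asymp> (\<Sum>P\<in>?M - ?D. 0 * ?R P) + (\<Sum>P\<in>?D. skew_det t gcT P N * ?R P)"
  proof (intro cong_add cong_refl cong_sum cong_mult_right)
   fix P assume P: "P : ?M - ?D"
   have "\<not> distinct P"
   proof
    assume "distinct P"
    then have "set P = N" using P by (intro card_subset_eq) (auto simp: distinct_card)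
    then show False using P \<open>distinct P\<close> by simp
   qed
   have "skew_det t gcT P N \<asymp> pscale (inv_sign t P) (skew_det t gcT (sort P) N)"
    by (rule col_det_sort) (use P in auto)
   also have "... = 0" unfolding inv_sign_not_distinct[OF \<open>\<not> distinct P\<close>] by (rule pscale_simps(6))
   finally show "skew_det t gcT P N \<asymp> 0" .
  qed
  also have "... = (\<Sum>P\<in>?D. skew_det t gcT P N * ?R P)" by (simp only: mult_zero_left sum.neutral_const add_0_left)
  finally show ?thesis by (rule cong_sym)
 qed
 also have "(\<Sum>P\<in>?M. skew_det t gcT P N * ?R P) = (\<Sum>P\<in>?M. (\<Sum>L\<in>?D. pscale (inv_sign t L) (prod_list (map2 (%i r. gc i r) L P))) * ?R P)"
 proof (rule sum.cong[OF refl])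
  fix P assume P: "P : ?M"
  have sw: "map2 gcT P L = map2 (%i r. gc i r) L P" if "L : ?D" for L
   by (rule nth_equalityI) (use P lenD[OF that] in auto)
  have "skew_det t gcT P N = (\<Sum>L\<in>?D. pscale (inv_sign t L) (prod_list (map2 gcT P L)))"
   by (rule skew_det_prod_lists) (use P in auto)
  also have "... = (\<Sum>L\<in>?D. pscale (inv_sign t L) (prod_list (map2 (%i r. gc i r) L P)))"
   by (intro sum.cong refl) (simp only: sw)
  finally show "skew_det t gcT P N * ?R P = (\<Sum>L\<in>?D. pscale (inv_sign t L) (prod_list (map2 (%i r. gc i r) L P))) * ?R P" by simp
 qed
 also have "... = (\<Sum>L\<in>?D. pscale (inv_sign t L) (\<Sum>P\<in>?M. prod_list (map2 (%i r. gc i r) L P) * ?R P))"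
  unfolding sum_distrib_right pscale_sum by (subst sum.swap) (simp only: pscale_mult)
 also have "... \<asymp> (\<Sum>L\<in>?D. pscale (inv_sign t L) (if L = ?I then 1 else 0))"
 proof (intro cong_sum cong_pscale)
  fix L assume L: "L : ?D"
  show "(\<Sum>P\<in>?M. prod_list (map2 (%i r. gc i r) L P) * ?R P) \<asymp> (if L = ?I then 1 else 0)"
   using contraction[of L ?I] lenD[OF L] L by (simp add: atLeastLessThanSuc_atLeastAtMost del: upt_Suc)
 qed
 also have "... = (\<Sum>L\<in>{?I}. pscale (inv_sign t L) (if L = ?I then 1 else 0))"
  by (rule sum.mono_neutral_right) (use finite_subset[OF D fin] in \<open>auto simp: pscale_simps simp del: upt_Suc\<close>)
 also have "... = 1"
  using inv_sign_sorted[of ?I t] by (simp add: pscale_simps del: upt_Suc inv_sign.simps)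
 finally have 1: "qdet n * th l (qdet n) \<asymp> 1" .
 have "th l (qdet n) = 1 * th l (qdet n)" by simp
 also have "... \<asymp> (gen_elt Dinv * qdet n) * th l (qdet n)" by (rule cong_mult_right[OF cong_sym[OF Dinv_det]])
 also have "... = gen_elt Dinv * (qdet n * th l (qdet n))" by (simp add: mult.assoc)
 also have "... \<asymp> gen_elt Dinv * 1" by (rule cong_mult_left[OF 1])
 finally show ?thesis by simp
qed

end

lemma sum_reflect: "(\<Sum>a\<in>{1..n}. f (n + 1 - a)) = (\<Sum>a\<in>{1..n::nat}. f a)"
 by (rule sum.reindex_bij_witness[where i = "%a. n + 1 - a" and j = "%a. n + 1 - a"]) auto

text \<open>Reflection reverses the order and the diagonal values sum to 1, so the two forms add up
  to the constant 1. The constant form yields a difference of products of total degrees, which is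
  0.\<close>

lemma twist_reflect:
 assumes "l + m = 1" "(\<Sum>k\<in>{1..n}. r k) = (\<Sum>k\<in>{1..n}. c k)" "(\<Sum>k\<in>{1..n}. r' k) = (\<Sum>k\<in>{1..n}. c' k)"
 shows "twist n l r c r' c' + twist n m (%k. - r (n + 1 - k)) (%k. - c (n + 1 - k)) (%k. - r' (n + 1 - k)) (%k. - c' (n + 1 - k)) = 0"
proof -
 have "twist n m (%k. - r (n + 1 - k)) (%k. - c (n + 1 - k)) (%k. - r' (n + 1 - k)) (%k. - c' (n + 1 - k)) =
  (\<Sum>a\<in>{1..n}. \<Sum>b\<in>{1..n}. bl m a b * (c (n + 1 - a) * c' (n + 1 - b) - r (n + 1 - a) * r' (n + 1 - b)))"
  unfolding twist_def by (simp only: minus_mult_minus)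
 also have "... = (\<Sum>a\<in>{1..n}. \<Sum>b\<in>{1..n}. bl m (n + 1 - a) (n + 1 - b) * (c (n + 1 - (n + 1 - a)) * c' (n + 1 - (n + 1 - b)) - r (n + 1 - (n + 1 - a)) * r' (n + 1 - (n + 1 - b))))"
  by (subst sum_reflect[symmetric], rule sum.cong[OF refl], subst sum_reflect[symmetric]) (rule refl)
 also have "... = (\<Sum>a\<in>{1..n}. \<Sum>b\<in>{1..n}. bl m (n + 1 - a) (n + 1 - b) * (c a * c' b - r a * r' b))"
  by (intro sum.cong refl) simp
 finally have "twist n l r c r' c' + twist n m (%k. - r (n + 1 - k)) (%k. - c (n + 1 - k)) (%k. - r' (n + 1 - k)) (%k. - c' (n + 1 - k)) =
  (\<Sum>a\<in>{1..n}. \<Sum>b\<in>{1..n}. (bl l a b + bl m (n + 1 - a) (n + 1 - b)) * (c a * c' b - r a * r' b))"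
  unfolding twist_def[of n l] by (simp only: sum.distrib[symmetric] distrib_right)
 also have "... = (\<Sum>a\<in>{1..n}. \<Sum>b\<in>{1..n}. c a * c' b - r a * r' b)"
 proof (intro sum.cong refl)
  fix a b assume "a : {1..n}" "b : {1..n}"
  then have "bl l a b + bl m (n + 1 - a) (n + 1 - b) = 1" using assms(1) by (auto simp: bl_def)
  then show "(bl l a b + bl m (n + 1 - a) (n + 1 - b)) * (c a * c' b - r a * r' b) = c a * c' b - r a * r' b" by simp
 qed
 also have "... = 0" using assms(2,3) by (simp add: sum_subtractf sum_product[symmetric])
 finally show ?thesis .
qed

lemma sum_deg:
 assumes "good n w"
 shows "(\<Sum>k\<in>{1..n}. rd w k) = (\<Sum>k\<in>{1..n}. cd w k)"
 using assms
proof (induction w)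
 case (Cons x w)
 have "(\<Sum>k\<in>{1..n}. rd [x] k) = (\<Sum>k\<in>{1..n}. cd [x] k)"
  using Cons.prems by (cases x) (auto simp: deg_single generators_def of_bool_def)
 then show ?case using Cons unfolding deg_Cons[of x w] by (simp add: sum.distrib)
qed (simp add: deg_Nil)

section \<open>The twisted map respects the relations and is invertible\<close>

context qgl
begin

lemma th_gc_gc:
 assumes "i : N" "j : N" "r : N" "s : N"
 shows "th l (gc i r * gc j s) = pscale (q powi (bl l r s - bl l i j) * q powi (l * (int i + int j - (int r + int s))))
  (y (n + 1 - r) (n + 1 - i) * y (n + 1 - s) (n + 1 - j))"
proof -
 have e: "gc i r * gc j s = (wd [Gen i r, Gen j s] :: 'k free)" by (simp add: gen_elt_wd wd_append[symmetric])
 have p: "q powi (l * (int i - int r)) * q powi (l * (int j - int s)) = q powi (l * (int i + int j - (int r + int s)))"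
  using q by (simp add: power_int_add[symmetric] algebra_simps)
 show ?thesis unfolding e th_wd tw.simps twist_Gen[OF assms(1,3,2,4)] p[symmetric]
  using assms by (simp add: deg_Nil pscale_mult pscale_simps mult_ac)
qed

lemma th_gen: "th l (gen_elt x) = tg l x"
 by (simp add: gen_elt_wd th_wd deg_Nil pscale_simps)

lemma th_one: "th l 1 = 1"
 using th_wd[of l "[]"] by (simp add: wd_Nil)

lemma th_qdet_Dinv: "th l (qdet n * gen_elt Dinv) \<asymp> 1" "th l (gen_elt Dinv * qdet n) \<asymp> 1"
proof -
 have "th l (qdet n * gen_elt Dinv) = th l (qdet n) * qdet n"
  unfolding th_mult[OF has_deg_qdet has_deg_Dinv] th_gen by (simp add: pscale_simps)
 also have "... \<asymp> gen_elt Dinv * qdet n" by (rule cong_mult_right[OF th_qdet])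
 also note Dinv_det
 finally show "th l (qdet n * gen_elt Dinv) \<asymp> 1" .
 have "th l (gen_elt Dinv * qdet n) = qdet n * th l (qdet n)"
  unfolding th_mult[OF has_deg_Dinv has_deg_qdet] th_gen by (simp add: pscale_simps)
 also have "... \<asymp> qdet n * gen_elt Dinv" by (rule cong_mult_left[OF th_qdet])
 also note det_Dinv
 finally show "th l (gen_elt Dinv * qdet n) \<asymp> 1" .
qed

text \<open>The reflected \<open>y\<close> satisfy the relations with the roles of rows and columns
  interchanged; the change of the twist under an exchange of two factors moves the power of
  \<open>q\<close> from rows to columns.\<close>

lemma th_relation:
 assumes "r : relations n q"
 shows "th l r \<asymp> 0"
 unfolding cong_free_def
proof
 fix ph assume ph: "ph : functionals n q"
 let ?z = "%i j. y (n + 1 - j) (n + 1 - i)"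
 have R: "ev ph (?z i a * ?z j a) = ev ph (?z j a * ?z i a)" if "i : N" "j : N" "a : N" for i j a
  using y_same_row[of "n + 1 - a" "n + 1 - i" "n + 1 - j"] reflect_N(1) that ph by (simp add: cong_free_def)
 have Q: "ev ph (?z i b * ?z j a) = q * ev ph (?z j a * ?z i b)" if "i : N" "j : N" "a : N" "b : N" "i \<le> j" "a < b" for i j a b
  using y_q[of "n + 1 - b" "n + 1 - a" "n + 1 - j" "n + 1 - i"] that ph by (simp add: cong_free_def ev_pscale)
 have X: "ev ph (?z j b * ?z i a) = ev ph (?z i a * ?z j b) + (q - 1) * ev ph (?z j a * ?z i b)"
  if "i : N" "j : N" "a : N" "b : N" "i < j" "a < b" for i j a b
  using y_cross[of "n + 1 - b" "n + 1 - a" "n + 1 - i" "n + 1 - j"] that ph by (simp add: cong_free_def ev_pscale ev_add)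
 show "ev ph (th l r) = ev ph 0"
  using assms
 proof (induction rule: relations_cases)
  case (row i a b)
  have *: "ev ph (th l (gc i a * gc i b)) = ev ph (th l (gc i b * gc i a))" if ab: "a : N" "b : N" "a < b" for a b
  proof -
   have "q powi (bl l a b - bl l i i) = q * q powi (bl l b a - bl l i i)"
    using ab(3) q by (simp add: bl_def power_int_diff power_int_minus divide_inverse)
   then show ?thesis
    unfolding th_gc_gc[OF row(1,1) ab(1,2)] th_gc_gc[OF row(1,1) ab(2,1)] ev_pscale Q[OF row(1,1) ab(1,2) order_refl ab(3)]
    by (simp add: add.commute)
  qed
  have "ev ph (th l (gc i a * gc i b)) = ev ph (th l (gc i b * gc i a))"
   using *[of a b] *[of b a] row by (cases a b rule: linorder_cases) auto
  then show ?case by (simp add: th_linear ev_diff)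
 next
  case (qrel i j a b)
  let ?C = "q powi (l * (int i + int j - (int a + int b)))"
  have 1: "th l (gc j a * gc i b) = pscale (q powi (bl l a b - bl l j i) * ?C) (?z j a * ?z i b)"
   using th_gc_gc[OF qrel(2,1,3,4), of l] by (simp add: add.commute)
  have 2: "th l (gc i b * gc j a) = pscale (q powi (bl l b a - bl l i j) * ?C) (?z i b * ?z j a)"
   using th_gc_gc[OF qrel(1,2,4,3), of l] by (simp add: add.commute)
  have 3: "q powi (bl l a b - bl l j i) * ev ph (?z j a * ?z i b) = q * (q powi (bl l b a - bl l i j) * ev ph (?z i b * ?z j a))"
  proof (cases "a = b")
   case True
   have "ev ph (?z j b * ?z i b) = ev ph (?z i b * ?z j b)" using R[OF qrel(2,1,4)] .
   then show ?thesis using q qrel(5) by (simp add: bl_def True power_int_diff)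
  next
   case False
   then have ab: "a < b" using qrel(6) by simp
   have "ev ph (?z i b * ?z j a) = q * ev ph (?z j a * ?z i b)" by (rule Q) (use qrel ab in auto)
   then show ?thesis using q qrel(5) ab by (simp add: bl_def power_int_minus)
  qed
  have "?C * (q powi (bl l a b - bl l j i) * ev ph (?z j a * ?z i b)) = ?C * (q * (q powi (bl l b a - bl l i j) * ev ph (?z i b * ?z j a)))"
   by (simp only: 3)
  then show ?case unfolding th_linear ev_diff ev_pscale 1 2 by (simp only: ev_zero mult_ac right_minus_eq)
 next
  case (cross i j a b)
  let ?C = "q powi (l * (int i + int j - (int a + int b)))"
  have 1: "th l (gc j b * gc i a) = pscale ?C (?z j b * ?z i a)"
   using th_gc_gc[OF cross(2,1,4,3), of l] cross(5,6) by (simp add: add.commute bl_def)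
  have 2: "th l (gc i a * gc j b) = pscale ?C (?z i a * ?z j b)"
   using th_gc_gc[OF cross(1,2,3,4), of l] cross(5,6) by (simp add: bl_def)
  have 3: "th l (gc i b * gc j a) = pscale (inverse q * ?C) (?z i b * ?z j a)"
   using th_gc_gc[OF cross(1,2,4,3), of l] cross(5,6) by (simp add: add.commute bl_def power_int_minus)
  have 4: "ev ph (?z i b * ?z j a) = q * ev ph (?z j a * ?z i b)" by (rule Q) (use cross in auto)
  have 5: "inverse q * ?C * (q * ev ph (?z j a * ?z i b)) = ?C * ev ph (?z j a * ?z i b)" using q by simp
  show ?case unfolding th_linear ev_diff ev_add ev_pscale 1 2 3 4 5 X[OF cross] ev_zero by (simp add: algebra_simps)
 next
  case det
  then show ?case using th_qdet_Dinv(1)[of l] ph by (simp add: th_linear th_one ev_diff cong_free_def)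
 next
  case Dinv
  then show ?case using th_qdet_Dinv(2)[of l] ph by (simp add: th_linear th_one ev_diff cong_free_def)
 qed
qed

lemma functional_sandwich:
 assumes ph: "ph : functionals n q"
 shows "(%w. ev ph (x * wd w * z)) : functionals n q"
proof (rule functionalsI)
 fix u v r assume r: "r : relations n q"
 have 0: "r \<asymp> 0" using functionals_relation[OF _ r] by (simp add: cong_free_def)
 have "(x * wd u) * r * (wd v * z) \<asymp> (x * wd u) * 0 * (wd v * z)" by (intro cong_mult_left cong_mult_right 0)
 then have "ev ph ((x * wd u) * r * (wd v * z)) = 0" using ph by (simp add: cong_free_def)
 then show "ev (%w. ev ph (x * wd (u @ w @ v) * z)) r = 0"
  using ev_sandwich[of ph "x * wd u" "wd v * z" r] by (simp add: wd_append mult.assoc)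
qed

lemma functional_left: "ph : functionals n q ==> (%w. ev ph (x * wd w)) : functionals n q"
 and functional_right: "ph : functionals n q ==> (%w. ev ph (wd w * x)) : functionals n q"
 using functional_sandwich[of ph x 1] functional_sandwich[of ph 1 x] by simp_all

text \<open>Dual form of the statement that \<open>th\<close> respects the ideal of relations; words
  with illegal letters are harmless by \<open>tw_bad\<close>.\<close>

lemma functional_tw:
 assumes ph: "ph : functionals n q"
 shows "(%w. ev ph (tw l w)) : functionals n q"
proof (rule functionalsI)
 fix u v r assume r: "r : relations n q"
 show "ev (%w. ev ph (tw l (u @ w @ v))) r = 0"
 proof (cases "good n u & good n v")
  case True
  obtain s d where d: "has_deg n r s d" using has_deg_relation[OF r] by blast
  have u: "has_deg n (wd u :: 'k free) (rd u) (cd u)" and v: "has_deg n (wd v :: 'k free) (rd v) (cd v)" using True has_deg_wd by auto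
  have "th l (wd u) * th l r * th l (wd v) \<asymp> th l (wd u) * 0 * th l (wd v)"
   by (intro cong_mult_left cong_mult_right th_relation[OF r])
  then have "ev ph (th l (wd u * r * wd v)) = 0"
   using ph unfolding th_mult[OF has_deg_mult[OF u d] v] th_mult[OF u d] by (simp add: cong_free_def pscale_mult ev_pscale)
  then show ?thesis using ev_shift[of "%w. ev ph (tw l w)" u v r] by (simp add: ev_th)
 next
  case False
  then have "(%w. ev ph (tw l (u @ w @ v))) = (%w. 0)" by (intro ext) (subst tw_bad, auto)
  then show ?thesis by (simp add: ev_def)
 qed
qed

lemma cong_th: "x \<asymp> z ==> th l x \<asymp> th l z"
 using functional_tw by (simp add: cong_free_def ev_th)

text \<open>Both sides invert the matrix with entries \<open>tg l (Gen a b)\<close>: the images of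
  the \<open>y\<close> from the right, by applying \<open>th\<close> to \<open>gc_y\<close>, and the
  reflected generators from the left, by \<open>gc_y_transposed\<close>.\<close>

lemma th_y:
 assumes "m : N" "i : N"
 shows "th l (y m i) \<asymp> pscale (q powi ((1 - l) * (int i - int m))) (gc (n + 1 - i) (n + 1 - m))"
proof (rule cong_sym)
 let ?Z = "%k i. pscale (q powi ((1 - l) * (int i - int k))) (gc (n + 1 - i) (n + 1 - k)) :: 'k free"
 have XY: "(\<Sum>b\<in>N. tg l (Gen a b) * th l (y b k)) \<asymp> (if a = k then 1 else 0)" if a: "a : N" and k: "k : N" for a k
 proof -
  have e: "th l (gc a b * y b k) = pscale (q powi (bl l a k - l)) (tg l (Gen a b) * th l (y b k))" if b: "b : N" for b
  proof -
   have "twist n l (%k. of_bool (k = a)) (%k. of_bool (k = b)) (%j. - of_bool (j = k)) (%j. - of_bool (j = b)) = bl l a k - l"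
    using twist_delta[OF a b k b, of l "-1"] by (simp add: bl_def)
   then show ?thesis using th_mult[OF has_deg_gc[OF a b] has_deg_y[OF b k], of l] unfolding th_gen by simp
  qed
  have "pscale (q powi (bl l a k - l)) (\<Sum>b\<in>N. tg l (Gen a b) * th l (y b k)) = th l (\<Sum>b\<in>N. gc a b * y b k)"
   unfolding th_linear pscale_sum by (intro sum.cong refl) (simp only: e)
  also have "... \<asymp> th l (if a = k then 1 else 0)" by (rule cong_th[OF gc_y[OF a k]])
  also have "... = pscale (q powi (bl l a k - l)) (if a = k then 1 else 0)"
   by (simp add: th_one th_linear bl_def pscale_simps)
  finally show ?thesis by (rule cong_pscale_cancel[rotated]) (use q in simp)
 qed
 have ZX: "(\<Sum>a\<in>N. ?Z k a * tg l (Gen a b)) \<asymp> (if k = b then 1 else 0)" if k: "k : N" and b: "b : N" for k b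
 proof -
  \<comment> \<open>The part of the exponent that does not depend on the summation index a; the rest
    is a - 1.\<close>
  let ?e = "1 - (1 - l) * int k - l * int b"
  have "(\<Sum>a\<in>N. ?Z k a * tg l (Gen a b)) = (\<Sum>a\<in>N. pscale (q powi ?e) (pscale (q ^ (n - (n + 1 - a))) (gc (n + 1 - a) (n + 1 - k) * y (n + 1 - b) (n + 1 - a))))"
  proof (rule sum.cong[OF refl])
   fix a assume a: "a : N"
   have "q powi ((1 - l) * (int a - int k)) * q powi (l * (int a - int b)) = q powi ?e * q powi (int a - 1)"
    using q by (simp add: power_int_add[symmetric] algebra_simps)
   also have "q powi (int a - 1) = q ^ (n - (n + 1 - a))"
    using a by (simp add: power_int_def nat_diff_distrib)
   finally have e: "q powi ((1 - l) * (int a - int k)) * q powi (l * (int a - int b)) = q powi ?e * q ^ (n - (n + 1 - a))" .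
   have "?Z k a * tg l (Gen a b) = pscale (q powi ((1 - l) * (int a - int k)) * q powi (l * (int a - int b))) (gc (n + 1 - a) (n + 1 - k) * y (n + 1 - b) (n + 1 - a))"
    using a b by (simp add: pscale_mult pscale_simps mult.commute)
   then show "?Z k a * tg l (Gen a b) = pscale (q powi ?e) (pscale (q ^ (n - (n + 1 - a))) (gc (n + 1 - a) (n + 1 - k) * y (n + 1 - b) (n + 1 - a)))"
    by (simp only: e pscale_simps(4))
  qed
  also have "... = pscale (q powi ?e) (\<Sum>a\<in>N. pscale (q ^ (n - a)) (gc a (n + 1 - k) * y (n + 1 - b) a))"
   unfolding pscale_sum[symmetric] by (subst sum_reflect) (rule refl)
  also have "... \<asymp> pscale (q powi ?e) (if n + 1 - k = n + 1 - b then pscale (q ^ (n - (n + 1 - b))) 1 else 0)"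
   by (intro cong_pscale gc_y_transposed reflect_N(1) k b)
  also have "... = (if k = b then 1 else 0)"
  proof (cases "k = b")
   case True
   have "q ^ (n - (n + 1 - b)) = q powi (int b - 1)" using b by (simp add: power_int_def nat_diff_distrib)
   moreover have "?e + (int b - 1) = 0" using True by (simp add: algebra_simps)
   ultimately have "q powi ?e * q ^ (n - (n + 1 - b)) = 1" using q by (simp add: power_int_add[symmetric])
   then show ?thesis using True by (simp add: pscale_simps)
  next
   case False
   then have "n + 1 - k ~= n + 1 - b" using k b by auto
   then show ?thesis using False by (simp add: pscale_simps)
  qed
  finally show ?thesis .
 qed
 show "?Z m i \<asymp> th l (y m i)"
  by (rule matrix_cong_unique[where Q = N and Z = ?Z and X' = "%a b. tg l (Gen a b)" and Y = "%b k. th l (y b k)"])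
   ((rule finite_atLeastAtMost assms ZX XY | assumption)+)
qed

lemma th_tg:
 assumes "l + m = 1" "x : generators n"
 shows "th m (tg l x) \<asymp> gen_elt x"
proof (cases x)
 case (Gen i j)
 then have ij: "i : N" "j : N" using assms(2) by (auto simp: generators_def)
 have "th m (tg l x) = pscale (q powi (l * (int i - int j))) (th m (y (n + 1 - j) (n + 1 - i)))"
  unfolding Gen using ij by (simp add: th_linear)
 also have "... \<asymp> pscale (q powi (l * (int i - int j))) (pscale (q powi ((1 - m) * (int (n + 1 - i) - int (n + 1 - j))))
   (gc (n + 1 - (n + 1 - i)) (n + 1 - (n + 1 - j))))"
  by (intro cong_pscale th_y reflect_N(1) ij)
 also have "... = gc i j"
 proof -
  have "l * (int i - int j) + (1 - m) * (int (n + 1 - i) - int (n + 1 - j)) = 0"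
  proof -
   have e: "1 - m = l" "int (n + 1 - i) - int (n + 1 - j) = int j - int i" using assms(1) ij by auto
   show ?thesis unfolding e by (simp add: algebra_simps)
  qed
  then show ?thesis unfolding reflect_N(2)[OF ij(1)] reflect_N(2)[OF ij(2)] using q by (simp add: pscale_simps power_int_add[symmetric])
 qed
 finally show ?thesis by (simp add: Gen)
qed (simp add: th_qdet)

text \<open>By \<open>twist_reflect\<close> the twists of the two maps cancel letter by
  letter.\<close>

lemma th_tw:
 assumes "l + m = 1" "good n w"
 shows "th m (tw l w) \<asymp> wd w"
 using assms(2)
proof (induction w)
 case (Cons x w)
 then have x: "x : generators n" and w: "good n w" by auto
 have "good n [x]" using x by simp
 from twist_reflect[OF assms(1) sum_deg[OF this] sum_deg[OF w]]
 have 0: "twist n l (rd [x]) (cd [x]) (rd w) (cd w) + twist n m (%k. - row_deg x (n + 1 - k)) (%k. - col_deg x (n + 1 - k)) (%k. - rd w (n + 1 - k)) (%k. - cd w (n + 1 - k)) = 0"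
  unfolding deg_single .
 have "th m (tw l (x # w)) = th m (tg l x) * th m (tw l w)"
  unfolding tw.simps th_linear th_mult[OF has_deg_tg[OF x] has_deg_tw[OF w]]
  using 0 q by (simp add: pscale_simps power_int_add[symmetric])
 also have "... \<asymp> gen_elt x * wd w" by (rule cong_mult[OF th_tg[OF assms(1) x] Cons.IH[OF w]])
 finally show ?case by (simp only: wd_Cons)
qed (simp add: th_one wd_Nil)

lemma th_th:
 assumes "l + m = 1" "z : FA n"
 shows "th m (th l z) \<asymp> z"
 using assms(2)
proof (induction rule: free_carrier_induct)
 case (add w a f)
 then show ?case
  unfolding th_linear th_wd by (intro cong_add cong_pscale th_tw[OF assms(1)])
qed (simp add: th_linear)

lemma th_carrier:
 assumes "z : FA n"
 shows "th l z : FA n"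
 using assms
proof (induction rule: free_carrier_induct)
 case (add w a f)
 then show ?case
  unfolding th_linear th_wd by (intro free_closed has_deg_carrier[OF has_deg_tw])
qed (simp add: th_linear free_closed)

section \<open>Compatibility with convolution\<close>

text \<open>The sum over j, h, m of the comultiplication of y_kj c_jh times y_mi \<otimes> y_hm is
  computed in two ways. Contracting y_kj with c_jh leaves the right side; splitting c_jh and
  contracting its parts with y_mi and y_hm leaves the comultiplication of y_ki. The antipode
  reverses the tensor factors.\<close>

lemma cv_y:
 assumes ph: "ph : functionals n q" and psi: "psi : functionals n q" and ki: "k : N" "i : N"
 shows "ev (cv n ph psi) (y k i) = (\<Sum>m\<in>N. ev ph (y m i) * ev psi (y k m))"
proof -
 let ?ph = "%m w. ev ph (wd w * y m i)" and ?psi = "%h m w. ev psi (wd w * y h m)"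
 \<comment> \<open>Summing over j replaces the product of y_kj and c_jh by a Kronecker
   delta.\<close>
 have A: "(\<Sum>j\<in>N. ev (cv n (?ph m) (?psi h m)) (y k j * gc j h)) = (if k = h then ev ph (y m i) * ev psi (y h m) else 0)"
  if "h : N" for h m
 proof -
  have "cv n (?ph m) (?psi h m) : functionals n q" by (intro cv_functionals functional_right ph psi)
  then have "(\<Sum>j\<in>N. ev (cv n (?ph m) (?psi h m)) (y k j * gc j h)) = ev (cv n (?ph m) (?psi h m)) (if k = h then 1 else 0)"
   using y_gc[OF ki(1) that] by (simp add: cong_free_def ev_sum)
  then show ?thesis by (simp add: wd_Nil[symmetric] cv_def) (simp add: wd_Nil)
 qed
 \<comment> \<open>Summing over h forces the middle index c to be m, and then summing over m forces
   j = i.\<close>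
 have B: "(\<Sum>h\<in>N. \<Sum>m\<in>N. \<Sum>c\<in>N. ev ph (wd a * gc j c * y m i) * ev psi (wd b * gc c h * y h m)) = (if j = i then ph a * psi b else 0)"
  if j: "j : N" for a b j
 proof -
  have B1: "(\<Sum>h\<in>N. ev psi (wd b * gc c h * y h m)) = (if c = m then psi b else 0)" if "c : N" "m : N" for c m
  proof -
   have "wd b * (\<Sum>h\<in>N. gc c h * y h m) \<asymp> wd b * (if c = m then 1 else 0)" by (rule cong_mult_left[OF gc_y[OF that]])
   then show ?thesis using psi by (simp add: cong_free_def sum_distrib_left ev_sum mult.assoc)
  qed
  have B2: "(\<Sum>m\<in>N. ev ph (wd a * gc j m * y m i)) = (if j = i then ph a else 0)"
  proof -
   have "wd a * (\<Sum>h\<in>N. gc j h * y h i) \<asymp> wd a * (if j = i then 1 else 0)" by (rule cong_mult_left[OF gc_y[OF j ki(2)]])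
   then show ?thesis using ph by (simp add: cong_free_def sum_distrib_left ev_sum mult.assoc)
  qed
  have "(\<Sum>h\<in>N. \<Sum>m\<in>N. \<Sum>c\<in>N. ev ph (wd a * gc j c * y m i) * ev psi (wd b * gc c h * y h m)) =
   (\<Sum>m\<in>N. \<Sum>c\<in>N. ev ph (wd a * gc j c * y m i) * (\<Sum>h\<in>N. ev psi (wd b * gc c h * y h m)))"
   unfolding sum_distrib_left by (subst sum.swap, rule sum.cong[OF refl], rule sum.swap)
  also have "... = (\<Sum>m\<in>N. \<Sum>c\<in>N. if c = m then ev ph (wd a * gc j c * y m i) * psi b else 0)"
   by (intro sum.cong refl) (simp only: B1 if_distrib[of "(*) _"] mult_zero_right)
  also have "... = (\<Sum>m\<in>N. ev ph (wd a * gc j m * y m i)) * psi b" by (simp add: sum_distrib_right)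
  finally show ?thesis unfolding B2 by simp
 qed
 have C: "ev (cv n (?ph m) (?psi h m)) (y k j * gc j h) =
  ev (cw n (%a b. \<Sum>c\<in>N. ev ph (wd a * gc j c * y m i) * ev psi (wd b * gc c h * y h m))) (y k j)" for j h m
 proof -
  have "ev (cv n (%w. ?ph m (a @ w)) (%w. ?psi h m (b @ w))) (gc j h) = (\<Sum>c\<in>N. ev ph (wd a * gc j c * y m i) * ev psi (wd b * gc c h * y h m))" for a b
   unfolding gen_elt_wd ev_wd cv_def cw_Gen cw_Nil by (simp only: wd_append mult.assoc)
  then show ?thesis unfolding ev_cv_mult(1) by simp
 qed
 have "(\<Sum>m\<in>N. ev ph (y m i) * ev psi (y k m)) = (\<Sum>h\<in>N. if k = h then \<Sum>m\<in>N. ev ph (y m i) * ev psi (y h m) else 0)"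
  using ki by simp
 also have "... = (\<Sum>h\<in>N. \<Sum>m\<in>N. \<Sum>j\<in>N. ev (cv n (?ph m) (?psi h m)) (y k j * gc j h))"
 proof (rule sum.cong[OF refl])
  fix h assume h: "h : N"
  show "(if k = h then \<Sum>m\<in>N. ev ph (y m i) * ev psi (y h m) else 0) = (\<Sum>m\<in>N. \<Sum>j\<in>N. ev (cv n (?ph m) (?psi h m)) (y k j * gc j h))"
   unfolding A[OF h] by simp
 qed
 also have "... = (\<Sum>j\<in>N. \<Sum>h\<in>N. \<Sum>m\<in>N. ev (cv n (?ph m) (?psi h m)) (y k j * gc j h))"
  by (subst sum.swap[of _ N N], rule sym, subst sum.swap, rule sum.cong[OF refl], subst sum.swap, rule sym, subst sum.swap) (rule refl)
 also have "... = (\<Sum>j\<in>N. ev (cw n (%a b. \<Sum>h\<in>N. \<Sum>m\<in>N. \<Sum>c\<in>N. ev ph (wd a * gc j c * y m i) * ev psi (wd b * gc c h * y h m))) (y k j))"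
  unfolding C by (simp only: ev_fun_sum[symmetric] cw_sum[symmetric])
 also have "... = (\<Sum>j\<in>N. ev (cw n (%a b. if j = i then ph a * psi b else 0)) (y k j))"
  by (intro sum.cong refl) (simp only: B)
 also have "... = (\<Sum>j\<in>N. if j = i then ev (cv n ph psi) (y k j) else 0)"
  by (intro sum.cong refl) (auto simp: cv_def ev_def)
 also have "... = ev (cv n ph psi) (y k i)" using ki by simp
 finally show ?thesis by simp
qed

text \<open>The transposed position undoes the reversal of tensor factors in \<open>cv_y\<close>,
  and the product of q^(l (i - m)) and q^(l (m - j)) does not depend on the middle index m.\<close>

lemma cv_tg:
 assumes ph: "ph : functionals n q" and psi: "psi : functionals n q" and x: "x : generators n"
 shows "ev (cv n ph psi) (tg l x) = (\<Sum>(a, b)\<in>gsplits n x. ev ph (tg l a) * ev psi (tg l b))"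
proof (cases x)
 case (Gen i j)
 then have ij: "i : N" "j : N" using x by (auto simp: generators_def)
 have inj: "inj_on (%l. (Gen i l, Gen l j)) N" by (auto simp: inj_on_def)
 have "(\<Sum>(a, b)\<in>gsplits n x. ev ph (tg l a) * ev psi (tg l b)) = (\<Sum>m\<in>N. ev ph (tg l (Gen i m)) * ev psi (tg l (Gen m j)))"
  unfolding Gen gsplits.simps sum.reindex[OF inj] by simp
 also have "... = (\<Sum>m\<in>N. q powi (l * (int i - int j)) * (ev ph (y (n + 1 - m) (n + 1 - i)) * ev psi (y (n + 1 - j) (n + 1 - m))))"
 proof (rule sum.cong[OF refl])
  fix m assume m: "m : N"
  have "q powi (l * (int i - int m)) * q powi (l * (int m - int j)) = q powi (l * (int i - int j))"
   using q by (simp add: power_int_add[symmetric] algebra_simps)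
  then show "ev ph (tg l (Gen i m)) * ev psi (tg l (Gen m j)) =
   q powi (l * (int i - int j)) * (ev ph (y (n + 1 - m) (n + 1 - i)) * ev psi (y (n + 1 - j) (n + 1 - m)))"
   using ij m by (simp add: ev_pscale mult_ac)
 qed
 also have "... = q powi (l * (int i - int j)) * (\<Sum>m\<in>N. ev ph (y m (n + 1 - i)) * ev psi (y (n + 1 - j) m))"
  unfolding sum_distrib_left[symmetric] by (subst sum_reflect) (rule refl)
 also have "... = ev (cv n ph psi) (tg l x)"
  unfolding cv_y[OF ph psi reflect_N(1)[OF ij(2)] reflect_N(1)[OF ij(1)], symmetric] Gen using ij by (simp add: ev_pscale)
 finally show ?thesis by simp
qed (simp add: cv_qdet[OF ph psi])

text \<open>Letter by letter this is \<open>cv_tg\<close>, and by \<open>twist_splits\<close> the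
  twists of the two parts multiply to the twist of the whole word. The functionals vary in the
  induction, being translated by the image of the first letter.\<close>

lemma cv_tw:
 assumes "ph : functionals n q" "psi : functionals n q" "good n w"
 shows "ev (cv n ph psi) (tw l w) = cv n (%u. ev ph (tw l u)) (%u. ev psi (tw l u)) w"
 using assms
proof (induction w arbitrary: ph psi)
 case Nil
 then show ?case by (simp add: cv_def wd_Nil[symmetric])
next
 case (Cons x w)
 note ph = Cons.prems(1) and psi = Cons.prems(2)
 have x: "x : generators n" and w: "good n w" using Cons.prems(3) by auto
 let ?t = "%x w. q powi twist n l (rd [x]) (cd [x]) (rd w) (cd w)"
 have "ev (cv n ph psi) (tg l x * tw l w) = ev (cw n (%a b. \<Sum>(c, d)\<in>gsplits n x. ev ph (tg l c * wd a) * ev psi (tg l d * wd b))) (tw l w)"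
  unfolding ev_cv_mult(2)
  using cv_tg[OF functionals_shift[OF ph, of "[]"] functionals_shift[OF psi, of "[]"] x] by (simp add: ev_mult_wd)
 also have "... = (\<Sum>(c, d)\<in>gsplits n x. ev (cv n (%a. ev ph (tg l c * wd a)) (%b. ev psi (tg l d * wd b))) (tw l w))"
  unfolding case_prod_beta cw_sum ev_fun_sum cv_def ..
 also have "... = (\<Sum>(c, d)\<in>gsplits n x. cv n (%u. ev ph (tg l c * tw l u)) (%u. ev psi (tg l d * tw l u)) w)"
 proof (intro sum.cong refl, clarify)
  fix c d
  have "ev (%a. ev chi (z * wd a)) x = ev chi (z * x)" for chi and z x :: "'k free"
   using ev_sandwich[of chi z 1 x] by simp
  then show "ev (cv n (%a. ev ph (tg l c * wd a)) (%b. ev psi (tg l d * wd b))) (tw l w) =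
   cv n (%u. ev ph (tg l c * tw l u)) (%u. ev psi (tg l d * tw l u)) w"
   using Cons.IH[OF functional_left[OF ph] functional_left[OF psi] w] by simp
 qed
 finally have 1: "ev (cv n ph psi) (tw l (x # w)) =
  ?t x w * (\<Sum>(c, d)\<in>gsplits n x. cv n (%u. ev ph (tg l c * tw l u)) (%u. ev psi (tg l d * tw l u)) w)"
  by (simp add: ev_pscale)
 have "cv n (%u. ev ph (tw l u)) (%u. ev psi (tw l u)) (x # w) =
  (\<Sum>(c, d)\<in>gsplits n x. cw n (%u v. ?t x w * (ev ph (tg l c * tw l u) * ev psi (tg l d * tw l v))) w)"
  unfolding cv_def cw_Cons
 proof (intro sum.cong refl, clarify, rule cw_cong)
  fix c d u v assume cd: "(c, d) : gsplits n x" and uv: "(u, v) : splits n w"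
  have "?t c u * ?t d v = ?t x w"
   using q twist_splits[OF cd uv, of l] by (simp add: power_int_add[symmetric])
  then show "ev ph (tw l (c # u)) * ev psi (tw l (d # v)) = ?t x w * (ev ph (tg l c * tw l u) * ev psi (tg l d * tw l v))"
   by (simp add: ev_pscale mult_ac)
 qed
 then show ?case unfolding 1 unfolding cw_mult case_prod_beta cv_def sum_distrib_left by (rule sym)
qed

end

section \<open>Compatibility with the torus\<close>

lemma weight_dual_add: "weight_dual n (mu + nu) = weight_dual n mu + weight_dual n nu"
 by (auto simp: weight_dual_def fun_eq_iff)

lemma weight_dual_zero: "weight_dual n 0 = 0"
 by (auto simp: weight_dual_def fun_eq_iff)

lemma weight_dual_gen:
 "i : {1..n} ==> weight_dual n (gen_weight n (Gen i i)) = - gen_weight n (Gen (n + 1 - i) (n + 1 - i))"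
 "weight_dual n (gen_weight n Dinv) = omega n"
 by (auto simp: weight_dual_def omega_def fun_eq_iff)

lemma weight_dual_lattice: "weight_dual n mu : weight_lattice n"
 by (auto simp: weight_dual_def weight_lattice_def)

lemma weight_dual_dual: "mu : weight_lattice n ==> weight_dual n (weight_dual n mu) = mu"
 by (auto simp: weight_dual_def weight_lattice_def fun_eq_iff)

lemma diag_deg: "list_all diag_gen w ==> rd w = cd w"
proof (induction w)
 case (Cons x w)
 then have "rd [x] = cd [x]" by (cases x) (auto simp: deg_single fun_eq_iff)
 then show ?case using Cons unfolding deg_Cons[of x w] by simp
qed (simp add: deg_Nil)

lemma ev_mult_eq: "ev (%v. ev ph (x * wd v)) z = ev ph (x * z)" "ev (%v. ev ph (wd v * x)) z = ev ph (z * x)"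
 using ev_sandwich[of ph x 1 z] ev_sandwich[of ph 1 x z] by simp_all

lemma torus_fun_Cons:
 "torus_fun n h (x # w) = (if diag_gen x then torus_fun n (%mu. h (gen_weight n x + mu)) w else 0)"
 by (simp add: torus_fun_def word_weight_def)

lemma torus_gen_mult:
 "ev (torus_fun n h) (gen_elt x * z) = (if diag_gen x then ev (torus_fun n (%mu. h (gen_weight n x + mu))) z else 0)"
 unfolding gen_elt_wd ev_mult ev_wd append_Cons append_Nil torus_fun_Cons by (simp add: ev_def)

lemma torus_qdet_mult:
 "ev (torus_fun n h) (qdet n * z) = ev (torus_fun n (%mu. h (omega n + mu))) z"
 "ev (torus_fun n h) (z * qdet n) = ev (torus_fun n (%mu. h (omega n + mu))) z"
 unfolding ev_mult_eq(1)[of _ "qdet n" z, symmetric] ev_mult_eq(2)[of _ "qdet n" z, symmetric] ev_torus_qdet by (rule refl)+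

lemma torus_mult_Dinv:
 "ev (torus_fun n h) (z * gen_elt Dinv) = ev (torus_fun n (%mu. h (- omega n + mu))) z"
proof -
 have "torus_fun n h (w @ [Dinv]) = torus_fun n (%mu. h (- omega n + mu)) w" for w
  by (simp add: torus_fun_def word_weight_def add.commute)
 then show ?thesis
  unfolding ev_mult_eq(2)[of _ "gen_elt Dinv" z, symmetric] by (simp add: gen_elt_wd wd_append[symmetric])
qed

lemma torus_mult_power:
 assumes "!!h z. ev (torus_fun n h) (z * g) = ev (torus_fun n (%mu. h (alp + mu))) z"
 shows "ev (torus_fun n h) (z * g ^ k) = ev (torus_fun n (%mu. h ((%i. int k * alp i) + mu))) z"
proof (induction k arbitrary: h)
 case 0
 have "(%i. int 0 * alp i) + mu = mu" for mu :: "nat => int" by (simp add: fun_eq_iff)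
 then show ?case by simp
next
 case (Suc k)
 have e: "alp + ((%i. int k * alp i) + mu) = (%i. int (Suc k) * alp i) + mu" for mu
  by (simp add: fun_eq_iff algebra_simps)
 have "z * g ^ Suc k = (z * g ^ k) * g" by (simp add: power_Suc2 mult.assoc del: power_Suc)
 then show ?case by (simp only: assms Suc.IH e)
qed

context qgl
begin

text \<open>On the torus the inverse matrix is diagonal with entries inverse to the coordinates. To
  derive this from \<open>gc_y\<close>, \<open>h\<close> is shifted beforehand so that
  multiplication by c_ii restores it.\<close>

lemma torus_y:
 assumes "i : N" "k : N"
 shows "ev (torus_fun n h) (y i k * z) = (if i = k then ev (torus_fun n (%mu. h (mu - gen_weight n (Gen i i)))) z else 0)"
proof -
 let ?h = "%mu. h (mu - gen_weight n (Gen i i))"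
 have "ev (torus_fun n h) (y i k * z) = (\<Sum>r\<in>N. if i = r then ev (torus_fun n (%mu. ?h (gen_weight n (Gen i r) + mu))) (y r k * z) else 0)"
  using assms(1) by simp
 also have "... = (\<Sum>r\<in>N. ev (torus_fun n ?h) (gc i r * (y r k * z)))"
  unfolding torus_gen_mult diag_gen.simps by (rule refl)
 also have "... = ev (torus_fun n ?h) ((\<Sum>r\<in>N. gc i r * y r k) * z)"
  by (simp only: sum_distrib_right ev_sum mult.assoc)
 also have "... = ev (torus_fun n ?h) ((if i = k then 1 else 0) * z)"
  using cong_mult_right[OF gc_y[OF assms], of z] torus_fun_functionals unfolding cong_free_def by blast
 finally show ?thesis by simp
qed

text \<open>On diagonal words row and column degrees agree and the twist is trivial; on other words
  both sides vanish.\<close>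

lemma torus_tw: "good n w ==> ev (torus_fun n h) (tw l w) = torus_fun n (%mu. h (weight_dual n mu)) w"
proof (induction w arbitrary: h)
 case Nil
 show ?case by (simp add: wd_Nil[symmetric] torus_fun_def word_weight_def weight_dual_zero)
next
 case (Cons x w)
 have x: "x : generators n" and w: "good n w" using Cons.prems by auto
 have tg: "ev (torus_fun n h) (tg l x * tw l w) = torus_fun n (%mu. h (weight_dual n mu)) (x # w)"
 proof (cases x)
  case (Gen i j)
  then have ij: "i : N" "j : N" using x by (auto simp: generators_def)
  have "ev (torus_fun n h) (tg l x * tw l w) = q powi (l * (int i - int j)) * ev (torus_fun n h) (y (n + 1 - j) (n + 1 - i) * tw l w)"
   unfolding Gen tg.simps using ij by (simp add: pscale_mult ev_pscale)
  also have "... = (if i = j then ev (torus_fun n (%mu. h (mu - gen_weight n (Gen (n + 1 - i) (n + 1 - i))))) (tw l w) else 0)"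
   unfolding torus_y[OF reflect_N(1)[OF ij(2)] reflect_N(1)[OF ij(1)]] using ij by auto
  also have "... = torus_fun n (%mu. h (weight_dual n mu)) (x # w)"
   unfolding Cons.IH[OF w] Gen torus_fun_Cons diag_gen.simps
  proof (rule if_cong[OF refl _ refl])
   assume e: "i = j"
   have "weight_dual n (gen_weight n (Gen i j) + mu) = weight_dual n mu - gen_weight n (Gen (n + 1 - i) (n + 1 - i))" for mu
    unfolding weight_dual_add e[symmetric] weight_dual_gen(1)[OF ij(1)] by (rule uminus_add_conv_diff)
   then show "torus_fun n (%mu. h (weight_dual n mu - gen_weight n (Gen (n + 1 - i) (n + 1 - i)))) w =
    torus_fun n (%mu. h (weight_dual n (gen_weight n (Gen i j) + mu))) w" by (simp only:)
  qed
  finally show ?thesis .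
 next
  case Dinv
  show ?thesis
   unfolding Dinv tg.simps torus_qdet_mult Cons.IH[OF w] torus_fun_Cons weight_dual_add weight_dual_gen(2) by simp
 qed
 show ?case
 proof (cases "list_all diag_gen (x # w)")
  case True
  then have "rd [x] = cd [x]" "rd w = cd w" by (auto intro: diag_deg)
  then show ?thesis using tg by (simp add: ev_pscale)
 next
  case False
  then have "torus_fun n (%mu. h (weight_dual n mu)) (x # w) = 0" unfolding torus_fun_def by (simp only: if_False simp_thms)
  then show ?thesis using tg by (simp add: ev_pscale)
 qed
qed

lemma torus_th: "z : FA n ==> ev (torus_fun n h) (th l z) = ev (torus_fun n (%mu. h (weight_dual n mu))) z"
 unfolding ev_th by (rule ev_cong_good, assumption, rule torus_tw)

section \<open>Powers of the determinant\<close>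

definition dp :: "int => 'k free" where
 "dp m = (if m \<ge> 0 then qdet n ^ nat m else gen_elt Dinv ^ nat (- m))"

lemma dp_carrier: "dp m : FA n"
proof -
 have p: "x ^ k : FA n" if "x : FA n" for x :: "'k free" and k
  using that by (induction k) (simp_all add: free_closed)
 then show ?thesis
  by (auto simp: dp_def generators_def intro!: p qdet_carrier gen_elt_carrier)
qed

lemma dp_inverse: "dp m * dp (- m) \<asymp> 1"
proof -
 have p: "a ^ k * b ^ k \<asymp> 1" if "a * b \<asymp> 1" for a b :: "'k free" and k
 proof (induction k)
  case (Suc k)
  have "a ^ Suc k * b ^ Suc k = a ^ k * (a * b) * b ^ k" by (simp only: power_Suc2[of a] power_Suc[of b] mult.assoc)
  also have "... \<asymp> a ^ k * 1 * b ^ k" by (intro cong_mult_left cong_mult_right that)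
  also have "... = a ^ k * b ^ k" by simp
  also note Suc
  finally show ?case .
 qed simp
 consider "m = 0" | "m > 0" | "m < 0" by linarith
 then show ?thesis
  by cases (use p[OF det_Dinv, of "nat m"] p[OF Dinv_det, of "nat (- m)"] in \<open>simp_all add: dp_def\<close>)
qed

definition group_like :: "'k free => bool" where
 "group_like g \<longleftrightarrow> (\<forall>ph\<in>functionals n q. \<forall>psi\<in>functionals n q. ev (cv n ph psi) g = ev ph g * ev psi g)"

text \<open>Right multiplication by a group-like element acts on both tensor factors of the
  comultiplication at once.\<close>

lemma cv_mult_group_like:
 assumes g: "group_like g" and ph: "ph : functionals n q" and psi: "psi : functionals n q"
 shows "ev (cv n ph psi) (z * g) = ev (cv n (%u. ev ph (wd u * g)) (%u. ev psi (wd u * g))) z"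
proof -
 have "ev (cv n (%w. ph (a @ w)) (%w. psi (b @ w))) g = ev ph (wd a * g) * ev psi (wd b * g)" for a b
  using g functionals_shift[OF ph, of a "[]"] functionals_shift[OF psi, of b "[]"]
  by (simp add: group_like_def ev_mult_wd)
 then show ?thesis unfolding ev_cv_mult(1) cv_def[of n "%u. ev ph (wd u * g)"] by simp
qed

lemma group_like_mult:
 assumes "group_like a" "group_like b"
 shows "group_like (a * b)"
 unfolding group_like_def
proof (intro ballI)
 fix ph psi assume *: "ph : functionals n q" "psi : functionals n q"
 show "ev (cv n ph psi) (a * b) = ev ph (a * b) * ev psi (a * b)"
  unfolding cv_mult_group_like[OF assms(2) *]
  using assms(1) functional_right[OF *(1), of b] functional_right[OF *(2), of b] by (simp add: group_like_def ev_mult_eq)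
qed

lemma group_like_dp: "group_like (dp m)"
proof -
 have 1: "group_like 1" by (simp add: group_like_def wd_Nil[symmetric] cv_def)
 have p: "group_like (g ^ k)" if "group_like g" for g k
  by (induction k) (simp_all add: 1 group_like_mult that)
 have "group_like (qdet n)" using cv_qdet by (simp add: group_like_def)
 moreover have "group_like (gen_elt Dinv)" by (simp add: group_like_def gen_elt_wd cv_def cw_Dinv)
 ultimately show ?thesis by (simp add: dp_def p)
qed

lemma torus_mult_dp: "ev (torus_fun n h) (z * dp m) = ev (torus_fun n (%mu. h ((%i. m * omega n i) + mu))) z"
proof (cases "m \<ge> 0")
 case True
 then show ?thesis
  using torus_mult_power[of n "qdet n" "omega n" h z "nat m", OF torus_qdet_mult(2)] by (simp add: dp_def)
next
 case False
 have "(%i. int (nat (- m)) * (- omega n) i) = (%i. m * omega n i)" using False by (simp add: fun_eq_iff)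
 then show ?thesis
  using torus_mult_power[of n "gen_elt Dinv" "- omega n" h z "nat (- m)", OF torus_mult_Dinv] False by (simp add: dp_def del: uminus_apply)
qed

section \<open>The automorphism\<close>

text \<open>Defined through an arbitrary representative of the coset, which \<open>cong_th\<close>
  makes legitimate. The diagonal value is 0, so that \<open>th 1\<close> inverts the first
  step.\<close>

definition theta :: "int => 'k free set => 'k free set" where
 "theta m c = cos n q (th 0 (SOME z. z : FA n & cos n q z = c) * dp m)"

lemma cos_eq_cong: "x : FA n ==> z : FA n ==> cos n q x = cos n q z \<longleftrightarrow> x \<asymp> z"
 by (simp add: cos_eq_iff cong_free_def)

lemma theta_mem: "z : FA n ==> th 0 z * dp m : FA n"
 by (intro free_closed(6) th_carrier dp_carrier)

lemma theta_cos:
 assumes z: "z : FA n"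
 shows "theta m (cos n q z) = cos n q (th 0 z * dp m)"
proof -
 define x where "x = (SOME x. x : FA n & cos n q x = cos n q z)"
 have x: "x : FA n & cos n q x = cos n q z"
  unfolding x_def by (rule someI[of _ z]) (simp add: z)
 then have "x \<asymp> z" using cos_eq_cong z by blast
 then have "th 0 x * dp m \<asymp> th 0 z * dp m" by (intro cong_mult_right cong_th)
 then show ?thesis
  unfolding theta_def x_def[symmetric] using cos_eq_cong[OF theta_mem theta_mem] x z by blast
qed

lemma theta_linear: "theta m : linear_maps (qgl_algebra n q) (qgl_algebra n q)"
proof (rule linear_mapsI)
 note l = linD[OF cos_linear[of n q], unfolded free_algebra_simps(2,6)]
 fix c assume "c : carrier (qgl_algebra n q)"
 then obtain x where x: "x : FA n" "c = cos n q x" unfolding carrier_qgl_algebra by (elim imageE)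
 show "theta m c : carrier (qgl_algebra n q)" unfolding x(2) theta_cos[OF x(1)] by (rule cos_carrier[OF theta_mem[OF x(1)]])
 show "theta m (a *[qgl_algebra n q] c) = a *[qgl_algebra n q] theta m c" for a
  unfolding x(2) l(3)[OF x(1), symmetric] theta_cos[OF x(1)] theta_cos[OF free_closed(5)[OF x(1)]]
   l(3)[OF theta_mem[OF x(1)], symmetric] th_linear pscale_mult by (rule refl)
 fix d assume "d : carrier (qgl_algebra n q)"
 then obtain z where z: "z : FA n" "d = cos n q z" unfolding carrier_qgl_algebra by (elim imageE)
 show "theta m (c +[qgl_algebra n q] d) = theta m c +[qgl_algebra n q] theta m d"
  unfolding x(2) z(2) l(2)[OF x(1) z(1), symmetric] theta_cos[OF x(1)] theta_cos[OF z(1)] theta_cos[OF free_closed(4)[OF x(1) z(1)]]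
   l(2)[OF theta_mem[OF x(1)] theta_mem[OF z(1)], symmetric] th_linear distrib_right by (rule refl)
qed

text \<open>The power of the determinant is cancelled by the opposite power, and \<open>th 1\<close>
  inverts \<open>th 0\<close>; so \<open>th 1\<close> of x times the opposite power represents a
  preimage of x.\<close>

lemma theta_bij: "bij_betw (theta m) (carrier (qgl_algebra n q)) (carrier (qgl_algebra n q))"
 unfolding bij_betw_def
proof
 show "inj_on (theta m) (carrier (qgl_algebra n q))"
 proof (rule inj_onI)
  fix c d assume c: "c : carrier (qgl_algebra n q)" "d : carrier (qgl_algebra n q)" and eq: "theta m c = theta m d"
  obtain x where x: "x : FA n" "c = cos n q x" using c(1) unfolding carrier_qgl_algebra by (elim imageE)
  obtain z where z: "z : FA n" "d = cos n q z" using c(2) unfolding carrier_qgl_algebra by (elim imageE)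
  have "th 0 x * dp m \<asymp> th 0 z * dp m"
   using eq cos_eq_cong[OF theta_mem[OF x(1)] theta_mem[OF z(1)]] by (simp add: x(2) z(2) theta_cos x(1) z(1))
  then have c: "th 0 x * dp m * dp (- m) \<asymp> th 0 z * dp m * dp (- m)" by (rule cong_mult_right)
  have k: "w * dp m * dp (- m) \<asymp> w" for w
   using cong_mult_left[OF dp_inverse[of m], of w] by (simp add: mult.assoc)
  have "th 0 x \<asymp> th 0 z" using cong_trans[OF cong_trans[OF cong_sym[OF k] c] k] .
  then have "th 1 (th 0 x) \<asymp> th 1 (th 0 z)" by (rule cong_th)
  moreover have "th 1 (th 0 x) \<asymp> x" "th 1 (th 0 z) \<asymp> z" by (rule th_th; simp add: x z)+
  ultimately have "x \<asymp> z" using cong_trans cong_sym by blast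
  then show "c = d" using cos_eq_cong x z by blast
 qed
 show "theta m ` carrier (qgl_algebra n q) = carrier (qgl_algebra n q)"
 proof (intro subset_antisym subsetI)
  fix c assume "c : carrier (qgl_algebra n q)"
  then obtain x where x: "x : FA n" "c = cos n q x" unfolding carrier_qgl_algebra by (elim imageE)
  let ?u = "x * dp (- m)"
  let ?z = "th 1 ?u"
  have u: "?u : FA n" by (intro free_closed(6) x dp_carrier)
  then have z: "?z : FA n" by (rule th_carrier)
  have "th 0 ?z * dp m \<asymp> ?u * dp m" by (intro cong_mult_right th_th u) simp
  also have "... = x * (dp (- m) * dp (- (- m)))" by (simp add: mult.assoc)
  also have "... \<asymp> x * 1" by (intro cong_mult_left dp_inverse)
  finally have "cos n q (th 0 ?z * dp m) = cos n q x" using cos_eq_cong[OF theta_mem[OF z] x(1)] by simp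
  then have "c = theta m (cos n q ?z)" by (simp add: theta_cos[OF z] x(2))
  then show "c : theta m ` carrier (qgl_algebra n q)" using cos_carrier[OF z] by blast
 qed (use linD(1)[OF theta_linear] in blast)
qed

text \<open>The counit is a torus functional with constant \<open>h\<close>, which a change of
  weights does not affect. For convolution, \<open>group_like_dp\<close> takes care of the power of
  the determinant and \<open>cv_tw\<close> of the rest.\<close>

lemma theta_coalg_auto: "coalg_auto (kG n q) (theta m)"
 unfolding coalg_auto_def kG_dual kG_carrier
proof (intro conjI ballI)
 show "theta m : linear_maps (kG n q) (kG n q)"
  unfolding same_module_linear_maps[OF same_module_kG same_module_kG] by (rule theta_linear)
 show "bij_betw (theta m) (carrier (qgl_algebra n q)) (carrier (qgl_algebra n q))" by (rule theta_bij)
 fix c assume "c : carrier (qgl_algebra n q)"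
 then obtain z where z: "z : FA n" "c = cos n q z" unfolding carrier_qgl_algebra by (elim imageE)
 show "counit (kG n q) (theta m c) = counit (kG n q) c"
  unfolding z(2) theta_cos[OF z(1)] counit_cos[OF theta_mem[OF z(1)]] counit_cos[OF z(1)] torus_mult_dp torus_th[OF z(1)] ..
 fix alp be assume alp: "alp : dual (qgl_algebra n q)" and be: "be : dual (qgl_algebra n q)"
 let ?p = "%alp u. ev (dualf n q alp) (wd u * dp m)"
 have d: "dualf n q (%c. \<gamma> (theta m c)) w = ev (?p \<gamma>) (tw 0 w)" if "good n w" "\<gamma> : dual (qgl_algebra n q)" for \<gamma> w
 proof -
  have w: "wd w : carrier (free_algebra n :: ('k, _) module)" using that by (simp add: free_closed)
  show ?thesis
   unfolding dualf_good[OF that(1)] theta_cos[OF w] dual_cos[OF that(2) theta_mem[OF w]] unfolding th_wd ev_mult_eq ..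
 qed
 have f: "?p alp : functionals n q" "?p be : functionals n q" by (intro functional_right dualf_functionals alp be)+
 have "conv (kG n q) alp be (theta m c) = ev (cv n (?p alp) (?p be)) (th 0 z)"
  unfolding z(2) theta_cos[OF z(1)] conv_cos[OF alp be theta_mem[OF z(1)]]
  by (rule cv_mult_group_like[OF group_like_dp dualf_functionals[OF alp] dualf_functionals[OF be]])
 also have "... = ev (cv n (%u. ev (?p alp) (tw 0 u)) (%u. ev (?p be) (tw 0 u))) z"
  unfolding ev_th by (rule ev_cong_good[OF z(1)]) (rule cv_tw[OF f])
 also have "... = ev (cv n (dualf n q (%c. alp (theta m c))) (dualf n q (%c. be (theta m c)))) z"
  unfolding cv_def by (intro ev_cong_good[OF z(1)] cw_cong) (use splits_good d alp be in auto)
 also have "... = conv (kG n q) (%c. alp (theta m c)) (%c. be (theta m c)) c"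
  unfolding z(2) by (rule conv_cos[symmetric, OF lin_comp[OF theta_linear alp] lin_comp[OF theta_linear be] z(1)])
 finally show "conv (kG n q) alp be (theta m c) = conv (kG n q) (%c. alp (theta m c)) (%c. be (theta m c)) c" .
qed

end

section \<open>The action on weights\<close>

definition shift_dual :: "nat => int => (nat => int) => (nat => int)" where
 "shift_dual n m mu = (%i. m * omega n i + weight_dual n mu i)"

lemma shift_dual_lattice: "shift_dual n m mu : weight_lattice n"
 using weight_dual_lattice[of n mu] by (auto simp: shift_dual_def weight_lattice_def omega_def)

lemma shift_dual_inverse:
 assumes "mu : weight_lattice n"
 shows "weight_dual n (%i. shift_dual n m mu i - m * omega n i) = mu"
  "shift_dual n m (weight_dual n (%i. mu i - m * omega n i)) = mu"
proof -
 show "weight_dual n (%i. shift_dual n m mu i - m * omega n i) = mu"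
  using weight_dual_dual[OF assms] by (simp add: shift_dual_def)
 have "(%i. mu i - m * omega n i) : weight_lattice n" using assms by (auto simp: weight_lattice_def omega_def)
 from weight_dual_dual[OF this] show "shift_dual n m (weight_dual n (%i. mu i - m * omega n i)) = mu"
  by (simp add: shift_dual_def)
qed

lemma shift_dual_bij: "bij_betw (shift_dual n m) (weight_lattice n) (weight_lattice n)"
 by (rule bij_betw_byWitness[where f' = "%mu. weight_dual n (%i. mu i - m * omega n i)"])
  (use shift_dual_inverse shift_dual_lattice weight_dual_lattice in auto)

text \<open>The first i entries of the dual are the last i entries of \<open>mu\<close>, negated;
  their sum is expressed by the total and the first n - i entries.\<close>

lemma sum_shift_dual:
 assumes "i \<le> n"
 shows "(\<Sum>j=1..i. shift_dual n m mu j) = m * int i - (\<Sum>j=1..n. mu j) + (\<Sum>j=1..n - i. mu j)"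
proof -
 have "(\<Sum>j=1..i. shift_dual n m mu j) = (\<Sum>j=1..i. m - mu (n + 1 - j))"
  by (rule sum.cong) (use assms in \<open>auto simp: shift_dual_def omega_def weight_dual_def\<close>)
 also have "... = m * int i - (\<Sum>j=1..i. mu (n + 1 - j))" by (simp add: sum_subtractf)
 also have "(\<Sum>j=1..i. mu (n + 1 - j)) = (\<Sum>j=n + 1 - i..n. mu j)"
  by (rule sum.reindex_bij_witness[where i = "%j. n + 1 - j" and j = "%j. n + 1 - j"]) (use assms in auto)
 also have "(\<Sum>j=1..n. mu j) = (\<Sum>j=1..n - i. mu j) + (\<Sum>j=n + 1 - i..n. mu j)"
 proof -
  have "{1..n} = {1..n - i} \<union> {n + 1 - i..n}" using assms by auto
  moreover have "{1..n - i} \<inter> {n + 1 - i..n} = {}" by auto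
  ultimately show ?thesis by (metis finite_atLeastAtMost sum.union_disjoint)
 qed
 then have "m * int i - (\<Sum>j=n + 1 - i..n. mu j) = m * int i - (\<Sum>j=1..n. mu j) + (\<Sum>j=1..n - i. mu j)" by simp
 finally show ?thesis .
qed

text \<open>As the totals agree, the inequality for i becomes the one for n - i; the shift adds the
  same amount to both sides.\<close>

lemma shift_dual_dominated: "dominated n (shift_dual n m mu) (shift_dual n m nu) \<longleftrightarrow> dominated n mu nu"
proof -
 have "(\<forall>i\<le>n. (\<Sum>j=1..n - i. mu j) \<le> (\<Sum>j=1..n - i. nu j)) \<longleftrightarrow> (\<forall>i\<le>n. (\<Sum>j=1..i. mu j) \<le> (\<Sum>j=1..i. nu j))"
  by (metis diff_diff_cancel diff_le_self)
 moreover have "(\<Sum>j=1..n. shift_dual n m mu j) = m * int n - (\<Sum>j=1..n. mu j)" for mu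
  using sum_shift_dual[of n n m mu] by simp
 ultimately show ?thesis
  unfolding dominated_def using sum_shift_dual by (auto simp: le_diff_eq)
qed

text \<open>Linear extension of a map of exponents to Laurent polynomials; it need not be
  multiplicative, as \<open>f\<close> may be a translation.\<close>

definition weight_map :: "nat => ((nat => int) => (nat => int)) => ((nat => int) \<Rightarrow>\<^sub>0 'k) => ((nat => int) \<Rightarrow>\<^sub>0 'k::field)" where
 "weight_map n f = linext (laurent n) (%mu. single (f mu) 1)"

lemma weight_map_linear:
 assumes "!!mu. mu : weight_lattice n ==> f mu : weight_lattice n"
 shows "weight_map n f : linear_maps (laurent n) (laurent n :: ('k::field, _) module)"
proof (rule linear_mapsI)
 let ?b = "%mu. single (f mu) (1 :: 'k)"
 have b: "?b mu : carrier (laurent n)" if "mu : weight_lattice n" for mu by (rule single_mem_laurent[OF assms[OF that]])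
 fix x assume x: "x : carrier (laurent n :: ('k, _) module)"
 then have k: "keys x \<subseteq> weight_lattice n" by (simp add: laurent_simps)
 show "weight_map n f x : carrier (laurent n)"
  unfolding weight_map_def by (rule linext_closed[OF vspace_laurent]) (use k b in blast)
 show "weight_map n f (a *[laurent n] x) = a *[laurent n] weight_map n f x" for a
  unfolding weight_map_def laurent_simps(6)[of n a x] by (rule linext_pscale[OF vspace_laurent]) (use k b in blast)
 fix y assume y: "y : carrier (laurent n :: ('k, _) module)"
 show "weight_map n f (x +[laurent n] y) = weight_map n f x +[laurent n] weight_map n f y"
  unfolding weight_map_def laurent_simps(2)[of n x y]
  by (rule linext_add[OF vspace_laurent, where S = "weight_lattice n"]) (use k y b in \<open>auto simp: laurent_simps\<close>)
qed

lemma weight_map_single: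
 "f mu : weight_lattice n ==> weight_map n f (single mu a) = (single (f mu) a :: _ \<Rightarrow>\<^sub>0 'k::field)"
 unfolding weight_map_def
 by (subst linext_single[OF vspace_laurent]) (auto simp: single_mem_laurent laurent_simps pscale_single)

lemma weight_map_inverse:
 fixes p :: "(nat => int) \<Rightarrow>\<^sub>0 'k::field"
 assumes f: "!!mu. mu : weight_lattice n ==> f mu : weight_lattice n" and g: "!!mu. mu : weight_lattice n ==> g mu : weight_lattice n"
  and gf: "!!mu. mu : weight_lattice n ==> g (f mu) = mu" and p: "p : carrier (laurent n)"
 shows "weight_map n g (weight_map n f p) = p"
proof -
 have k: "mu : weight_lattice n" if "mu : keys p" for mu using p that by (auto simp: laurent_simps)
 have "weight_map n g (weight_map n f p) = linext (laurent n) (%mu. weight_map n g (single (f mu) 1)) p"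
  unfolding weight_map_def[of n f]
  by (rule linear_maps_linext[OF vspace_laurent vspace_laurent weight_map_linear[OF g]], assumption) (rule single_mem_laurent[OF f[OF k]])
 also have "... = linext (laurent n) (%mu. single mu 1) p"
 proof (rule linext_cong[OF vspace_laurent])
  fix mu assume "mu : keys p"
  then have mu: "mu : weight_lattice n" by (rule k)
  show "weight_map n g (single (f mu) 1) = (single mu 1 :: _ \<Rightarrow>\<^sub>0 'k)"
   using weight_map_single[of g "f mu" n "1 :: 'k"] g[OF f[OF mu]] gf[OF mu] by simp
  show "single mu 1 : carrier (laurent n :: ('k, _) module)" by (rule single_mem_laurent[OF mu])
 qed
 also have "... = p"
 proof (rule poly_mapping_eqI)
  fix nu
  have "lookup (linext (laurent n) (%mu. single mu 1) p) nu = evt (%mu. lookup (single mu 1) nu) p"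
   unfolding evt_linext by (rule linear_maps_linext[OF vspace_laurent vspace_scalars lookup_dual_laurent]) (auto intro!: single_mem_laurent k)
  also have "... = (\<Sum>mu\<in>keys p. if mu = nu then lookup p mu else 0)"
   unfolding evt_def by (intro sum.cong) (auto simp: lookup_single)
  also have "... = lookup p nu" by (simp add: in_keys_iff)
  finally show "lookup (linext (laurent n) (%mu. single mu 1) p) nu = lookup p nu" .
 qed
 finally show ?thesis .
qed

context qgl
begin

text \<open>Each coefficient of either side is a linear functional on the free algebra, so the
  comparison is made on words.\<close>

lemma torus_restrict_theta:
 assumes z: "z : FA n"
 shows "torus_restrict n (theta m (cos n q z)) = weight_map n (shift_dual n m) (torus_restrict n (cos n q z))"
proof (rule poly_mapping_eqI)
 fix nu :: "nat => int"
 let ?\<delta> = "%mu. if mu = nu then 1 else 0 :: 'k" and ?s = "weight_map n (shift_dual n m) :: _ => (nat => int) \<Rightarrow>\<^sub>0 'k"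
 let ?ph = "%z. lookup (?s (torus_restrict n (cos n q z))) nu"
 have sl: "?s : linear_maps (laurent n) (laurent n)" by (rule weight_map_linear) (rule shift_dual_lattice)
 have tr: "torus_restrict n (cos n q (wd w)) = (if list_all diag_gen w then single (word_weight n w) 1 else 0 :: _ \<Rightarrow>\<^sub>0 'k)"
  if w: "good n w" for w
 proof (rule poly_mapping_eqI)
  fix mu
  have "wd w : carrier (free_algebra n :: ('k, _) module)" using w by (simp add: free_closed)
  from torus_restrict_cos[OF this, of q mu]
  show "lookup (torus_restrict n (cos n q (wd w))) mu = lookup (if list_all diag_gen w then single (word_weight n w) 1 else 0) mu"
   by (simp add: torus_fun_def lookup_single when_def)
 qed
 have s0: "?s 0 = 0" using linear_maps_zero[OF vspace_laurent vspace_laurent sl] by (simp add: laurent_simps)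
 have "?ph : dual (free_algebra n)"
  using lin_comp[OF cos_linear lin_comp[OF torus_restrict_linear lin_comp[OF sl lookup_dual_laurent]]] .
 then have "?ph z = ev (torus_fun n (%mu. ?\<delta> (shift_dual n m mu))) z"
 proof (rule ev_restrict_good[OF _ _ z])
  fix w assume "good n w"
  then show "?ph (wd w) = torus_fun n (%mu. ?\<delta> (shift_dual n m mu)) w"
   by (simp add: tr torus_fun_def weight_map_single[of "shift_dual n m", OF shift_dual_lattice] s0 lookup_single when_def)
 qed
 moreover have "lookup (torus_restrict n (theta m (cos n q z))) nu = ev (torus_fun n (%mu. ?\<delta> (shift_dual n m mu))) z"
 proof -
  have "shift_dual n m mu = (%i. m * omega n i) + weight_dual n mu" for mu by (simp add: shift_dual_def fun_eq_iff)
  then show ?thesis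
   unfolding theta_cos[OF z] torus_restrict_cos[OF theta_mem[OF z]] torus_mult_dp torus_th[OF z] by simp
 qed
 ultimately show "lookup (torus_restrict n (theta m (cos n q z))) nu = ?ph z" by simp
qed

lemma theta_torus_auto: "torus_auto n q (theta m) (shift_dual n m)"
 unfolding torus_auto_def
proof (intro conjI ballI)
 let ?s = "weight_map n (shift_dual n m) :: _ => (nat => int) \<Rightarrow>\<^sub>0 'k"
 let ?g = "%mu. weight_dual n (%i. mu i - m * omega n i)"
 show "coalg_auto (kG n q) (theta m)" by (rule theta_coalg_auto)
 show "bij_betw (shift_dual n m) (weight_lattice n) (weight_lattice n)" by (rule shift_dual_bij)
 show "dominated n (shift_dual n m mu) (shift_dual n m nu) = dominated n mu nu" for mu nu by (rule shift_dual_dominated)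
 have l: "?s : linear_maps (laurent n) (laurent n)" "weight_map n ?g : linear_maps (laurent n) (laurent n :: ('k, _) module)"
  by (rule weight_map_linear; rule shift_dual_lattice weight_dual_lattice)+
 have 1: "weight_map n ?g (?s p) = p" if "p : carrier (laurent n)" for p
  by (rule weight_map_inverse[OF shift_dual_lattice weight_dual_lattice shift_dual_inverse(1) that])
 have 2: "?s (weight_map n ?g p) = p" if "p : carrier (laurent n)" for p
  by (rule weight_map_inverse[OF weight_dual_lattice shift_dual_lattice shift_dual_inverse(2) that])
 have "bij_betw ?s (carrier (laurent n)) (carrier (laurent n))"
  by (rule bij_betw_byWitness[where f' = "weight_map n ?g"]) (use 1 2 linD(1)[OF l(1)] linD(1)[OF l(2)] in blast)+
 moreover have "?s (single mu 1) = single (shift_dual n m mu) 1" for mu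
  by (rule weight_map_single) (rule shift_dual_lattice)
 moreover have "torus_restrict n (theta m c) = ?s (torus_restrict n c)" if c: "c : carrier (kG n q)" for c
 proof -
  obtain z where z: "z : FA n" "c = cos n q z" using c unfolding kG_carrier carrier_qgl_algebra by (elim imageE)
  show ?thesis unfolding z(2) by (rule torus_restrict_theta[OF z(1)])
 qed
 ultimately show "\<exists>s. s : linear_maps (laurent n) (laurent n) & bij_betw s (carrier (laurent n :: ('k, _) module)) (carrier (laurent n)) &
    (\<forall>mu\<in>weight_lattice n. s (single mu 1) = single (shift_dual n m mu) 1) &
    (\<forall>c\<in>carrier (kG n q). torus_restrict n (theta m c) = s (torus_restrict n c))"
  using l(1) by blast
qed

end

theorem mainTheorem5:
  fixes n :: nat and q :: "'k::field" and P :: "(nat \<Rightarrow> int) set" and m :: int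
  assumes "n \<ge> 1" and "q \<noteq> 0" and "finite P" and "P \<subseteq> X_plus n"
  shows "coalgebra_isomorphic (A_trunc n q P) (A_trunc n q (shifted_dual n m P))
    \<and> algebra_isomorphic (S_trunc n q P) (S_trunc n q (shifted_dual n m P))"
proof -
 interpret qgl n q by unfold_locales (rule assms(2))
 have "shifted_dual n m P = shift_dual n m ` P"
  by (simp add: shifted_dual_def shift_dual_def image_image)
 moreover have "P \<subseteq> weight_lattice n" using assms(4) by (auto simp: X_plus_def)
 ultimately show ?thesis
  using quantum_gl.trunc_isomorphic[OF quantum_gl theta_torus_auto] by simp
qed

end
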